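(* Let $n\in\mathbf N$, $A\in\mathbb G^\infty_{n\times n}$, $t_0\in I$, and let $f\in\mathcal R^{n\prime}$ satisfy $f=0$ for $t<t_0$. Then there exists a unique solution $x\in\mathcal R^{n\prime}$ of the Cauchy problem $$x'-A(t)x=f,\qquad x=0\ \text{ if } t<t_0 .$$ Furthermore, $x=Xy$, where $X$ is the fundamental solution (fundamental matrix) of the homogeneous system $x'-A(t)x=0$ and $y\in\mathcal R^{n\prime}$ is the primitive of the distribution $X^{-1}f$ that is equal to $0$ for $t<t_0$.
   Context: $I=(a,b)\subset\mathbf R$ is an open interval (e.g. $I=\mathbf R$), $\mathbf N_0=\mathbf N\cup\{0\}$; functions are identified when equal almost everywhere. $\mathbb G$ is the algebra of essentially bounded $g:I\to\mathbf C$ possessing both limits $g(t\pm)=\operatorname{ess\,lim}_{s\to t\pm}g(s)$ at every $t\in I$; $\sigma_t(g):=g(t+)-g(t-)$. $\mathbb G^\infty$ is the algebra of $g\in\mathbb G$ such that for every $k\in\mathbf N$ there is $g^{(k)}\in\mathbb G$ with $g^{(k)}(t\pm)=\operatorname{ess\,lim}_{s\to t\pm}\frac{g^{(k-1)}(s)-g^{(k-1)}(t\pm)}{s-t}$ for all $t\in I$ ($g^{(0)}=g$), with the norms $\|g\|_k=\max_{0\le i\le k}\|g^{(i)}\|_{L_\infty}$, $k\in\mathbf N_0$. For $g\in\mathbb G$, $\operatorname{supp}(g)$ is the closure in $I$ of $\{t: g(t-)\ne0\text{ or }g(t+)\ne0\}$. $\mathcal R$ is the space of $\varphi\in\mathbb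 G^\infty$ with compact support in $I$, with the locally convex inductive limit topology of the countably normed spaces $\{\varphi\in\mathbb G^\infty:\varphi=0\text{ outside }J\}$ (norms $\|\cdot\|_k$), $J$ running over bounded subintervals with $\bar J\subset I$. $\mathcal R'$ is the space of continuous linear functionals $f:\mathcal R\to\mathbf C$, $\varphi\mapsto(f,\varphi)$, with the weak* topology. A locally summable function $f$ is identified with the distribution $(f,\varphi)=\int_I f\varphi\,dt$. Product: for a function $g$ such that $g\varphi\in\mathcal R$ for all $\varphi\in\mathcal R$ and $\varphi\mapsto g\varphi$ is continuous on $\mathcal R$ (in particular $g\in\mathbb G^\infty$, or $g$ an entry of $X$ or $X^{-1}$), $(gf,\varphi):=(f,g\varphi)$. Derivative: let $\mathbb C$ be the bounded continuous functions on $I$; $\mathbb F_k\subset\mathbb G^\infty$ is the set of $g$ with $g^{(i)}\in\mathbb C$ for all $i\ne k$ and $g^{(k)}$ piecewise continuous (locally finitely many discontinuities); $\mathbb F$ is the linear span of all $\mathbb F_k$, $k\in\mathbf N_0$; $\mathcal R_F=\mathcal R\cap\mathbb F$. $\Delta\subset\mathcal R'$ is the set of $g\in\mathcal R'$ for which there is $c:I\to\mathbf C$ with $(g,\varphi)=\sum_{t\in I}c(t)\sigma_t(\varphi)$ for all $\varphi\in\mathcal R_F$ (a finite sum). For $f\in\mathcal R'$ let $(\frac{df}{dt},\varphi):=-(f,\varphi')$; a derivative of $f$ is any element $f'$ of $D(f):=\frac{df}{dt}+\Delta$ (differentiation is multivalued). $\mathcal R^{n\prime}$ is the space of $\mathbf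 C^n$-valued distributions ($n$-tuples of elements of $\mathcal R'$), and $\mathbb G^\infty_{n\times n}$ the $n\times n$ matrices with entries in $\mathbb G^\infty$; all operations are componentwise, matrix-times-vector as usual. "$f=0$ for $t<t_0$" means $(f,\varphi)=0$ for all $\varphi\in\mathcal R$ with $\operatorname{supp}(\varphi)\subset(a,t_0)$. A solution of $x'-A(t)x=f$ is $x\in\mathcal R^{n\prime}$ having some derivative $x'\in D(x)$ (componentwise) with $(x'-Ax,\varphi)=(f,\varphi)$ for all $\varphi\in\mathcal R$. A primitive of $h\in\mathcal R^{n\prime}$ is a solution $y$ of $y'=h$ (i.e. $h\in D(y)$ componentwise). The fundamental matrix $X$ is an invertible, locally absolutely continuous $n\times n$ matrix function with $X'=AX$ a.e. *)

theory Defs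
  imports "HOL-Analysis.Analysis" "HOL-Probability.Essential_Supremum"
begin

text \<open>
  Throughout, \<open>I\<close> is an open interval of the real line. A function on \<open>I\<close> is represented by a
  total function \<open>real \<Rightarrow> complex\<close>; only its almost-everywhere class on \<open>I\<close> matters. (The exception is
  the fundamental matrix, which is a genuine pointwise function on \<open>I\<close>.) Functionals need no
  separate invariance requirement: test functions that agree almost everywhere on \<open>I\<close> are
  topologically indistinguishable, so a continuous functional takes the same value on them.
\<close>

section \<open>One-sided essential limits and the algebras \<open>G\<close> and \<open>G\<^sup>\<infinity>\<close>\<close>

text \<open>A property holds eventually for these filters iff it holds for almost all points of some
  \<open>{t<..<t + d}\<close> (respectively \<open>{t - d<..<t}\<close>) with \<open>d > 0\<close>.\<close>

definition ess_right :: "real \<Rightarrow> real filter" where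
  "ess_right t = inf (at_right t) (ae_filter lebesgue)"

definition ess_left :: "real \<Rightarrow> real filter" where
  "ess_left t = inf (at_left t) (ae_filter lebesgue)"

definition rlim :: "(real \<Rightarrow> complex) \<Rightarrow> real \<Rightarrow> complex" where
  "rlim g t = Lim (ess_right t) g"

definition llim :: "(real \<Rightarrow> complex) \<Rightarrow> real \<Rightarrow> complex" where
  "llim g t = Lim (ess_left t) g"

definition jump :: "real \<Rightarrow> (real \<Rightarrow> complex) \<Rightarrow> complex" where
  "jump t g = rlim g t - llim g t"

definition reg_fun :: "real set \<Rightarrow> (real \<Rightarrow> complex) set" where
  "reg_fun I = {g. g \<in> borel_measurable (lebesgue_on I)
      \<and> (\<exists>C. AE t in lebesgue_on I. norm (g t) \<le> C)
      \<and> (\<forall>t\<in>I. (\<exists>l. (g \<longlongrightarrow> l) (ess_right t)) \<and> (\<exists>l. (g \<longlongrightarrow> l) (ess_left t)))}"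

definition is_gderiv :: "real set \<Rightarrow> (real \<Rightarrow> complex) \<Rightarrow> (real \<Rightarrow> complex) \<Rightarrow> bool" where
  "is_gderiv I g h \<longleftrightarrow> h \<in> reg_fun I \<and>
     (\<forall>t\<in>I. ((\<lambda>s. (g s - rlim g t) / of_real (s - t)) \<longlongrightarrow> rlim h t) (ess_right t)
          \<and> ((\<lambda>s. (g s - llim g t) / of_real (s - t)) \<longlongrightarrow> llim h t) (ess_left t))"

definition smooth_reg_fun :: "real set \<Rightarrow> (real \<Rightarrow> complex) set" where
  "smooth_reg_fun I = {g. g \<in> reg_fun I \<and>
     (\<exists>D. D 0 = g \<and> (\<forall>k::nat. is_gderiv I (D k) (D (Suc k))))}"

text \<open>The derivative is determined almost everywhere on \<open>I\<close>; a representative is chosen.\<close>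

definition gderiv :: "real set \<Rightarrow> (real \<Rightarrow> complex) \<Rightarrow> real \<Rightarrow> complex" where
  "gderiv I g = (SOME h. is_gderiv I g h)"

definition Linf_norm :: "real set \<Rightarrow> (real \<Rightarrow> complex) \<Rightarrow> real" where
  "Linf_norm I g = real_of_ereal (esssup (lebesgue_on I) (\<lambda>t. ereal (norm (g t))))"

definition ck_norm :: "real set \<Rightarrow> nat \<Rightarrow> (real \<Rightarrow> complex) \<Rightarrow> real" where
  "ck_norm I k g = Max ((\<lambda>i. Linf_norm I ((gderiv I ^^ i) g)) ` {..k})"

definition gsupp :: "real set \<Rightarrow> (real \<Rightarrow> complex) \<Rightarrow> real set" where
  "gsupp I g = I \<inter> closure {t\<in>I. llim g t \<noteq> 0 \<or> rlim g t \<noteq> 0}"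

section \<open>Test functions and distributions\<close>

definition test_fun :: "real set \<Rightarrow> (real \<Rightarrow> complex) set" where
  "test_fun I = {\<phi> \<in> smooth_reg_fun I. compact (gsupp I \<phi>)}"

definition admissible :: "real set \<Rightarrow> real set \<Rightarrow> bool" where
  "admissible I J \<longleftrightarrow> is_interval J \<and> bounded J \<and> closure J \<subseteq> I"

definition test_fun_on :: "real set \<Rightarrow> real set \<Rightarrow> (real \<Rightarrow> complex) set" where
  "test_fun_on I J = {\<phi> \<in> smooth_reg_fun I. AE t in lebesgue_on I. t \<notin> J \<longrightarrow> \<phi> t = 0}"

definition abs_convex :: "(real \<Rightarrow> complex) set \<Rightarrow> bool" where
  "abs_convex V \<longleftrightarrow> (\<forall>u\<in>V. \<forall>v\<in>V. \<forall>\<alpha> \<beta> :: complex.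
     norm \<alpha> + norm \<beta> \<le> 1 \<longrightarrow> (\<lambda>t. \<alpha> * u t + \<beta> * v t) \<in> V)"

text \<open>Basic neighbourhoods of zero of the locally convex inductive limit: the absolutely convex
  sets whose trace on every step \<open>test_fun_on I J\<close> is a neighbourhood of zero there. (The norms
  \<open>ck_norm I k\<close> increase with \<open>k\<close>, so one of them suffices.)\<close>

definition ind_nhd :: "real set \<Rightarrow> (real \<Rightarrow> complex) set \<Rightarrow> bool" where
  "ind_nhd I V \<longleftrightarrow> V \<subseteq> test_fun I \<and> abs_convex V \<and>
     (\<forall>J. admissible I J \<longrightarrow>
       (\<exists>k. \<exists>e>0. \<forall>\<phi>\<in>test_fun_on I J. ck_norm I k \<phi> < e \<longrightarrow> \<phi> \<in> V))"

definition test_open :: "real set \<Rightarrow> (real \<Rightarrow> complex) set \<Rightarrow> bool" where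
  "test_open I U \<longleftrightarrow> U \<subseteq> test_fun I \<and>
     (\<forall>\<phi>\<in>U. \<exists>V. ind_nhd I V \<and> (\<forall>\<psi>\<in>V. (\<lambda>t. \<phi> t + \<psi> t) \<in> U))"

definition test_topology :: "real set \<Rightarrow> (real \<Rightarrow> complex) topology" where
  "test_topology I = topology (test_open I)"

lemma ind_nhd_Int:
  assumes "ind_nhd I V" "ind_nhd I W"
  shows "ind_nhd I (V \<inter> W)"
proof -
  have mono: "ck_norm I k \<phi> \<le> ck_norm I m \<phi>" if "k \<le> m" for k m \<phi>
    unfolding ck_norm_def using that by (intro Max_mono) auto
  have "\<exists>k. \<exists>e>0. \<forall>\<phi>\<in>test_fun_on I J. ck_norm I k \<phi> < e \<longrightarrow> \<phi> \<in> V \<inter> W"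
    if J: "admissible I J" for J
  proof -
    obtain k1 e1 where 1: "e1 > 0" "\<forall>\<phi>\<in>test_fun_on I J. ck_norm I k1 \<phi> < e1 \<longrightarrow> \<phi> \<in> V"
      using assms(1) J unfolding ind_nhd_def by blast
    obtain k2 e2 where 2: "e2 > 0" "\<forall>\<phi>\<in>test_fun_on I J. ck_norm I k2 \<phi> < e2 \<longrightarrow> \<phi> \<in> W"
      using assms(2) J unfolding ind_nhd_def by blast
    have "\<phi> \<in> V \<inter> W"
      if "\<phi> \<in> test_fun_on I J" "ck_norm I (max k1 k2) \<phi> < min e1 e2" for \<phi>
      using 1(2) 2(2) that mono[of k1 "max k1 k2" \<phi>] mono[of k2 "max k1 k2" \<phi>] by fastforce
    then show ?thesis using 1(1) 2(1) by (metis min_less_iff_conj)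
  qed
  then show ?thesis
    using assms unfolding ind_nhd_def abs_convex_def by blast
qed

lemma istopology_test_open: "istopology (test_open I)"
  unfolding istopology_def
proof (intro conjI allI impI)
  fix S T assume S: "test_open I S" and T: "test_open I T"
  have "\<exists>V. ind_nhd I V \<and> (\<forall>\<psi>\<in>V. (\<lambda>t. \<phi> t + \<psi> t) \<in> S \<inter> T)" if \<phi>: "\<phi> \<in> S \<inter> T" for \<phi>
  proof -
    obtain V where V: "ind_nhd I V" "\<forall>\<psi>\<in>V. (\<lambda>t. \<phi> t + \<psi> t) \<in> S"
      using S \<phi> unfolding test_open_def by blast
    obtain W where W: "ind_nhd I W" "\<forall>\<psi>\<in>W. (\<lambda>t. \<phi> t + \<psi> t) \<in> T"
      using T \<phi> unfolding test_open_def by blast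
    show ?thesis using ind_nhd_Int[OF V(1) W(1)] V(2) W(2) by blast
  qed
  then show "test_open I (S \<inter> T)"
    using S unfolding test_open_def by blast
next
  fix \<K> assume "\<forall>K\<in>\<K>. test_open I K"
  then show "test_open I (\<Union>\<K>)"
    unfolding test_open_def by (meson UnionE UnionI Sup_least)
qed

lemma openin_test_topology: "openin (test_topology I) = test_open I"
  unfolding test_topology_def using istopology_test_open by (rule topology_inverse')

text \<open>Distributions are extended by zero to arguments that are not test functions, so that
  equality of distributions is equality of HOL functions.\<close>

type_synonym dist = "(real \<Rightarrow> complex) \<Rightarrow> complex"

definition distrib :: "real set \<Rightarrow> dist set" where
  "distrib I = {f.
     (\<forall>\<phi>\<in>test_fun I. \<forall>\<psi>\<in>test_fun I. f (\<lambda>t. \<phi> t + \<psi> t) = f \<phi> + f \<psi>) \<and>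
     (\<forall>\<phi>\<in>test_fun I. \<forall>c. f (\<lambda>t. c * \<phi> t) = c * f \<phi>) \<and>
     continuous_map (test_topology I) euclidean f \<and>
     (\<forall>\<phi>. \<phi> \<notin> test_fun I \<longrightarrow> f \<phi> = 0)}"

definition mult_dist :: "real set \<Rightarrow> (real \<Rightarrow> complex) \<Rightarrow> dist \<Rightarrow> dist" where
  "mult_dist I g f = (\<lambda>\<phi>. if \<phi> \<in> test_fun I then f (\<lambda>t. g t * \<phi> t) else 0)"

section \<open>The multivalued derivative\<close>

definition ess_bdd_cont :: "real set \<Rightarrow> (real \<Rightarrow> complex) set" where
  "ess_bdd_cont I = {g. \<exists>h. continuous_on I h \<and> bounded (h ` I) \<and> (AE t in lebesgue_on I. g t = h t)}"

definition ess_piecewise_cont :: "real set \<Rightarrow> (real \<Rightarrow> complex) set" where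
  "ess_piecewise_cont I = {g. \<exists>h.
     (\<forall>K. compact K \<and> K \<subseteq> I \<longrightarrow> finite {t\<in>K. \<not> isCont h t}) \<and> (AE t in lebesgue_on I. g t = h t)}"

definition F_level :: "real set \<Rightarrow> nat \<Rightarrow> (real \<Rightarrow> complex) set" where
  "F_level I k = {g \<in> smooth_reg_fun I.
     (\<forall>i. i \<noteq> k \<longrightarrow> (gderiv I ^^ i) g \<in> ess_bdd_cont I) \<and>
     (gderiv I ^^ k) g \<in> ess_piecewise_cont I}"

definition F_span :: "real set \<Rightarrow> (real \<Rightarrow> complex) set" where
  "F_span I = {g. \<exists>S c. finite S \<and> S \<subseteq> (\<Union>k. F_level I k) \<and> g = (\<lambda>t. \<Sum>h\<in>S. c h * h t)}"

definition test_fun_F :: "real set \<Rightarrow> (real \<Rightarrow> complex) set" where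
  "test_fun_F I = test_fun I \<inter> F_span I"

text \<open>An element of \<open>test_fun_F I\<close> has only finitely many jumps in \<open>I\<close>, so the sum is finite.\<close>

definition Delta :: "real set \<Rightarrow> dist set" where
  "Delta I = {g \<in> distrib I. \<exists>c :: real \<Rightarrow> complex.
     \<forall>\<phi>\<in>test_fun_F I. g \<phi> = (\<Sum>t | t \<in> I \<and> jump t \<phi> \<noteq> 0. c t * jump t \<phi>)}"

definition ddt :: "real set \<Rightarrow> dist \<Rightarrow> dist" where
  "ddt I f = (\<lambda>\<phi>. if \<phi> \<in> test_fun I then - f (gderiv I \<phi>) else 0)"

definition derivs :: "real set \<Rightarrow> dist \<Rightarrow> dist set" where
  "derivs I f = {\<lambda>\<phi>. ddt I f \<phi> + \<delta> \<phi> | \<delta>. \<delta> \<in> Delta I}"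

section \<open>Vector-valued distributions and linear systems\<close>

definition distrib_vec :: "real set \<Rightarrow> (dist ^ 'n) set" where
  "distrib_vec I = {f. \<forall>i. f $ i \<in> distrib I}"

definition smooth_reg_mat :: "real set \<Rightarrow> (real \<Rightarrow> complex ^ 'n ^ 'n) set" where
  "smooth_reg_mat I = {A. \<forall>i j. (\<lambda>t. A t $ i $ j) \<in> smooth_reg_fun I}"

definition mat_mult_dist :: "real set \<Rightarrow> (real \<Rightarrow> complex ^ 'n ^ 'n) \<Rightarrow> dist ^ 'n \<Rightarrow> dist ^ 'n" where
  "mat_mult_dist I A f = (\<chi> i. (\<lambda>\<phi>. \<Sum>j\<in>UNIV. mult_dist I (\<lambda>t. A t $ i $ j) (f $ j) \<phi>))"

definition zero_before :: "real set \<Rightarrow> real \<Rightarrow> dist ^ 'n \<Rightarrow> bool" where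
  "zero_before I t\<^sub>0 f \<longleftrightarrow>
     (\<forall>\<phi>\<in>test_fun I. gsupp I \<phi> \<subseteq> I \<inter> {..<t\<^sub>0} \<longrightarrow> (\<forall>i. (f $ i) \<phi> = 0))"

definition is_solution ::
    "real set \<Rightarrow> (real \<Rightarrow> complex ^ 'n ^ 'n) \<Rightarrow> dist ^ 'n \<Rightarrow> dist ^ 'n \<Rightarrow> bool" where
  "is_solution I A f x \<longleftrightarrow> x \<in> distrib_vec I \<and>
     (\<exists>x' :: dist ^ 'n. (\<forall>i. x' $ i \<in> derivs I (x $ i)) \<and>
        (\<forall>\<phi>\<in>test_fun I. \<forall>i. (x' $ i) \<phi> - (mat_mult_dist I A x $ i) \<phi> = (f $ i) \<phi>))"

definition is_primitive :: "real set \<Rightarrow> dist ^ 'n \<Rightarrow> dist ^ 'n \<Rightarrow> bool" where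
  "is_primitive I h y \<longleftrightarrow> h \<in> distrib_vec I \<and> y \<in> distrib_vec I \<and> (\<forall>i. h $ i \<in> derivs I (y $ i))"

definition abs_cont_on :: "real set \<Rightarrow> (real \<Rightarrow> 'a::metric_space) \<Rightarrow> bool" where
  "abs_cont_on S X \<longleftrightarrow> (\<forall>e>0. \<exists>d>0. \<forall>(m::nat) u v.
     (\<forall>i<m. u i \<in> S \<and> v i \<in> S \<and> u i \<le> v i) \<and>
     disjoint_family_on (\<lambda>i. {u i<..<v i}) {..<m} \<and> (\<Sum>i<m. v i - u i) < d
     \<longrightarrow> (\<Sum>i<m. dist (X (u i)) (X (v i))) < e)"

definition fundamental_matrix ::
    "real set \<Rightarrow> (real \<Rightarrow> complex ^ 'n ^ 'n) \<Rightarrow> (real \<Rightarrow> complex ^ 'n ^ 'n) \<Rightarrow> bool" where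
  "fundamental_matrix I A X \<longleftrightarrow> (\<forall>t\<in>I. invertible (X t)) \<and>
     (\<forall>c d. {c..d} \<subseteq> I \<longrightarrow> abs_cont_on {c..d} X) \<and>
     (AE t in lebesgue_on I. (X has_vector_derivative A t ** X t) (at t))"

end

theory Submission
  imports Defs
begin

text \<open>
  Multiplication by the inverse \<open>Y\<close> of the fundamental matrix turns the Cauchy problem into the search
  for a primitive: by the Leibniz rule, \<open>x\<close> solves \<open>x' - A x = f\<close> iff \<open>y = Y x\<close> satisfies
  \<open>y' = Y f\<close>, because \<open>Y' = - Y A\<close>. A primitive of \<open>h\<close> that vanishes before \<open>t\<^sub>0\<close> is obtained by duality
  from the integral operator that sends a test function to its antiderivative vanishing on the
  right, cut off by a step function at some point \<open>u < t\<^sub>0\<close>.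

  The delicate point is that elements of \<open>Delta I\<close> are prescribed only on \<open>test_fun_F I\<close>, while both the
  Leibniz rule and the uniqueness of primitives evaluate them on other test functions. A test
  function with finitely many jumps is a limit, in every norm and with fixed support, of piecewise
  polynomials that have exactly the same jumps: near a point one takes one-sided Taylor
  polynomials with a linear correction, and these local pieces are chained together by bisection.
  Piecewise polynomials with compact support belong to \<open>test_fun_F I\<close>, being combinations of truncated
  powers times a smooth cutoff function. Hence the formula that defines \<open>Delta I\<close> extends to all test
  functions with finitely many jumps.
\<close>

section \<open>One-sided essential limits\<close>

text \<open>Functions enter only through their one-sided essential limits \<open>lm b g t\<close>,
  which determine the almost-everywhere class, so that null sets disappear from most arguments. The
  multipliers are entries of \<open>X\<close> and of its inverse; these may be unbounded on
  \<open>I\<close>, which is why the calculus is built on local notions (\<open>lreg\<close>,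
  \<open>lder\<close>, \<open>lsm\<close>) without the global bounds of
  \<open>smooth_reg_fun I\<close>.

  Members of \<open>Delta I\<close> have to be evaluated outside \<open>test_fun_F I\<close> for two
  reasons. An entry \<open>m\<close> of \<open>X\<close> is continuous, but its derivatives may jump
  at infinitely many points because \<open>A\<close> may; so \<open>m * \<phi>\<close> keeps
  finitely many jumps of its own and yet need not lie in the span. In the uniqueness proof the test
  function is built from an antiderivative of an arbitrary test function: it is continuous, with
  uncontrolled derivatives.

  The linear correction exists because a Taylor polynomial at \<open>x\<close> misses the prescribed
  value at the other end \<open>y\<close>. Its error there is a small multiple of the distance from
  \<open>x\<close> to \<open>y\<close>, so a line of small slope repairs it, and it perturbs only
  the derivatives of order 0 and 1.\<close>

definition es :: "bool \<Rightarrow> real \<Rightarrow> real filter" where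
  "es b t = (if b then ess_right t else ess_left t)"

definition side :: "bool \<Rightarrow> real \<Rightarrow> real \<Rightarrow> real set" where
  "side b t d = (if b then {t<..<t + d} else {t - d<..<t})"

definition lm :: "bool \<Rightarrow> (real \<Rightarrow> complex) \<Rightarrow> real \<Rightarrow> complex" where
  "lm b g t = Lim (es b t) g"

lemma rlim_eq_lm: "rlim g t = lm True g t"
  and llim_eq_lm: "llim g t = lm False g t"
  by (simp_all add: rlim_def llim_def lm_def es_def)

lemma jump_eq_lm: "jump t g = lm True g t - lm False g t"
  by (simp add: jump_def rlim_eq_lm llim_eq_lm)

lemma open_side: "open (side b t d)"
  by (simp add: side_def)

lemma eventually_es: "eventually P (es b t) \<longleftrightarrow> (\<exists>d>0. AE s in lebesgue. s \<in> side b t d \<longrightarrow> P s)"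
proof
  assume "eventually P (es b t)"
  then obtain Q R where Q: "eventually Q (if b then at_right t else at_left t)"
    and R: "eventually R (ae_filter lebesgue)" and P: "\<And>s. Q s \<and> R s \<Longrightarrow> P s"
    unfolding es_def ess_right_def ess_left_def by (cases b) (auto simp: eventually_inf)
  have "\<exists>d>0. \<forall>s\<in>side b t d. Q s"
  proof (cases b)
    case True
    then obtain u where "u > t" "\<forall>y>t. y < u \<longrightarrow> Q y"
      using Q by (auto simp: eventually_at_right_field)
    then show ?thesis using True by (intro exI[of _ "u - t"]) (auto simp: side_def)
  next
    case False
    then obtain u where "u < t" "\<forall>y>u. y < t \<longrightarrow> Q y"
      using Q by (auto simp: eventually_at_left_field)
    then show ?thesis using False by (intro exI[of _ "t - u"]) (auto simp: side_def)
  qed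
  then obtain d where "d > 0" "\<forall>s\<in>side b t d. Q s" by blast
  moreover from this have "AE s in lebesgue. s \<in> side b t d \<longrightarrow> P s"
    using R by (auto intro: eventually_mono P)
  ultimately show "\<exists>d>0. AE s in lebesgue. s \<in> side b t d \<longrightarrow> P s" by blast
next
  assume "\<exists>d>0. AE s in lebesgue. s \<in> side b t d \<longrightarrow> P s"
  then obtain d where d: "d > 0" "AE s in lebesgue. s \<in> side b t d \<longrightarrow> P s" by blast
  have *: "eventually (\<lambda>s. s \<in> side b t d) (if b then at_right t else at_left t)"
  proof (cases b)
    case True
    then show ?thesis using d(1)
      by (auto simp: side_def eventually_at_right_field intro!: exI[of _ "t + d"])
  next
    case False
    then show ?thesis using d(1)
      by (auto simp: side_def eventually_at_left_field intro!: exI[of _ "t - d"])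
  qed
  show "eventually P (es b t)"
  proof (cases b)
    case True
    then show ?thesis using * d(2) by (simp add: es_def ess_right_def eventually_inf) blast
  next
    case False
    then show ?thesis using * d(2) by (simp add: es_def ess_left_def eventually_inf) blast
  qed
qed

lemma emeasure_lebesgue_open_pos:
  fixes S :: "real set"
  assumes "open S" "S \<noteq> {}"
  shows "emeasure lebesgue S \<noteq> 0"
proof
  assume "emeasure lebesgue S = 0"
  then have "negligible S"
    using assms(1) by (auto simp: negligible_iff_null_sets null_sets_def borel_open)
  then show False using open_not_negligible assms by blast
qed

text \<open>A one-sided neighbourhood is a nonempty open set and hence not a null set. Uniqueness of
  one-sided limits, and with it the meaning of \<open>lm\<close>, rests on this.\<close>

lemma es_nontriv [simp]: "es b t \<noteq> bot"
proof
  assume "es b t = bot"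
  then have "eventually (\<lambda>_. False) (es b t)" by simp
  then obtain d where d: "d > 0" "AE s in lebesgue. s \<notin> side b t d"
    by (auto simp: eventually_es)
  have "side b t d \<in> sets lebesgue" using open_side by (simp add: borel_open)
  then have "emeasure lebesgue (side b t d) = 0"
    using d(2) by (simp add: AE_iff_null_sets null_setsD1 AE_iff_measurable[of "side b t d"])
  moreover have "side b t d \<noteq> {}" using d(1) by (auto simp: side_def)
  ultimately show False using emeasure_lebesgue_open_pos open_side by blast
qed

lemma lm_eq: "(g \<longlongrightarrow> l) (es b t) \<Longrightarrow> lm b g t = l"
  unfolding lm_def by (simp add: tendsto_Lim)

lemma AE_lebesgue_neq: "AE s in lebesgue. s \<noteq> (t::real)"
  by (rule AE_I[where N="{t}"]) auto

text \<open>Passes between statements almost everywhere and statements at every point of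
  \<open>S\<close>. From right to left, each point has a neighbourhood on which \<open>P\<close>
  holds almost everywhere, the point itself being null; Lindelof reduces this cover to a countable
  one.\<close>

lemma AE_open_iff:
  assumes "open S"
  shows "(AE s in lebesgue. s \<in> S \<longrightarrow> P s) \<longleftrightarrow> (\<forall>t\<in>S. \<forall>b. eventually P (es b t))"
proof
  assume A: "AE s in lebesgue. s \<in> S \<longrightarrow> P s"
  show "\<forall>t\<in>S. \<forall>b. eventually P (es b t)"
  proof (intro ballI allI)
    fix t b assume "t \<in> S"
    then obtain d where d: "d > 0" "ball t d \<subseteq> S" using assms by (meson openE)
    then have "side b t d \<subseteq> S" by (auto simp: side_def dist_real_def ball_def subset_iff split: if_splits)
    then show "eventually P (es b t)" unfolding eventually_es using A d(1)
      by (intro exI[of _ d]) (auto elim: eventually_mono)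
  qed
next
  assume A: "\<forall>t\<in>S. \<forall>b. eventually P (es b t)"
  define \<U> where "\<U> = {U. open U \<and> U \<subseteq> S \<and> (AE s in lebesgue. s \<in> U \<longrightarrow> P s)}"
  have cov: "\<Union>\<U> = S"
  proof
    show "\<Union>\<U> \<subseteq> S" by (auto simp: \<U>_def)
    show "S \<subseteq> \<Union>\<U>"
    proof
      fix t assume t: "t \<in> S"
      obtain d1 where d1: "d1 > 0" "AE s in lebesgue. s \<in> side True t d1 \<longrightarrow> P s"
        using A t unfolding eventually_es by blast
      obtain d2 where d2: "d2 > 0" "AE s in lebesgue. s \<in> side False t d2 \<longrightarrow> P s"
        using A t unfolding eventually_es by blast
      have "AE s in lebesgue. s \<in> {t - d2<..<t + d1} \<inter> S \<longrightarrow> P s"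
        using d1(2) d2(2) AE_lebesgue_neq[of t] by eventually_elim (auto simp: side_def)
      then have "{t - d2<..<t + d1} \<inter> S \<in> \<U>" using assms by (auto simp: \<U>_def)
      moreover have "t \<in> {t - d2<..<t + d1} \<inter> S" using t d1(1) d2(1) by simp
      ultimately show "t \<in> \<Union>\<U>" by (rule UnionI)
    qed
  qed
  obtain \<V> where V: "\<V> \<subseteq> \<U>" "countable \<V>" "\<Union>\<V> = \<Union>\<U>"
    using Lindelof[of \<U>] by (auto simp: \<U>_def)
  have "AE s in lebesgue. \<forall>U\<in>\<V>. s \<in> U \<longrightarrow> P s"
    using V(1,2) by (subst AE_ball_countable) (auto simp: \<U>_def)
  then show "AE s in lebesgue. s \<in> S \<longrightarrow> P s"
    using V(3) cov by (auto elim!: eventually_mono)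
qed

lemma eventually_es_side: "d > 0 \<Longrightarrow> eventually (\<lambda>s. s \<in> side b t d) (es b t)"
  unfolding eventually_es by blast

lemma eventually_es_open: "open S \<Longrightarrow> t \<in> S \<Longrightarrow> eventually (\<lambda>s. s \<in> S) (es b t)"
  using AE_open_iff[of S "\<lambda>s. s \<in> S"] by auto

text \<open>An interval on one side of \<open>t\<close> is open, so it is a two-sided neighbourhood
  of each of its points. In this way an estimate for \<open>g\<close> near \<open>t\<close> passes
  to the limits \<open>lm b' g s\<close> at neighbouring points \<open>s\<close>.\<close>

lemma eventually_es_local:
  assumes "eventually P (es b t)"
  obtains d where "d > 0" "\<And>s b'. s \<in> side b t d \<Longrightarrow> eventually P (es b' s)"
  using assms AE_open_iff[OF open_side] unfolding eventually_es[of P b t] by metis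

lemma es_le_at: "es b t \<le> at t"
  unfolding es_def ess_right_def ess_left_def
  by (auto intro!: le_infI1 simp: at_le)

lemma tendsto_es_continuous: "isCont g t \<Longrightarrow> (g \<longlongrightarrow> g t) (es b t)"
  using es_le_at filterlim_mono unfolding isCont_def by blast

lemma norm_lm_le:
  assumes "(g \<longlongrightarrow> lm b g t) (es b t)" "eventually (\<lambda>s. norm (g s) \<le> M) (es b t)"
  shows "norm (lm b g t) \<le> M"
  using tendsto_upperbound[OF tendsto_norm[OF assms(1)] assms(2)] by simp

lemma tendsto_es_cong:
  assumes "eventually (\<lambda>s. f s = g s) (es b t)"
  shows "(f \<longlongrightarrow> l) (es b t) \<longleftrightarrow> (g \<longlongrightarrow> l) (es b t)"
  using assms by (rule tendsto_cong)

lemma lm_cong: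
  assumes "eventually (\<lambda>s. f s = g s) (es b t)"
  shows "lm b f t = lm b g t"
  unfolding lm_def t2_space_class.Lim_def by (simp only: tendsto_es_cong[OF assms])

text \<open>Turns essential bounds into bounds on the limits. For the converse, the limit bound
  gives \<open>M + 1 / (n + 1)\<close> near every point, and the exceptional null sets for the
  countably many \<open>n\<close> are united.\<close>

lemma AE_norm_le_iff:
  assumes "open S" "\<And>t b. t \<in> S \<Longrightarrow> (g \<longlongrightarrow> lm b g t) (es b t)"
  shows "(AE s in lebesgue. s \<in> S \<longrightarrow> norm (g s) \<le> M) \<longleftrightarrow> (\<forall>t\<in>S. \<forall>b. norm (lm b g t) \<le> M)"
proof
  assume "AE s in lebesgue. s \<in> S \<longrightarrow> norm (g s) \<le> M"
  then show "\<forall>t\<in>S. \<forall>b. norm (lm b g t) \<le> M"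
    using AE_open_iff[OF assms(1)] norm_lm_le[OF assms(2)] by blast
next
  assume M: "\<forall>t\<in>S. \<forall>b. norm (lm b g t) \<le> M"
  have "AE s in lebesgue. s \<in> S \<longrightarrow> norm (g s) \<le> M + inverse (real (Suc n))" for n
    unfolding AE_open_iff[OF assms(1)]
  proof (intro ballI allI)
    fix t b assume t: "t \<in> S"
    have "norm (lm b g t) < M + inverse (real (Suc n))" using M t by (smt (verit) inverse_positive_iff_positive of_nat_0_less_iff zero_less_Suc)
    then have "\<forall>\<^sub>F s in es b t. norm (g s) < M + inverse (real (Suc n))"
      using order_tendstoD(2)[OF tendsto_norm[OF assms(2)[OF t, of b]]] by blast
    then show "\<forall>\<^sub>F s in es b t. norm (g s) \<le> M + inverse (real (Suc n))"
      by (auto elim: eventually_mono)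
  qed
  then have "AE s in lebesgue. \<forall>n. s \<in> S \<longrightarrow> norm (g s) \<le> M + inverse (real (Suc n))"
    unfolding AE_all_countable by blast
  then show "AE s in lebesgue. s \<in> S \<longrightarrow> norm (g s) \<le> M"
  proof (rule eventually_mono, intro impI)
    fix s assume s: "\<forall>n. s \<in> S \<longrightarrow> norm (g s) \<le> M + inverse (real (Suc n))" "s \<in> S"
    have "(\<lambda>n. M + inverse (real (Suc n))) \<longlonglongrightarrow> M + 0"
      by (intro tendsto_intros LIMSEQ_inverse_real_of_nat)
    then show "norm (g s) \<le> M" using s by (intro LIMSEQ_le_const[of _ M]) auto
  qed
qed

text \<open>Takes the place of Lebesgue's density theorem: near \<open>t\<close> on side
  \<open>b\<close>, both \<open>g s\<close> and the limits of \<open>g\<close> at \<open>s\<close>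
  are within \<open>1 / (n + 1)\<close> of \<open>lm b g t\<close>, hence within twice that of each
  other. So the limits determine \<open>g\<close> up to a null set.\<close>

lemma AE_lm_eq:
  assumes "open S" "\<And>t b. t \<in> S \<Longrightarrow> (g \<longlongrightarrow> lm b g t) (es b t)"
  shows "AE s in lebesgue. s \<in> S \<longrightarrow> (\<forall>b. lm b g s = g s)"
proof -
  have "AE s in lebesgue. s \<in> S \<longrightarrow> (\<forall>b. norm (lm b g s - g s) \<le> 2 * inverse (real (Suc n)))" for n
    unfolding AE_open_iff[OF assms(1)]
  proof (intro ballI allI)
    fix t b assume t: "t \<in> S"
    let ?e = "inverse (real (Suc n))"
    have 1: "\<forall>\<^sub>F s in es b t. dist (g s) (lm b g t) < ?e"
      using assms(2)[OF t] by (rule tendstoD) simp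
    obtain d where d: "d > 0" "\<And>s b'. s \<in> side b t d \<Longrightarrow> \<forall>\<^sub>F r in es b' s. dist (g r) (lm b g t) < ?e"
      using eventually_es_local[OF 1] by metis
    have "\<forall>\<^sub>F s in es b t. s \<in> side b t d \<and> s \<in> S"
      using eventually_es_side[OF d(1)] eventually_es_open[OF assms(1) t] by (auto intro: eventually_conj)
    with 1 show "\<forall>\<^sub>F s in es b t. \<forall>b. norm (lm b g s - g s) \<le> 2 * ?e"
    proof eventually_elim
      case (elim s)
      show ?case
      proof
        fix b'
        have "((\<lambda>r. dist (g r) (lm b g t)) \<longlongrightarrow> dist (lm b' g s) (lm b g t)) (es b' s)"
          using assms(2) elim by (intro tendsto_intros) auto
        then have "dist (lm b' g s) (lm b g t) \<le> ?e"
          by (rule tendsto_upperbound) (use d(2)[of s b'] elim in \<open>auto elim!: eventually_mono\<close>)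
        then show "norm (lm b' g s - g s) \<le> 2 * ?e"
          using elim by (smt (verit) dist_commute dist_norm dist_triangle2)
      qed
    qed
  qed
  then have "AE s in lebesgue. \<forall>n. s \<in> S \<longrightarrow> (\<forall>b. norm (lm b g s - g s) \<le> 2 * inverse (real (Suc n)))"
    unfolding AE_all_countable by blast
  then show ?thesis
  proof (rule eventually_mono, intro impI allI)
    fix s b assume s: "\<forall>n. s \<in> S \<longrightarrow> (\<forall>b. norm (lm b g s - g s) \<le> 2 * inverse (real (Suc n)))" "s \<in> S"
    have "(\<lambda>n. 2 * inverse (real (Suc n))) \<longlonglongrightarrow> 2 * 0"
      by (intro tendsto_intros LIMSEQ_inverse_real_of_nat)
    then have "norm (lm b g s - g s) \<le> 2 * 0" using s by (elim LIMSEQ_le_const) blast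
    then show "lm b g s = g s" by simp
  qed
qed

section \<open>Locally regulated functions and their derivatives\<close>

locale open_interval =
  fixes I :: "real set"
  assumes open_I: "open I" and interval_I: "is_interval I" and nonempty_I: "I \<noteq> {}"
begin

lemma segment_subset: "c \<in> I \<Longrightarrow> d \<in> I \<Longrightarrow> {c..d} \<subseteq> I"
  using interval_I unfolding is_interval_1 by (meson atLeastAtMost_iff subsetI)

lemma AE_I_iff: "(AE t in lebesgue_on I. P t) \<longleftrightarrow> (AE t in lebesgue. t \<in> I \<longrightarrow> P t)"
  using open_I by (subst AE_restrict_space_iff) (auto simp: borel_open)

text \<open>This is \<open>reg_fun I\<close> without the global bound: entries of the fundamental
  matrix may be unbounded on \<open>I\<close>, but they have to serve as multipliers.\<close>

definition lreg :: "(real \<Rightarrow> complex) \<Rightarrow> bool" where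
  "lreg g \<longleftrightarrow> g \<in> borel_measurable (lebesgue_on I) \<and> (\<forall>t\<in>I. \<forall>b. (g \<longlongrightarrow> lm b g t) (es b t))"

text \<open>A relation and not a function, since \<open>h\<close> is determined only up to a null
  set. The one-sided quotients are centred at \<open>lm b g t\<close>, so a jump of \<open>g\<close>
  contributes nothing to \<open>h\<close>.\<close>

definition lder :: "(real \<Rightarrow> complex) \<Rightarrow> (real \<Rightarrow> complex) \<Rightarrow> bool" where
  "lder g h \<longleftrightarrow> lreg h \<and>
     (\<forall>t\<in>I. \<forall>b. ((\<lambda>s. (g s - lm b g t) / of_real (s - t)) \<longlongrightarrow> lm b h t) (es b t))"

lemma lregI:
  assumes "g \<in> borel_measurable (lebesgue_on I)" "\<And>t b. t \<in> I \<Longrightarrow> (g \<longlongrightarrow> l b t) (es b t)"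
  shows "lreg g"
  using assms lm_eq unfolding lreg_def by metis

lemma lreg_tendsto: "lreg g \<Longrightarrow> t \<in> I \<Longrightarrow> (g \<longlongrightarrow> lm b g t) (es b t)"
  by (simp add: lreg_def)

lemma lreg_measurable: "lreg g \<Longrightarrow> g \<in> borel_measurable (lebesgue_on I)"
  by (simp add: lreg_def)

lemma lder_lreg: "lder g h \<Longrightarrow> lreg h"
  by (simp add: lder_def)

lemma lder_tendsto:
  "lder g h \<Longrightarrow> t \<in> I \<Longrightarrow> ((\<lambda>s. (g s - lm b g t) / of_real (s - t)) \<longlongrightarrow> lm b h t) (es b t)"
  by (simp add: lder_def)

lemma lderI:
  assumes "lreg h" "\<And>t b. t \<in> I \<Longrightarrow> ((\<lambda>s. (g s - lm b g t) / of_real (s - t)) \<longlongrightarrow> lm b h t) (es b t)"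
  shows "lder g h"
  using assms by (simp add: lder_def)

lemma lder_unique: "lder g h \<Longrightarrow> lder g h' \<Longrightarrow> t \<in> I \<Longrightarrow> lm b h t = lm b h' t"
  by (rule tendsto_unique[OF es_nontriv lder_tendsto lder_tendsto])

lemma lder_cong:
  assumes "lder g h" "\<And>t b. t \<in> I \<Longrightarrow> eventually (\<lambda>s. g s = g' s) (es b t)"
  shows "lder g' h"
proof (rule lderI[OF lder_lreg[OF assms(1)]])
  fix t b assume t: "t \<in> I"
  have "\<forall>\<^sub>F s in es b t. (g s - lm b g t) / of_real (s - t) = (g' s - lm b g' t) / of_real (s - t)"
    using assms(2)[OF t, of b] lm_cong[OF assms(2)[OF t, of b]] by (auto elim: eventually_mono)
  from tendsto_es_cong[OF this] show "((\<lambda>s. (g' s - lm b g' t) / of_real (s - t)) \<longlongrightarrow> lm b h t) (es b t)"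
    using lder_tendsto[OF assms(1) t] by blast
qed

text \<open>Both functions agree almost everywhere with their limits, so equal limits mean equality
  almost everywhere on \<open>I\<close>.\<close>

lemma lreg_lm_eq_imp_eventually:
  assumes "lreg g" "lreg h" "\<And>t b. t \<in> I \<Longrightarrow> lm b g t = lm b h t" "t \<in> I"
  shows "eventually (\<lambda>s. g s = h s) (es b t)"
proof -
  have "AE s in lebesgue. s \<in> I \<longrightarrow> (\<forall>b. lm b g s = g s)" "AE s in lebesgue. s \<in> I \<longrightarrow> (\<forall>b. lm b h s = h s)"
    using AE_lm_eq[OF open_I] assms(1,2) by (auto simp: lreg_def)
  then have "AE s in lebesgue. s \<in> I \<longrightarrow> g s = h s"
    by eventually_elim (metis assms(3))
  then show ?thesis using AE_open_iff[OF open_I] assms(4) by blast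
qed

lemma lreg_add: "lreg f \<Longrightarrow> lreg g \<Longrightarrow> lreg (\<lambda>s. f s + g s)"
  by (rule lregI[where l="\<lambda>b t. lm b f t + lm b g t"])
    (auto intro!: tendsto_intros simp: lreg_def)

lemma lreg_mult: "lreg f \<Longrightarrow> lreg g \<Longrightarrow> lreg (\<lambda>s. f s * g s)"
  by (rule lregI[where l="\<lambda>b t. lm b f t * lm b g t"])
    (auto intro!: tendsto_intros simp: lreg_def)

lemma lreg_const: "lreg (\<lambda>_. c)"
  by (rule lregI[where l="\<lambda>_ _. c"]) auto

lemma lm_const [simp]: "lm b (\<lambda>_. c) t = c"
  by (rule lm_eq) simp

lemma lm_add: "lreg f \<Longrightarrow> lreg g \<Longrightarrow> t \<in> I \<Longrightarrow> lm b (\<lambda>s. f s + g s) t = lm b f t + lm b g t"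
  by (rule lm_eq) (auto intro!: tendsto_intros simp: lreg_def)

lemma lm_mult: "lreg f \<Longrightarrow> lreg g \<Longrightarrow> t \<in> I \<Longrightarrow> lm b (\<lambda>s. f s * g s) t = lm b f t * lm b g t"
  by (rule lm_eq) (auto intro!: tendsto_intros simp: lreg_def)

lemma lder_const: "lder (\<lambda>_. c) (\<lambda>_. 0)"
  by (rule lderI[OF lreg_const]) simp

lemma lder_add:
  assumes "lder f f'" "lder g g'" "lreg f" "lreg g"
  shows "lder (\<lambda>s. f s + g s) (\<lambda>s. f' s + g' s)"
proof (rule lderI)
  show "lreg (\<lambda>s. f' s + g' s)" using assms lder_lreg lreg_add by blast
  fix t b assume t: "t \<in> I"
  have "((\<lambda>s. (f s - lm b f t) / of_real (s - t) + (g s - lm b g t) / of_real (s - t))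
      \<longlongrightarrow> lm b f' t + lm b g' t) (es b t)"
    using lder_tendsto assms t by (intro tendsto_add) auto
  then show "((\<lambda>s. (f s + g s - lm b (\<lambda>s. f s + g s) t) / of_real (s - t))
      \<longlongrightarrow> lm b (\<lambda>s. f' s + g' s) t) (es b t)"
    using assms lder_lreg t by (simp add: lm_add diff_divide_distrib add_divide_distrib algebra_simps)
qed

lemma lder_mult:
  assumes "lder f f'" "lder g g'" "lreg f" "lreg g"
  shows "lder (\<lambda>s. f s * g s) (\<lambda>s. f' s * g s + f s * g' s)"
proof (rule lderI)
  have r: "lreg f'" "lreg g'" using assms lder_lreg by blast+
  show "lreg (\<lambda>s. f' s * g s + f s * g' s)" using assms r by (intro lreg_add lreg_mult)
  fix t b assume t: "t \<in> I"
  have "((\<lambda>s. (f s - lm b f t) / of_real (s - t) * g s + lm b f t * ((g s - lm b g t) / of_real (s - t)))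
      \<longlongrightarrow> lm b f' t * lm b g t + lm b f t * lm b g' t) (es b t)"
    using lder_tendsto lreg_tendsto assms t by (intro tendsto_intros) auto
  moreover have "(f s - lm b f t) / of_real (s - t) * g s + lm b f t * ((g s - lm b g t) / of_real (s - t))
     = (f s * g s - lm b (\<lambda>s. f s * g s) t) / of_real (s - t)" for s
    using assms t by (simp add: lm_mult diff_divide_distrib algebra_simps)
  ultimately show "((\<lambda>s. (f s * g s - lm b (\<lambda>s. f s * g s) t) / of_real (s - t))
      \<longlongrightarrow> lm b (\<lambda>s. f' s * g s + f s * g' s) t) (es b t)"
    using assms r t by (simp add: lm_add lm_mult lreg_mult)
qed

lemma lreg_cmult: "lreg f \<Longrightarrow> lreg (\<lambda>s. c * f s)"
  using lreg_mult[OF lreg_const] by blast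

lemma lm_cmult: "lreg f \<Longrightarrow> t \<in> I \<Longrightarrow> lm b (\<lambda>s. c * f s) t = c * lm b f t"
  using lm_mult[OF lreg_const] by simp

lemma lder_cmult: "lder f f' \<Longrightarrow> lreg f \<Longrightarrow> lder (\<lambda>s. c * f s) (\<lambda>s. c * f' s)"
  using lder_mult[OF lder_const _ lreg_const, of f f' c] by simp

lemma lreg_uminus: "lreg f \<Longrightarrow> lreg (\<lambda>s. - f s)"
  using lreg_cmult[of f "-1"] by simp

lemma lm_uminus: "lreg f \<Longrightarrow> t \<in> I \<Longrightarrow> lm b (\<lambda>s. - f s) t = - lm b f t"
  using lm_cmult[of f t b "-1"] by simp

lemma lreg_diff: "lreg f \<Longrightarrow> lreg g \<Longrightarrow> lreg (\<lambda>s. f s - g s)"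
  using lreg_add[OF _ lreg_uminus] by fastforce

lemma lm_diff: "lreg f \<Longrightarrow> lreg g \<Longrightarrow> t \<in> I \<Longrightarrow> lm b (\<lambda>s. f s - g s) t = lm b f t - lm b g t"
  using lm_add[OF _ lreg_uminus] lm_uminus by fastforce

lemma lder_diff: "lder f f' \<Longrightarrow> lder g g' \<Longrightarrow> lreg f \<Longrightarrow> lreg g \<Longrightarrow> lder (\<lambda>s. f s - g s) (\<lambda>s. f' s - g' s)"
  using lder_add[of f f' "\<lambda>s. - g s" "\<lambda>s. - g' s"] lder_cmult[of g g' "-1"] lreg_uminus[of g] by simp

lemma lreg_sum: "(\<And>i. i \<in> S \<Longrightarrow> lreg (f i)) \<Longrightarrow> lreg (\<lambda>s. \<Sum>i\<in>S. f i s)"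
  by (induction S rule: infinite_finite_induct) (auto intro!: lreg_add lreg_const)

lemma lm_sum:
  "(\<And>i. i \<in> S \<Longrightarrow> lreg (f i)) \<Longrightarrow> t \<in> I \<Longrightarrow> lm b (\<lambda>s. \<Sum>i\<in>S. f i s) t = (\<Sum>i\<in>S. lm b (f i) t)"
  by (induction S rule: infinite_finite_induct) (auto simp: lm_add lreg_sum)

lemma lder_sum:
  "(\<And>i. i \<in> S \<Longrightarrow> lder (f i) (f' i)) \<Longrightarrow> (\<And>i. i \<in> S \<Longrightarrow> lreg (f i)) \<Longrightarrow>
   lder (\<lambda>s. \<Sum>i\<in>S. f i s) (\<lambda>s. \<Sum>i\<in>S. f' i s)"
  by (induction S rule: infinite_finite_induct) (auto intro!: lder_add lder_const lreg_sum)

lemma lreg_continuous: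
  assumes "continuous_on I g"
  shows "lreg g" and "t \<in> I \<Longrightarrow> lm b g t = g t"
proof -
  have c: "isCont g t" if "t \<in> I" for t
    using assms open_I that continuous_on_eq_continuous_at by blast
  show "lreg g"
    using assms c open_I
    by (intro lregI[where l="\<lambda>b. g"] tendsto_es_continuous continuous_imp_measurable_on_sets_lebesgue)
      (auto simp: borel_open)
  show "t \<in> I \<Longrightarrow> lm b g t = g t"
    using c tendsto_es_continuous lm_eq by blast
qed

lemma lder_has_vector_derivative:
  assumes "continuous_on I g'" "\<And>t. t \<in> I \<Longrightarrow> (g has_vector_derivative g' t) (at t)"
  shows "lder g g'"
proof (rule lderI)
  show "lreg g'" using assms(1) by (rule lreg_continuous)
  fix t b assume t: "t \<in> I"
  have "isCont g t" using assms(2)[OF t] has_vector_derivative_continuous by blast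
  then have g: "lm b g t = g t" using tendsto_es_continuous lm_eq by blast
  have "(\<lambda>s. (g s - g t) /\<^sub>R (s - t)) \<midarrow>t\<rightarrow> g' t"
  proof (rule Lim_null[THEN iffD2], rule tendsto_norm_zero_cancel)
    have "(\<lambda>s. norm (g s - g t - (s - t) *\<^sub>R g' t) / norm (s - t)) \<midarrow>t\<rightarrow> 0"
      using assms(2)[OF t] by (simp add: has_vector_derivative_def has_derivative_iff_norm)
    moreover have "\<forall>\<^sub>F s in at t. norm (g s - g t - (s - t) *\<^sub>R g' t) / norm (s - t)
        = norm ((g s - g t) /\<^sub>R (s - t) - g' t)"
    proof (rule eventually_at_topological[THEN iffD2], intro exI[of _ UNIV] conjI ballI impI)
      fix s assume "s \<noteq> t"
      then have "(g s - g t) /\<^sub>R (s - t) - g' t = (g s - g t - (s - t) *\<^sub>R g' t) /\<^sub>R (s - t)"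
        by (simp add: scaleR_diff_right)
      then show "norm (g s - g t - (s - t) *\<^sub>R g' t) / norm (s - t) = norm ((g s - g t) /\<^sub>R (s - t) - g' t)"
        by (simp add: divide_inverse mult.commute)
    qed auto
    ultimately show "(\<lambda>s. norm ((g s - g t) /\<^sub>R (s - t) - g' t)) \<midarrow>t\<rightarrow> 0"
      by (rule Lim_transform_eventually)
  qed
  then have "((\<lambda>s. (g s - g t) /\<^sub>R (s - t)) \<longlongrightarrow> g' t) (es b t)"
    using es_le_at filterlim_mono by blast
  then show "((\<lambda>s. (g s - lm b g t) / of_real (s - t)) \<longlongrightarrow> lm b g' t) (es b t)"
    by (simp add: g lreg_continuous(2)[OF assms(1) t] scaleR_conv_of_real divide_inverse mult.commute)
qed

section \<open>Step functions\<close>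

definition heav :: "real \<Rightarrow> real \<Rightarrow> complex" where
  "heav \<tau> s = (if \<tau> \<le> s then 1 else 0)"

lemma tendsto_heav: "(heav \<tau> \<longlongrightarrow> (if \<tau> < t \<or> \<tau> = t \<and> b then 1 else 0)) (es b t)"
  and eventually_heav: "eventually (\<lambda>s. heav \<tau> s = (if \<tau> < t \<or> \<tau> = t \<and> b then 1 else 0)) (es b t)"
proof -
  consider "\<tau> < t" | "\<tau> = t" | "t < \<tau>" by linarith
  then show e: "eventually (\<lambda>s. heav \<tau> s = (if \<tau> < t \<or> \<tau> = t \<and> b then 1 else 0)) (es b t)"
  proof cases
    case 1
    then have "eventually (\<lambda>s. s \<in> {\<tau><..}) (es b t)" by (intro eventually_es_open) auto
    then show ?thesis using 1 by (auto elim!: eventually_mono simp: heav_def)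
  next
    case 2
    have "eventually (\<lambda>s. s \<in> side b t 1) (es b t)" by (intro eventually_es_side) auto
    then show ?thesis using 2 by (auto elim!: eventually_mono simp: heav_def side_def)
  next
    case 3
    then have "eventually (\<lambda>s. s \<in> {..<\<tau>}) (es b t)" by (intro eventually_es_open) auto
    then show ?thesis using 3 by (auto elim!: eventually_mono simp: heav_def)
  qed
  show "(heav \<tau> \<longlongrightarrow> (if \<tau> < t \<or> \<tau> = t \<and> b then 1 else 0)) (es b t)"
    by (rule tendsto_eventually[OF e])
qed

lemma lm_heav: "lm b (heav \<tau>) t = (if \<tau> < t \<or> \<tau> = t \<and> b then 1 else 0)"
  using tendsto_heav by (rule lm_eq)

lemma lreg_heav: "lreg (heav \<tau>)"
proof (rule lregI[OF _ tendsto_heav])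
  have "heav \<tau> \<in> borel_measurable borel" unfolding heav_def[abs_def] by measurable
  then show "heav \<tau> \<in> borel_measurable (lebesgue_on I)"
    by (intro measurable_restrict_space1 measurable_completion) simp
qed

text \<open>\<open>heav \<tau>\<close> is constant on either side of every point, including
  \<open>\<tau>\<close>, so its derivative is 0 everywhere. This makes cutting off by a step cheap,
  and it is why constancy of a function requires absence of jumps besides a zero derivative.\<close>

lemma lder_heav: "lder (heav \<tau>) (\<lambda>_. 0)"
proof (rule lderI[OF lreg_const])
  fix t b
  show "((\<lambda>s. (heav \<tau> s - lm b (heav \<tau>) t) / of_real (s - t)) \<longlongrightarrow> lm b (\<lambda>_. 0) t) (es b t)"
    using eventually_heav[of \<tau> t b] unfolding lm_heav
    by (intro tendsto_eventually) (auto elim!: eventually_mono)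
qed

subsection \<open>The mean value inequality\<close>

lemma lm_bound_near:
  assumes "lreg g" "t \<in> I" "eventually (\<lambda>s. norm (g s - z) \<le> K * \<bar>s - t\<bar>) (es b t)"
  obtains d where "d > 0" "\<And>s b'. s \<in> side b t d \<Longrightarrow> s \<in> I \<Longrightarrow> norm (lm b' g s - z) \<le> K * \<bar>s - t\<bar>"
proof -
  obtain d where d: "d > 0" "\<And>s b'. s \<in> side b t d \<Longrightarrow> eventually (\<lambda>r. norm (g r - z) \<le> K * \<bar>r - t\<bar>) (es b' s)"
    using eventually_es_local[OF assms(3)] by metis
  have "norm (lm b' g s - z) \<le> K * \<bar>s - t\<bar>" if "s \<in> side b t d" "s \<in> I" for s b'
  proof (rule tendsto_le[OF es_nontriv[of b' s]])
    show "((\<lambda>r. K * \<bar>r - t\<bar>) \<longlongrightarrow> K * \<bar>s - t\<bar>) (es b' s)"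
      by (rule tendsto_es_continuous) auto
    show "((\<lambda>r. norm (g r - z)) \<longlongrightarrow> norm (lm b' g s - z)) (es b' s)"
      using lreg_tendsto[OF assms(1) that(2)] by (intro tendsto_intros)
  qed (use d(2) that in auto)
  then show ?thesis using that d(1) by blast
qed

text \<open>The strict inequality for \<open>lm b h t\<close> is what lets the limit of the
  difference quotients give a bound on a whole one-sided interval.\<close>

lemma lder_bound_near:
  assumes "lreg g" "lder g h" "t \<in> I" "norm (lm b h t) < K"
  obtains d where "d > 0" "\<And>s b'. s \<in> side b t d \<Longrightarrow> s \<in> I \<Longrightarrow> norm (lm b' g s - lm b g t) \<le> K * \<bar>s - t\<bar>"
proof -
  have "eventually (\<lambda>s. norm ((g s - lm b g t) / of_real (s - t)) < K) (es b t)"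
    using order_tendstoD(2)[OF tendsto_norm[OF lder_tendsto[OF assms(2,3)]] assms(4)] .
  moreover have "eventually (\<lambda>s. s \<in> side b t 1) (es b t)" by (rule eventually_es_side) simp
  ultimately have "eventually (\<lambda>s. norm (g s - lm b g t) \<le> K * \<bar>s - t\<bar>) (es b t)"
  proof eventually_elim
    case (elim s)
    then have "\<bar>s - t\<bar> > 0" by (auto simp: side_def split: if_splits)
    with elim show ?case by (simp add: norm_divide field_simps flip: of_real_diff)
  qed
  from lm_bound_near[OF assms(1,3) this] that show ?thesis by metis
qed

text \<open>Bisection: the bound for a segment is additive as long as there is no jump at the cut,
  and it holds on short segments about each point by the one-sided difference quotients. Taking the
  limits from inside at both ends leaves jumps at \<open>c\<close> and \<open>d\<close> themselves
  out.\<close>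

lemma mean_value_inequality:
  assumes "lreg g" "lder g h" "c < d" "{c..d} \<subseteq> I"
    and nojump: "\<And>t. c < t \<Longrightarrow> t < d \<Longrightarrow> lm True g t = lm False g t"
    and M: "\<And>t b. c \<le> t \<Longrightarrow> t \<le> d \<Longrightarrow> norm (lm b h t) \<le> M"
  shows "norm (lm False g d - lm True g c) \<le> M * (d - c)"
proof -
  \<comment> \<open>The slack \<open>e\<close> turns the bound \<open>M\<close> for \<open>h\<close>
    into the strict inequality that \<open>lder_bound_near\<close> asks for; it is let go to 0 at
    the end.\<close>
  have "norm (lm False g d - lm True g c) \<le> (M + e) * (d - c)" if e: "e > 0" for e
  proof -
    define P where "P u v \<longleftrightarrow> (u < v \<and> c \<le> u \<and> v \<le> d \<longrightarrow>
      norm (lm False g v - lm True g u) \<le> (M + e) * (v - u))" for u v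
    have "c \<le> d" using assms(3) by simp
    then have "P c d"
    proof (induction rule: Bolzano)
      case (trans u v w)
      show ?case unfolding P_def
      proof (intro impI)
        assume uw: "u < w \<and> c \<le> u \<and> w \<le> d"
        show "norm (lm False g w - lm True g u) \<le> (M + e) * (w - u)"
        proof (cases "u = v \<or> v = w")
          case True then show ?thesis using trans uw by (auto simp: P_def)
        next
          case False
          then have v: "u < v" "v < w" using trans by auto
          have "norm (lm False g w - lm True g u) \<le> norm (lm False g w - lm True g v) + norm (lm False g v - lm True g u)"
            using nojump[of v] v uw norm_triangle_ineq[of "lm False g w - lm True g v" "lm False g v - lm True g u"] by simp
          also have "\<dots> \<le> (M + e) * (w - v) + (M + e) * (v - u)"
            using trans v uw by (intro add_mono) (auto simp: P_def)
          finally show ?thesis by (simp add: algebra_simps)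
        qed
      qed
    next
      case (local x)
      then have x: "x \<in> I" using assms(4) by auto
      have *: "norm (lm b h x) < M + e" for b using M[of x b] local e by simp
      obtain d1 where d1: "d1 > 0" "\<And>s b'. s \<in> side True x d1 \<Longrightarrow> s \<in> I \<Longrightarrow> norm (lm b' g s - lm True g x) \<le> (M + e) * \<bar>s - x\<bar>"
        using lder_bound_near[OF assms(1,2) x *] by metis
      obtain d2 where d2: "d2 > 0" "\<And>s b'. s \<in> side False x d2 \<Longrightarrow> s \<in> I \<Longrightarrow> norm (lm b' g s - lm False g x) \<le> (M + e) * \<bar>s - x\<bar>"
        using lder_bound_near[OF assms(1,2) x *] by metis
      show ?case
      proof (intro exI[of _ "min d1 d2"] conjI allI impI)
        fix u v assume uv: "u \<le> x \<and> x \<le> v \<and> v - u < min d1 d2"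
        show "P u v" unfolding P_def
        proof (intro impI)
          assume uv': "u < v \<and> c \<le> u \<and> v \<le> d"
          have uI: "u \<in> I" "v \<in> I" using uv' assms(4) by auto
          have r: "norm (lm False g v - lm True g x) \<le> (M + e) * (v - x)" if "x < v"
            using d1(2)[of v False] that uv uI by (auto simp: side_def)
          have l: "norm (lm False g x - lm True g u) \<le> (M + e) * (x - u)" if "u < x"
            using d2(2)[of u True] that uv uI by (auto simp: side_def norm_minus_commute)
          show "norm (lm False g v - lm True g u) \<le> (M + e) * (v - u)"
          proof (cases "u = x \<or> x = v")
            case True then show ?thesis using r l uv' by auto
          next
            case False
            then have v: "u < x" "x < v" using uv by auto
            have "norm (lm False g v - lm True g u) \<le> norm (lm False g v - lm True g x) + norm (lm False g x - lm True g u)"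
              using nojump[of x] v uv' norm_triangle_ineq[of "lm False g v - lm True g x" "lm False g x - lm True g u"] by simp
            also have "\<dots> \<le> (M + e) * (v - x) + (M + e) * (x - u)"
              using v by (intro add_mono r l)
            finally show ?thesis by (simp add: algebra_simps)
          qed
        qed
      qed (use d1 d2 in auto)
    qed
    then show ?thesis using assms(3) by (simp add: P_def)
  qed
  note eps = this
  show ?thesis
  proof (rule field_le_epsilon)
    fix e :: real assume e: "e > 0"
    from assms(3) e have "norm (lm False g d - lm True g c) \<le> (M + e / (d - c)) * (d - c)"
      by (intro eps) simp
    also have "\<dots> = M * (d - c) + e"
      using assms(3) by (simp add: distrib_right)
    finally show "norm (lm False g d - lm True g c) \<le> M * (d - c) + e" .
  qed
qed

subsection \<open>Infinitely differentiable functions\<close>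

text \<open>\<open>sm N\<close> consists of the infinitely differentiable functions all of whose derivatives jump
  only in \<open>N\<close>.\<close>

coinductive sm :: "real set \<Rightarrow> (real \<Rightarrow> complex) \<Rightarrow> bool" for N where
  smI: "lreg g \<Longrightarrow> (\<And>t. t \<in> I \<Longrightarrow> t \<notin> N \<Longrightarrow> lm True g t = lm False g t) \<Longrightarrow> lder g h \<Longrightarrow> sm N h \<Longrightarrow> sm N g"

abbreviation lsm :: "(real \<Rightarrow> complex) \<Rightarrow> bool" where
  "lsm \<equiv> sm UNIV"

lemma lsmI: "lreg g \<Longrightarrow> lder g h \<Longrightarrow> lsm h \<Longrightarrow> lsm g"
  by (rule smI) auto

lemma sm_mono: "sm N g \<Longrightarrow> N \<subseteq> N' \<Longrightarrow> sm N' g"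
proof -
  assume N: "N \<subseteq> N'" and g: "sm N g"
  show ?thesis
  proof (rule sm.coinduct[where X="sm N", OF g])
    fix g assume "sm N g"
    then show "\<exists>ga h. g = ga \<and> lreg ga \<and> (\<forall>t. t \<in> I \<longrightarrow> t \<notin> N' \<longrightarrow> lm True ga t = lm False ga t) \<and>
        lder ga h \<and> (sm N h \<or> sm N' h)"
      using N by cases blast
  qed
qed

lemma sm_imp_lsm: "sm N g \<Longrightarrow> lsm g"
  by (rule sm_mono) auto

lemma sm_lreg: "sm N g \<Longrightarrow> lreg g"
  by (auto elim: sm.cases)

lemma sm_jump_free: "sm N g \<Longrightarrow> t \<in> I \<Longrightarrow> t \<notin> N \<Longrightarrow> lm True g t = lm False g t"
  by (auto elim: sm.cases)

lemma sm_lder: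
  assumes "sm N g" obtains h where "lder g h" "sm N h"
  using assms by (auto elim: sm.cases)

lemma lsm_lreg: "lsm g \<Longrightarrow> lreg g"
  by (rule sm_lreg)

lemma lsm_lder:
  assumes "lsm g" obtains h where "lder g h" "lsm h"
  using assms by (rule sm_lder)

section \<open>Algebras closed under differentiation\<close>

inductive_set alg :: "(real \<Rightarrow> complex) set \<Rightarrow> (real \<Rightarrow> complex) set" for S where
  alg_base: "g \<in> S \<Longrightarrow> g \<in> alg S"
| alg_const: "(\<lambda>_. c) \<in> alg S"
| alg_add: "g \<in> alg S \<Longrightarrow> h \<in> alg S \<Longrightarrow> (\<lambda>s. g s + h s) \<in> alg S"
| alg_mult: "g \<in> alg S \<Longrightarrow> h \<in> alg S \<Longrightarrow> (\<lambda>s. g s * h s) \<in> alg S"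

lemma alg_sum: "(\<And>i. i \<in> J \<Longrightarrow> f i \<in> alg S) \<Longrightarrow> (\<lambda>s. \<Sum>i\<in>J. f i s) \<in> alg S"
  by (induction J rule: infinite_finite_induct) (auto intro: alg.intros)

text \<open>Differential closure: an algebra whose generators have derivatives in the algebra
  consists of infinitely differentiable functions.\<close>

lemma sm_alg:
  assumes "\<And>g. g \<in> S \<Longrightarrow> lreg g \<and> (\<forall>t\<in>I - N. lm True g t = lm False g t) \<and> (\<exists>h\<in>alg S. lder g h)"
    and "g \<in> alg S"
  shows "sm N g"
proof -
  have *: "lreg g \<and> (\<forall>t\<in>I - N. lm True g t = lm False g t) \<and> (\<exists>h\<in>alg S. lder g h)" if "g \<in> alg S" for g
    using that
  proof induction
    case (alg_base g) then show ?case using assms(1) by blast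
  next
    case (alg_const c)
    have "\<exists>h\<in>alg S. lder (\<lambda>_. c) h" 
      by (rule bexI[where x="\<lambda>_. 0"]) (rule lder_const alg.alg_const)+
    then show ?case by (simp add: lreg_const)
  next
    case (alg_add g h)
    then obtain g' h' where gh: "g' \<in> alg S" "h' \<in> alg S" "lder g g'" "lder h h'" by blast
    have "(\<lambda>s. g' s + h' s) \<in> alg S" "lder (\<lambda>s. g s + h s) (\<lambda>s. g' s + h' s)"
      using gh alg_add by (auto intro: alg.alg_add lder_add)
    then show ?case using alg_add by (auto simp: lm_add lreg_add)
  next
    case (alg_mult g h)
    then obtain g' h' where gh: "g' \<in> alg S" "h' \<in> alg S" "lder g g'" "lder h h'" by blast
    have "(\<lambda>s. g' s * h s + g s * h' s) \<in> alg S" "lder (\<lambda>s. g s * h s) (\<lambda>s. g' s * h s + g s * h' s)"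
      using gh alg_mult by (auto intro: alg.alg_add alg.alg_mult lder_mult)
    then show ?case using alg_mult by (auto simp: lm_mult lreg_mult)
  qed
  \<comment> \<open>The generated algebra itself is the invariant of the coinduction: by the
    induction above it contains a derivative of each of its members.\<close>
  show ?thesis
  proof (rule sm.coinduct[where X="\<lambda>g. g \<in> alg S", OF assms(2)])
    fix g assume "g \<in> alg S"
    then obtain h where "lreg g" "\<forall>t\<in>I - N. lm True g t = lm False g t" "h \<in> alg S" "lder g h"
      using * by blast
    then show "\<exists>ga h. g = ga \<and> lreg ga \<and> (\<forall>t. t \<in> I \<longrightarrow> t \<notin> N \<longrightarrow> lm True ga t = lm False ga t) \<and>
        lder ga h \<and> (h \<in> alg S \<or> sm N h)" by blast
  qed
qed

lemma lsm_alg: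
  assumes "\<And>g. g \<in> S \<Longrightarrow> lreg g \<and> (\<exists>h\<in>alg S. lder g h)" "g \<in> alg S"
  shows "lsm g"
  using assms by (intro sm_alg[of S]) auto

text \<open>Taking all of \<open>sm N\<close> as generators yields closure under sums and products
  without a separate coinduction for each operation.\<close>

lemma sm_in_alg: "g \<in> alg (Collect (sm N)) \<Longrightarrow> sm N g"
  by (rule sm_alg[of "Collect (sm N)"]) (auto dest: sm_lreg sm_jump_free elim: sm_lder intro: alg_base)

lemma sm_const: "sm N (\<lambda>_. c)"
  using sm_in_alg alg_const by blast

lemma sm_add: "sm N f \<Longrightarrow> sm N g \<Longrightarrow> sm N (\<lambda>s. f s + g s)"
  by (intro sm_in_alg alg_add alg_base) auto

lemma sm_mult: "sm N f \<Longrightarrow> sm N g \<Longrightarrow> sm N (\<lambda>s. f s * g s)"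
  by (intro sm_in_alg alg_mult alg_base) auto

lemma sm_cmult: "sm N f \<Longrightarrow> sm N (\<lambda>s. c * f s)"
  using sm_mult[OF sm_const] by blast

lemma sm_uminus: "sm N f \<Longrightarrow> sm N (\<lambda>s. - f s)"
  using sm_cmult[of N f "-1"] by simp

lemma sm_diff: "sm N f \<Longrightarrow> sm N g \<Longrightarrow> sm N (\<lambda>s. f s - g s)"
  using sm_add[OF _ sm_uminus] by fastforce

lemma sm_sum: "(\<And>i. i \<in> S \<Longrightarrow> sm N (f i)) \<Longrightarrow> sm N (\<lambda>s. \<Sum>i\<in>S. f i s)"
  by (intro sm_in_alg alg_sum alg_base) auto

lemmas lsm_const = sm_const[of UNIV]
  and lsm_add = sm_add[of UNIV]
  and lsm_mult = sm_mult[of UNIV]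
  and lsm_diff = sm_diff[of UNIV]

lemma sm_heav: "sm {\<tau>} (heav \<tau>)"
  by (rule smI[OF lreg_heav _ lder_heav sm_const]) (auto simp: lm_heav)

lemma lsm_heav: "lsm (heav \<tau>)"
  using sm_heav by (rule sm_imp_lsm)

text \<open>Any two derivatives of \<open>g\<close> have the same limits, hence agree almost
  everywhere, and a derivative of one is a derivative of the other.\<close>

lemma sm_lder_unique:
  assumes "sm N g" "lder g h"
  shows "sm N h"
proof -
  obtain h0 where h0: "lder g h0" "sm N h0" using sm_lder[OF assms(1)] by blast
  then obtain k where k: "lder h0 k" "sm N k" using sm_lder by blast
  have "lder h k"
    by (rule lder_cong[OF k(1) lreg_lm_eq_imp_eventually[OF lder_lreg lder_lreg lder_unique]])
      (rule h0 assms | assumption)+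
  moreover have "lm True h t = lm False h t" if "t \<in> I" "t \<notin> N" for t
    using sm_jump_free[OF h0(2) that] lder_unique[OF assms(2) h0(1) that(1)] by simp
  ultimately show ?thesis using smI lder_lreg[OF assms(2)] k(2) by blast
qed

text \<open>Where \<open>g\<close> does not jump, its right limits stay close to
  \<open>lm True g t\<close> on both sides of \<open>t\<close>. They supply the continuous
  representatives asked for by \<open>ess_bdd_cont\<close> and
  \<open>ess_piecewise_cont\<close>.\<close>

lemma isCont_lm:
  assumes "lreg g" "t \<in> I" "lm True g t = lm False g t"
  shows "isCont (lm True g) t"
  unfolding isCont_def
proof (rule tendstoI)
  fix e :: real assume e: "e > 0"
  have "\<exists>d>0. \<forall>s\<in>side b t d. s \<in> I \<longrightarrow> dist (lm True g s) (lm True g t) < e" for b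
  proof -
    have l: "lm b g t = lm True g t" using assms(3) by (cases b) auto
    have "\<forall>\<^sub>F s in es b t. dist (g s) (lm b g t) < e / 2"
      using e by (intro tendstoD[OF lreg_tendsto[OF assms(1,2)]]) simp
    from eventually_es_local[OF this] obtain d where d: "d > 0"
      "\<And>s b'. s \<in> side b t d \<Longrightarrow> \<forall>\<^sub>F r in es b' s. dist (g r) (lm b g t) < e / 2" by metis
    have "dist (lm True g s) (lm True g t) < e" if "s \<in> side b t d" "s \<in> I" for s
    proof -
      have "((\<lambda>r. dist (g r) (lm b g t)) \<longlongrightarrow> dist (lm True g s) (lm b g t)) (es True s)"
        using lreg_tendsto[OF assms(1) that(2)] by (intro tendsto_intros)
      then have "dist (lm True g s) (lm b g t) \<le> e / 2"
        by (rule tendsto_upperbound) (use d(2)[OF that(1), of True] in \<open>auto elim: eventually_mono\<close>)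
      then show ?thesis using e l by simp
    qed
    then show ?thesis using d(1) by blast
  qed
  from this[of True] this[of False] obtain d1 d2 where d: "d1 > 0" "d2 > 0"
    "\<forall>s\<in>side True t d1. s \<in> I \<longrightarrow> dist (lm True g s) (lm True g t) < e"
    "\<forall>s\<in>side False t d2. s \<in> I \<longrightarrow> dist (lm True g s) (lm True g t) < e" by blast
  show "\<forall>\<^sub>F s in at t. dist (lm True g s) (lm True g t) < e"
    unfolding eventually_at_topological
  proof (intro exI[of _ "{t - d2<..<t + d1} \<inter> I"] conjI ballI impI)
    fix s assume "s \<in> {t - d2<..<t + d1} \<inter> I" "s \<noteq> t"
    then show "dist (lm True g s) (lm True g t) < e"
      using d(3,4) by (cases "s < t") (auto simp: side_def)
  qed (use d(1,2) assms(2) open_I in auto)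
qed

end

section \<open>Test functions and distributions\<close>

context open_interval
begin

text \<open>Compactness by bisection. Near \<open>x\<close> the limits on either side are bounded by
  the norm of the corresponding limit at \<open>x\<close> plus 1, and bounds on adjacent segments
  combine by a maximum.\<close>

lemma lreg_bounded:
  assumes "lreg g" "c \<in> I" "d \<in> I"
  obtains M where "M \<ge> 0" "\<And>t b. c \<le> t \<Longrightarrow> t \<le> d \<Longrightarrow> norm (lm b g t) \<le> M"
proof (cases "c \<le> d")
  case True
  define P where "P u v \<longleftrightarrow> (c \<le> u \<and> v \<le> d \<longrightarrow> (\<exists>M. \<forall>t b. u \<le> t \<longrightarrow> t \<le> v \<longrightarrow> norm (lm b g t) \<le> M))" for u v
  from True have "P c d"
  proof (induction rule: Bolzano)
    case (trans u v w)
    show ?case unfolding P_def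
    proof (intro impI)
      assume "c \<le> u \<and> w \<le> d"
      with trans obtain M1 M2 where "\<forall>t b. u \<le> t \<longrightarrow> t \<le> v \<longrightarrow> norm (lm b g t) \<le> M1"
        "\<forall>t b. v \<le> t \<longrightarrow> t \<le> w \<longrightarrow> norm (lm b g t) \<le> M2" by (auto simp: P_def)
      then show "\<exists>M. \<forall>t b. u \<le> t \<longrightarrow> t \<le> w \<longrightarrow> norm (lm b g t) \<le> M"
        by (intro exI[of _ "max M1 M2"]) (meson le_max_iff_disj linear)
    qed
  next
    case (local x)
    then have x: "x \<in> I" using segment_subset[OF assms(2,3)] by auto
    have "\<exists>e>0. \<forall>s b'. s \<in> side b x e \<longrightarrow> s \<in> I \<longrightarrow> norm (lm b' g s) \<le> norm (lm b g x) + 1" for b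
    proof -
      have "\<forall>\<^sub>F s in es b x. norm (g s) < norm (lm b g x) + 1"
        by (rule order_tendstoD(2)[OF tendsto_norm[OF lreg_tendsto[OF assms(1) x]]]) simp
      from eventually_es_local[OF this] obtain e where e: "e > 0"
        "\<And>s b'. s \<in> side b x e \<Longrightarrow> \<forall>\<^sub>F r in es b' s. norm (g r) < norm (lm b g x) + 1" by metis
      have "norm (lm b' g s) \<le> norm (lm b g x) + 1" if "s \<in> side b x e" "s \<in> I" for s b'
        by (rule norm_lm_le[OF lreg_tendsto[OF assms(1) that(2)]])
          (use e(2)[OF that(1), of b'] in \<open>auto elim: eventually_mono\<close>)
      then show ?thesis using e(1) by blast
    qed
    from this[of True] this[of False] obtain e1 e2 where e: "e1 > 0" "e2 > 0"
      "\<And>s b'. s \<in> side True x e1 \<Longrightarrow> s \<in> I \<Longrightarrow> norm (lm b' g s) \<le> norm (lm True g x) + 1"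
      "\<And>s b'. s \<in> side False x e2 \<Longrightarrow> s \<in> I \<Longrightarrow> norm (lm b' g s) \<le> norm (lm False g x) + 1" by blast
    show ?case
    proof (intro exI[of _ "min e1 e2"] conjI allI impI)
      fix u v assume uv: "u \<le> x \<and> x \<le> v \<and> v - u < min e1 e2"
      show "P u v" unfolding P_def
      proof (intro impI exI allI)
        fix t b assume t: "c \<le> u \<and> v \<le> d" "u \<le> t" "t \<le> v"
        then have tI: "t \<in> I" using segment_subset[OF assms(2,3)] by auto
        consider "t < x" | "t = x" | "t > x" by linarith
        then show "norm (lm b g t) \<le> norm (lm True g x) + norm (lm False g x) + 1"
        proof cases
          case 1
          then have "norm (lm b g t) \<le> norm (lm False g x) + 1"
            using t uv by (intro e(4) tI) (auto simp: side_def)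
          then show ?thesis using norm_ge_zero[of "lm True g x"] by linarith
        next
          case 2
          then show ?thesis by (cases b) auto
        next
          case 3
          then have "norm (lm b g t) \<le> norm (lm True g x) + 1"
            using t uv by (intro e(3) tI) (auto simp: side_def)
          then show ?thesis using norm_ge_zero[of "lm False g x"] by linarith
        qed
      qed
    qed (use e in auto)
  qed
  then obtain M where M: "\<forall>t b. c \<le> t \<longrightarrow> t \<le> d \<longrightarrow> norm (lm b g t) \<le> M" by (auto simp: P_def)
  then show ?thesis by (intro that[of "max M 0"]) (auto simp: le_max_iff_disj)
qed (use that[of 0] in auto)

section \<open>Functions vanishing outside a segment\<close>

definition van :: "real \<Rightarrow> real \<Rightarrow> (real \<Rightarrow> complex) \<Rightarrow> bool" where
  "van c d g \<longleftrightarrow> (\<forall>t\<in>I. \<forall>b. t \<notin> {c..d} \<longrightarrow> lm b g t = 0)"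

text \<open>Local form of a step of the inductive limit. For \<open>c\<close> and \<open>d\<close>
  in \<open>I\<close> the global bounds come for free: the function and its derivatives are bounded
  on \<open>{c..d}\<close> and vanish elsewhere.\<close>

definition tst :: "real \<Rightarrow> real \<Rightarrow> (real \<Rightarrow> complex) \<Rightarrow> bool" where
  "tst c d g \<longleftrightarrow> lsm g \<and> van c d g"

lemma vanD: "van c d g \<Longrightarrow> t \<in> I \<Longrightarrow> t \<notin> {c..d} \<Longrightarrow> lm b g t = 0"
  by (simp add: van_def)

lemma van_AE:
  assumes "lreg g" "van c d g"
  shows "AE s in lebesgue. s \<in> I - {c..d} \<longrightarrow> g s = 0"
proof -
  have "AE s in lebesgue. s \<in> I \<longrightarrow> (\<forall>b. lm b g s = g s)"
    using AE_lm_eq[OF open_I] assms(1) by (auto simp: lreg_def)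
  then show ?thesis by eventually_elim (use assms(2) in \<open>auto simp: van_def\<close>)
qed

lemma van_eventually:
  assumes "lreg g" "van c d g" "t \<in> I" "t \<notin> {c..d}"
  shows "eventually (\<lambda>s. g s = 0) (es b t)"
proof -
  have "open (I - {c..d})" using open_I by (intro open_Diff) auto
  then show ?thesis using van_AE[OF assms(1,2)] AE_open_iff assms(3,4) by blast
qed

lemma van_lder:
  assumes "lreg g" "van c d g" "lder g h"
  shows "van c d h"
  unfolding van_def
proof (intro ballI allI impI)
  fix t b assume t: "t \<in> I" "t \<notin> {c..d}"
  have "\<forall>\<^sub>F s in es b t. (g s - lm b g t) / of_real (s - t) = 0"
    using van_eventually[OF assms(1,2) t, of b] vanD[OF assms(2) t, of b] by (auto elim: eventually_mono)
  then have "((\<lambda>s. (g s - lm b g t) / of_real (s - t)) \<longlongrightarrow> 0) (es b t)"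
    by (rule tendsto_eventually)
  then show "lm b h t = 0"
    using lder_tendsto[OF assms(3) t(1)] tendsto_unique[OF es_nontriv] by blast
qed

lemma van_mono: "van c d g \<Longrightarrow> c' \<le> c \<Longrightarrow> d \<le> d' \<Longrightarrow> van c' d' g"
  by (auto simp: van_def)

lemma van_add: "lreg f \<Longrightarrow> lreg g \<Longrightarrow> van c d f \<Longrightarrow> van c d g \<Longrightarrow> van c d (\<lambda>s. f s + g s)"
  by (auto simp: van_def lm_add)

lemma van_mult: "lreg f \<Longrightarrow> lreg g \<Longrightarrow> van c d g \<Longrightarrow> van c d (\<lambda>s. f s * g s)"
  by (auto simp: van_def lm_mult)

lemma tst_lsm: "tst c d g \<Longrightarrow> lsm g"
  and tst_lreg: "tst c d g \<Longrightarrow> lreg g"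
  and tst_van: "tst c d g \<Longrightarrow> van c d g"
  by (auto simp: tst_def dest: lsm_lreg)

lemma tst_mono: "tst c d g \<Longrightarrow> c' \<le> c \<Longrightarrow> d \<le> d' \<Longrightarrow> tst c' d' g"
  using van_mono by (auto simp: tst_def)

lemma tst_add: "tst c d f \<Longrightarrow> tst c d g \<Longrightarrow> tst c d (\<lambda>s. f s + g s)"
  by (simp add: tst_def lsm_add van_add lsm_lreg)

lemma tst_mult: "lsm m \<Longrightarrow> tst c d g \<Longrightarrow> tst c d (\<lambda>s. m s * g s)"
  by (simp add: tst_def lsm_mult van_mult lsm_lreg)

lemma tst_cmult: "tst c d g \<Longrightarrow> tst c d (\<lambda>s. k * g s)"
  using tst_mult[OF lsm_const] by blast

lemma tst_lder: "tst c d g \<Longrightarrow> lder g h \<Longrightarrow> tst c d h"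
  by (auto simp: tst_def intro: sm_lder_unique van_lder lsm_lreg)

lemma compact_subset_segment:
  assumes "compact K" "K \<subseteq> I"
  obtains c d where "c \<in> I" "d \<in> I" "c < d" "K \<subseteq> {c<..<d}"
proof -
  obtain x where x: "x \<in> I" using nonempty_I by blast
  \<comment> \<open>A point of \<open>I\<close> is added so that minimum and maximum exist also for
    empty \<open>K\<close>.\<close>
  let ?K = "insert x K"
  have K: "compact ?K" "?K \<noteq> {}" "?K \<subseteq> I" using assms x by auto
  obtain l where l: "l \<in> ?K" "\<And>y. y \<in> ?K \<Longrightarrow> l \<le> y" using compact_attains_inf[OF K(1,2)] by blast
  obtain u where u: "u \<in> ?K" "\<And>y. y \<in> ?K \<Longrightarrow> y \<le> u" using compact_attains_sup[OF K(1,2)] by blast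
  obtain e1 where e1: "e1 > 0" "ball l e1 \<subseteq> I" using open_I K(3) l(1) by (meson openE subsetD)
  obtain e2 where e2: "e2 > 0" "ball u e2 \<subseteq> I" using open_I K(3) u(1) by (meson openE subsetD)
  have "l - e1 / 2 \<in> I" "u + e2 / 2 \<in> I"
    using e1 e2 by (auto simp: subset_iff dist_real_def)
  moreover have "l - e1 / 2 < u + e2 / 2" using l(2)[OF u(1)] e1 e2 by linarith
  moreover have "K \<subseteq> {l - e1 / 2<..<u + e2 / 2}" using l(2) u(2) e1(1) e2(1) by fastforce
  ultimately show ?thesis using that by blast
qed

section \<open>The given function spaces in terms of one-sided limits\<close>

lemma reg_fun_iff: "g \<in> reg_fun I \<longleftrightarrow> lreg g \<and> (\<exists>C. \<forall>t\<in>I. \<forall>b. norm (lm b g t) \<le> C)"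
proof -
  have "(\<exists>l. (g \<longlongrightarrow> l) (ess_right t)) \<and> (\<exists>l. (g \<longlongrightarrow> l) (ess_left t)) \<longleftrightarrow> (\<forall>b. (g \<longlongrightarrow> lm b g t) (es b t))" for t
  proof -
    have "(\<exists>l. (g \<longlongrightarrow> l) (es b t)) \<longleftrightarrow> (g \<longlongrightarrow> lm b g t) (es b t)" for b using lm_eq by blast
    from this[of True] this[of False] show ?thesis by (simp add: es_def all_bool_eq)
  qed
  then have *: "g \<in> reg_fun I \<longleftrightarrow> lreg g \<and> (\<exists>C. AE t in lebesgue_on I. norm (g t) \<le> C)"
    by (auto simp: reg_fun_def lreg_def)
  show ?thesis unfolding * AE_I_iff
    using AE_norm_le_iff[OF open_I, of g] by (auto simp: lreg_def)
qed

lemma is_gderiv_iff: "is_gderiv I g h \<longleftrightarrow> lder g h \<and> (\<exists>C. \<forall>t\<in>I. \<forall>b. norm (lm b h t) \<le> C)"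
  by (auto simp: is_gderiv_def reg_fun_iff lder_def rlim_eq_lm llim_eq_lm es_def all_bool_eq)

lemma smooth_reg_fun_reg: "g \<in> smooth_reg_fun I \<Longrightarrow> g \<in> reg_fun I"
  by (simp add: smooth_reg_fun_def)

text \<open>The space is its own invariant for the coinduction: dropping the first term of a
  derivative sequence leaves a derivative sequence.\<close>

lemma smooth_reg_fun_lsm:
  assumes "g \<in> smooth_reg_fun I"
  shows "lsm g"
proof (rule sm.coinduct[where X="\<lambda>g. g \<in> smooth_reg_fun I", OF assms])
  fix g assume g: "g \<in> smooth_reg_fun I"
  then obtain D where D: "D 0 = g" "\<And>k. is_gderiv I (D k) (D (Suc k))"
    by (auto simp: smooth_reg_fun_def)
  have "D 1 \<in> smooth_reg_fun I"
    unfolding smooth_reg_fun_def using D(2) D(2)[of 0]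
    by (auto simp: is_gderiv_def intro!: exI[of _ "\<lambda>k. D (Suc k)"])
  moreover have "lder g (D 1)" using D(2)[of 0] D(1) by (simp add: is_gderiv_iff)
  ultimately show "\<exists>ga h. g = ga \<and> lreg ga \<and> (\<forall>t. t \<in> I \<longrightarrow> t \<notin> UNIV \<longrightarrow> lm True ga t = lm False ga t) \<and>
      lder ga h \<and> (h \<in> smooth_reg_fun I \<or> lsm h)"
    using g by (auto simp: smooth_reg_fun_def reg_fun_iff)
qed

text \<open>The choice made by \<open>gderiv\<close> may differ from the first derivative in the
  given sequence, but only on a null set, so the rest of the sequence still continues it.\<close>

lemma gderiv_smooth_reg_fun:
  assumes "g \<in> smooth_reg_fun I"
  shows "is_gderiv I g (gderiv I g)" and "gderiv I g \<in> smooth_reg_fun I"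
proof -
  obtain D where D: "D 0 = g" "\<And>k. is_gderiv I (D k) (D (Suc k))"
    using assms by (auto simp: smooth_reg_fun_def)
  show d: "is_gderiv I g (gderiv I g)"
    unfolding gderiv_def using someI[of "is_gderiv I g" "D 1"] D(2)[of 0] D(1) by simp
  have l: "lder g (D 1)" "lder g (gderiv I g)" using D(2)[of 0] D(1) d by (auto simp: is_gderiv_iff)
  have "lder (gderiv I g) (D 2)"
  proof (rule lder_cong)
    show "lder (D 1) (D 2)" using D(2)[of 1] by (simp add: is_gderiv_iff numeral_2_eq_2)
    show "\<forall>\<^sub>F s in es b t. D 1 s = gderiv I g s" if "t \<in> I" for t b
      by (rule lreg_lm_eq_imp_eventually[OF lder_lreg[OF l(1)] lder_lreg[OF l(2)] lder_unique[OF l] that])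
  qed
  then have 2: "is_gderiv I (gderiv I g) (D 2)"
    using D(2)[of 1] by (simp add: is_gderiv_iff numeral_2_eq_2)
  show "gderiv I g \<in> smooth_reg_fun I"
    unfolding smooth_reg_fun_def
  proof (intro CollectI conjI exI allI)
    show "gderiv I g \<in> reg_fun I" using d by (simp add: is_gderiv_def)
    fix k
    show "is_gderiv I ((\<lambda>k. if k = 0 then gderiv I g else D (Suc k)) k)
       ((\<lambda>k. if k = 0 then gderiv I g else D (Suc k)) (Suc k))"
      using 2 D(2) by (auto simp: numeral_2_eq_2)
  qed simp
qed

lemma test_fun_on_tst:
  assumes "admissible I J"
  obtains c d where "c \<in> I" "d \<in> I" "c < d" "\<And>\<phi>. \<phi> \<in> test_fun_on I J \<Longrightarrow> tst c d \<phi>"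
proof -
  have "compact (closure J)" "closure J \<subseteq> I" using assms by (auto simp: admissible_def)
  then obtain c d where cd: "c \<in> I" "d \<in> I" "c < d" "closure J \<subseteq> {c<..<d}"
    using compact_subset_segment by metis
  have "tst c d \<phi>" if \<phi>: "\<phi> \<in> test_fun_on I J" for \<phi>
  proof -
    have s: "lsm \<phi>" using \<phi> smooth_reg_fun_lsm by (auto simp: test_fun_on_def)
    have "AE t in lebesgue. t \<in> I \<longrightarrow> t \<notin> J \<longrightarrow> \<phi> t = 0"
      using \<phi> by (auto simp: test_fun_on_def AE_I_iff)
    then have a: "AE t in lebesgue. t \<in> I - {c..d} \<longrightarrow> \<phi> t = 0"
    proof eventually_elim
      case (elim t)
      then show ?case using cd(4) closure_subset[of J] by fastforce
    qed
    have o: "open (I - {c..d})" using open_I by (intro open_Diff) auto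
    have "lm b \<phi> t = 0" if "t \<in> I" "t \<notin> {c..d}" for t b
    proof (rule lm_eq, rule tendsto_eventually)
      show "\<forall>\<^sub>F s in es b t. \<phi> s = 0" using a AE_open_iff[OF o] that by blast
    qed
    then show ?thesis using s by (simp add: tst_def van_def)
  qed
  then show ?thesis using that cd by blast
qed

text \<open>Every member of a derivative sequence of \<open>\<phi>\<close> inherits the vanishing
  outside \<open>{c..d}\<close> and is bounded on \<open>{c..d}\<close>, which gives the global
  bounds in \<open>reg_fun I\<close>. The sequence is built by dependent choice.\<close>

lemma tst_test_fun_on:
  assumes "c \<in> I" "d \<in> I" "tst c d \<phi>"
  shows "\<phi> \<in> test_fun_on I {c..d}" and "\<phi> \<in> test_fun I"
proof -
  have bd: "\<exists>C. \<forall>t\<in>I. \<forall>b. norm (lm b g t) \<le> C" if g: "tst c d g" for g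
  proof -
    obtain M where "M \<ge> 0" "\<And>t b. c \<le> t \<Longrightarrow> t \<le> d \<Longrightarrow> norm (lm b g t) \<le> M"
      using lreg_bounded[OF tst_lreg[OF g] assms(1,2)] by blast
    then show ?thesis using tst_van[OF g] by (intro exI[of _ M]) (auto simp: van_def)
  qed
  obtain D where D: "\<And>n. tst c d (D n) \<and> (n = 0 \<longrightarrow> D n = \<phi>)" "\<And>n. lder (D n) (D (Suc n))"
    using dependent_nat_choice[of "\<lambda>n g. tst c d g \<and> (n = 0 \<longrightarrow> g = \<phi>)" "\<lambda>n. lder"] assms(3)
      tst_lder tst_lsm lsm_lder by (metis nat.distinct(1))
  have s: "\<phi> \<in> smooth_reg_fun I"
    unfolding smooth_reg_fun_def
  proof (intro CollectI conjI exI[of _ D] allI)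
    show "\<phi> \<in> reg_fun I" using assms(3) bd tst_lreg by (simp add: reg_fun_iff)
    show "D 0 = \<phi>" using D(1)[of 0] by simp
    show "is_gderiv I (D k) (D (Suc k))" for k
      using D(1)[of "Suc k"] D(2)[of k] bd by (simp add: is_gderiv_iff)
  qed
  then show "\<phi> \<in> test_fun_on I {c..d}"
    using van_AE[OF tst_lreg tst_van, OF assms(3,3)] by (auto simp: test_fun_on_def AE_I_iff elim: eventually_mono)
  have "{t\<in>I. llim \<phi> t \<noteq> 0 \<or> rlim \<phi> t \<noteq> 0} \<subseteq> {c..d}"
    using tst_van[OF assms(3)] by (auto simp: van_def llim_eq_lm rlim_eq_lm)
  then have "closure {t\<in>I. llim \<phi> t \<noteq> 0 \<or> rlim \<phi> t \<noteq> 0} \<subseteq> {c..d}"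
    by (rule closure_minimal) simp
  moreover from this have "gsupp I \<phi> = closure {t\<in>I. llim \<phi> t \<noteq> 0 \<or> rlim \<phi> t \<noteq> 0}"
    using segment_subset[OF assms(1,2)] by (auto simp: gsupp_def)
  ultimately have "compact (gsupp I \<phi>)"
    using bounded_subset[OF bounded_closed_interval[of c d]] by (simp add: compact_eq_bounded_closed)
  then show "\<phi> \<in> test_fun I" using s by (simp add: test_fun_def)
qed

lemma gsupp_van:
  assumes "gsupp I \<phi> \<subseteq> {c..d}"
  shows "van c d \<phi>"
  unfolding van_def
proof (intro ballI allI impI)
  fix t b assume t: "t \<in> I" "t \<notin> {c..d}"
  then have "t \<notin> closure {t\<in>I. llim \<phi> t \<noteq> 0 \<or> rlim \<phi> t \<noteq> 0}" using assms by (auto simp: gsupp_def)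
  then have "t \<notin> {t\<in>I. llim \<phi> t \<noteq> 0 \<or> rlim \<phi> t \<noteq> 0}"
    by (rule contra_subsetD[OF closure_subset])
  then have "llim \<phi> t = 0" "rlim \<phi> t = 0" using t(1) by auto
  then show "lm b \<phi> t = 0" by (cases b) (auto simp: llim_eq_lm rlim_eq_lm)
qed

lemma test_fun_tst:
  assumes "\<phi> \<in> test_fun I"
  obtains c d where "c \<in> I" "d \<in> I" "c < d" "tst c d \<phi>"
proof -
  have K: "compact (gsupp I \<phi>)" "gsupp I \<phi> \<subseteq> I" and s: "\<phi> \<in> smooth_reg_fun I"
    using assms by (auto simp: test_fun_def gsupp_def)
  obtain c d where cd: "c \<in> I" "d \<in> I" "c < d" "gsupp I \<phi> \<subseteq> {c<..<d}"
    using compact_subset_segment[OF K] by metis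
  then have "van c d \<phi>" by (intro gsupp_van) auto
  then show ?thesis using that cd smooth_reg_fun_lsm[OF s] by (auto simp: tst_def)
qed

lemma tst_common:
  assumes "tst c d f" "tst c' d' g" "c \<in> I" "d \<in> I" "c' \<in> I" "d' \<in> I"
  obtains u v where "u \<in> I" "v \<in> I" "tst u v f" "tst u v g"
proof (rule that[of "min c c'" "max d d'"])
  show "min c c' \<in> I" "max d d' \<in> I" using assms by (auto simp: min_def max_def)
qed (use assms in \<open>auto intro: tst_mono\<close>)

lemma test_fun_add:
  assumes "\<phi> \<in> test_fun I" "\<psi> \<in> test_fun I"
  shows "(\<lambda>s. \<phi> s + \<psi> s) \<in> test_fun I"
proof -
  obtain c d where 1: "c \<in> I" "d \<in> I" "tst c d \<phi>" using test_fun_tst[OF assms(1)] by metis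
  obtain c' d' where 2: "c' \<in> I" "d' \<in> I" "tst c' d' \<psi>" using test_fun_tst[OF assms(2)] by metis
  obtain u v where "u \<in> I" "v \<in> I" "tst u v \<phi>" "tst u v \<psi>"
    using tst_common[OF 1(3) 2(3) 1(1,2) 2(1,2)] by metis
  then show ?thesis using tst_test_fun_on(2) tst_add by blast
qed

lemma test_fun_mult:
  assumes "lsm m" "\<phi> \<in> test_fun I"
  shows "(\<lambda>s. m s * \<phi> s) \<in> test_fun I"
  using test_fun_tst[OF assms(2)] tst_test_fun_on(2) tst_mult[OF assms(1)] by metis

lemma test_fun_cmult: "\<phi> \<in> test_fun I \<Longrightarrow> (\<lambda>s. k * \<phi> s) \<in> test_fun I"
  using test_fun_mult[OF lsm_const] by blast

lemma test_fun_uminus: "\<phi> \<in> test_fun I \<Longrightarrow> (\<lambda>s. - \<phi> s) \<in> test_fun I"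
  using test_fun_cmult[of \<phi> "-1"] by simp

lemma test_fun_diff: "\<phi> \<in> test_fun I \<Longrightarrow> \<psi> \<in> test_fun I \<Longrightarrow> (\<lambda>s. \<phi> s - \<psi> s) \<in> test_fun I"
  using test_fun_add[OF _ test_fun_uminus] by fastforce

lemma test_fun_lsm: "\<phi> \<in> test_fun I \<Longrightarrow> lsm \<phi>"
  by (simp add: test_fun_def smooth_reg_fun_lsm)

lemma test_fun_lreg: "\<phi> \<in> test_fun I \<Longrightarrow> lreg \<phi>"
  using test_fun_lsm lsm_lreg by blast

lemma test_fun_gderiv: "\<phi> \<in> test_fun I \<Longrightarrow> lder \<phi> (gderiv I \<phi>)"
  using gderiv_smooth_reg_fun(1) by (auto simp: test_fun_def is_gderiv_iff)

lemma tst_gderiv: "c \<in> I \<Longrightarrow> d \<in> I \<Longrightarrow> tst c d \<phi> \<Longrightarrow> tst c d (gderiv I \<phi>)"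
  using tst_lder test_fun_gderiv tst_test_fun_on(2) by blast

lemma gderiv_test_fun: "\<phi> \<in> test_fun I \<Longrightarrow> gderiv I \<phi> \<in> test_fun I"
  using test_fun_tst tst_gderiv tst_test_fun_on(2) by metis

subsection \<open>Norms\<close>

text \<open>The inequality \<open>ck_norm I k g \<le> M\<close> (see \<open>ck_norm_le_iff\<close>)
  in a form that speaks of some chain of derivatives and not of the iterated choice
  \<open>gderiv\<close>, so that sums and products can be estimated by induction on
  \<open>k\<close>.\<close>

primrec dbound :: "nat \<Rightarrow> real \<Rightarrow> (real \<Rightarrow> complex) \<Rightarrow> bool" where
  "dbound 0 M g \<longleftrightarrow> lreg g \<and> (\<forall>t\<in>I. \<forall>b. norm (lm b g t) \<le> M)"
| "dbound (Suc k) M g \<longleftrightarrow> (lreg g \<and> (\<forall>t\<in>I. \<forall>b. norm (lm b g t) \<le> M)) \<and> (\<exists>h. lder g h \<and> dbound k M h)"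

lemma dbound_lreg: "dbound k M g \<Longrightarrow> lreg g"
  by (cases k) auto

lemma dbound_le: "dbound k M g \<Longrightarrow> t \<in> I \<Longrightarrow> norm (lm b g t) \<le> M"
  by (cases k) auto

lemma dbound_nonneg: "dbound k M g \<Longrightarrow> M \<ge> 0"
  using dbound_le nonempty_I norm_ge_zero order_trans by (metis all_not_in_conv)

lemma dbound_cong:
  assumes "dbound k M g" "lreg h" "\<And>t b. t \<in> I \<Longrightarrow> lm b g t = lm b h t"
  shows "dbound k M h"
proof (cases k)
  case 0
  then show ?thesis using assms by auto
next
  case (Suc k')
  then obtain g' where g': "lder g g'" "dbound k' M g'" using assms(1) by auto
  have "lder h g'"
    by (rule lder_cong[OF g'(1)]) (use assms dbound_lreg lreg_lm_eq_imp_eventually in blast)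
  then show ?thesis using g'(2) assms Suc by auto
qed

lemma dbound_lder:
  assumes "dbound (Suc k) M g" "lder g h"
  shows "dbound k M h"
proof -
  obtain h' where "lder g h'" "dbound k M h'" using assms(1) by auto
  then show ?thesis using dbound_cong lder_lreg[OF assms(2)] lder_unique[OF _ assms(2)] by blast
qed

lemma dbound_Suc: "dbound (Suc k) M g \<Longrightarrow> dbound k M g"
proof (induction k arbitrary: g)
  case (Suc k)
  then obtain h where "lder g h" "dbound (Suc k) M h" by auto
  then show ?case using Suc by auto
qed auto

lemma dbound_mono: "dbound k M g \<Longrightarrow> j \<le> k \<Longrightarrow> M \<le> N \<Longrightarrow> dbound j N g"
proof -
  have "dbound k N g" if "dbound k M g" "M \<le> N" for g
    using that
  proof (induction k arbitrary: g)
    case 0 then show ?case by (auto intro: order_trans)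
  next
    case (Suc k)
    then obtain h where "lder g h" "dbound k N h" by auto
    then show ?case using Suc.prems by (auto intro: order_trans)
  qed
  moreover have "dbound j N g" if "j \<le> k" "dbound k N g" for g
    using that by (induction rule: inc_induct) (auto simp del: dbound.simps intro: dbound_Suc)
  ultimately show "dbound k M g \<Longrightarrow> j \<le> k \<Longrightarrow> M \<le> N \<Longrightarrow> dbound j N g" by blast
qed

lemma dbound_add:
  "dbound k M f \<Longrightarrow> dbound k N g \<Longrightarrow> dbound k (M + N) (\<lambda>s. f s + g s)"
proof (induction k arbitrary: f g)
  case 0
  then show ?case by (auto simp: lm_add intro!: lreg_add norm_triangle_mono)
next
  case (Suc k)
  then obtain f' g' where "lder f f'" "lder g g'" "dbound k M f'" "dbound k N g'" by auto
  then have "lder (\<lambda>s. f s + g s) (\<lambda>s. f' s + g' s) \<and> dbound k (M + N) (\<lambda>s. f' s + g' s)"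
    using Suc lder_add dbound_lreg by blast
  then show ?case using Suc.prems by (auto simp: lm_add intro!: lreg_add norm_triangle_mono)
qed

lemma dbound_cmult: "dbound k M f \<Longrightarrow> dbound k (norm c * M) (\<lambda>s. c * f s)"
proof (induction k arbitrary: f)
  case 0
  then show ?case by (auto simp: lm_cmult norm_mult intro!: lreg_cmult mult_left_mono)
next
  case (Suc k)
  then obtain f' where "lder f f'" "dbound k M f'" by auto
  then have "lder (\<lambda>s. c * f s) (\<lambda>s. c * f' s) \<and> dbound k (norm c * M) (\<lambda>s. c * f' s)"
    using Suc lder_cmult dbound_lreg by blast
  then show ?case using Suc.prems by (auto simp: lm_cmult norm_mult intro!: lreg_cmult mult_left_mono)
qed

text \<open>Leibniz rule by induction on \<open>k\<close>, with the constants for \<open>m\<close>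
  and for its derivative added. Since \<open>m\<close> may be unbounded on \<open>I\<close>, the
  support condition confines the estimate to \<open>{c..d}\<close>.\<close>

lemma dbound_mult:
  assumes "lsm m" "c \<in> I" "d \<in> I"
  shows "\<exists>C\<ge>0. \<forall>\<phi> M. tst c d \<phi> \<longrightarrow> dbound k M \<phi> \<longrightarrow> dbound k (C * M) (\<lambda>s. m s * \<phi> s)"
  using assms(1)
proof (induction k arbitrary: m)
  case (0 m)
  obtain C where C: "C \<ge> 0" "\<And>t b. c \<le> t \<Longrightarrow> t \<le> d \<Longrightarrow> norm (lm b m t) \<le> C"
    using lreg_bounded[OF lsm_lreg[OF 0] assms(2,3)] by blast
  have "norm (lm b (\<lambda>s. m s * \<phi> s) t) \<le> C * M" if "tst c d \<phi>" "dbound 0 M \<phi>" "t \<in> I" for \<phi> M t b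
  proof (cases "t \<in> {c..d}")
    case True
    then show ?thesis using that C lsm_lreg[OF 0] by (auto simp: lm_mult norm_mult intro!: mult_mono)
  next
    case False
    then show ?thesis using vanD[OF tst_van[OF that(1)] that(3)] that lsm_lreg[OF 0] C(1) dbound_nonneg[OF that(2)]
      by (auto simp: lm_mult)
  qed
  then show ?case using C(1) 0 lsm_lreg by (intro exI[of _ C]) (auto intro!: lreg_mult)
next
  case (Suc k m)
  obtain m' where m': "lder m m'" "lsm m'" using lsm_lder[OF Suc.prems] by blast
  obtain C1 where C1: "C1 \<ge> 0" "\<And>\<phi> M. tst c d \<phi> \<Longrightarrow> dbound k M \<phi> \<Longrightarrow> dbound k (C1 * M) (\<lambda>s. m s * \<phi> s)"
    using Suc.IH[OF Suc.prems] by blast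
  obtain C2 where C2: "C2 \<ge> 0" "\<And>\<phi> M. tst c d \<phi> \<Longrightarrow> dbound k M \<phi> \<Longrightarrow> dbound k (C2 * M) (\<lambda>s. m' s * \<phi> s)"
    using Suc.IH[OF m'(2)] by blast
  have "dbound (Suc k) ((C1 + C2) * M) (\<lambda>s. m s * \<phi> s)" if \<phi>: "tst c d \<phi>" "dbound (Suc k) M \<phi>" for \<phi> M
  proof -
    have M: "M \<ge> 0" using dbound_nonneg[OF \<phi>(2)] .
    obtain \<phi>' where \<phi>': "lder \<phi> \<phi>'" using \<phi>(2) by auto
    have b: "dbound k M \<phi>" "dbound k M \<phi>'" "tst c d \<phi>'"
      using dbound_Suc \<phi> \<phi>' dbound_lder tst_lder by blast+
    have "dbound k (C2 * M + C1 * M) (\<lambda>s. m' s * \<phi> s + m s * \<phi>' s)"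
      by (intro dbound_add C1(2) C2(2) b \<phi>)
    moreover have "lder (\<lambda>s. m s * \<phi> s) (\<lambda>s. m' s * \<phi> s + m s * \<phi>' s)"
      using lder_mult m' \<phi>' lsm_lreg Suc.prems tst_lreg \<phi>(1) by blast
    moreover have "dbound k ((C1 + C2) * M) (\<lambda>s. m s * \<phi> s)"
      using dbound_mono[OF C1(2)[OF \<phi>(1) b(1)] order_refl] M C2(1) by (simp add: distrib_right)
    ultimately show ?thesis
      using dbound_le dbound_lreg by (auto simp: algebra_simps)
  qed
  then show ?case using C1(1) C2(1) by (intro exI[of _ "C1 + C2"]) auto
qed

lemma Linf_norm_le_iff:
  assumes "g \<in> reg_fun I"
  shows "Linf_norm I g \<le> M \<longleftrightarrow> (\<forall>t\<in>I. \<forall>b. norm (lm b g t) \<le> M)"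
proof -
  have g: "lreg g" using assms by (simp add: reg_fun_iff)
  have AE: "(AE t in lebesgue_on I. norm (g t) \<le> N) \<longleftrightarrow> (\<forall>t\<in>I. \<forall>b. norm (lm b g t) \<le> N)" for N
    unfolding AE_I_iff using AE_norm_le_iff[OF open_I] g by (simp add: lreg_def)
  have meas: "(\<lambda>t. ereal (norm (g t))) \<in> borel_measurable (lebesgue_on I)"
    using lreg_measurable[OF g] by measurable
  define E where "E = esssup (lebesgue_on I) (\<lambda>t. ereal (norm (g t)))"
  have E: "AE t in lebesgue_on I. ereal (norm (g t)) \<le> E"
    unfolding E_def by (rule esssup_AE)
  \<comment> \<open>\<open>real_of_ereal\<close> maps infinite values to 0, so \<open>E\<close> is
    first shown to be finite: an essential bound excludes plus infinity, and nonempty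
    \<open>I\<close> excludes minus infinity.\<close>
  obtain C where "AE t in lebesgue_on I. norm (g t) \<le> C" using assms by (auto simp: reg_fun_def)
  then have "E \<le> ereal C" unfolding E_def by (intro esssup_I[OF meas]) auto
  moreover have "E \<noteq> -\<infinity>"
  proof
    assume "E = -\<infinity>"
    then have "AE t in lebesgue_on I. norm (g t) \<le> -1" using E by (auto elim: eventually_mono)
    then show False using AE[of "-1"] nonempty_I by (metis all_not_in_conv norm_ge_zero not_one_le_zero neg_0_le_iff_le order_trans)
  qed
  ultimately obtain r where r: "E = ereal r" by (cases E) auto
  then have L: "Linf_norm I g = r" by (simp add: Linf_norm_def flip: E_def)
  have "AE t in lebesgue_on I. norm (g t) \<le> r" using E r by simp
  then have 1: "\<forall>t\<in>I. \<forall>b. norm (lm b g t) \<le> r" using AE by blast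
  have 2: "r \<le> M" if "AE t in lebesgue_on I. norm (g t) \<le> M"
  proof -
    have "E \<le> ereal M" unfolding E_def using that by (intro esssup_I[OF meas]) auto
    then show ?thesis using r by simp
  qed
  show ?thesis using L 1 2 AE by (meson order_trans)
qed

lemma ck_norm_le_iff:
  assumes "\<phi> \<in> smooth_reg_fun I"
  shows "ck_norm I k \<phi> \<le> M \<longleftrightarrow> dbound k M \<phi>"
proof -
  have "(\<forall>i\<le>k. Linf_norm I ((gderiv I ^^ i) \<phi>) \<le> M) \<longleftrightarrow> dbound k M \<phi>"
    using assms
  proof (induction k arbitrary: \<phi>)
    case 0
    then show ?case using Linf_norm_le_iff smooth_reg_fun_reg by (simp add: smooth_reg_fun_lsm lsm_lreg)
  next
    case (Suc k)
    have d: "lder \<phi> (gderiv I \<phi>)" "gderiv I \<phi> \<in> smooth_reg_fun I"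
      using gderiv_smooth_reg_fun[OF Suc.prems] by (auto simp: is_gderiv_iff)
    have "(\<forall>i\<le>Suc k. Linf_norm I ((gderiv I ^^ i) \<phi>) \<le> M) \<longleftrightarrow>
        Linf_norm I \<phi> \<le> M \<and> (\<forall>i\<le>k. Linf_norm I ((gderiv I ^^ i) (gderiv I \<phi>)) \<le> M)"
      unfolding less_Suc_eq_le[symmetric] All_less_Suc2 by (simp add: funpow_Suc_right del: funpow.simps(2))
    also have "\<dots> \<longleftrightarrow> Linf_norm I \<phi> \<le> M \<and> dbound k M (gderiv I \<phi>)" using Suc.IH[OF d(2)] by simp
    also have "\<dots> \<longleftrightarrow> dbound (Suc k) M \<phi>"
      using Linf_norm_le_iff[OF smooth_reg_fun_reg[OF Suc.prems]] d(1) dbound_lder[OF _ d(1), of k M]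
        lsm_lreg[OF smooth_reg_fun_lsm[OF Suc.prems]] unfolding dbound.simps by blast
    finally show ?case .
  qed
  then show ?thesis unfolding ck_norm_def by (subst Max_le_iff) auto
qed

section \<open>Continuity of functionals as norm estimates\<close>

lemma topspace_test_topology: "topspace (test_topology I) = test_fun I"
proof -
  have "ind_nhd I (test_fun I)"
    unfolding ind_nhd_def
  proof (intro conjI allI impI)
    show "abs_convex (test_fun I)" unfolding abs_convex_def
      using test_fun_add test_fun_cmult by blast
    fix J assume "admissible I J"
    then obtain c d where "c \<in> I" "d \<in> I" "\<And>\<phi>. \<phi> \<in> test_fun_on I J \<Longrightarrow> tst c d \<phi>"
      using test_fun_on_tst by metis
    then have "test_fun_on I J \<subseteq> test_fun I" using tst_test_fun_on(2) by blast
    then show "\<exists>k. \<exists>e>0. \<forall>\<phi>\<in>test_fun_on I J. ck_norm I k \<phi> < e \<longrightarrow> \<phi> \<in> test_fun I"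
      using zero_less_one by blast
  qed simp
  then have "test_open I (test_fun I)" unfolding test_open_def using test_fun_add by blast
  then show ?thesis using openin_subset openin_test_topology
    unfolding topspace_def by (metis (no_types, lifting) Union_upper cSup_eq_maximum mem_Collect_eq test_open_def)
qed

text \<open>An estimate by one norm on each step makes every set \<open>norm (f \<phi>) < r\<close>
  a basic neighbourhood of zero, and additivity moves it to any point.\<close>

lemma distribI:
  assumes add: "\<And>\<phi> \<psi>. \<phi> \<in> test_fun I \<Longrightarrow> \<psi> \<in> test_fun I \<Longrightarrow> f (\<lambda>t. \<phi> t + \<psi> t) = f \<phi> + f \<psi>"
    and cmult: "\<And>\<phi> c. \<phi> \<in> test_fun I \<Longrightarrow> f (\<lambda>t. c * \<phi> t) = c * f \<phi>"
    and off: "\<And>\<phi>. \<phi> \<notin> test_fun I \<Longrightarrow> f \<phi> = 0"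
    and bd: "\<And>c d. c \<in> I \<Longrightarrow> d \<in> I \<Longrightarrow> c < d \<Longrightarrow>
      \<exists>k C. \<forall>\<phi> M. tst c d \<phi> \<longrightarrow> dbound k M \<phi> \<longrightarrow> norm (f \<phi>) \<le> C * M"
  shows "f \<in> distrib I"
proof -
  have nhd: "ind_nhd I {\<phi> \<in> test_fun I. norm (f \<phi>) < r}" if r: "r > 0" for r
    unfolding ind_nhd_def
  proof (intro conjI allI impI)
    show "abs_convex {\<phi> \<in> test_fun I. norm (f \<phi>) < r}"
      unfolding abs_convex_def
    proof (intro ballI allI impI)
      fix u v and \<alpha> \<beta> :: complex
      assume u: "u \<in> {\<phi> \<in> test_fun I. norm (f \<phi>) < r}" and v: "v \<in> {\<phi> \<in> test_fun I. norm (f \<phi>) < r}"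
        and ab: "norm \<alpha> + norm \<beta> \<le> 1"
      have "f (\<lambda>t. \<alpha> * u t + \<beta> * v t) = \<alpha> * f u + \<beta> * f v"
        using u v add[OF test_fun_cmult test_fun_cmult, of u v \<alpha> \<beta>] cmult by simp
      also have "norm \<dots> \<le> norm \<alpha> * norm (f u) + norm \<beta> * norm (f v)"
        by (metis norm_mult norm_triangle_ineq)
      also have "\<dots> \<le> norm \<alpha> * max (norm (f u)) (norm (f v)) + norm \<beta> * max (norm (f u)) (norm (f v))"
        by (intro add_mono mult_left_mono) auto
      also have "\<dots> \<le> 1 * max (norm (f u)) (norm (f v))"
        unfolding distrib_right[symmetric] by (rule mult_right_mono[OF ab]) (simp add: le_max_iff_disj)
      also have "\<dots> < r" using u v by simp
      finally show "(\<lambda>t. \<alpha> * u t + \<beta> * v t) \<in> {\<phi> \<in> test_fun I. norm (f \<phi>) < r}"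
        using u v test_fun_add test_fun_cmult by simp
    qed
    fix J assume J: "admissible I J"
    obtain c d where cd: "c \<in> I" "d \<in> I" "c < d" "\<And>\<phi>. \<phi> \<in> test_fun_on I J \<Longrightarrow> tst c d \<phi>"
      using test_fun_on_tst[OF J] by metis
    obtain k C where C: "\<And>\<phi> M. tst c d \<phi> \<Longrightarrow> dbound k M \<phi> \<Longrightarrow> norm (f \<phi>) \<le> C * M"
      using bd[OF cd(1-3)] by blast
    \<comment> \<open>The added 1 excludes division by 0 and makes the final estimate
      strict.\<close>
    define e where "e = r / (\<bar>C\<bar> + 1)"
    have e: "e > 0" using r by (simp add: e_def)
    have "\<phi> \<in> {\<phi> \<in> test_fun I. norm (f \<phi>) < r}" if \<phi>: "\<phi> \<in> test_fun_on I J" "ck_norm I k \<phi> < e" for \<phi>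
    proof -
      have "dbound k e \<phi>"
        using \<phi> by (intro ck_norm_le_iff[THEN iffD1]) (auto simp: test_fun_on_def)
      then have "norm (f \<phi>) \<le> C * e" using C cd(4) \<phi>(1) by blast
      also have "\<dots> < (\<bar>C\<bar> + 1) * e" using e by (intro mult_strict_right_mono) auto
      also have "\<dots> = r" by (simp add: e_def)
      finally show ?thesis using tst_test_fun_on(2)[OF cd(1,2) cd(4)[OF \<phi>(1)]] by simp
    qed
    then show "\<exists>k. \<exists>e>0. \<forall>\<phi>\<in>test_fun_on I J. ck_norm I k \<phi> < e \<longrightarrow> \<phi> \<in> {\<phi> \<in> test_fun I. norm (f \<phi>) < r}"
      using e by blast
  qed auto
  have "continuous_map (test_topology I) euclidean f"
    unfolding continuous_map_def topspace_test_topology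
  proof (intro conjI allI impI)
    fix U :: "complex set" assume "openin euclidean U"
    then have U: "open U" by simp
    show "openin (test_topology I) {x \<in> test_fun I. f x \<in> U}"
      unfolding openin_test_topology test_open_def
    proof (intro conjI ballI)
      fix \<phi> assume \<phi>: "\<phi> \<in> {x \<in> test_fun I. f x \<in> U}"
      then have "f \<phi> \<in> U" by simp
      then obtain r where r: "r > 0" "ball (f \<phi>) r \<subseteq> U" using openE[OF U] by blast
      have "(\<lambda>t. \<phi> t + \<psi> t) \<in> {x \<in> test_fun I. f x \<in> U}" if "\<psi> \<in> {\<phi> \<in> test_fun I. norm (f \<phi>) < r}" for \<psi>
        using that \<phi> r(2) add[of \<phi> \<psi>] test_fun_add by (auto simp: subset_iff dist_norm)
      then show "\<exists>V. ind_nhd I V \<and> (\<forall>\<psi>\<in>V. (\<lambda>t. \<phi> t + \<psi> t) \<in> {x \<in> test_fun I. f x \<in> U})"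
        using nhd[OF r(1)] by blast
    qed auto
  qed auto
  then show ?thesis using add cmult off by (simp add: distrib_def)
qed

lemma distrib_add: "f \<in> distrib I \<Longrightarrow> \<phi> \<in> test_fun I \<Longrightarrow> \<psi> \<in> test_fun I \<Longrightarrow> f (\<lambda>t. \<phi> t + \<psi> t) = f \<phi> + f \<psi>"
  and distrib_cmult: "f \<in> distrib I \<Longrightarrow> \<phi> \<in> test_fun I \<Longrightarrow> f (\<lambda>t. c * \<phi> t) = c * f \<phi>"
  and distrib_off: "f \<in> distrib I \<Longrightarrow> \<phi> \<notin> test_fun I \<Longrightarrow> f \<phi> = 0"
  by (auto simp: distrib_def)

lemma distrib_uminus: "f \<in> distrib I \<Longrightarrow> \<phi> \<in> test_fun I \<Longrightarrow> f (\<lambda>t. - \<phi> t) = - f \<phi>"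
  using distrib_cmult[of f \<phi> "-1"] by simp

lemma distrib_diff: "f \<in> distrib I \<Longrightarrow> \<phi> \<in> test_fun I \<Longrightarrow> \<psi> \<in> test_fun I \<Longrightarrow> f (\<lambda>t. \<phi> t - \<psi> t) = f \<phi> - f \<psi>"
  using distrib_add[OF _ _ test_fun_uminus] distrib_uminus by fastforce

text \<open>Converse of \<open>distribI\<close>, by scaling a test function into a neighbourhood on
  which \<open>f\<close> is smaller than 1 in norm.\<close>

lemma distrib_bound:
  assumes f: "f \<in> distrib I" and cd: "c \<in> I" "d \<in> I"
  obtains k C where "C \<ge> 0" "\<And>\<phi> M. tst c d \<phi> \<Longrightarrow> dbound k M \<phi> \<Longrightarrow> norm (f \<phi>) \<le> C * M"
proof -
  have z: "(\<lambda>_. 0) \<in> test_fun I"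
    using cd by (intro tst_test_fun_on(2)[of c d]) (auto simp: tst_def van_def lsm_const)
  have "openin (test_topology I) {\<phi> \<in> topspace (test_topology I). f \<phi> \<in> ball 0 1}"
    using f by (intro openin_continuous_map_preimage) (auto simp: distrib_def)
  then have o: "test_open I {\<phi> \<in> test_fun I. norm (f \<phi>) < 1}"
    by (simp add: openin_test_topology topspace_test_topology)
  have "f (\<lambda>_. 0) = 0" using distrib_cmult[OF f z, of 0] by simp
  then obtain V where V: "ind_nhd I V" "\<And>\<psi>. \<psi> \<in> V \<Longrightarrow> norm (f \<psi>) < 1"
    using o z unfolding test_open_def by fastforce
  have "admissible I {c..d}" using segment_subset[OF cd] by (simp add: admissible_def is_interval_cc)
  then obtain k e where ke: "e > 0" "\<And>\<phi>. \<phi> \<in> test_fun_on I {c..d} \<Longrightarrow> ck_norm I k \<phi> < e \<Longrightarrow> \<phi> \<in> V"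
    using V(1) unfolding ind_nhd_def by blast
  have "norm (f \<phi>) \<le> (1 / e) * M" if \<phi>: "tst c d \<phi>" "dbound k M \<phi>" for \<phi> M
  proof -
    have M: "M \<ge> 0" using dbound_nonneg[OF \<phi>(2)] .
    \<comment> \<open>Scaling by \<open>e / r\<close> with \<open>r > M\<close>, in place of
      \<open>e / M\<close>, reaches the strict inequality for the norm and covers
      \<open>M = 0\<close>; afterwards \<open>r\<close> tends to \<open>M\<close>.\<close>
    have "norm (f \<phi>) \<le> r / e" if r: "r > M" for r
    proof -
      let ?\<alpha> = "complex_of_real (e / r)"
      have "norm ?\<alpha> * M < e" using r M ke(1) by (simp add: norm_divide field_simps)
      moreover have t: "tst c d (\<lambda>s. ?\<alpha> * \<phi> s)" by (rule tst_cmult[OF \<phi>(1)])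
      moreover have "ck_norm I k (\<lambda>s. ?\<alpha> * \<phi> s) \<le> norm ?\<alpha> * M"
        using tst_test_fun_on(1)[OF cd t] dbound_cmult[OF \<phi>(2), of ?\<alpha>] unfolding test_fun_on_def
        by (intro ck_norm_le_iff[THEN iffD2]) blast+
      ultimately have "norm (f (\<lambda>s. ?\<alpha> * \<phi> s)) < 1" using V(2) ke(2) tst_test_fun_on(1)[OF cd] by force
      moreover have "f (\<lambda>s. ?\<alpha> * \<phi> s) = ?\<alpha> * f \<phi>" by (rule distrib_cmult[OF f tst_test_fun_on(2)[OF cd \<phi>(1)]])
      ultimately have "(e / r) * norm (f \<phi>) < 1" using r M ke(1) by (simp add: norm_mult norm_divide)
      then show ?thesis using r M ke(1) by (simp add: field_simps)
    qed
    then have "e * norm (f \<phi>) \<le> r" if "r > M" for r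
      using that ke(1) by (simp add: field_simps)
    then have "e * norm (f \<phi>) \<le> M" by (rule dense_ge)
    then show ?thesis using ke(1) by (simp add: field_simps)
  qed
  then show ?thesis using that[of "1 / e" k] ke(1) by simp
qed

text \<open>The difference satisfies \<open>dbound k 0\<close>, so the estimate of
  \<open>distrib_bound\<close> forces equality. Hence functionals respect equality almost
  everywhere, and limits suffice to identify their arguments.\<close>

lemma distrib_cong:
  assumes f: "f \<in> distrib I" and "\<phi> \<in> test_fun I" "\<psi> \<in> test_fun I" "\<And>t b. t \<in> I \<Longrightarrow> lm b \<phi> t = lm b \<psi> t"
  shows "f \<phi> = f \<psi>"
proof -
  let ?\<eta> = "\<lambda>t. \<phi> t - \<psi> t"
  have \<eta>: "?\<eta> \<in> test_fun I" using test_fun_diff assms by blast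
  obtain c d where cd: "c \<in> I" "d \<in> I" "tst c d ?\<eta>" using test_fun_tst[OF \<eta>] by metis
  obtain k C where C: "\<And>\<phi> M. tst c d \<phi> \<Longrightarrow> dbound k M \<phi> \<Longrightarrow> norm (f \<phi>) \<le> C * M"
    using distrib_bound[OF f cd(1,2)] by metis
  have z: "lm b ?\<eta> t = 0" if "t \<in> I" for t b using assms that by (simp add: lm_diff test_fun_lreg)
  have "dbound k 0 (\<lambda>_. 0)" by (induction k) (auto intro: lreg_const lder_const)
  then have "dbound k 0 ?\<eta>" by (rule dbound_cong) (use z test_fun_lreg[OF \<eta>] in auto)
  then have "f ?\<eta> = 0" using C[OF cd(3)] by fastforce
  then show ?thesis using distrib_diff[OF f assms(2,3)] by simp
qed

end

section \<open>Operations on distributions\<close>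

context open_interval
begin

text \<open>The operator \<open>L\<close> need only be linear up to null sets, as is the case for \<open>gderiv I\<close>.\<close>

lemma distrib_comp:
  assumes f: "f \<in> distrib I"
    and test: "\<And>\<phi>. \<phi> \<in> test_fun I \<Longrightarrow> L \<phi> \<in> test_fun I"
    and add: "\<And>\<phi> \<psi> t b. \<phi> \<in> test_fun I \<Longrightarrow> \<psi> \<in> test_fun I \<Longrightarrow> t \<in> I \<Longrightarrow>
      lm b (L (\<lambda>s. \<phi> s + \<psi> s)) t = lm b (L \<phi>) t + lm b (L \<psi>) t"
    and cmult: "\<And>\<phi> c t b. \<phi> \<in> test_fun I \<Longrightarrow> t \<in> I \<Longrightarrow> lm b (L (\<lambda>s. c * \<phi> s)) t = c * lm b (L \<phi>) t"
    and bd: "\<And>c d. c \<in> I \<Longrightarrow> d \<in> I \<Longrightarrow> c < d \<Longrightarrow> \<exists>c'\<in>I. \<exists>d'\<in>I. (\<forall>\<phi>. tst c d \<phi> \<longrightarrow> tst c' d' (L \<phi>)) \<and>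
      (\<forall>k. \<exists>k' C. \<forall>\<phi> M. tst c d \<phi> \<longrightarrow> dbound k' M \<phi> \<longrightarrow> dbound k (C * M) (L \<phi>))"
  shows "(\<lambda>\<phi>. if \<phi> \<in> test_fun I then f (L \<phi>) else 0) \<in> distrib I"
proof (rule distribI)
  fix \<phi> \<psi> assume a: "\<phi> \<in> test_fun I" "\<psi> \<in> test_fun I"
  have "f (L (\<lambda>s. \<phi> s + \<psi> s)) = f (\<lambda>s. L \<phi> s + L \<psi> s)"
    using a test test_fun_add add by (intro distrib_cong[OF f]) (auto simp: lm_add test_fun_lreg)
  then show "(if (\<lambda>t. \<phi> t + \<psi> t) \<in> test_fun I then f (L (\<lambda>t. \<phi> t + \<psi> t)) else 0) =
      (if \<phi> \<in> test_fun I then f (L \<phi>) else 0) + (if \<psi> \<in> test_fun I then f (L \<psi>) else 0)"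
    using a test test_fun_add distrib_add[OF f] by simp
next
  fix \<phi> c assume a: "\<phi> \<in> test_fun I"
  have "f (L (\<lambda>s. c * \<phi> s)) = f (\<lambda>s. c * L \<phi> s)"
    using a test test_fun_cmult cmult by (intro distrib_cong[OF f]) (auto simp: lm_cmult test_fun_lreg)
  then show "(if (\<lambda>t. c * \<phi> t) \<in> test_fun I then f (L (\<lambda>t. c * \<phi> t)) else 0) = c * (if \<phi> \<in> test_fun I then f (L \<phi>) else 0)"
    using a test test_fun_cmult distrib_cmult[OF f] by simp
next
  fix c d assume cd: "c \<in> I" "d \<in> I" "c < d"
  obtain c' d' where c': "c' \<in> I" "d' \<in> I" "\<And>\<phi>. tst c d \<phi> \<Longrightarrow> tst c' d' (L \<phi>)"
    and k: "\<And>k. \<exists>k' C. \<forall>\<phi> M. tst c d \<phi> \<longrightarrow> dbound k' M \<phi> \<longrightarrow> dbound k (C * M) (L \<phi>)"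
    using bd[OF cd] by metis
  obtain k C where C: "\<And>\<phi> M. tst c' d' \<phi> \<Longrightarrow> dbound k M \<phi> \<Longrightarrow> norm (f \<phi>) \<le> C * M"
    using distrib_bound[OF f c'(1,2)] by metis
  obtain k' C' where C': "\<And>\<phi> M. tst c d \<phi> \<Longrightarrow> dbound k' M \<phi> \<Longrightarrow> dbound k (C' * M) (L \<phi>)"
    using k[of k] by metis
  have "norm (f (L \<phi>)) \<le> (C * C') * M" if "tst c d \<phi>" "dbound k' M \<phi>" for \<phi> M
    using C[OF c'(3)[OF that(1)] C'[OF that]] by (simp add: mult.assoc)
  then show "\<exists>k C. \<forall>\<phi> M. tst c d \<phi> \<longrightarrow> dbound k M \<phi> \<longrightarrow>
      norm (if \<phi> \<in> test_fun I then f (L \<phi>) else 0) \<le> C * M"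
    using tst_test_fun_on(2)[OF cd(1,2)] by (intro exI[of _ k'] exI[of _ "C * C'"]) auto
qed simp

lemma distrib_mult:
  assumes "lsm m" "f \<in> distrib I"
  shows "mult_dist I m f \<in> distrib I"
  unfolding mult_dist_def
proof (rule distrib_comp[OF assms(2)])
  fix c d assume cd: "c \<in> I" "d \<in> I" "c < d"
  have "\<exists>k' C. \<forall>\<phi> M. tst c d \<phi> \<longrightarrow> dbound k' M \<phi> \<longrightarrow> dbound k (C * M) (\<lambda>t. m t * \<phi> t)" for k
    using dbound_mult[OF assms(1) cd(1,2), of k] by metis
  then show "\<exists>c'\<in>I. \<exists>d'\<in>I. (\<forall>\<phi>. tst c d \<phi> \<longrightarrow> tst c' d' (\<lambda>t. m t * \<phi> t)) \<and>
      (\<forall>k. \<exists>k' C. \<forall>\<phi> M. tst c d \<phi> \<longrightarrow> dbound k' M \<phi> \<longrightarrow> dbound k (C * M) (\<lambda>t. m t * \<phi> t))"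
    using cd tst_mult[OF assms(1)] by blast
next
  fix \<phi> \<psi> t b assume "\<phi> \<in> test_fun I" "\<psi> \<in> test_fun I" "t \<in> I"
  then show "lm b (\<lambda>t. m t * (\<phi> t + \<psi> t)) t = lm b (\<lambda>t. m t * \<phi> t) t + lm b (\<lambda>t. m t * \<psi> t) t"
    using assms(1) by (simp add: lm_mult lm_add lreg_add lreg_mult test_fun_lreg lsm_lreg distrib_left)
next
  fix \<phi> c t b assume "\<phi> \<in> test_fun I" "t \<in> I"
  then show "lm b (\<lambda>t. m t * (c * \<phi> t)) t = c * lm b (\<lambda>t. m t * \<phi> t) t"
    using assms(1) by (simp add: lm_mult lm_cmult lreg_cmult test_fun_lreg lsm_lreg)
qed (rule test_fun_mult[OF assms(1)])

lemma mult_dist_mult_dist: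
  assumes "lsm m1"
  shows "mult_dist I m1 (mult_dist I m2 f) = mult_dist I (\<lambda>t. m1 t * m2 t) f"
  using test_fun_mult[OF assms] by (auto simp: mult_dist_def fun_eq_iff mult.commute mult.left_commute)

lemma mult_dist_cong:
  assumes "f \<in> distrib I" "lsm m" "lsm m'" "\<And>t b. t \<in> I \<Longrightarrow> lm b m t = lm b m' t"
  shows "mult_dist I m f = mult_dist I m' f"
proof
  fix \<phi>
  show "mult_dist I m f \<phi> = mult_dist I m' f \<phi>"
  proof (cases "\<phi> \<in> test_fun I")
    case True
    have "f (\<lambda>t. m t * \<phi> t) = f (\<lambda>t. m' t * \<phi> t)"
      by (rule distrib_cong[OF assms(1) test_fun_mult[OF assms(2) True] test_fun_mult[OF assms(3) True]])
        (simp add: lm_mult lsm_lreg test_fun_lreg assms True)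
    then show ?thesis using True by (simp add: mult_dist_def)
  qed (simp add: mult_dist_def)
qed

lemma distrib_zero: "(\<lambda>_. 0) \<in> distrib I"
proof (rule distribI)
  fix c d
  have "norm (0 :: complex) \<le> 0 * M" for M :: real by simp
  then show "\<exists>k C. \<forall>\<phi> M. tst c d \<phi> \<longrightarrow> dbound k M \<phi> \<longrightarrow> norm (0 :: complex) \<le> C * M" by blast
qed auto

lemma distrib_plus:
  assumes "f \<in> distrib I" "g \<in> distrib I"
  shows "(\<lambda>\<phi>. f \<phi> + g \<phi>) \<in> distrib I"
proof (rule distribI)
  fix c d assume cd: "c \<in> I" "d \<in> I" "c < d"
  obtain k1 C1 where 1: "C1 \<ge> 0" "\<And>\<phi> M. tst c d \<phi> \<Longrightarrow> dbound k1 M \<phi> \<Longrightarrow> norm (f \<phi>) \<le> C1 * M"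
    using distrib_bound[OF assms(1) cd(1,2)] by metis
  obtain k2 C2 where 2: "C2 \<ge> 0" "\<And>\<phi> M. tst c d \<phi> \<Longrightarrow> dbound k2 M \<phi> \<Longrightarrow> norm (g \<phi>) \<le> C2 * M"
    using distrib_bound[OF assms(2) cd(1,2)] by metis
  have "norm (f \<phi> + g \<phi>) \<le> (C1 + C2) * M" if "tst c d \<phi>" "dbound (max k1 k2) M \<phi>" for \<phi> M
  proof -
    have "dbound k1 M \<phi>" "dbound k2 M \<phi>" using that(2) by (auto intro: dbound_mono)
    then have "norm (f \<phi>) + norm (g \<phi>) \<le> (C1 + C2) * M" using 1(2) 2(2) that(1) by (smt (verit) distrib_right)
    then show ?thesis using norm_triangle_ineq order_trans by blast
  qed
  then show "\<exists>k C. \<forall>\<phi> M. tst c d \<phi> \<longrightarrow> dbound k M \<phi> \<longrightarrow> norm (f \<phi> + g \<phi>) \<le> C * M" by blast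
qed (use assms in \<open>auto simp: distrib_add distrib_cmult distrib_off algebra_simps\<close>)

lemma distrib_scale:
  assumes "f \<in> distrib I"
  shows "(\<lambda>\<phi>. k * f \<phi>) \<in> distrib I"
proof -
  have "mult_dist I (\<lambda>_. k) f = (\<lambda>\<phi>. k * f \<phi>)"
    using assms by (auto simp: mult_dist_def fun_eq_iff distrib_cmult distrib_off)
  then show ?thesis using distrib_mult[OF lsm_const assms, of k] by simp
qed

lemma distrib_minus: "f \<in> distrib I \<Longrightarrow> g \<in> distrib I \<Longrightarrow> (\<lambda>\<phi>. f \<phi> - g \<phi>) \<in> distrib I"
  using distrib_plus[of f "\<lambda>\<phi>. - 1 * g \<phi>"] distrib_scale[of g "-1"] by simp

lemma distrib_sum: "(\<And>i. i \<in> S \<Longrightarrow> f i \<in> distrib I) \<Longrightarrow> (\<lambda>\<phi>. \<Sum>i\<in>S. f i \<phi>) \<in> distrib I"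
  by (induction S rule: infinite_finite_induct) (auto intro: distrib_zero distrib_plus)

lemma gderiv_unique:
  "\<phi> \<in> test_fun I \<Longrightarrow> lder \<phi> h \<Longrightarrow> t \<in> I \<Longrightarrow> lm b (gderiv I \<phi>) t = lm b h t"
  using lder_unique test_fun_gderiv by blast

text \<open>Replaces the unspecified representative chosen by \<open>gderiv\<close> by an explicit
  derivative.\<close>

lemma distrib_gderiv:
  assumes f: "f \<in> distrib I" and "\<phi> \<in> test_fun I" "lder \<phi> h" "h \<in> test_fun I"
  shows "f (gderiv I \<phi>) = f h"
  using assms by (intro distrib_cong[OF f] gderiv_test_fun gderiv_unique)

lemma distrib_ddt:
  assumes f: "f \<in> distrib I"
  shows "ddt I f \<in> distrib I"
proof -
  have "(\<lambda>\<phi>. if \<phi> \<in> test_fun I then f (gderiv I \<phi>) else 0) \<in> distrib I"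
  proof (rule distrib_comp[OF f])
    fix \<phi> \<psi> t b assume a: "\<phi> \<in> test_fun I" "\<psi> \<in> test_fun I" "t \<in> I"
    have "lder (\<lambda>s. \<phi> s + \<psi> s) (\<lambda>s. gderiv I \<phi> s + gderiv I \<psi> s)"
      using a by (intro lder_add test_fun_gderiv test_fun_lreg)
    from gderiv_unique[OF test_fun_add[OF a(1,2)] this a(3)]
    show "lm b (gderiv I (\<lambda>s. \<phi> s + \<psi> s)) t = lm b (gderiv I \<phi>) t + lm b (gderiv I \<psi>) t"
      using a by (simp add: lm_add test_fun_lreg gderiv_test_fun)
  next
    fix \<phi> t b and c :: complex assume a: "\<phi> \<in> test_fun I" "t \<in> I"
    have "lder (\<lambda>s. c * \<phi> s) (\<lambda>s. c * gderiv I \<phi> s)"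
      using a by (intro lder_cmult test_fun_gderiv test_fun_lreg)
    from gderiv_unique[OF test_fun_cmult[OF a(1)] this a(2)]
    show "lm b (gderiv I (\<lambda>s. c * \<phi> s)) t = c * lm b (gderiv I \<phi>) t"
      using a by (simp add: lm_cmult test_fun_lreg gderiv_test_fun)
  next
    fix c d assume cd: "c \<in> I" "d \<in> I" "c < d"
    have "dbound k (1 * M) (gderiv I \<phi>)" if "tst c d \<phi>" "dbound (Suc k) M \<phi>" for k M \<phi>
      using dbound_lder[OF that(2)] test_fun_gderiv tst_test_fun_on(2)[OF cd(1,2) that(1)] by simp
    then show "\<exists>c'\<in>I. \<exists>d'\<in>I. (\<forall>\<phi>. tst c d \<phi> \<longrightarrow> tst c' d' (gderiv I \<phi>)) \<and>
      (\<forall>k. \<exists>k' C. \<forall>\<phi> M. tst c d \<phi> \<longrightarrow> dbound k' M \<phi> \<longrightarrow> dbound k (C * M) (gderiv I \<phi>))"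
      using cd tst_gderiv by blast
  qed (rule gderiv_test_fun)
  from distrib_scale[OF this, of "-1"] show ?thesis
    by (simp add: ddt_def if_distrib[of "(*) (- 1)"] if_distrib[of uminus] cong: if_cong)
qed

section \<open>The class \<open>Delta I\<close> and the multivalued derivative\<close>

lemma test_fun_F_test_fun: "\<phi> \<in> test_fun_F I \<Longrightarrow> \<phi> \<in> test_fun I"
  by (simp add: test_fun_F_def)

lemma Delta_distrib: "\<delta> \<in> Delta I \<Longrightarrow> \<delta> \<in> distrib I"
  by (simp add: Delta_def)

lemma Delta_zero: "(\<lambda>_. 0) \<in> Delta I"
  unfolding Delta_def using distrib_zero by (auto intro: exI[of _ "\<lambda>_. 0"])

lemma Delta_add:
  assumes "\<delta> \<in> Delta I" "\<eta> \<in> Delta I"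
  shows "(\<lambda>\<phi>. \<delta> \<phi> + \<eta> \<phi>) \<in> Delta I"
proof -
  obtain c where c: "\<forall>\<phi>\<in>test_fun_F I. \<delta> \<phi> = (\<Sum>t | t \<in> I \<and> jump t \<phi> \<noteq> 0. c t * jump t \<phi>)"
    using assms(1) unfolding Delta_def by auto
  obtain e where e: "\<forall>\<phi>\<in>test_fun_F I. \<eta> \<phi> = (\<Sum>t | t \<in> I \<and> jump t \<phi> \<noteq> 0. e t * jump t \<phi>)"
    using assms(2) unfolding Delta_def by auto
  have "\<forall>\<phi>\<in>test_fun_F I. \<delta> \<phi> + \<eta> \<phi> = (\<Sum>t | t \<in> I \<and> jump t \<phi> \<noteq> 0. (c t + e t) * jump t \<phi>)"
    using c e by (simp add: sum.distrib distrib_right)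
  then show ?thesis unfolding Delta_def using distrib_plus assms by (auto simp: Delta_def)
qed

lemma Delta_scale:
  assumes "\<delta> \<in> Delta I"
  shows "(\<lambda>\<phi>. k * \<delta> \<phi>) \<in> Delta I"
proof -
  obtain c where c: "\<forall>\<phi>\<in>test_fun_F I. \<delta> \<phi> = (\<Sum>t | t \<in> I \<and> jump t \<phi> \<noteq> 0. c t * jump t \<phi>)"
    using assms(1) unfolding Delta_def by auto
  have "\<forall>\<phi>\<in>test_fun_F I. k * \<delta> \<phi> = (\<Sum>t | t \<in> I \<and> jump t \<phi> \<noteq> 0. (k * c t) * jump t \<phi>)"
    using c by (simp add: sum_distrib_left mult.assoc)
  then show ?thesis unfolding Delta_def using distrib_scale assms
    by (auto simp: Delta_def intro!: exI[of _ "\<lambda>t. k * c t"])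
qed

lemma derivs_iff: "h \<in> derivs I f \<longleftrightarrow> (\<lambda>\<phi>. h \<phi> - ddt I f \<phi>) \<in> Delta I"
  unfolding derivs_def by (auto intro!: exI[of _ "\<lambda>\<phi>. h \<phi> - ddt I f \<phi>"])

lemma derivs_zero: "(\<lambda>_. 0) \<in> derivs I (\<lambda>_. 0)"
proof -
  have "ddt I (\<lambda>_. 0) = (\<lambda>_. 0)" by (auto simp: ddt_def)
  then show ?thesis unfolding derivs_iff using Delta_zero by simp
qed

lemma derivs_add:
  assumes "h \<in> derivs I f" "k \<in> derivs I g"
  shows "(\<lambda>\<phi>. h \<phi> + k \<phi>) \<in> derivs I (\<lambda>\<phi>. f \<phi> + g \<phi>)"
proof -
  have "(\<lambda>\<phi>. (h \<phi> - ddt I f \<phi>) + (k \<phi> - ddt I g \<phi>)) = (\<lambda>\<phi>. h \<phi> + k \<phi> - ddt I (\<lambda>\<phi>. f \<phi> + g \<phi>) \<phi>)"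
    by (auto simp: ddt_def)
  then show ?thesis using Delta_add[OF assms[unfolded derivs_iff]] unfolding derivs_iff by simp
qed

lemma derivs_diff:
  assumes "h \<in> derivs I f" "k \<in> derivs I g"
  shows "(\<lambda>\<phi>. h \<phi> - k \<phi>) \<in> derivs I (\<lambda>\<phi>. f \<phi> - g \<phi>)"
proof -
  have "(\<lambda>\<phi>. (h \<phi> - ddt I f \<phi>) + - 1 * (k \<phi> - ddt I g \<phi>)) = (\<lambda>\<phi>. h \<phi> - k \<phi> - ddt I (\<lambda>\<phi>. f \<phi> - g \<phi>) \<phi>)"
    by (auto simp: ddt_def)
  then show ?thesis
    using Delta_add[OF assms(1)[unfolded derivs_iff] Delta_scale[OF assms(2)[unfolded derivs_iff], of "-1"]]
    unfolding derivs_iff by simp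
qed

lemma derivs_sum:
  "(\<And>i. i \<in> S \<Longrightarrow> h i \<in> derivs I (f i)) \<Longrightarrow> (\<lambda>\<phi>. \<Sum>i\<in>S. h i \<phi>) \<in> derivs I (\<lambda>\<phi>. \<Sum>i\<in>S. f i \<phi>)"
  by (induction S rule: infinite_finite_induct) (auto intro: derivs_zero derivs_add)

lemma derivs_distrib: "f \<in> distrib I \<Longrightarrow> h \<in> derivs I f \<Longrightarrow> h \<in> distrib I"
  unfolding derivs_def using distrib_plus distrib_ddt Delta_distrib by blast

end

section \<open>Antiderivatives\<close>

context open_interval
begin

lemma lreg_integrable:
  assumes "lreg w" "c \<in> I" "d \<in> I"
  shows "w integrable_on {c..d}"
proof -
  have sub: "{c..d} \<subseteq> I" using segment_subset assms(2,3) .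
  obtain M where M: "\<And>t b. c \<le> t \<Longrightarrow> t \<le> d \<Longrightarrow> norm (lm b w t) \<le> M"
    using lreg_bounded[OF assms] by metis
  have "AE s in lebesgue. s \<in> I \<longrightarrow> (\<forall>b. lm b w s = w s)"
    using AE_lm_eq[OF open_I] assms(1) by (auto simp: lreg_def)
  then have "AE s in lebesgue. s \<in> {c..d} \<longrightarrow> norm (w s) \<le> M"
  proof eventually_elim
    case (elim s)
    then show ?case using M[of s True] sub by fastforce
  qed
  moreover have "w \<in> borel_measurable (lebesgue_on {c..d})"
    using lreg_measurable[OF assms(1)] sub measurable_restrict_mono by blast
  ultimately have "set_integrable lebesgue {c..d} w"
    unfolding set_integrable_def
    by (intro integrableI_bounded_set[where A="{c..d}" and B=M])
      (auto simp: borel_measurable_restrict_space_iff emeasure_lborel_Icc_eq)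
  then show ?thesis by (rule set_lebesgue_integral_eq_integral(1))
qed

lemma integral_approx_AE:
  fixes w :: "real \<Rightarrow> complex"
  assumes "w integrable_on {s..t}" "s \<le> t" "e \<ge> 0"
    and "AE r in lebesgue. s < r \<longrightarrow> r < t \<longrightarrow> norm (w r - l) \<le> e"
  shows "norm (integral {s..t} w - of_real (t - s) * l) \<le> e * (t - s)"
proof -
  \<comment> \<open>\<open>v\<close> equals \<open>w\<close> almost everywhere on the segment and
    satisfies the bound at every point, as the integral estimate requires.\<close>
  define v where "v r = (if norm (w r - l) \<le> e then w r else l)" for r
  obtain N where N: "N \<in> null_sets lebesgue" "\<And>r. s < r \<Longrightarrow> r < t \<Longrightarrow> r \<notin> N \<Longrightarrow> norm (w r - l) \<le> e"
    using assms(4) unfolding eventually_ae_filter by force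
  have neg: "negligible (N \<union> {s, t})"
    using N(1) by (auto simp: negligible_iff_null_sets[symmetric] intro!: negligible_Un)
  have vi: "(v has_integral integral {s..t} w) {s..t}"
    by (rule has_integral_spike[OF neg _ integrable_integral[OF assms(1)]]) (use N(2) in \<open>auto simp: v_def\<close>)
  have "((\<lambda>r. v r - l) has_integral (integral {s..t} w - (t - s) *\<^sub>R l)) {s..t}"
    using has_integral_diff[OF vi has_integral_const_real[of l s t]] assms(2) by simp
  then have "norm (integral {s..t} w - (t - s) *\<^sub>R l) \<le> e * (t - s)"
    using assms(2,3) has_integral_bound_real[where f="\<lambda>r. v r - l" and B=e and a=s and b=t and S="{}"]
    by (auto simp: v_def)
  then show ?thesis by (simp add: scaleR_conv_of_real)
qed

definition antideriv :: "real \<Rightarrow> (real \<Rightarrow> complex) \<Rightarrow> real \<Rightarrow> complex" where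
  "antideriv u w t = (if u \<le> t then integral {u..t} w else - integral {t..u} w)"

lemma antideriv_diff:
  assumes "lreg w" "u \<in> I" "s \<in> I" "t \<in> I" "s \<le> t"
  shows "antideriv u w t - antideriv u w s = integral {s..t} w"
proof -
  note i = lreg_integrable[OF assms(1)]
  consider "u \<le> s" | "s < u" "u \<le> t" | "t < u" by linarith
  then show ?thesis
  proof cases
    case 1
    then show ?thesis using Henstock_Kurzweil_Integration.integral_combine[of u s t w] i assms
      by (simp add: antideriv_def algebra_simps)
  next
    case 2
    then show ?thesis using Henstock_Kurzweil_Integration.integral_combine[of s u t w] i assms
      by (simp add: antideriv_def algebra_simps)
  next
    case 3
    then show ?thesis using Henstock_Kurzweil_Integration.integral_combine[of s t u w] i assms
      by (simp add: antideriv_def algebra_simps)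
  qed
qed

lemma antideriv_approx:
  assumes "lreg w" "u \<in> I" "s \<in> I" "t \<in> I" "e \<ge> 0"
    and "AE r in lebesgue. min s t < r \<longrightarrow> r < max s t \<longrightarrow> norm (w r - l) \<le> e"
  shows "norm (antideriv u w s - antideriv u w t - of_real (s - t) * l) \<le> e * \<bar>s - t\<bar>"
proof (cases "s \<le> t")
  case True
  have "norm (integral {s..t} w - of_real (t - s) * l) \<le> e * (t - s)"
    using True assms by (intro integral_approx_AE lreg_integrable) auto
  moreover have "antideriv u w s - antideriv u w t - of_real (s - t) * l = - (integral {s..t} w - of_real (t - s) * l)"
    using antideriv_diff[OF assms(1-4) True] by (simp add: algebra_simps)
  ultimately show ?thesis using True by (simp only: norm_minus_cancel) simp
next
  case False
  have "norm (integral {t..s} w - of_real (s - t) * l) \<le> e * (s - t)"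
    using False assms by (intro integral_approx_AE lreg_integrable) (auto simp: min_def max_def)
  then show ?thesis
    using antideriv_diff[OF assms(1,2,4,3)] False by simp
qed

lemma AE_lreg_norm_le:
  assumes "lreg w" "S \<subseteq> I" "\<And>t b. t \<in> S \<Longrightarrow> norm (lm b w t) \<le> M"
  shows "AE s in lebesgue. s \<in> S \<longrightarrow> norm (w s) \<le> M"
proof -
  have "AE s in lebesgue. s \<in> I \<longrightarrow> (\<forall>b. lm b w s = w s)"
    using AE_lm_eq[OF open_I] assms(1) by (auto simp: lreg_def)
  then show ?thesis by eventually_elim (metis assms(2,3) subsetD)
qed

lemma antideriv_lipschitz:
  assumes "lreg w" "u \<in> I" "s \<in> I" "t \<in> I" "M \<ge> 0"
    and "\<And>r b. min s t \<le> r \<Longrightarrow> r \<le> max s t \<Longrightarrow> norm (lm b w r) \<le> M"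
  shows "norm (antideriv u w s - antideriv u w t) \<le> M * \<bar>s - t\<bar>"
proof -
  have "{min s t..max s t} \<subseteq> I" using assms(3,4) by (intro segment_subset) (auto simp: min_def max_def)
  from AE_lreg_norm_le[OF assms(1) this, of M]
  have "AE r in lebesgue. r \<in> {min s t..max s t} \<longrightarrow> norm (w r) \<le> M"
    using assms(6) by simp
  then have "AE r in lebesgue. min s t < r \<longrightarrow> r < max s t \<longrightarrow> norm (w r - 0) \<le> M"
    by eventually_elim auto
  from antideriv_approx[OF assms(1-5) this] show ?thesis by simp
qed

lemma antideriv_continuous:
  assumes "lreg w" "u \<in> I"
  shows "continuous_on I (antideriv u w)"
proof (intro continuous_at_imp_continuous_on ballI)
  fix t assume t: "t \<in> I"
  obtain c d where cd: "c \<in> I" "d \<in> I" "c < t" "t < d"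
    by (rule compact_subset_segment[of "{t}"]) (use t in auto)
  obtain M where M: "M \<ge> 0" "\<And>r b. c \<le> r \<Longrightarrow> r \<le> d \<Longrightarrow> norm (lm b w r) \<le> M"
    using lreg_bounded[OF assms(1) cd(1,2)] by metis
  have "(M + 1)-lipschitz_on {c<..<d} (antideriv u w)"
  proof (rule lipschitz_onI)
    fix x y assume xy: "x \<in> {c<..<d}" "y \<in> {c<..<d}"
    then have "x \<in> I" "y \<in> I" using segment_subset[OF cd(1,2)] by auto
    then have "norm (antideriv u w x - antideriv u w y) \<le> M * \<bar>x - y\<bar>"
      using xy M by (intro antideriv_lipschitz assms) auto
    also have "\<dots> \<le> (M + 1) * \<bar>x - y\<bar>" by (simp add: distrib_right)
    finally show "dist (antideriv u w x) (antideriv u w y) \<le> (M + 1) * dist x y"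
      by (simp add: dist_norm)
  qed (use M in auto)
  then have "continuous_on {c<..<d} (antideriv u w)" by (rule lipschitz_on_continuous_on)
  then show "isCont (antideriv u w) t" using cd by (simp add: continuous_on_eq_continuous_at)
qed

lemma lreg_antideriv: "lreg w \<Longrightarrow> u \<in> I \<Longrightarrow> lreg (antideriv u w)"
  and lm_antideriv: "lreg w \<Longrightarrow> u \<in> I \<Longrightarrow> t \<in> I \<Longrightarrow> lm b (antideriv u w) t = antideriv u w t"
  using lreg_continuous antideriv_continuous by blast+

text \<open>One-sided fundamental theorem: close to \<open>t\<close> on side \<open>b\<close> the
  integrand is within \<open>e / 2\<close> of \<open>lm b w t\<close> almost everywhere, so a jump
  of \<open>w\<close> at \<open>t\<close> only means different one-sided derivatives.\<close>

lemma lder_antideriv: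
  assumes "lreg w" "u \<in> I"
  shows "lder (antideriv u w) w"
proof (rule lderI[OF assms(1)])
  fix t b assume t: "t \<in> I"
  show "((\<lambda>s. (antideriv u w s - lm b (antideriv u w) t) / of_real (s - t)) \<longlongrightarrow> lm b w t) (es b t)"
    unfolding lm_antideriv[OF assms t]
  proof (rule tendstoI)
    fix e :: real assume e: "e > 0"
    have "\<forall>\<^sub>F s in es b t. dist (w s) (lm b w t) < e / 2"
      using e by (intro tendstoD[OF lreg_tendsto[OF assms(1) t]]) simp
    then obtain d where d: "d > 0" "AE s in lebesgue. s \<in> side b t d \<longrightarrow> dist (w s) (lm b w t) < e / 2"
      unfolding eventually_es by blast
    have "\<forall>\<^sub>F s in es b t. s \<in> side b t d \<and> s \<in> I"
      using eventually_es_side[OF d(1)] eventually_es_open[OF open_I t] by (auto intro: eventually_conj)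
    then show "\<forall>\<^sub>F s in es b t. dist ((antideriv u w s - antideriv u w t) / of_real (s - t)) (lm b w t) < e"
    proof eventually_elim
      case (elim s)
      have st: "s \<noteq> t" using elim by (auto simp: side_def split: if_splits)
      have "AE r in lebesgue. min s t < r \<longrightarrow> r < max s t \<longrightarrow> norm (w r - lm b w t) \<le> e / 2"
        using d(2)
      proof eventually_elim
        case (elim r)
        then show ?case using \<open>s \<in> side b t d \<and> s \<in> I\<close>
          by (auto simp: side_def dist_norm min_def max_def split: if_splits)
      qed
      then have a: "norm (antideriv u w s - antideriv u w t - of_real (s - t) * lm b w t) \<le> e / 2 * \<bar>s - t\<bar>"
        using elim e by (intro antideriv_approx assms t) auto
      have "(antideriv u w s - antideriv u w t) / of_real (s - t) - lm b w t =
          (antideriv u w s - antideriv u w t - of_real (s - t) * lm b w t) / of_real (s - t)"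
        using st by (simp add: divide_simps)
      then have "dist ((antideriv u w s - antideriv u w t) / of_real (s - t)) (lm b w t) =
          norm (antideriv u w s - antideriv u w t - of_real (s - t) * lm b w t) / \<bar>s - t\<bar>"
        by (simp only: dist_norm norm_divide norm_of_real)
      also have "\<dots> \<le> e / 2" using a st by (simp add: divide_simps)
      finally show ?case using e by simp
    qed
  qed
qed

text \<open>For a test function \<open>w\<close> this is the antiderivative that vanishes near the right end of \<open>I\<close>.\<close>

definition tail :: "(real \<Rightarrow> complex) \<Rightarrow> real \<Rightarrow> complex" where
  "tail w t = - integral (I \<inter> {t..}) w"

text \<open>Since \<open>w\<close> vanishes almost everywhere outside \<open>{c..d}\<close>, the
  integral over the rest of \<open>I\<close> reduces to one that ends at \<open>d\<close>. The
  definition of \<open>tail\<close> does not mention \<open>d\<close>, which keeps it additive for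
  functions with different supports.\<close>

lemma tail_eq:
  assumes "lreg w" "van c d w" "c \<in> I" "d \<in> I" "t \<in> I" "c \<le> d"
  shows "tail w t = antideriv d w t" and "d \<le> t \<Longrightarrow> tail w t = 0"
proof -
  obtain N where N: "N \<in> null_sets lebesgue" "\<And>s. s \<in> I - {c..d} \<Longrightarrow> s \<notin> N \<Longrightarrow> w s = 0"
    using van_AE[OF assms(1,2)] unfolding eventually_ae_filter by force
  have neg: "negligible N" using N(1) by (simp add: negligible_iff_null_sets)
  \<comment> \<open>\<open>van\<close> says nothing at \<open>d\<close> itself; that single point is
    put into the null set.\<close>
  have z: "integral S w = 0" if "S \<subseteq> I - {c..d} \<union> {d}" for S
  proof -
    have "integral S w = integral S (\<lambda>_. 0)"
      by (rule integral_spike[OF negligible_Un[OF neg negligible_sing[of d]]]) (use N(2) that in auto)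
    then show ?thesis by simp
  qed
  show *: "tail w t = 0" if "d \<le> t"
  proof -
    have "I \<inter> {t..} \<subseteq> I - {c..d} \<union> {d}" using that by auto
    then show ?thesis using z unfolding tail_def by simp
  qed
  show "tail w t = antideriv d w t"
  proof (cases "d \<le> t")
    case True
    have "{d..t} \<subseteq> I - {c..d} \<union> {d}" using segment_subset[OF assms(4,5)] by auto
    then have "integral {d..t} w = 0" by (rule z)
    then show ?thesis using * True by (simp add: antideriv_def)
  next
    case False
    have "integral (I \<inter> {t..}) w = integral {t..d} w"
    proof -
      have "integral (I \<inter> {t..}) w = integral (I \<inter> {t..}) (\<lambda>s. if s \<in> {t..d} then w s else 0)"
        by (rule integral_spike[OF negligible_Un[OF neg negligible_sing[of d]]]) (use N(2) in auto)
      also have "\<dots> = integral ({t..d} \<inter> (I \<inter> {t..})) w" by (rule integral_restrict_Int)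
      also have "{t..d} \<inter> (I \<inter> {t..}) = {t..d}" using segment_subset[OF assms(5,4)] by auto
      finally show ?thesis .
    qed
    then show ?thesis using False by (simp add: tail_def antideriv_def)
  qed
qed

lemma tail_props:
  assumes "w \<in> test_fun I"
  shows "continuous_on I (tail w)" "lreg (tail w)" "t \<in> I \<Longrightarrow> lm b (tail w) t = tail w t" "lder (tail w) w"
proof -
  obtain c d where cd: "c \<in> I" "d \<in> I" "c < d" "tst c d w" using test_fun_tst[OF assms] by metis
  note w = tst_lreg[OF cd(4)]
  have e: "tail w t = antideriv d w t" if "t \<in> I" for t
    using tail_eq(1)[OF w tst_van[OF cd(4)] cd(1,2) that] cd(3) by simp
  show c: "continuous_on I (tail w)"
    using antideriv_continuous[OF w cd(2)] e by (simp cong: continuous_on_cong)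
  show "lreg (tail w)" "t \<in> I \<Longrightarrow> lm b (tail w) t = tail w t" using lreg_continuous[OF c] by auto
  show "lder (tail w) w"
  proof (rule lder_cong[OF lder_antideriv[OF w cd(2)]])
    fix t b assume "t \<in> I"
    then show "\<forall>\<^sub>F s in es b t. antideriv d w s = tail w s"
      by (intro eventually_mono[OF eventually_es_open[OF open_I]]) (auto simp: e)
  qed
qed

lemma tail_add:
  assumes "v \<in> test_fun I" "w \<in> test_fun I" "t \<in> I"
  shows "tail (\<lambda>s. v s + w s) t = tail v t + tail w t"
    and "tail (\<lambda>s. k * v s) t = k * tail v t"
proof -
  obtain c1 d1 where 1: "c1 \<in> I" "d1 \<in> I" "tst c1 d1 v" using test_fun_tst[OF assms(1)] by metis
  obtain c2 d2 where 2: "c2 \<in> I" "d2 \<in> I" "c2 < d2" "tst c2 d2 w" using test_fun_tst[OF assms(2)] by metis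
  define c d where "c = min c1 c2" and "d = max d1 d2"
  have cd: "c \<in> I" "d \<in> I" "c \<le> d" using 1 2 by (auto simp: c_def d_def min_def max_def)
  have t: "tst c d v" "tst c d w" using 1 2 by (auto simp: c_def d_def intro: tst_mono)
  note e = tail_eq(1)[OF tst_lreg tst_van cd(1,2) assms(3) cd(3)]
  note i = lreg_integrable[OF tst_lreg, OF t(1)] lreg_integrable[OF tst_lreg, OF t(2)]
  show "tail (\<lambda>s. v s + w s) t = tail v t + tail w t"
    using e[OF t(1) t(1)] e[OF t(2) t(2)] e[OF tst_add[OF t] tst_add[OF t]] i cd assms(3)
    by (simp add: antideriv_def Henstock_Kurzweil_Integration.integral_add)
  show "tail (\<lambda>s. k * v s) t = k * tail v t"
    using e[OF t(1) t(1)] e[OF tst_cmult[OF t(1)] tst_cmult[OF t(1)], of k]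
    by (simp add: antideriv_def)
qed

definition tail_from :: "real \<Rightarrow> (real \<Rightarrow> complex) \<Rightarrow> real \<Rightarrow> complex" where
  "tail_from u w s = heav u s * tail w s"

text \<open>\<open>heav u\<close> has derivative 0 even at \<open>u\<close>, so the cut leaves no
  boundary term in the derivative; its only trace is a possible jump at \<open>u\<close>.\<close>

lemma lder_tail_from:
  assumes "w \<in> test_fun I"
  shows "lder (tail_from u w) (\<lambda>s. heav u s * w s)"
  using lder_mult[OF lder_heav tail_props(4)[OF assms] lreg_heav tail_props(2)[OF assms]]
  by (simp add: tail_from_def[abs_def])

lemma lreg_tail_from: "w \<in> test_fun I \<Longrightarrow> lreg (tail_from u w)"
  unfolding tail_from_def[abs_def] by (intro lreg_mult lreg_heav tail_props(2))

lemma lm_tail_from: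
  "w \<in> test_fun I \<Longrightarrow> t \<in> I \<Longrightarrow> lm b (tail_from u w) t = lm b (heav u) t * tail w t"
  unfolding tail_from_def[abs_def] by (simp add: lm_mult lreg_heav tail_props)

lemma tst_tail_from:
  assumes "u \<in> I" "c \<in> I" "d \<in> I" "c \<le> d" "tst c d w"
  shows "tst u (max u d) (tail_from u w)"
proof -
  have w: "w \<in> test_fun I" using tst_test_fun_on(2) assms by blast
  have "lsm (tail_from u w)"
    by (rule lsmI[OF lreg_tail_from[OF w] lder_tail_from[OF w]])
      (intro lsm_mult lsm_heav tst_lsm[OF assms(5)])
  moreover have "lm b (tail_from u w) t = 0" if "t \<in> I" "t \<notin> {u..max u d}" for t b
    using that tail_eq(2)[OF tst_lreg tst_van assms(2,3) that(1) assms(4), OF assms(5,5)]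
    by (auto simp: lm_tail_from[OF w] lm_heav)
  ultimately show ?thesis by (simp add: tst_def van_def)
qed

lemma tail_from_test_fun: "u \<in> I \<Longrightarrow> w \<in> test_fun I \<Longrightarrow> tail_from u w \<in> test_fun I"
proof -
  assume u: "u \<in> I" and w: "w \<in> test_fun I"
  obtain c d where cd: "c \<in> I" "d \<in> I" "c < d" "tst c d w" using test_fun_tst[OF w] by metis
  then have "tst u (max u d) (tail_from u w)" using u by (intro tst_tail_from) auto
  then show ?thesis using u cd(2) by (intro tst_test_fun_on(2)) (auto simp: max_def)
qed

text \<open>No order of differentiation is lost: the function itself is bounded by a length times
  \<open>M\<close>, and its derivative is \<open>heav u\<close> times \<open>\<phi>\<close>, which
  \<open>dbound_mult\<close> covers.\<close>

lemma dbound_tail_from: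
  assumes "u \<in> I" "c \<in> I" "d \<in> I" "c < d"
  shows "\<exists>C. \<forall>\<phi> M. tst c d \<phi> \<longrightarrow> dbound k M \<phi> \<longrightarrow> dbound k (C * M) (tail_from u \<phi>)"
proof -
  \<comment> \<open>Length of the segment outside which \<open>tail_from u \<phi>\<close>
    vanishes.\<close>
  define L where "L = max u d - u"
  have L: "L \<ge> 0" by (simp add: L_def)
  have b: "norm (lm b (tail_from u \<phi>) t) \<le> L * M"
    if \<phi>: "tst c d \<phi>" "dbound k M \<phi>" and t: "t \<in> I" for \<phi> M t b k
  proof -
    have w: "\<phi> \<in> test_fun I" using tst_test_fun_on(2) assms \<phi> by blast
    have M: "M \<ge> 0" using dbound_nonneg[OF \<phi>(2)] .
    show ?thesis
    proof (cases "u \<le> t \<and> t \<le> max u d \<and> t < d")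
      case True
      have "tail \<phi> d = 0" "tail \<phi> t = antideriv d \<phi> t"
        using tail_eq[OF tst_lreg tst_van assms(2,3), OF \<phi>(1,1)] t assms(3,4) by auto
      moreover have "antideriv d \<phi> d = 0" by (simp add: antideriv_def)
      moreover have "norm (lm b \<phi> r) \<le> M" if "min t d \<le> r" "r \<le> max t d" for r b
        using dbound_le[OF \<phi>(2)] that segment_subset[OF t assms(3)] True by (auto simp: min_def max_def)
      ultimately have "norm (tail \<phi> t) \<le> M * \<bar>t - d\<bar>"
        using antideriv_lipschitz[OF tst_lreg[OF \<phi>(1)] assms(3) t assms(3) M] by simp
      also have "\<dots> \<le> M * L" using True M by (intro mult_left_mono) (auto simp: L_def)
      finally show ?thesis using w t L M by (auto simp: lm_tail_from lm_heav mult.commute)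
    next
      case False
      then have "lm b (heav u) t = 0 \<or> tail \<phi> t = 0"
        using tail_eq(2)[OF tst_lreg tst_van assms(2,3) t, OF \<phi>(1,1)] assms(4) by (auto simp: lm_heav)
      then show ?thesis using w t L M by (auto simp: lm_tail_from)
    qed
  qed
  show ?thesis
  proof (cases k)
    case 0
    have "dbound 0 (L * M) (tail_from u \<phi>)" if "tst c d \<phi>" "dbound 0 M \<phi>" for \<phi> M
      using b[OF that] lreg_tail_from tst_test_fun_on(2)[OF assms(2,3) that(1)] by simp
    then show ?thesis using 0 by blast
  next
    case (Suc j)
    obtain C where C: "C \<ge> 0" "\<And>\<phi> M. tst c d \<phi> \<Longrightarrow> dbound j M \<phi> \<Longrightarrow> dbound j (C * M) (\<lambda>s. heav u s * \<phi> s)"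
      using dbound_mult[OF lsm_heav assms(2,3)] by metis
    have "dbound (Suc j) ((L + C) * M) (tail_from u \<phi>)" if \<phi>: "tst c d \<phi>" "dbound (Suc j) M \<phi>" for \<phi> M
    proof -
      have M: "M \<ge> 0" using dbound_nonneg[OF \<phi>(2)] .
      have w: "\<phi> \<in> test_fun I" using tst_test_fun_on(2) assms \<phi> by blast
      have "dbound j ((L + C) * M) (\<lambda>s. heav u s * \<phi> s)"
        using C(2)[OF \<phi>(1) dbound_Suc[OF \<phi>(2)]] by (rule dbound_mono) (use L M in \<open>auto intro: mult_right_mono\<close>)
      moreover have "norm (lm b (tail_from u \<phi>) t) \<le> (L + C) * M" if "t \<in> I" for t b
      proof -
        have "norm (lm b (tail_from u \<phi>) t) \<le> L * M" by (rule b[OF \<phi> that])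
        also have "\<dots> \<le> (L + C) * M" using C(1) M by (intro mult_right_mono) auto
        finally show ?thesis .
      qed
      ultimately show ?thesis using lreg_tail_from[OF w] lder_tail_from[OF w, of u] unfolding dbound.simps by blast
    qed
    then show ?thesis using Suc by blast
  qed
qed

lemma distrib_tail_from:
  assumes "f \<in> distrib I" "u \<in> I"
  shows "(\<lambda>\<phi>. if \<phi> \<in> test_fun I then f (tail_from u \<phi>) else 0) \<in> distrib I"
proof (rule distrib_comp[OF assms(1) tail_from_test_fun[OF assms(2)]])
  fix \<phi> \<psi> t b assume a: "\<phi> \<in> test_fun I" "\<psi> \<in> test_fun I" "t \<in> I"
  then show "lm b (tail_from u (\<lambda>s. \<phi> s + \<psi> s)) t = lm b (tail_from u \<phi>) t + lm b (tail_from u \<psi>) t"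
    by (simp add: lm_tail_from test_fun_add tail_add distrib_left)
next
  fix \<phi> t b and c :: complex assume a: "\<phi> \<in> test_fun I" "t \<in> I"
  then show "lm b (tail_from u (\<lambda>s. c * \<phi> s)) t = c * lm b (tail_from u \<phi>) t"
    by (simp add: lm_tail_from test_fun_cmult tail_add(2)[OF a(1,1)])
next
  fix c d assume cd: "c \<in> I" "d \<in> I" "c < d"
  have "max u d \<in> I" using assms(2) cd by (simp add: max_def)
  moreover have "\<forall>\<phi>. tst c d \<phi> \<longrightarrow> tst u (max u d) (tail_from u \<phi>)"
    using tst_tail_from[OF assms(2) cd(1,2)] cd(3) by simp
  moreover have "\<forall>k. \<exists>k' C. \<forall>\<phi> M. tst c d \<phi> \<longrightarrow> dbound k' M \<phi> \<longrightarrow> dbound k (C * M) (tail_from u \<phi>)"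
    using dbound_tail_from[OF assms(2) cd] by blast
  ultimately show "\<exists>c'\<in>I. \<exists>d'\<in>I. (\<forall>\<phi>. tst c d \<phi> \<longrightarrow> tst c' d' (tail_from u \<phi>)) \<and>
      (\<forall>k. \<exists>k' C. \<forall>\<phi> M. tst c d \<phi> \<longrightarrow> dbound k' M \<phi> \<longrightarrow> dbound k (C * M) (tail_from u \<phi>))"
    using assms(2) by blast
qed

end

section \<open>Smooth cutoff functions and truncated powers\<close>

definition exp_inv :: "real poly \<Rightarrow> real \<Rightarrow> real" where
  "exp_inv p x = (if x > 0 then poly p (1 / x) * exp (- (1 / x)) else 0)"

lemma poly_times_exp_neg_tendsto_0: "((\<lambda>y. poly p y * exp (- y)) \<longlongrightarrow> 0) (at_top :: real filter)"
proof -
  have "((\<lambda>y. \<Sum>i\<le>degree p. coeff p i * (y ^ i / exp y)) \<longlongrightarrow> (\<Sum>i\<le>degree p. coeff p i * 0)) (at_top :: real filter)"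
    by (intro tendsto_sum tendsto_mult tendsto_const tendsto_power_div_exp_0)
  then show ?thesis
    by (simp add: poly_altdef exp_minus divide_inverse sum_distrib_right mult.assoc)
qed

text \<open>For \<open>x > 0\<close> the chain rule gives the factor \<open>1 / x^2\<close>, which
  is the polynomial \<open>[:0, 0, 1:]\<close> evaluated at \<open>1 / x\<close>. At 0 the
  right-hand quotient is \<open>y * poly p y * exp (- y)\<close> with \<open>y = 1 / x\<close>
  tending to infinity.\<close>

lemma exp_inv_has_derivative:
  "(exp_inv p has_real_derivative exp_inv ([:0, 0, 1:] * (p - pderiv p)) x) (at x)"
proof -
  consider "x > 0" | "x < 0" | "x = 0" by linarith
  then show ?thesis
  proof cases
    case 1
    have "((\<lambda>x. poly p (1 / x) * exp (- (1 / x))) has_real_derivative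
        exp_inv ([:0, 0, 1:] * (p - pderiv p)) x) (at x)"
      using 1 by (auto intro!: derivative_eq_intros simp: exp_inv_def field_simps power2_eq_square)
    then show ?thesis
    proof (rule DERIV_cong_ev[THEN iffD1, rotated 3, OF _ refl _ refl])
      show "\<forall>\<^sub>F x in nhds x. poly p (1 / x) * exp (- (1 / x)) = exp_inv p x"
        using eventually_nhds_in_open[of "{0<..}" x] 1 by (auto elim!: eventually_mono simp: exp_inv_def)
    qed
  next
    case 2
    have "((\<lambda>x. 0) has_real_derivative exp_inv ([:0, 0, 1:] * (p - pderiv p)) x) (at x)"
      using 2 by (simp add: exp_inv_def)
    then show ?thesis
    proof (rule DERIV_cong_ev[THEN iffD1, rotated 3, OF _ refl _ refl])
      show "\<forall>\<^sub>F x in nhds x. 0 = exp_inv p x"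
        using eventually_nhds_in_open[of "{..<0}" x] 2 by (auto elim!: eventually_mono simp: exp_inv_def)
    qed
  next
    case 3
    have "((\<lambda>h. exp_inv p h / h) \<longlongrightarrow> 0) (at_left 0)"
    proof (rule tendsto_eventually)
      show "\<forall>\<^sub>F h in at_left 0. exp_inv p h / h = 0"
        unfolding eventually_at_left_field by (intro exI[of _ "-1"]) (auto simp: exp_inv_def)
    qed
    moreover have "((\<lambda>h. exp_inv p h / h) \<longlongrightarrow> 0) (at_right 0)"
    proof (rule Lim_transform_eventually)
      show "((\<lambda>h. poly ([:0, 1:] * p) (inverse h) * exp (- inverse h)) \<longlongrightarrow> 0) (at_right 0)"
        by (rule filterlim_compose[OF poly_times_exp_neg_tendsto_0 filterlim_inverse_at_top_right])
      show "\<forall>\<^sub>F h in at_right 0. poly ([:0, 1:] * p) (inverse h) * exp (- inverse h) = exp_inv p h / h"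
        unfolding eventually_at_right_field by (intro exI[of _ 1]) (auto simp: exp_inv_def field_simps)
    qed
    ultimately have "((\<lambda>h. exp_inv p h / h) \<longlongrightarrow> 0) (at 0)"
      by (rule filterlim_split_at)
    then show ?thesis using 3 by (simp add: DERIV_def exp_inv_def[of p 0] exp_inv_def[of _ 0])
  qed
qed

lemma exp_inv_pos: "x > 0 \<Longrightarrow> exp_inv 1 x > 0"
  and exp_inv_zero: "x \<le> 0 \<Longrightarrow> exp_inv p x = 0"
  by (simp_all add: exp_inv_def)

lemma isCont_exp_inv: "isCont (\<lambda>s. exp_inv p (k * s + c)) t"
proof -
  have "isCont (\<lambda>s. k * s + c) t" by (intro continuous_intros)
  from isCont_o2[OF this DERIV_isCont[OF exp_inv_has_derivative]] show ?thesis .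
qed

lemma exp_inv_nonneg: "exp_inv 1 x \<ge> 0"
  by (simp add: exp_inv_def)

context open_interval
begin

lemma sm_of_continuous_derivative:
  assumes "\<And>g. g \<in> S \<Longrightarrow> \<exists>h\<in>alg S. continuous_on I h \<and> (\<forall>t\<in>I. (g has_vector_derivative h t) (at t))"
    and "g \<in> S"
  shows "sm {} g"
proof (rule sm_alg[of S _ g, OF _ alg_base[OF assms(2)]])
  fix g assume "g \<in> S"
  then obtain h where h: "h \<in> alg S" "continuous_on I h" "\<And>t. t \<in> I \<Longrightarrow> (g has_vector_derivative h t) (at t)"
    using assms(1) by blast
  then have c: "continuous_on I g"
    by (intro continuous_at_imp_continuous_on ballI has_vector_derivative_continuous)
  show "lreg g \<and> (\<forall>t\<in>I - {}. lm True g t = lm False g t) \<and> (\<exists>h\<in>alg S. lder g h)"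
    using lreg_continuous[OF c] lder_has_vector_derivative[OF h(2,3)] h(1) by auto
qed

text \<open>The functions for all \<open>p\<close> together generate an algebra that contains their
  derivatives, so smoothness of every one of them follows at once.\<close>

lemma sm_exp_inv: "sm {} (\<lambda>s. of_real (exp_inv p (k * s + c)))"
proof -
  let ?S = "range (\<lambda>p s. complex_of_real (exp_inv p (k * s + c)))"
  have d: "((\<lambda>s. complex_of_real (exp_inv p (k * s + c))) has_vector_derivative
      of_real k * of_real (exp_inv ([:0, 0, 1:] * (p - pderiv p)) (k * t + c))) (at t)" for p t
  proof -
    have "((\<lambda>s. exp_inv p (k * s + c)) has_real_derivative
        exp_inv ([:0, 0, 1:] * (p - pderiv p)) (k * t + c) * k) (at t)"
      by (rule DERIV_chain2[OF exp_inv_has_derivative]) (auto intro!: derivative_eq_intros)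
    from has_vector_derivative_of_real[OF this] show ?thesis by (simp add: mult.commute)
  qed
  show ?thesis
  proof (rule sm_of_continuous_derivative[of ?S])
    fix g assume "g \<in> ?S"
    then obtain p where g: "g = (\<lambda>s. complex_of_real (exp_inv p (k * s + c)))" by blast
    let ?h = "\<lambda>t. complex_of_real k * of_real (exp_inv ([:0, 0, 1:] * (p - pderiv p)) (k * t + c))"
    have "?h \<in> alg ?S" by (intro alg_mult alg_const alg_base rangeI)
    moreover have "continuous_on I ?h"
      by (intro continuous_intros continuous_at_imp_continuous_on ballI isCont_exp_inv)
    ultimately show "\<exists>h\<in>alg ?S. continuous_on I h \<and> (\<forall>t\<in>I. (g has_vector_derivative h t) (at t))"
      using d g by blast
  qed blast
qed

lemma sm_of_real: "sm {} of_real"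
proof (rule sm_of_continuous_derivative[of "{of_real}"])
  fix g :: "real \<Rightarrow> complex" assume "g \<in> {of_real}"
  moreover have "(of_real has_vector_derivative (1::complex)) (at t)" for t :: real
    using has_vector_derivative_of_real[OF DERIV_ident] by simp
  ultimately show "\<exists>h\<in>alg {of_real}. continuous_on I h \<and> (\<forall>t\<in>I. (g has_vector_derivative h t) (at t))"
    by (intro bexI[of _ "\<lambda>_. 1"]) (auto intro: alg_const)
qed simp

lemma lder_of_real: "lder of_real (\<lambda>_. 1)"
proof (rule lder_has_vector_derivative)
  show "(of_real has_vector_derivative (1::complex)) (at t)" for t :: real
    using has_vector_derivative_of_real[OF DERIV_ident] by simp
qed simp

text \<open>The step is \<open>exp_inv 1 (s - p)\<close> divided by \<open>W s\<close>, a sum of two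
  nonnegative functions without common zero. The reciprocal \<open>u\<close> of \<open>W\<close>
  satisfies \<open>u' = - w' * u * u\<close>, so adjoining it to the smooth functions gives an
  algebra closed under differentiation.\<close>

lemma smooth_step:
  assumes "p < q"
  obtains \<sigma> where "sm {} \<sigma>" "\<And>s. s \<le> p \<Longrightarrow> \<sigma> s = 0" "\<And>s. q \<le> s \<Longrightarrow> \<sigma> s = 1"
proof -
  define W where "W s = exp_inv 1 (s - p) + exp_inv 1 (q - s)" for s
  have W: "W s > 0" for s
    using assms exp_inv_pos[of "s - p"] exp_inv_pos[of "q - s"] exp_inv_nonneg[of "s - p"] exp_inv_nonneg[of "q - s"]
    by (cases "s > p") (auto simp: W_def intro: add_pos_nonneg add_nonneg_pos)
  define d where "d = ([:0, 0, 1:] * (1 - pderiv 1) :: real poly)"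
  have dW: "(W has_real_derivative (exp_inv d (s - p) - exp_inv d (q - s))) (at s)" for s
  proof -
    have "((\<lambda>s. exp_inv 1 (s - p)) has_real_derivative exp_inv d (s - p) * 1) (at s)"
      unfolding d_def by (rule DERIV_chain2[OF exp_inv_has_derivative]) (auto intro!: derivative_eq_intros)
    moreover have "((\<lambda>s. exp_inv 1 (q - s)) has_real_derivative exp_inv d (q - s) * (- 1)) (at s)"
      unfolding d_def by (rule DERIV_chain2[OF exp_inv_has_derivative]) (auto intro!: derivative_eq_intros)
    ultimately show ?thesis unfolding W_def[abs_def] using DERIV_add by fastforce
  qed
  define u where "u s = complex_of_real (inverse (W s))" for s
  \<comment> \<open>The derivative of \<open>W\<close>, written with affine arguments of the shape
    that \<open>sm_exp_inv\<close> treats.\<close>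
  define w' where "w' s = complex_of_real (exp_inv d (1 * s + - p)) - complex_of_real (exp_inv d (- 1 * s + q))" for s
  have w': "sm {} w'" unfolding w'_def[abs_def] by (intro sm_diff sm_exp_inv)
  have du: "(u has_vector_derivative - (w' s * (u s * u s))) (at s)" for s
  proof -
    have "((\<lambda>s. inverse (W s)) has_real_derivative - (inverse (W s) * (exp_inv d (s - p) - exp_inv d (q - s)) * inverse (W s))) (at s)"
      using DERIV_inverse'[OF dW] W[of s] by simp
    from has_vector_derivative_of_real[OF this] show ?thesis
      by (simp add: u_def[abs_def] w'_def algebra_simps del: of_real_inverse)
  qed
  have u: "sm {} u"
  proof (rule sm_alg[of "insert u (Collect (sm {}))"])
    fix g assume "g \<in> insert u (Collect (sm {}))"
    then show "lreg g \<and> (\<forall>t\<in>I - {}. lm True g t = lm False g t) \<and> (\<exists>h\<in>alg (insert u (Collect (sm {}))). lder g h)"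
    proof
      assume g: "g = u"
      have cu: "continuous_on I u"
        using du by (intro continuous_at_imp_continuous_on ballI) (rule has_vector_derivative_continuous)
      have lu: "lreg u" "\<And>t b. t \<in> I \<Longrightarrow> lm b u t = u t" using lreg_continuous[OF cu] by auto
      have "isCont (\<lambda>s. complex_of_real (exp_inv d (k * s + c))) t" for k c t
        by (intro continuous_intros isCont_exp_inv)
      then have "continuous_on I w'" unfolding w'_def[abs_def]
        by (intro continuous_on_diff continuous_at_imp_continuous_on ballI)
      then have "lder u (\<lambda>s. - (w' s * (u s * u s)))"
        by (intro lder_has_vector_derivative[OF _ du] continuous_intros cu)
      moreover have "(\<lambda>s. (- 1) * (w' s * (u s * u s))) \<in> alg (insert u (Collect (sm {})))"
        using w' by (intro alg_mult alg_const alg_base) auto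
      ultimately show ?thesis using g lu by auto
    next
      assume "g \<in> Collect (sm {})"
      then have "sm {} g" by simp
      then show ?thesis
        by (metis Diff_iff alg_base insertI2 mem_Collect_eq sm_jump_free sm_lder sm_lreg)
    qed
  qed (auto intro: alg_base)
  have "sm {} (\<lambda>s. complex_of_real (exp_inv 1 (1 * s + - p)) * u s)"
    by (intro sm_mult sm_exp_inv u)
  moreover have "complex_of_real (exp_inv 1 (1 * s + - p)) * u s = 0" if "s \<le> p" for s
    using that by (simp add: exp_inv_zero)
  moreover have "complex_of_real (exp_inv 1 (1 * s + - p)) * u s = 1" if "q \<le> s" for s
  proof -
    have "W s = exp_inv 1 (s - p)" using that by (simp add: W_def exp_inv_zero)
    then show ?thesis using W[of s] by (simp add: u_def flip: of_real_mult of_real_inverse)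
  qed
  ultimately show ?thesis using that by blast
qed

lemma smooth_cutoff:
  assumes "p < p'" "q' < q"
  obtains \<theta> where "sm {} \<theta>" "\<And>s. p' \<le> s \<Longrightarrow> s \<le> q' \<Longrightarrow> \<theta> s = 1" "\<And>s. s \<le> p \<or> q \<le> s \<Longrightarrow> \<theta> s = 0"
proof -
  obtain \<sigma> where \<sigma>: "sm {} \<sigma>" "\<And>s. s \<le> p \<Longrightarrow> \<sigma> s = 0" "\<And>s. p' \<le> s \<Longrightarrow> \<sigma> s = 1"
    using smooth_step[OF assms(1)] by metis
  obtain \<tau> where \<tau>: "sm {} \<tau>" "\<And>s. s \<le> q' \<Longrightarrow> \<tau> s = 0" "\<And>s. q \<le> s \<Longrightarrow> \<tau> s = 1"
    using smooth_step[OF assms(2)] by metis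
  have "sm {} (\<lambda>s. \<sigma> s * (1 - \<tau> s))" by (intro sm_mult sm_diff sm_const \<sigma> \<tau>)
  then show ?thesis using that[of "\<lambda>s. \<sigma> s * (1 - \<tau> s)"] \<sigma> \<tau> by auto
qed

section \<open>Truncated powers\<close>

lemma gderiv_funpow_test_fun: "\<phi> \<in> test_fun I \<Longrightarrow> (gderiv I ^^ i) \<phi> \<in> test_fun I"
  by (induction i) (auto intro: gderiv_test_fun)

text \<open>The iterated choices of \<open>gderiv\<close> have the limits of any explicit derivative
  sequence; this makes membership in \<open>F_level\<close> computable.\<close>

lemma lm_gderiv_funpow:
  assumes "\<phi> \<in> test_fun I" "D 0 = \<phi>" "\<And>i. lder (D i) (D (Suc i))" "t \<in> I"
  shows "lm b ((gderiv I ^^ i) \<phi>) t = lm b (D i) t"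
  using assms(4)
proof (induction i arbitrary: t b)
  case 0
  then show ?case using assms(2) by simp
next
  case (Suc i)
  let ?g = "(gderiv I ^^ i) \<phi>"
  have g: "?g \<in> test_fun I" by (rule gderiv_funpow_test_fun[OF assms(1)])
  have r: "lreg (D i)" using assms(1-3) lder_lreg test_fun_lreg by (cases i) auto
  have "lder ?g (D (Suc i))"
    by (rule lder_cong[OF assms(3)], rule lreg_lm_eq_imp_eventually[OF r test_fun_lreg[OF g]])
      (use Suc.IH in auto)
  then show ?case using gderiv_unique[OF g _ Suc.prems] by simp
qed

lemma ess_bdd_contI:
  assumes "lreg g" "\<And>t. t \<in> I \<Longrightarrow> lm True g t = lm False g t" "g \<in> reg_fun I"
  shows "g \<in> ess_bdd_cont I"
  unfolding ess_bdd_cont_def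
proof (intro CollectI exI[of _ "lm True g"] conjI)
  show "continuous_on I (lm True g)"
    by (intro continuous_at_imp_continuous_on ballI isCont_lm assms) auto
  obtain C where "\<forall>t\<in>I. \<forall>b. norm (lm b g t) \<le> C" using assms(3) by (auto simp: reg_fun_iff)
  then show "bounded (lm True g ` I)" unfolding bounded_iff by (intro exI[of _ C]) auto
  have "AE s in lebesgue. s \<in> I \<longrightarrow> (\<forall>b. lm b g s = g s)"
    using AE_lm_eq[OF open_I] assms(1) by (auto simp: lreg_def)
  then show "AE t in lebesgue_on I. g t = lm True g t"
    unfolding AE_I_iff by (auto elim!: eventually_mono)
qed

lemma ess_piecewise_contI:
  assumes "lreg g" "\<And>t. t \<in> I \<Longrightarrow> t \<noteq> \<tau> \<Longrightarrow> lm True g t = lm False g t"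
  shows "g \<in> ess_piecewise_cont I"
  unfolding ess_piecewise_cont_def
proof (intro CollectI exI[of _ "lm True g"] conjI allI impI)
  fix K assume "compact K \<and> K \<subseteq> I"
  then have "{t\<in>K. \<not> isCont (lm True g) t} \<subseteq> {\<tau>}" using isCont_lm[OF assms(1)] assms(2) by blast
  then show "finite {t\<in>K. \<not> isCont (lm True g) t}" by (rule finite_subset) simp
next
  have "AE s in lebesgue. s \<in> I \<longrightarrow> (\<forall>b. lm b g s = g s)"
    using AE_lm_eq[OF open_I] assms(1) by (auto simp: lreg_def)
  then show "AE t in lebesgue_on I. g t = lm True g t"
    unfolding AE_I_iff by (auto elim!: eventually_mono)
qed

text \<open>At \<open>\<tau>\<close> the derivatives of the \<open>j\<close>-th power of
  \<open>s - \<tau>\<close> vanish in every order but \<open>j\<close>, and elsewhere the step is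
  locally constant; so cutting at \<open>\<tau>\<close> creates a jump only in the
  \<open>j\<close>-th derivative. The cutoff \<open>\<theta>\<close> is 1 near \<open>\<tau>\<close>
  and does not interfere there.\<close>

lemma truncated_power_F_level:
  assumes \<theta>: "sm {} \<theta>" "\<And>s. p' \<le> s \<Longrightarrow> s \<le> q' \<Longrightarrow> \<theta> s = 1" "\<And>s. s \<le> p \<or> q \<le> s \<Longrightarrow> \<theta> s = 0"
    and "p \<in> I" "q \<in> I" "p' < \<tau>" "\<tau> < q'" "\<tau> \<in> I"
  shows "(\<lambda>s. heav \<tau> s * (\<theta> s * (of_real (s - \<tau>)) ^ j)) \<in> F_level I j"
    and "(\<lambda>s. heav \<tau> s * (\<theta> s * (of_real (s - \<tau>)) ^ j)) \<in> test_fun I"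
proof -
  \<comment> \<open>\<open>v i\<close> is the \<open>i\<close>-th derivative of the power: the
    quotient of factorials is the falling factorial with \<open>i\<close> factors, and orders above
    \<open>j\<close> give 0.\<close>
  define v where "v i s = (if i \<le> j then of_nat (fact j div fact (j - i)) * complex_of_real (s - \<tau>) ^ (j - i) else 0)" for i s
  have dv: "(v i has_vector_derivative v (Suc i) s) (at s)" for i s
  proof (cases "i < j")
    case True
    then obtain m where m: "j = Suc (i + m)" using less_imp_Suc_add by blast
    have f: "(fact j div fact (Suc m)) * Suc m = (fact j div fact m :: nat)"
    proof -
      have "fact (Suc m) dvd (fact j :: nat)" by (rule fact_dvd) (simp add: m)
      then obtain r where r: "(fact j :: nat) = fact (Suc m) * r" by (auto elim: dvdE)
      have "fact (Suc m) * r div fact (Suc m) = r" by (rule nonzero_mult_div_cancel_left) simp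
      moreover have "fact (Suc m) * r = fact m * (Suc m * r)" by (simp add: algebra_simps)
      then have "fact (Suc m) * r div fact m = Suc m * r"
        by (metis nonzero_mult_div_cancel_left fact_nonzero)
      ultimately show ?thesis unfolding r by simp
    qed
    have "((\<lambda>s. s - \<tau>) has_real_derivative 1) (at s)" by (auto intro!: derivative_eq_intros)
    from DERIV_power_Suc[OF this, of m]
    have dp: "((\<lambda>s. (s - \<tau>) ^ Suc m) has_real_derivative of_nat (Suc m) * (s - \<tau>) ^ m) (at s)" by simp
    have "((\<lambda>s. of_nat (fact j div fact (Suc m)) * complex_of_real ((s - \<tau>) ^ Suc m)) has_vector_derivative
        of_nat (fact j div fact (Suc m)) * complex_of_real (of_nat (Suc m) * (s - \<tau>) ^ m)) (at s)"
      by (intro has_vector_derivative_mult_right has_vector_derivative_of_real dp)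
    moreover have "of_nat (fact j div fact (Suc m)) * complex_of_real (of_nat (Suc m) * (s - \<tau>) ^ m) =
        of_nat (fact j div fact m) * complex_of_real (s - \<tau>) ^ m"
      unfolding f[symmetric] of_nat_mult by (simp add: mult.assoc)
    moreover have "j - i = Suc m" "j - Suc i = m" using m by auto
    then have "v i = (\<lambda>s. of_nat (fact j div fact (Suc m)) * complex_of_real ((s - \<tau>) ^ Suc m))"
      "v (Suc i) s = of_nat (fact j div fact m) * complex_of_real (s - \<tau>) ^ m"
      using True by (simp_all add: v_def fun_eq_iff del: fact_Suc)
    ultimately show ?thesis by (simp only:)
  next
    case False
    have "v i = (\<lambda>_. v i 0)" using False by (auto simp: v_def fun_eq_iff)
    moreover have "v (Suc i) s = 0" using False by (simp add: v_def)
    ultimately show ?thesis using has_vector_derivative_const by metis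
  qed
  have cv: "continuous_on I (v i)" for i
    using dv by (intro continuous_at_imp_continuous_on ballI) (rule has_vector_derivative_continuous)
  have ldv: "lder (v i) (v (Suc i))" for i using cv dv by (rule lder_has_vector_derivative)
  have v0: "v 0 s = of_real (s - \<tau>) ^ j" for s by (simp add: v_def)
  have sv: "sm {} (v 0)"
  proof (rule sm_of_continuous_derivative[of "range v"])
    fix g assume "g \<in> range v"
    then show "\<exists>h\<in>alg (range v). continuous_on I h \<and> (\<forall>t\<in>I. (g has_vector_derivative h t) (at t))"
      using cv dv by (blast intro: alg_base)
  qed blast
  define w where "w s = \<theta> s * v 0 s" for s
  have sw: "sm {} w" unfolding w_def[abs_def] by (intro sm_mult \<theta> sv)
  obtain D where D: "\<And>n. sm {} (D n) \<and> (n = 0 \<longrightarrow> D n = w)" "\<And>n. lder (D n) (D (Suc n))"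
    using dependent_nat_choice[of "\<lambda>n g. sm {} g \<and> (n = 0 \<longrightarrow> g = w)" "\<lambda>n. lder"] sw sm_lder
    by (metis nat.distinct(1))
  \<comment> \<open>Where \<open>\<theta>\<close> is 1, the derivatives \<open>D i\<close> of the
    product have the limits of those of the bare power; their values at \<open>\<tau>\<close> decide
    about the jumps.\<close>
  have near: "t \<in> {p'<..<q'} \<inter> I \<Longrightarrow> lm b (D i) t = lm b (v i) t" for i t b
  proof (induction i arbitrary: t b)
    case 0
    have "\<forall>\<^sub>F s in es b t. s \<in> {p'<..<q'} \<inter> I"
      using 0 open_I by (intro eventually_es_open) auto
    then have "\<forall>\<^sub>F s in es b t. D 0 s = v 0 s"
      using D(1)[of 0] \<theta>(2) by (auto elim!: eventually_mono simp: w_def)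
    then show ?case by (rule lm_cong)
  next
    case (Suc i)
    have o: "open ({p'<..<q'} \<inter> I)" using open_I by auto
    have r: "lreg (D i)" "lreg (v i)" using D(1) sm_lreg lreg_continuous[OF cv] by blast+
    have "AE s in lebesgue. s \<in> I \<longrightarrow> (\<forall>b. lm b (D i) s = D i s)" "AE s in lebesgue. s \<in> I \<longrightarrow> (\<forall>b. lm b (v i) s = v i s)"
      using AE_lm_eq[OF open_I] r by (auto simp: lreg_def)
    then have "AE s in lebesgue. s \<in> {p'<..<q'} \<inter> I \<longrightarrow> D i s = v i s"
      by eventually_elim (metis Suc.IH IntD2)
    then have e: "\<forall>\<^sub>F s in es b t. D i s = v i s" using AE_open_iff[OF o] Suc.prems by blast
    have "\<forall>\<^sub>F s in es b t. (D i s - lm b (D i) t) / of_real (s - t) = (v i s - lm b (v i) t) / of_real (s - t)"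
      using e lm_cong[OF e] by (auto elim!: eventually_mono)
    then have "((\<lambda>s. (v i s - lm b (v i) t) / of_real (s - t)) \<longlongrightarrow> lm b (D (Suc i)) t) (es b t)"
      by (subst tendsto_es_cong[symmetric], assumption) (use lder_tendsto[OF D(2)] Suc.prems in blast)
    moreover have "((\<lambda>s. (v i s - lm b (v i) t) / of_real (s - t)) \<longlongrightarrow> lm b (v (Suc i)) t) (es b t)"
      using lder_tendsto[OF ldv] Suc.prems by blast
    ultimately show ?case by (rule tendsto_unique[OF es_nontriv])
  qed
  define E where "E i s = heav \<tau> s * D i s" for i s
  have lE: "lder (E i) (E (Suc i))" "lreg (E i)" for i
    using lder_mult[OF lder_heav D(2) lreg_heav, of i \<tau>] D(1) sm_lreg
    by (auto simp: E_def[abs_def] intro!: lreg_mult lreg_heav)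
  have E0: "E 0 = (\<lambda>s. heav \<tau> s * (\<theta> s * (of_real (s - \<tau>)) ^ j))"
    using D(1)[of 0] by (simp add: E_def[abs_def] w_def v0)
  have "lsm (E 0)" unfolding E_def[abs_def] using D(1) sm_imp_lsm by (intro lsm_mult lsm_heav) blast
  moreover have "lm b (E 0) t = 0" if "t \<in> I" "t \<notin> {p..q}" for t b
  proof -
    have "\<forall>\<^sub>F s in es b t. s \<in> - {p..q}" using that by (intro eventually_es_open) auto
    then have "\<forall>\<^sub>F s in es b t. E 0 s = 0" using \<theta>(3) by (auto elim!: eventually_mono simp: E0)
    then show ?thesis by (intro lm_eq tendsto_eventually)
  qed
  ultimately have tE: "tst p q (E 0)" by (simp add: tst_def van_def)
  then have E_test: "E 0 \<in> test_fun I" using assms tst_test_fun_on(2) by blast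
  then show "(\<lambda>s. heav \<tau> s * (\<theta> s * (of_real (s - \<tau>)) ^ j)) \<in> test_fun I" by (simp add: E0)
  have lmE: "lm b (E i) t = lm b (heav \<tau>) t * lm b (D i) t" if "t \<in> I" for b i t
    unfolding E_def[abs_def] using D(1)[of i] sm_lreg that by (blast intro: lm_mult lreg_heav)
  \<comment> \<open>Away from \<open>\<tau>\<close> neither the smooth factor \<open>D i\<close> nor
    the step jumps; at \<open>\<tau>\<close> the factor \<open>D i\<close> vanishes unless
    \<open>i = j\<close>.\<close>
  have jump: "lm True (E i) t = lm False (E i) t" if "t \<in> I" "i \<noteq> j \<or> t \<noteq> \<tau>" for i t
  proof (cases "t = \<tau>")
    case True
    have "lm b (D i) \<tau> = 0" for b
      using near[of \<tau> b i] assms that True lreg_continuous(2)[OF cv, of \<tau> b i] by (auto simp: v_def)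
    then show ?thesis using True that by (simp add: lmE)
  next
    case False
    then show ?thesis using sm_jump_free[of "{}" "D i" t] that D(1) by (auto simp: lmE lm_heav)
  qed
  have g: "(gderiv I ^^ i) (E 0) \<in> test_fun I" for i by (rule gderiv_funpow_test_fun[OF E_test])
  have lmg: "lm b ((gderiv I ^^ i) (E 0)) t = lm b (E i) t" if "t \<in> I" for i b t
    using lm_gderiv_funpow[OF E_test refl lE(1) that] .
  have "E 0 \<in> F_level I j"
    unfolding F_level_def
  proof (intro CollectI conjI allI impI)
    show "E 0 \<in> smooth_reg_fun I" using E_test by (simp add: test_fun_def)
    show "(gderiv I ^^ i) (E 0) \<in> ess_bdd_cont I" if "i \<noteq> j" for i
      using g[of i] jump that
      by (intro ess_bdd_contI test_fun_lreg) (auto simp: lmg test_fun_def smooth_reg_fun_reg)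
    show "(gderiv I ^^ j) (E 0) \<in> ess_piecewise_cont I"
      using g[of j] jump by (intro ess_piecewise_contI[of _ \<tau>] test_fun_lreg) (auto simp: lmg)
  qed
  then show "(\<lambda>s. heav \<tau> s * (\<theta> s * (of_real (s - \<tau>)) ^ j)) \<in> F_level I j" by (simp add: E0)
qed

end

section \<open>Approximation by piecewise polynomials\<close>

lemma pderiv_surj:
  fixes p :: "complex poly"
  obtains q where "pderiv q = p"
proof
  have "(\<Sum>i\<le>degree p. monom (coeff p i) i) = p" by (rule poly_as_sum_of_monoms)
  moreover have "pderiv (monom (coeff p i / of_nat (Suc i)) (Suc i)) = monom (coeff p i) i" for i
    by (simp add: pderiv_monom del: of_nat_Suc)
  ultimately show "pderiv (\<Sum>i\<le>degree p. monom (coeff p i / of_nat (Suc i)) (Suc i)) = p"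
    by (simp only: higher_pderiv_sum[where n=1, simplified])
qed

text \<open>Induction by antidifferentiation: a polynomial for the shifted data is integrated, and
  the constant of integration is adjusted to give the value \<open>a 0\<close>.\<close>

lemma poly_prescribed_derivatives:
  fixes x :: complex
  shows "\<exists>p. \<forall>i\<le>k. poly ((pderiv ^^ i) p) x = a i"
proof (induction k arbitrary: a)
  case 0
  show ?case by (intro exI[of _ "[:a 0:]"]) auto
next
  case (Suc k)
  obtain p1 where p1: "\<And>i. i \<le> k \<Longrightarrow> poly ((pderiv ^^ i) p1) x = a (Suc i)" using Suc.IH[of "\<lambda>i. a (Suc i)"] by blast
  obtain q where q: "pderiv q = p1" using pderiv_surj by metis
  define p where "p = q + [:a 0 - poly q x:]"
  have p: "pderiv p = p1" "poly p x = a 0" by (simp_all add: p_def q pderiv_add pderiv_pCons)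
  have "poly ((pderiv ^^ i) p) x = a i" if "i \<le> Suc k" for i
    using that p p1 by (cases i) (auto simp: funpow_Suc_right simp del: funpow.simps(2))
  then show ?case by blast
qed

lemma poly_of_real_has_vector_derivative:
  "((\<lambda>s. poly q (complex_of_real s)) has_vector_derivative poly (pderiv q) (of_real s)) (at s)"
  by (rule has_vector_derivative_real_field[OF poly_DERIV])

context open_interval
begin

section \<open>The span \<open>F_span I\<close> and its jumps\<close>

lemma F_span_add:
  assumes "f \<in> F_span I" "g \<in> F_span I"
  shows "(\<lambda>t. f t + g t) \<in> F_span I"
proof -
  obtain S c where S: "finite S" "S \<subseteq> (\<Union>k. F_level I k)" "f = (\<lambda>t. \<Sum>h\<in>S. c h * h t)"
    using assms(1) by (auto simp: F_span_def)
  obtain T e where T: "finite T" "T \<subseteq> (\<Union>k. F_level I k)" "g = (\<lambda>t. \<Sum>h\<in>T. e h * h t)"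
    using assms(2) by (auto simp: F_span_def)
  let ?c = "\<lambda>h. (if h \<in> S then c h else 0) + (if h \<in> T then e h else 0)"
  have "f t + g t = (\<Sum>h\<in>S \<union> T. ?c h * h t)" for t
  proof -
    have "(\<Sum>h\<in>S. c h * h t) = (\<Sum>h\<in>S \<union> T. (if h \<in> S then c h else 0) * h t)"
      by (rule sum.mono_neutral_cong_left) (use S T in auto)
    moreover have "(\<Sum>h\<in>T. e h * h t) = (\<Sum>h\<in>S \<union> T. (if h \<in> T then e h else 0) * h t)"
      by (rule sum.mono_neutral_cong_left) (use S T in auto)
    ultimately show ?thesis by (simp only: S T distrib_right sum.distrib)
  qed
  then show ?thesis unfolding F_span_def using S T by (intro CollectI exI[of _ "S \<union> T"] exI[of _ ?c]) auto
qed

lemma F_span_level: "g \<in> F_level I k \<Longrightarrow> (\<lambda>t. c * g t) \<in> F_span I"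
  unfolding F_span_def by (intro CollectI exI[of _ "{g}"] exI[of _ "\<lambda>_. c"]) auto

lemma F_span_zero: "(\<lambda>_. 0) \<in> F_span I"
  unfolding F_span_def by (intro CollectI exI[of _ "{}"]) auto

lemma test_fun_F_add: "f \<in> test_fun_F I \<Longrightarrow> g \<in> test_fun_F I \<Longrightarrow> (\<lambda>t. f t + g t) \<in> test_fun_F I"
  by (simp add: test_fun_F_def F_span_add test_fun_add)

lemma test_fun_zero: "(\<lambda>_. 0) \<in> test_fun I"
proof -
  obtain c where "c \<in> I" using nonempty_I by blast
  then show ?thesis by (intro tst_test_fun_on(2)[of c c]) (auto simp: tst_def van_def sm_const)
qed

lemma test_fun_F_sum: "(\<And>i. i \<in> S \<Longrightarrow> f i \<in> test_fun_F I) \<Longrightarrow> (\<lambda>t. \<Sum>i\<in>S. f i t) \<in> test_fun_F I"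
proof (induction S rule: infinite_finite_induct)
  case (insert x F)
  then show ?case by (simp add: test_fun_F_add)
qed (simp_all add: test_fun_F_def F_span_zero test_fun_zero)

text \<open>Sums over infinite sets are 0 by default, so the formula in \<open>Delta I\<close> has
  its intended meaning only thanks to this. A generator of level 0 is piecewise continuous; one of
  level \<open>k > 0\<close> is itself continuous, because order 0 differs from \<open>k\<close>.
  Compact support leaves finitely many points.\<close>

lemma test_fun_F_finite_jumps:
  assumes "\<phi> \<in> test_fun_F I"
  shows "finite {t\<in>I. jump t \<phi> \<noteq> 0}"
proof -
  have t: "\<phi> \<in> test_fun I" and sp: "\<phi> \<in> F_span I" using assms by (auto simp: test_fun_F_def)
  obtain S c where S: "finite S" "S \<subseteq> (\<Union>k. F_level I k)" "\<phi> = (\<lambda>t. \<Sum>h\<in>S. c h * h t)"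
    using sp by (auto simp: F_span_def)
  obtain a d where a: "a \<in> I" "d \<in> I" "tst a d \<phi>" using test_fun_tst[OF t] by metis
  have r: "lreg h" if "h \<in> S" for h
    using S(2) that by (auto simp: F_level_def dest: smooth_reg_fun_lsm lsm_lreg)
  have "finite {t\<in>{a..d}. jump t h \<noteq> 0}" if h: "h \<in> S" for h
  proof -
    obtain k where k: "h \<in> F_level I k" using S(2) h by blast
    have "\<exists>h'. finite {t\<in>{a..d}. \<not> isCont h' t} \<and> (AE t in lebesgue_on I. h t = h' t)"
    proof (cases "k = 0")
      case True
      then have "h \<in> ess_piecewise_cont I" using k by (auto simp: F_level_def)
      then show ?thesis using segment_subset[OF a(1,2)] unfolding ess_piecewise_cont_def by blast
    next
      case False
      then have "(gderiv I ^^ 0) h \<in> ess_bdd_cont I"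
        using k unfolding F_level_def by (metis (mono_tags, lifting) mem_Collect_eq)
      then obtain h' where h': "continuous_on I h'" "AE t in lebesgue_on I. h t = h' t"
        by (auto simp: ess_bdd_cont_def)
      have "{t\<in>{a..d}. \<not> isCont h' t} = {}"
        using h'(1) open_I segment_subset[OF a(1,2)] by (auto simp: continuous_on_eq_continuous_at)
      then show ?thesis using h'(2) by (metis finite.emptyI)
    qed
    then obtain h' where h': "finite {t\<in>{a..d}. \<not> isCont h' t}" "AE t in lebesgue. t \<in> I \<longrightarrow> h t = h' t"
      by (auto simp: AE_I_iff)
    have "jump t h = 0" if "t \<in> {a..d}" "isCont h' t" for t
    proof -
      have "t \<in> I" using segment_subset[OF a(1,2)] that by blast
      moreover have "AE t in lebesgue. t \<in> I \<longrightarrow> h' t = h t" using h'(2) by (auto elim: eventually_mono)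
      ultimately have "\<forall>\<^sub>F s in es b t. h' s = h s" for b
        using AE_open_iff[OF open_I] by blast
      then have "lm b h t = h' t" for b
        using tendsto_es_continuous[OF that(2)] tendsto_es_cong lm_eq by metis
      then show ?thesis by (simp add: jump_eq_lm)
    qed
    then have "{t\<in>{a..d}. jump t h \<noteq> 0} \<subseteq> {t\<in>{a..d}. \<not> isCont h' t}" by blast
    then show ?thesis using h'(1) finite_subset by blast
  qed
  then have "finite (\<Union>h\<in>S. {t\<in>{a..d}. jump t h \<noteq> 0})" using S(1) by blast
  moreover have "{t\<in>I. jump t \<phi> \<noteq> 0} \<subseteq> (\<Union>h\<in>S. {t\<in>{a..d}. jump t h \<noteq> 0})"
  proof
    fix t assume t: "t \<in> {t\<in>I. jump t \<phi> \<noteq> 0}"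
    have "t \<in> {a..d}"
    proof (rule ccontr)
      assume "t \<notin> {a..d}"
      then show False using t vanD[OF tst_van[OF a(3)], of t] by (simp add: jump_eq_lm)
    qed
    moreover have "lm b \<phi> t = (\<Sum>h\<in>S. c h * lm b h t)" for b
      using t r unfolding S(3) by (auto simp: lm_sum lm_cmult lreg_cmult)
    then have "jump t \<phi> = (\<Sum>h\<in>S. c h * jump t h)"
      by (simp add: jump_eq_lm right_diff_distrib sum_subtractf)
    then have "\<exists>h\<in>S. jump t h \<noteq> 0" using t by (metis (mono_tags, lifting) mem_Collect_eq mult_zero_right sum.neutral)
    ultimately show "t \<in> (\<Union>h\<in>S. {t\<in>{a..d}. jump t h \<noteq> 0})" by blast
  qed
  ultimately show ?thesis by (rule rev_finite_subset)
qed

subsection \<open>Polynomial pieces\<close>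

text \<open>Tells which one-sided limits at \<open>t\<close> see the segment: at \<open>c\<close>
  only the right one, at \<open>d\<close> only the left one. Adjacent segments therefore share no
  limit.\<close>

definition inside :: "real \<Rightarrow> real \<Rightarrow> bool \<Rightarrow> real \<Rightarrow> bool" where
  "inside c d b t \<longleftrightarrow> (if b then c \<le> t \<and> t < d else c < t \<and> t \<le> d)"

definition piece :: "real \<Rightarrow> real \<Rightarrow> complex poly \<Rightarrow> real \<Rightarrow> complex" where
  "piece c d q s = (heav c s - heav d s) * poly q (of_real s)"

lemma sm_poly: "sm {} (\<lambda>s. poly q (of_real s))"
proof (rule sm_of_continuous_derivative[of "range (\<lambda>q s. poly q (complex_of_real s))"])
  fix g assume "g \<in> range (\<lambda>q s. poly q (complex_of_real s))"
  then obtain q where g: "g = (\<lambda>s. poly q (complex_of_real s))" by blast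
  have "continuous_on I (\<lambda>s. poly (pderiv q) (complex_of_real s))" by (intro continuous_intros)
  then show "\<exists>h\<in>alg (range (\<lambda>q s. poly q (complex_of_real s))). continuous_on I h \<and> (\<forall>t\<in>I. (g has_vector_derivative h t) (at t))"
    using poly_of_real_has_vector_derivative g
    by (intro bexI[of _ "\<lambda>s. poly (pderiv q) (complex_of_real s)"]) (auto intro: alg_base)
qed blast

lemma lreg_poly: "lreg (\<lambda>s. poly q (of_real s))"
  using sm_poly sm_lreg by blast

lemma lm_poly: "t \<in> I \<Longrightarrow> lm b (\<lambda>s. poly q (of_real s)) t = poly q (of_real t)"
  by (intro lreg_continuous(2) continuous_intros)

lemma lder_poly: "lder (\<lambda>s. poly q (of_real s)) (\<lambda>s. poly (pderiv q) (of_real s))"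
  by (intro lder_has_vector_derivative poly_of_real_has_vector_derivative continuous_intros)

lemma lm_piece:
  assumes "t \<in> I" "c < d"
  shows "lm b (piece c d q) t = (if inside c d b t then poly q (of_real t) else 0)"
  unfolding piece_def[abs_def] using assms
  by (auto simp: lm_mult lm_diff lreg_diff lreg_heav lreg_poly lm_heav lm_poly inside_def)

lemma lder_piece: "lder (piece c d q) (piece c d (pderiv q))"
  unfolding piece_def[abs_def]
  using lder_mult[OF lder_diff[OF lder_heav lder_heav lreg_heav lreg_heav] lder_poly lreg_diff[OF lreg_heav lreg_heav] lreg_poly]
  by simp

text \<open>Expanding \<open>q\<close> in powers of \<open>s - c\<close> and of \<open>s - d\<close>
  writes the piece as a truncated polynomial started at \<open>c\<close> minus one started at
  \<open>d\<close>, each a combination of truncated powers. The cutoff \<open>\<theta>\<close> gives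
  both compact support; being 1 on \<open>{c..d}\<close>, it disappears from the difference.\<close>

lemma piece_test_fun_F:
  assumes "c \<in> I" "d \<in> I" "c < d"
  shows "piece c d q \<in> test_fun_F I"
proof -
  obtain p r where pr: "p \<in> I" "r \<in> I" "p < c" "d < r"
    using compact_subset_segment[of "{c..d}"] segment_subset[OF assms(1,2)] assms(3)
    by (metis atLeastAtMost_iff compact_Icc greaterThanLessThan_iff less_eq_real_def order_refl subset_eq)
  define p' r' where "p' = (p + c) / 2" and "r' = (d + r) / 2"
  have p': "p < p'" "p' < c" "d < r'" "r' < r" using pr by (auto simp: p'_def r'_def field_simps)
  obtain \<theta> where \<theta>: "sm {} \<theta>" "\<And>s. p' \<le> s \<Longrightarrow> s \<le> r' \<Longrightarrow> \<theta> s = 1" "\<And>s. s \<le> p \<or> r \<le> s \<Longrightarrow> \<theta> s = 0"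
    using smooth_cutoff[of p p' r' r] p' by metis
  have *: "(\<lambda>s. k * (heav \<tau> s * (\<theta> s * poly q (of_real s)))) \<in> test_fun_F I" if \<tau>: "p' < \<tau>" "\<tau> < r'" "\<tau> \<in> I" for \<tau> k
  proof -
    define q' where "q' = pcompose q [:of_real \<tau>, 1:]"
    have "poly q (of_real s) = (\<Sum>i\<le>degree q'. coeff q' i * of_real (s - \<tau>) ^ i)" for s
    proof -
      have "poly q' (of_real (s - \<tau>)) = poly q (of_real s)" by (simp add: q'_def poly_pcompose)
      then show ?thesis by (simp add: poly_altdef)
    qed
    then have "(\<lambda>s. k * (heav \<tau> s * (\<theta> s * poly q (of_real s)))) =
        (\<lambda>s. \<Sum>i\<le>degree q'. (k * coeff q' i) * (heav \<tau> s * (\<theta> s * of_real (s - \<tau>) ^ i)))"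
      by (simp add: fun_eq_iff sum_distrib_left mult_ac)
    moreover have "(\<lambda>s. (k * coeff q' i) * (heav \<tau> s * (\<theta> s * of_real (s - \<tau>) ^ i))) \<in> test_fun_F I" for i
      unfolding test_fun_F_def
      using truncated_power_F_level[OF \<theta> pr(1,2) \<tau>, of i] F_span_level test_fun_cmult by blast
    ultimately show ?thesis
      using test_fun_F_sum[of "{..degree q'}" "\<lambda>i s. (k * coeff q' i) * (heav \<tau> s * (\<theta> s * of_real (s - \<tau>) ^ i))"]
      by (simp only:)
  qed
  have "(\<lambda>s. 1 * (heav c s * (\<theta> s * poly q (of_real s))) + (- 1) * (heav d s * (\<theta> s * poly q (of_real s)))) \<in> test_fun_F I"
    using p' assms by (intro test_fun_F_add *) auto
  moreover have "1 * (heav c s * (\<theta> s * poly q (of_real s))) + (- 1) * (heav d s * (\<theta> s * poly q (of_real s))) = piece c d q s" for s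
  proof (cases "c \<le> s \<and> s < d")
    case True
    then have "\<theta> s = 1" using p' by (intro \<theta>(2)) auto
    then show ?thesis by (simp add: piece_def algebra_simps)
  next
    case False
    then show ?thesis using assms(3) by (auto simp: piece_def heav_def)
  qed
  ultimately show ?thesis by simp
qed

lemma dbound_seq:
  assumes "lreg (F 0)" "\<And>i. lder (F i) (F (Suc i))" "\<And>i t b. i \<le> k \<Longrightarrow> t \<in> I \<Longrightarrow> norm (lm b (F i) t) \<le> M"
  shows "dbound k M (F 0)"
  using assms
proof (induction k arbitrary: F)
  case (Suc k)
  have "dbound k M (F (Suc 0))"
    using Suc.prems lder_lreg[OF Suc.prems(2)] by (intro Suc.IH) auto
  then show ?case using Suc.prems(2)[of 0] Suc.prems(1) Suc.prems(3)[of 0] by auto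
qed auto

text \<open>Agreement up to order \<open>k + 1\<close>, and not only \<open>k\<close>, makes each
  \<open>G i\<close> with \<open>i \<le> k\<close> vanish at \<open>x\<close> together with its
  first derivative. Hence the error is \<open>e\<close> times the distance and not merely
  \<open>e\<close>; the slope estimate in \<open>approx_local\<close> depends on this.\<close>

lemma taylor_piece_near:
  assumes D: "lreg (D 0)" "\<And>i. lder (D i) (D (Suc i))" and x: "x \<in> I" and e: "e > 0"
  obtains \<eta> p where "\<eta> > 0" "\<And>i. i \<le> Suc k \<Longrightarrow> poly ((pderiv ^^ i) p) (of_real x) = lm b (D i) x"
    "\<And>i s b'. i \<le> k \<Longrightarrow> s \<in> side b x \<eta> \<Longrightarrow> s \<in> I \<Longrightarrow>
      norm (lm b' (D i) s - poly ((pderiv ^^ i) p) (of_real s)) \<le> e * \<bar>s - x\<bar>"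
proof -
  have r: "lreg (D i)" for i using D lder_lreg by (cases i) auto
  obtain p where p: "\<And>i. i \<le> Suc k \<Longrightarrow> poly ((pderiv ^^ i) p) (of_real x) = lm b (D i) x"
    using poly_prescribed_derivatives[of "Suc k" "complex_of_real x" "\<lambda>i. lm b (D i) x"] by blast
  define G where "G i s = D i s - poly ((pderiv ^^ i) p) (of_real s)" for i s
  have G: "lreg (G i)" "lder (G i) (G (Suc i))" for i
    using r D(2) lder_poly[of "(pderiv ^^ i) p"] unfolding G_def[abs_def]
    by (auto intro!: lreg_diff lreg_poly lder_diff)
  have lG: "lm b' (G i) s = lm b' (D i) s - poly ((pderiv ^^ i) p) (of_real s)" if "s \<in> I" for b' i s
    unfolding G_def[abs_def] using that r by (simp add: lm_diff lreg_poly lm_poly)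
  have "\<exists>\<eta>>0. \<forall>s b'. s \<in> side b x \<eta> \<longrightarrow> s \<in> I \<longrightarrow> norm (lm b' (G i) s) \<le> e * \<bar>s - x\<bar>" if "i \<le> k" for i
  proof -
    have z: "lm b (G i) x = 0" "lm b (G (Suc i)) x = 0"
      using lG[OF x] p[of i] p[of "Suc i"] that by auto
    have "norm (lm b (G (Suc i)) x) < e" using z e by simp
    from lder_bound_near[OF G x this] show ?thesis by (metis diff_zero z(1))
  qed
  then obtain \<eta> where \<eta>: "\<And>i. i \<le> k \<Longrightarrow> \<eta> i > 0"
    "\<And>i s b'. i \<le> k \<Longrightarrow> s \<in> side b x (\<eta> i) \<Longrightarrow> s \<in> I \<Longrightarrow> norm (lm b' (G i) s) \<le> e * \<bar>s - x\<bar>" by metis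
  define h where "h = Min (\<eta> ` {..k})"
  have h: "h > 0" "\<And>i. i \<le> k \<Longrightarrow> h \<le> \<eta> i" using \<eta>(1) by (auto simp: h_def)
  have "side b x h \<subseteq> side b x (\<eta> i)" if "i \<le> k" for i
    using h(2)[OF that] by (auto simp: side_def)
  then show ?thesis using that[OF h(1) p] \<eta>(2) lG by (metis subsetD)
qed

text \<open>Prescribing the one-sided values at both ends makes approximations on adjacent segments glue
  without spurious jumps.\<close>

definition approx :: "(nat \<Rightarrow> real \<Rightarrow> complex) \<Rightarrow> nat \<Rightarrow> real \<Rightarrow> real \<Rightarrow> real \<Rightarrow> bool" where
  "approx D k e c d \<longleftrightarrow> (\<exists>E. E 0 \<in> test_fun_F I \<and> (\<forall>i. lder (E i) (E (Suc i))) \<and>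
     (\<forall>t\<in>I. \<forall>b. \<forall>i\<le>k. inside c d b t \<longrightarrow> norm (lm b (E i) t - lm b (D i) t) \<le> e) \<and>
     (\<forall>t\<in>I. \<forall>b i. \<not> inside c d b t \<longrightarrow> lm b (E i) t = 0) \<and>
     lm True (E 0) c = lm True (D 0) c \<and> lm False (E 0) d = lm False (D 0) d \<and>
     (\<forall>t. c < t \<and> t < d \<longrightarrow> jump t (E 0) = jump t (D 0)))"

lemma approx_piece:
  assumes "c \<in> I" "d \<in> I" "c < d"
    and "\<And>t b i. inside c d b t \<Longrightarrow> i \<le> k \<Longrightarrow> norm (poly ((pderiv ^^ i) q) (of_real t) - lm b (D i) t) \<le> e"
    and "poly q (of_real c) = lm True (D 0) c" "poly q (of_real d) = lm False (D 0) d"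
    and "\<And>t. c < t \<Longrightarrow> t < d \<Longrightarrow> jump t (D 0) = 0"
  shows "approx D k e c d"
  unfolding approx_def
proof (intro exI[of _ "\<lambda>i. piece c d ((pderiv ^^ i) q)"] conjI ballI allI impI)
  show "piece c d ((pderiv ^^ 0) q) \<in> test_fun_F I" using piece_test_fun_F assms by simp
  show "lder (piece c d ((pderiv ^^ i) q)) (piece c d ((pderiv ^^ Suc i) q))" for i
    using lder_piece by simp
  show "jump t (piece c d ((pderiv ^^ 0) q)) = jump t (D 0)" if "c < t \<and> t < d" for t
  proof -
    have "t \<in> I" using that segment_subset[OF assms(1,2)] by auto
    then show ?thesis using that assms(3,7) by (auto simp: jump_eq_lm lm_piece inside_def)
  qed
qed (use assms in \<open>auto simp: lm_piece inside_def\<close>)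

lemma approx_join:
  assumes "approx D k e u v" "approx D k e v w" "u < v" "v < w" "u \<in> I" "w \<in> I"
  shows "approx D k e u w"
proof -
  obtain E where E: "E 0 \<in> test_fun_F I" "\<And>i. lder (E i) (E (Suc i))"
     "\<And>t b i. t \<in> I \<Longrightarrow> i \<le> k \<Longrightarrow> inside u v b t \<Longrightarrow> norm (lm b (E i) t - lm b (D i) t) \<le> e"
     "\<And>t b i. t \<in> I \<Longrightarrow> \<not> inside u v b t \<Longrightarrow> lm b (E i) t = 0"
     "lm True (E 0) u = lm True (D 0) u" "lm False (E 0) v = lm False (D 0) v"
     "\<And>t. u < t \<Longrightarrow> t < v \<Longrightarrow> jump t (E 0) = jump t (D 0)"
    using assms(1) unfolding approx_def by blast
  obtain F where F: "F 0 \<in> test_fun_F I" "\<And>i. lder (F i) (F (Suc i))"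
     "\<And>t b i. t \<in> I \<Longrightarrow> i \<le> k \<Longrightarrow> inside v w b t \<Longrightarrow> norm (lm b (F i) t - lm b (D i) t) \<le> e"
     "\<And>t b i. t \<in> I \<Longrightarrow> \<not> inside v w b t \<Longrightarrow> lm b (F i) t = 0"
     "lm True (F 0) v = lm True (D 0) v" "lm False (F 0) w = lm False (D 0) w"
     "\<And>t. v < t \<Longrightarrow> t < w \<Longrightarrow> jump t (F 0) = jump t (D 0)"
    using assms(2) unfolding approx_def by blast
  have r: "lreg (E i)" "lreg (F i)" for i
    using E(1,2) F(1,2) lder_lreg test_fun_lreg test_fun_F_test_fun by (cases i; blast)+
  have l: "lm b (\<lambda>s. E i s + F i s) t = lm b (E i) t + lm b (F i) t" if "t \<in> I" for b i t
    using r that by (rule lm_add)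
  have sub: "t \<in> I" if "u \<le> t" "t \<le> w" for t using segment_subset[OF assms(5,6)] that by auto
  show ?thesis
    unfolding approx_def
  proof (intro exI[of _ "\<lambda>i s. E i s + F i s"] conjI ballI allI impI)
    show "(\<lambda>s. E 0 s + F 0 s) \<in> test_fun_F I" by (rule test_fun_F_add[OF E(1) F(1)])
    show "lder (\<lambda>s. E i s + F i s) (\<lambda>s. E (Suc i) s + F (Suc i) s)" for i
      by (rule lder_add[OF E(2) F(2) r])
    fix t b i assume t: "t \<in> I"
    show "norm (lm b (\<lambda>s. E i s + F i s) t - lm b (D i) t) \<le> e" if "i \<le> k" "inside u w b t"
    proof (cases "inside u v b t")
      case True
      then have "\<not> inside v w b t" by (auto simp: inside_def split: if_splits)
      then show ?thesis using True E(3)[OF t that(1)] F(4)[OF t] l[OF t] by simp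
    next
      case False
      then have "inside v w b t" using that(2) by (auto simp: inside_def split: if_splits)
      then show ?thesis using False F(3)[OF t that(1)] E(4)[OF t] l[OF t] by simp
    qed
    show "lm b (\<lambda>s. E i s + F i s) t = 0" if "\<not> inside u w b t"
    proof -
      have "\<not> inside u v b t" "\<not> inside v w b t"
        using that assms(3,4) by (auto simp: inside_def split: if_splits)
      then show ?thesis using E(4)[OF t] F(4)[OF t] l[OF t] by simp
    qed
  next
    show "lm True (\<lambda>s. E 0 s + F 0 s) u = lm True (D 0) u"
      using l[OF assms(5)] E(5) F(4)[OF assms(5), of True] assms(3) by (simp add: inside_def)
    show "lm False (\<lambda>s. E 0 s + F 0 s) w = lm False (D 0) w"
      using l[OF assms(6)] F(6) E(4)[OF assms(6), of False] assms(4) by (simp add: inside_def)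
    fix t assume t: "u < t \<and> t < w"
    then have tI: "t \<in> I" using sub by simp
    have j: "jump t (\<lambda>s. E 0 s + F 0 s) = jump t (E 0) + jump t (F 0)" using l[OF tI] by (simp add: jump_eq_lm)
    consider "t < v" | "t = v" | "t > v" by linarith
    then show "jump t (\<lambda>s. E 0 s + F 0 s) = jump t (D 0)"
    proof cases
      case 1
      then have "jump t (F 0) = 0" using F(4)[OF tI] by (simp add: jump_eq_lm inside_def)
      then show ?thesis using j 1 t E(7) by simp
    next
      \<comment> \<open>At the joint the left limit comes from \<open>E\<close> and the right one
        from \<open>F\<close>; their prescribed values reproduce the jump of
        \<open>D 0\<close>.\<close>
      case 2
      then have "lm True (E 0) t = 0" "lm False (F 0) t = 0"
        using E(4)[OF tI] F(4)[OF tI] by (auto simp: inside_def)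
      then show ?thesis using 2 j E(6) F(5) by (simp add: jump_eq_lm)
    next
      case 3
      then have "jump t (E 0) = 0" using E(4)[OF tI] by (simp add: jump_eq_lm inside_def)
      then show ?thesis using j 3 t F(7) by simp
    qed
  qed
qed

text \<open>On a short segment with \<open>x\<close> as one end the Taylor polynomial already fits
  at \<open>x\<close>, and a linear term vanishing at \<open>x\<close> makes it fit at
  \<open>y\<close>. Exact values at both ends are what \<open>approx_join\<close> needs for
  gluing.\<close>

lemma approx_local:
  assumes D: "lreg (D 0)" "\<And>i. lder (D i) (D (Suc i))" and x: "x \<in> I" and e: "e > 0"
    and fin: "finite {t\<in>I. jump t (D 0) \<noteq> 0}"
  obtains \<eta> where "\<eta> > 0" "\<And>y. y \<in> side b x \<eta> \<Longrightarrow> y \<in> I \<Longrightarrow> approx D k e (min x y) (max x y)"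
proof -
  have r: "lreg (D i)" for i using D lder_lreg by (cases i) auto
  obtain \<eta>1 p where p: "\<eta>1 > 0" "\<And>i. i \<le> Suc k \<Longrightarrow> poly ((pderiv ^^ i) p) (of_real x) = lm b (D i) x"
    "\<And>i s b'. i \<le> k \<Longrightarrow> s \<in> side b x \<eta>1 \<Longrightarrow> s \<in> I \<Longrightarrow>
      norm (lm b' (D i) s - poly ((pderiv ^^ i) p) (of_real s)) \<le> e / 2 * \<bar>s - x\<bar>"
    using taylor_piece_near[OF D x, of "e / 2" k b] e by auto
  obtain \<eta>2 where \<eta>2: "\<eta>2 > 0" "\<And>t. t \<in> I \<Longrightarrow> jump t (D 0) \<noteq> 0 \<Longrightarrow> t \<noteq> x \<Longrightarrow> \<eta>2 \<le> dist x t"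
    using finite_set_avoid[OF fin, of x] by auto
  \<comment> \<open>The three bounds secure the Taylor estimate, the absence of jumps strictly
    between \<open>x\<close> and \<open>y\<close>, and a distance of at most 1, which keeps the
    linear term within \<open>e / 2\<close>.\<close>
  define \<eta> where "\<eta> = min (min \<eta>1 \<eta>2) 1"
  have "approx D k e (min x y) (max x y)" if y: "y \<in> side b x \<eta>" "y \<in> I" for y
  proof -
    have neq: "y \<noteq> x" using y by (auto simp: side_def split: if_splits)
    have small: "\<bar>y - x\<bar> < 1" "\<bar>y - x\<bar> < \<eta>2" using y by (auto simp: side_def \<eta>_def split: if_splits)
    \<comment> \<open>The slope that forces the value at \<open>y\<close>. The limit prescribed
      there is the one facing back to \<open>x\<close>, hence \<open>\<not> b\<close>; the Taylor
      error bounds the slope by \<open>e / 2\<close>.\<close>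
    define \<gamma> where "\<gamma> = (lm (\<not> b) (D 0) y - poly p (of_real y)) / of_real (y - x)"
    define q where "q = p + smult \<gamma> [:- of_real x, 1:]"
    have near: "s \<in> side b x \<eta>1" "\<bar>s - x\<bar> \<le> \<bar>y - x\<bar>" "s \<in> I" if "min x y \<le> s" "s \<le> max x y" "s \<noteq> x" for s
      using that y segment_subset[OF x y(2)] segment_subset[OF y(2) x]
      by (auto simp: side_def \<eta>_def min_def max_def abs_if split: if_splits)
    have "norm (lm (\<not> b) (D 0) y - poly p (of_real y)) \<le> e / 2 * \<bar>y - x\<bar>"
      using p(3)[of 0 y] near[of y] neq by auto
    then have \<gamma>: "norm \<gamma> \<le> e / 2"
      using neq by (simp add: \<gamma>_def norm_divide divide_simps flip: of_real_diff)
    have q0: "poly q (of_real s) = poly p (of_real s) + \<gamma> * of_real (s - x)" for s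
      by (simp add: q_def algebra_simps)
    have qy: "poly q (of_real y) = lm (\<not> b) (D 0) y"
      using neq by (simp add: q0 \<gamma>_def flip: of_real_diff)
    have qx: "poly q (of_real x) = lm b (D 0) x" using p(2)[of 0] by (simp add: q0)
    have q1: "pderiv q = pderiv p + [:\<gamma>:]" by (simp add: q_def pderiv_add pderiv_smult pderiv_pCons)
    have q2: "(pderiv ^^ Suc (Suc i)) q = (pderiv ^^ Suc (Suc i)) p" for i
      by (simp add: funpow_Suc_right q1 pderiv_add pderiv_pCons del: funpow.simps(2))
    have corr: "norm (poly ((pderiv ^^ i) q) (of_real s) - poly ((pderiv ^^ i) p) (of_real s)) \<le> e / 2"
      if "\<bar>s - x\<bar> \<le> 1" for i s
    proof -
      consider "i = 0" | "i = 1" | j where "i = Suc (Suc j)" by (metis One_nat_def not0_implies_Suc)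
      then show ?thesis
      proof cases
        case 1
        have "norm \<gamma> * \<bar>s - x\<bar> \<le> (e / 2) * 1" using \<gamma> that e by (intro mult_mono) auto
        then show ?thesis using 1 by (simp add: q0 norm_mult flip: of_real_diff)
      next
        case 2 then show ?thesis using \<gamma> by (simp add: q1)
      next
        case 3 then show ?thesis using q2[of j] e by (simp del: funpow.simps(2))
      qed
    qed
    show ?thesis
    proof (rule approx_piece)
      show "min x y \<in> I" "max x y \<in> I" "min x y < max x y" using x y neq by (auto simp: min_def max_def)
      have "b \<longleftrightarrow> x < y" using y by (auto simp: side_def split: if_splits)
      then show "poly q (of_real (min x y)) = lm True (D 0) (min x y)" "poly q (of_real (max x y)) = lm False (D 0) (max x y)"
        using qx qy neq by (auto simp: min_def max_def)
      show "jump t (D 0) = 0" if "min x y < t" "t < max x y" for t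
      proof (rule ccontr)
        assume "jump t (D 0) \<noteq> 0"
        moreover have "t \<noteq> x" using that by auto
        moreover have "t \<in> I" "\<bar>t - x\<bar> \<le> \<bar>y - x\<bar>" using near[of t] that \<open>t \<noteq> x\<close> by auto
        ultimately have "\<eta>2 \<le> dist x t" using \<eta>2(2) by blast
        then show False using small \<open>\<bar>t - x\<bar> \<le> \<bar>y - x\<bar>\<close> by (simp add: dist_real_def)
      qed
      fix t b' i assume t: "inside (min x y) (max x y) b' t" and i: "i \<le> k"
      have tr: "min x y \<le> t" "t \<le> max x y" using t by (auto simp: inside_def split: if_splits)
      have t1: "\<bar>t - x\<bar> \<le> 1" using tr small by (auto simp: min_def max_def abs_if split: if_splits)
      have "norm (lm b' (D i) t - poly ((pderiv ^^ i) p) (of_real t)) \<le> e / 2"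
      proof (cases "t = x")
        case True
        then have "b' = b" using t \<open>b \<longleftrightarrow> x < y\<close> by (auto simp: inside_def min_def max_def split: if_splits)
        then show ?thesis using p(2)[of i] i True e by simp
      next
        case False
        have "norm (lm b' (D i) t - poly ((pderiv ^^ i) p) (of_real t)) \<le> e / 2 * \<bar>t - x\<bar>"
          using near[OF tr False] p(3)[OF i] by blast
        also have "\<dots> \<le> e / 2 * 1" using t1 e by (intro mult_left_mono) auto
        finally show ?thesis by simp
      qed
      then show "norm (poly ((pderiv ^^ i) q) (of_real t) - lm b' (D i) t) \<le> e"
        using corr[OF t1, of i] norm_triangle_ineq[of "poly ((pderiv ^^ i) q) (of_real t) - poly ((pderiv ^^ i) p) (of_real t)"
            "poly ((pderiv ^^ i) p) (of_real t) - lm b' (D i) t"]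
        by (simp add: norm_minus_commute)
    qed
  qed
  moreover have "\<eta> > 0" using p(1) \<eta>2(1) by (simp add: \<eta>_def)
  ultimately show ?thesis using that by blast
qed

lemma approx_segment:
  assumes D: "lreg (D 0)" "\<And>i. lder (D i) (D (Suc i))" and e: "e > 0"
    and fin: "finite {t\<in>I. jump t (D 0) \<noteq> 0}" and cd: "c \<in> I" "d \<in> I" "c < d"
  shows "approx D k e c d"
proof -
  have sub: "t \<in> I" if "c \<le> t" "t \<le> d" for t using segment_subset[OF cd(1,2)] that by auto
  have "c \<le> d" using cd(3) by simp
  then have "c \<le> c \<and> d \<le> d \<and> c < d \<longrightarrow> approx D k e c d"
  proof (induction rule: Bolzano[where P="\<lambda>u v. c \<le> u \<and> v \<le> d \<and> u < v \<longrightarrow> approx D k e u v"])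
    case (trans u v w)
    show ?case
    proof (intro impI)
      assume uw: "c \<le> u \<and> w \<le> d \<and> u < w"
      show "approx D k e u w"
      proof (cases "u = v \<or> v = w")
        case True then show ?thesis using trans uw by auto
      next
        case False
        then have "u < v" "v < w" using trans by auto
        then show ?thesis using trans uw sub by (intro approx_join[of D k e u v w]) auto
      qed
    qed
  next
    case (local x)
    obtain e1 where e1: "e1 > 0" "\<And>y. y \<in> side True x e1 \<Longrightarrow> y \<in> I \<Longrightarrow> approx D k e (min x y) (max x y)"
      using approx_local[OF D sub[OF local] e fin, of True k] by metis
    obtain e2 where e2: "e2 > 0" "\<And>y. y \<in> side False x e2 \<Longrightarrow> y \<in> I \<Longrightarrow> approx D k e (min x y) (max x y)"
      using approx_local[OF D sub[OF local] e fin, of False k] by metis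
    show ?case
    proof (intro exI[of _ "min e1 e2"] conjI allI impI)
      fix u v assume uv: "u \<le> x \<and> x \<le> v \<and> v - u < min e1 e2" and uv': "c \<le> u \<and> v \<le> d \<and> u < v"
      have I: "u \<in> I" "v \<in> I" using sub uv' by auto
      have r: "approx D k e x v" if "x < v"
      proof -
        have "v \<in> side True x e1" using that uv by (simp add: side_def)
        then show ?thesis using e1(2)[OF _ I(2)] that by (simp add: min_def max_def)
      qed
      have l: "approx D k e u x" if "u < x"
      proof -
        have "u \<in> side False x e2" using that uv by (simp add: side_def)
        then show ?thesis using e2(2)[OF _ I(1)] that by (simp add: min_def max_def)
      qed
      show "approx D k e u v"
      proof (cases "u = x \<or> x = v")
        case True then show ?thesis using r l uv' by auto
      next
        case False
        then have "u < x" "x < v" using uv by auto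
        then show ?thesis using r l I by (intro approx_join[of D k e u x v]) auto
      qed
    qed (use e1 e2 in auto)
  qed
  then show ?thesis using cd by simp
qed

lemma jump_functional_extends:
  assumes \<delta>: "\<delta> \<in> distrib I"
    and c: "\<And>\<phi>. \<phi> \<in> test_fun_F I \<Longrightarrow> \<delta> \<phi> = (\<Sum>t | t \<in> I \<and> jump t \<phi> \<noteq> 0. c t * jump t \<phi>)"
    and \<psi>: "\<psi> \<in> test_fun I" "finite {t\<in>I. jump t \<psi> \<noteq> 0}"
  shows "\<delta> \<psi> = (\<Sum>t | t \<in> I \<and> jump t \<psi> \<noteq> 0. c t * jump t \<psi>)" (is "_ = ?S")
proof -
  obtain l u where lu: "l \<in> I" "u \<in> I" "l < u" "tst l u \<psi>" using test_fun_tst[OF \<psi>(1)] by metis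
  \<comment> \<open>On the larger segment the limits of \<open>\<psi>\<close> at the ends are 0, so
    the prescribed end values of the approximation are 0 and it acquires no jump at \<open>p\<close>
    or \<open>q\<close>.\<close>
  obtain p q where pq: "p \<in> I" "q \<in> I" "p < l" "u < q"
    using compact_subset_segment[of "{l..u}"] segment_subset[OF lu(1,2)] lu(3)
    by (metis atLeastAtMost_iff compact_Icc greaterThanLessThan_iff less_eq_real_def order_refl subset_eq)
  have t\<psi>: "tst p q \<psi>" using lu(4) by (rule tst_mono) (use pq in auto)
  have z: "lm b \<psi> p = 0" "lm b \<psi> q = 0" for b using vanD[OF tst_van[OF lu(4)]] pq lu(3) by auto
  define D where "D i = (gderiv I ^^ i) \<psi>" for i
  have D: "lreg (D 0)" "\<And>i. lder (D i) (D (Suc i))"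
    using \<psi>(1) test_fun_lreg gderiv_funpow_test_fun test_fun_gderiv by (auto simp: D_def)
  have D0: "D 0 = \<psi>" by (simp add: D_def)
  have rD: "lreg (D i)" for i using D lder_lreg by (cases i) auto
  obtain k C where C: "C \<ge> 0" "\<And>\<phi> M. tst p q \<phi> \<Longrightarrow> dbound k M \<phi> \<Longrightarrow> norm (\<delta> \<phi>) \<le> C * M"
    using distrib_bound[OF \<delta> pq(1,2)] by metis
  have "norm (\<delta> \<psi> - ?S) \<le> C * e" if e: "e > 0" for e
  proof -
    have "approx D k e p q"
      using pq lu(3) \<psi>(2) by (intro approx_segment D e) (auto simp: D0)
    then obtain E where E: "E 0 \<in> test_fun_F I" "\<And>i. lder (E i) (E (Suc i))"
     "\<And>t b i. t \<in> I \<Longrightarrow> i \<le> k \<Longrightarrow> inside p q b t \<Longrightarrow> norm (lm b (E i) t - lm b (D i) t) \<le> e"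
     "\<And>t b i. t \<in> I \<Longrightarrow> \<not> inside p q b t \<Longrightarrow> lm b (E i) t = 0"
     "lm True (E 0) p = lm True (D 0) p" "lm False (E 0) q = lm False (D 0) q"
     "\<And>t. p < t \<Longrightarrow> t < q \<Longrightarrow> jump t (E 0) = jump t (D 0)"
      unfolding approx_def by blast
    have E0: "E 0 \<in> test_fun I" by (rule test_fun_F_test_fun[OF E(1)])
    have rE: "lreg (E i)" for i using E0 E(2) lder_lreg test_fun_lreg by (cases i) auto
    have vE: "tst p q (E 0)"
      using test_fun_lsm[OF E0] E(4) by (auto simp: tst_def van_def inside_def)
    have vD: "tst p q (D i)" for i by (induction i) (use t\<psi> D0 D(2) tst_lder in auto)
    have j: "jump t (E 0) = jump t \<psi>" if t: "t \<in> I" for t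
    proof (cases "p < t \<and> t < q")
      case False
      then have "\<not> inside p q b t \<or> (t = p \<and> b) \<or> (t = q \<and> \<not> b)" for b by (auto simp: inside_def)
      then have "lm b (E 0) t = 0" for b using E(4)[OF t] E(5,6) z D0 by (metis (full_types))
      moreover have "lm b \<psi> t = 0" for b using False vanD[OF tst_van[OF lu(4)] t] pq by auto
      ultimately show ?thesis by (simp add: jump_eq_lm)
    qed (use E(7) D0 in auto)
    \<comment> \<open>The approximation has the same jumps as \<open>\<psi>\<close>, so
      \<open>\<delta>\<close> takes on it the value \<open>?S\<close> whatever \<open>e\<close> is;
      only the remainder depends on \<open>e\<close>.\<close>
    have "\<delta> (E 0) = ?S" using c[OF E(1)] j by (intro trans[OF c[OF E(1)]] sum.cong) auto
    moreover have "tst p q (\<lambda>s. E 0 s + (- 1) * D 0 s)" by (intro tst_add tst_cmult vE vD)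
    moreover have "dbound k e ((\<lambda>i s. E i s - D i s) 0)"
    proof (rule dbound_seq)
      fix i t b assume it: "i \<le> k" "t \<in> I"
      show "norm (lm b (\<lambda>s. E i s - D i s) t) \<le> e"
      proof (cases "inside p q b t")
        case True
        then show ?thesis using E(3)[OF it(2,1)] it rE rD by (simp add: lm_diff)
      next
        case False
        \<comment> \<open>At the ends \<open>p\<close> and \<open>q\<close> themselves
          \<open>tst p q\<close> gives nothing, and the smaller support \<open>{l..u}\<close> is
          used.\<close>
        have "lm b (D i) t = 0"
        proof (cases "t \<in> {p..q}")
          case True
          then have t: "t = p \<or> t = q" using False by (auto simp: inside_def split: if_splits)
          have "tst l u (D i)" by (induction i) (use lu(4) D0 D(2) tst_lder in auto)
          then show ?thesis using vanD[OF tst_van, of l u "D i" t b] it t pq lu(3) by auto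
        qed (use vanD[OF tst_van[OF vD]] it in auto)
        then show ?thesis using E(4)[OF it(2) False] it rE rD e by (simp add: lm_diff)
      qed
    qed (use rE rD E(2) D(2) in \<open>auto intro: lreg_diff lder_diff\<close>)
    ultimately have "norm (\<delta> (\<lambda>s. E 0 s - \<psi> s)) \<le> C * e" using C(2) D0 by simp
    then show ?thesis using distrib_diff[OF \<delta> E0 \<psi>(1)] \<open>\<delta> (E 0) = ?S\<close> by (simp add: norm_minus_commute)
  qed
  then have "norm (\<delta> \<psi> - ?S) \<le> 0 + e" if "e > 0" for e
    using that C(1)
    by (smt (verit, best) divide_pos_pos mult.commute mult_left_mono nonzero_eq_divide_eq pos_divide_le_eq zero_less_mult_pos)
  then have "norm (\<delta> \<psi> - ?S) \<le> 0" by (rule field_le_epsilon)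
  then show ?thesis by simp
qed

end

section \<open>Leibniz rule and primitives\<close>

context open_interval
begin

lemma jump_mult:
  assumes "lreg m" "lreg \<phi>" "t \<in> I" "lm True m t = lm False m t"
  shows "jump t (\<lambda>s. m s * \<phi> s) = lm True m t * jump t \<phi>"
  using assms by (simp add: jump_eq_lm lm_mult right_diff_distrib)

text \<open>As \<open>m\<close> does not jump, multiplication scales each jump by the value of
  \<open>m\<close> there, and so are the coefficients scaled. The product may leave
  \<open>test_fun_F I\<close>, whence the appeal to \<open>jump_functional_extends\<close>.\<close>

lemma Delta_mult:
  assumes \<delta>: "\<delta> \<in> Delta I" and m: "lsm m" "\<And>t. t \<in> I \<Longrightarrow> lm True m t = lm False m t"
  shows "mult_dist I m \<delta> \<in> Delta I"
proof -
  obtain c where c: "\<And>\<phi>. \<phi> \<in> test_fun_F I \<Longrightarrow> \<delta> \<phi> = (\<Sum>t | t \<in> I \<and> jump t \<phi> \<noteq> 0. c t * jump t \<phi>)"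
    using \<delta> unfolding Delta_def by auto
  have "mult_dist I m \<delta> \<phi> = (\<Sum>t | t \<in> I \<and> jump t \<phi> \<noteq> 0. (c t * lm True m t) * jump t \<phi>)"
    if F: "\<phi> \<in> test_fun_F I" for \<phi>
  proof -
    have \<phi>: "\<phi> \<in> test_fun I" by (rule test_fun_F_test_fun[OF F])
    have j: "jump t (\<lambda>s. m s * \<phi> s) = lm True m t * jump t \<phi>" if "t \<in> I" for t
      using jump_mult[OF lsm_lreg[OF m(1)] test_fun_lreg[OF \<phi>] that m(2)[OF that]] .
    have sub: "{t. t \<in> I \<and> jump t (\<lambda>s. m s * \<phi> s) \<noteq> 0} \<subseteq> {t. t \<in> I \<and> jump t \<phi> \<noteq> 0}"
      using j by auto
    have fin: "finite {t. t \<in> I \<and> jump t \<phi> \<noteq> 0}" using test_fun_F_finite_jumps[OF F] by simp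
    have "mult_dist I m \<delta> \<phi> = \<delta> (\<lambda>s. m s * \<phi> s)" using \<phi> by (simp add: mult_dist_def)
    also have "\<dots> = (\<Sum>t | t \<in> I \<and> jump t (\<lambda>s. m s * \<phi> s) \<noteq> 0. c t * jump t (\<lambda>s. m s * \<phi> s))"
    proof (rule jump_functional_extends[OF Delta_distrib[OF \<delta>] c test_fun_mult[OF m(1) \<phi>]])
      show "finite {t \<in> I. jump t (\<lambda>s. m s * \<phi> s) \<noteq> 0}" using finite_subset[OF sub fin] by simp
    qed
    also have "\<dots> = (\<Sum>t | t \<in> I \<and> jump t \<phi> \<noteq> 0. c t * jump t (\<lambda>s. m s * \<phi> s))"
      by (rule sum.mono_neutral_left[OF fin sub]) auto
    also have "\<dots> = (\<Sum>t | t \<in> I \<and> jump t \<phi> \<noteq> 0. (c t * lm True m t) * jump t \<phi>)"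
      by (rule sum.cong) (auto simp: j)
    finally show ?thesis .
  qed
  then show ?thesis unfolding Delta_def using distrib_mult[OF m(1) Delta_distrib[OF \<delta>]]
    by (auto intro!: exI[of _ "\<lambda>t. c t * lm True m t"])
qed

text \<open>For \<open>ddt\<close> alone the Leibniz rule is exact, by the product rule for test
  functions. The remaining part of \<open>h\<close> lies in \<open>Delta I\<close>, is multiplied by
  \<open>m\<close>, and stays there by \<open>Delta_mult\<close>.\<close>

lemma derivs_mult:
  assumes x: "x \<in> distrib I" and h: "h \<in> derivs I x"
    and m: "lsm m" "\<And>t. t \<in> I \<Longrightarrow> lm True m t = lm False m t" "lder m m'"
  shows "(\<lambda>\<phi>. mult_dist I m h \<phi> + mult_dist I m' x \<phi>) \<in> derivs I (mult_dist I m x)"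
proof -
  have m': "lsm m'" using sm_lder_unique m by blast
  define \<delta> where "\<delta> = (\<lambda>\<phi>. h \<phi> - ddt I x \<phi>)"
  have \<delta>: "\<delta> \<in> Delta I" using h unfolding derivs_iff \<delta>_def .
  have "mult_dist I m h \<phi> + mult_dist I m' x \<phi> - ddt I (mult_dist I m x) \<phi> = mult_dist I m \<delta> \<phi>" for \<phi>
  proof (cases "\<phi> \<in> test_fun I")
    case True
    let ?\<phi>' = "gderiv I \<phi>"
    have t: "(\<lambda>s. m' s * \<phi> s) \<in> test_fun I" "(\<lambda>s. m s * ?\<phi>' s) \<in> test_fun I" "(\<lambda>s. m s * \<phi> s) \<in> test_fun I"
      using test_fun_mult m m' True gderiv_test_fun by auto
    have "lder (\<lambda>s. m s * \<phi> s) (\<lambda>s. m' s * \<phi> s + m s * ?\<phi>' s)"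
      using lder_mult m True test_fun_gderiv test_fun_lreg lsm_lreg by blast
    then have "x (gderiv I (\<lambda>s. m s * \<phi> s)) = x (\<lambda>s. m' s * \<phi> s) + x (\<lambda>s. m s * ?\<phi>' s)"
      using distrib_gderiv[OF x t(3)] test_fun_add t(1,2) distrib_add[OF x] by simp
    then show ?thesis using True t gderiv_test_fun
      by (simp add: mult_dist_def ddt_def \<delta>_def)
  qed (simp add: mult_dist_def ddt_def)
  then show ?thesis unfolding derivs_iff using Delta_mult[OF \<delta> m(1,2)] by simp
qed

section \<open>Distributions vanishing before a point\<close>

definition before :: "real \<Rightarrow> dist \<Rightarrow> bool" where
  "before t\<^sub>0 y \<longleftrightarrow> (\<forall>\<phi>\<in>test_fun I. gsupp I \<phi> \<subseteq> I \<inter> {..<t\<^sub>0} \<longrightarrow> y \<phi> = 0)"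

lemma zero_before_iff: "zero_before I t\<^sub>0 f \<longleftrightarrow> (\<forall>i. before t\<^sub>0 (f $ i))"
  by (auto simp: zero_before_def before_def)

lemma van_gsupp:
  assumes "van c d \<phi>"
  shows "gsupp I \<phi> \<subseteq> I \<inter> {c..d}"
proof -
  have "{t\<in>I. llim \<phi> t \<noteq> 0 \<or> rlim \<phi> t \<noteq> 0} \<subseteq> {c..d}"
    using assms by (auto simp: van_def llim_eq_lm rlim_eq_lm)
  then have "closure {t\<in>I. llim \<phi> t \<noteq> 0 \<or> rlim \<phi> t \<noteq> 0} \<subseteq> {c..d}"
    by (rule closure_minimal) simp
  then show ?thesis by (auto simp: gsupp_def)
qed

lemma beforeD:
  assumes "before t\<^sub>0 y" "c \<in> I" "d \<in> I" "tst c d \<phi>" "d < t\<^sub>0"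
  shows "y \<phi> = 0"
  using assms van_gsupp[OF tst_van[OF assms(4)]] tst_test_fun_on(2)[OF assms(2-4)]
  unfolding before_def by fastforce

lemma point_before:
  assumes "t\<^sub>0 \<in> I" obtains u where "u \<in> I" "u < t\<^sub>0"
  by (rule compact_subset_segment[of "{t\<^sub>0}"]) (use assms that in auto)

text \<open>A compact subset of the smaller interval \<open>I \<inter> {..<t\<^sub>0}\<close> lies
  inside a segment of it, so the support keeps a positive distance from \<open>t\<^sub>0\<close>.
  For this the theory is instantiated at that interval.\<close>

lemma gsupp_before_tst:
  assumes "t\<^sub>0 \<in> I" "\<phi> \<in> test_fun I" "gsupp I \<phi> \<subseteq> I \<inter> {..<t\<^sub>0}"
  obtains c d where "c \<in> I" "d \<in> I" "c < d" "d < t\<^sub>0" "tst c d \<phi>"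
proof -
  have "open_interval (I \<inter> {..<t\<^sub>0})"
  proof
    show "open (I \<inter> {..<t\<^sub>0})" using open_I by auto
    show "is_interval (I \<inter> {..<t\<^sub>0})" 
      using interval_I unfolding is_interval_1 by fastforce
    show "I \<inter> {..<t\<^sub>0} \<noteq> {}" using point_before[OF assms(1)] by blast
  qed
  then interpret B: open_interval "I \<inter> {..<t\<^sub>0}" .
  have "compact (gsupp I \<phi>)" using assms(2) by (simp add: test_fun_def)
  from B.compact_subset_segment[OF this assms(3)] obtain c d where
    cd: "c \<in> I \<inter> {..<t\<^sub>0}" "d \<in> I \<inter> {..<t\<^sub>0}" "c < d" "gsupp I \<phi> \<subseteq> {c<..<d}" by metis
  have "van c d \<phi>" using cd(4) by (intro gsupp_van) auto
  then show ?thesis using that cd test_fun_lsm[OF assms(2)] by (auto simp: tst_def)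
qed

text \<open>The product of \<open>m - 1\<close> with \<open>\<phi>\<close> lives to the left of
  \<open>u\<close>, hence before \<open>t\<^sub>0\<close>; there the argument of \<open>y\<close>
  may be modified freely.\<close>

lemma before_heav:
  assumes y: "y \<in> distrib I" "before t\<^sub>0 y" and u: "u \<in> I" "u < t\<^sub>0" and \<phi>: "\<phi> \<in> test_fun I"
    and m: "lsm m" "\<And>s. u \<le> s \<Longrightarrow> m s = 1"
  shows "y (\<lambda>s. m s * \<phi> s) = y \<phi>"
proof -
  obtain c d where cd: "c \<in> I" "d \<in> I" "c < d" "tst c d \<phi>" using test_fun_tst[OF \<phi>] by metis
  have "tst (min c u) u (\<lambda>s. (m s - 1) * \<phi> s)"
  proof -
    have "lsm (\<lambda>s. (m s - 1) * \<phi> s)" by (intro lsm_mult lsm_diff m lsm_const tst_lsm[OF cd(4)])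
    moreover have "lm b (\<lambda>s. (m s - 1) * \<phi> s) t = 0" if t: "t \<in> I" "t \<notin> {min c u..u}" for t b
    proof (cases "t < u")
      case True
      then have "t \<notin> {c..d}" using t(2) by auto
      then have "lm b \<phi> t = 0" by (rule vanD[OF tst_van[OF cd(4)] t(1)])
      then show ?thesis using t m(1) \<phi> by (simp add: lm_mult lreg_diff lreg_const lsm_lreg test_fun_lreg)
    next
      case False
      then have "t \<in> {u<..}" using t by auto
      then have "\<forall>\<^sub>F s in es b t. s \<in> {u<..}" by (intro eventually_es_open) auto
      then have "\<forall>\<^sub>F s in es b t. (m s - 1) * \<phi> s = 0" by (rule eventually_mono) (use m(2) in auto)
      then show ?thesis by (intro lm_eq tendsto_eventually)
    qed
    ultimately show ?thesis by (simp add: tst_def van_def)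
  qed
  then have "y (\<lambda>s. (m s - 1) * \<phi> s) = 0"
    using beforeD[OF y(2) _ u(1) _ u(2)] cd(1) u(1) by (metis min_def)
  moreover have "y (\<lambda>s. (m s - 1) * \<phi> s) = y (\<lambda>s. m s * \<phi> s) - y \<phi>"
    using distrib_diff[OF y(1) test_fun_mult[OF m(1) \<phi>] \<phi>] by (simp add: left_diff_distrib)
  ultimately show ?thesis by simp
qed

section \<open>Existence and uniqueness of primitives\<close>

lemma distrib_linear_sum:
  assumes "f \<in> distrib I" "finite J" "\<And>j. j \<in> J \<Longrightarrow> \<rho> j \<in> test_fun I"
  shows "(\<lambda>s. \<Sum>j\<in>J. k j * \<rho> j s) \<in> test_fun I \<and> f (\<lambda>s. \<Sum>j\<in>J. k j * \<rho> j s) = (\<Sum>j\<in>J. k j * f (\<rho> j))"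
  using assms(2,3)
proof (induction J rule: finite_induct)
  case empty
  then show ?case using test_fun_zero distrib_cmult[OF assms(1) test_fun_zero, of 0] by simp
next
  case (insert j J)
  then have IH: "(\<lambda>s. \<Sum>j\<in>J. k j * \<rho> j s) \<in> test_fun I" "f (\<lambda>s. \<Sum>j\<in>J. k j * \<rho> j s) = (\<Sum>j\<in>J. k j * f (\<rho> j))"
    and j: "\<rho> j \<in> test_fun I" by auto
  then show ?case
    using insert(1,2) test_fun_add[OF test_fun_cmult[OF j] IH(1)]
      distrib_add[OF assms(1) test_fun_cmult[OF j] IH(1)] distrib_cmult[OF assms(1) j] by simp
qed

text \<open>\<open>\<phi>\<close> equals the antiderivative of its derivative up to a step function
  that carries its jumps; \<open>1 - heav \<tau>\<close> is 1 to the left of \<open>\<tau>\<close>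
  and 0 to the right. The discrepancy \<open>G\<close> has zero derivative and no jumps and vanishes
  far to the right, so the mean value inequality makes it 0.\<close>

lemma test_fun_jump_decomposition:
  assumes \<phi>: "\<phi> \<in> test_fun I" and fin: "finite J" and J: "J = {t\<in>I. jump t \<phi> \<noteq> 0}" and t: "t \<in> I"
  shows "lm b \<phi> t - tail (gderiv I \<phi>) t + (\<Sum>\<tau>\<in>J. jump \<tau> \<phi> * (1 - lm b (heav \<tau>) t)) = 0"
proof -
  define G where "G s = \<phi> s - tail (gderiv I \<phi>) s + (\<Sum>\<tau>\<in>J. jump \<tau> \<phi> * (1 - heav \<tau> s))" for s
  note \<phi>' = gderiv_test_fun[OF \<phi>]
  note regs = test_fun_lreg[OF \<phi>] tail_props(2)[OF \<phi>'] lreg_heav lreg_const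
  have G: "lreg G" unfolding G_def[abs_def]
    by (intro lreg_add lreg_diff lreg_sum lreg_cmult regs)
  have lG: "lm b G t = lm b \<phi> t - tail (gderiv I \<phi>) t + (\<Sum>\<tau>\<in>J. jump \<tau> \<phi> * (1 - lm b (heav \<tau>) t))"
    if "t \<in> I" for b t
    unfolding G_def[abs_def] using that
    by (simp add: lm_add lm_diff lm_sum lm_cmult lreg_sum lreg_cmult lreg_diff regs tail_props(3)[OF \<phi>'])
  have d: "lder G (\<lambda>_. 0)"
  proof -
    have "lder G (\<lambda>s. gderiv I \<phi> s - gderiv I \<phi> s + (\<Sum>\<tau>\<in>J. jump \<tau> \<phi> * (0 - 0)))"
      unfolding G_def[abs_def]
      by (intro lder_add lder_diff lder_sum lder_cmult lreg_diff lreg_sum lreg_cmult regs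
          lder_const lder_heav test_fun_gderiv \<phi> tail_props(4) \<phi>')
    then show ?thesis by simp
  qed
  have jf: "lm True G t = lm False G t" if "t \<in> I" for t
  proof -
    have "(\<Sum>\<tau>\<in>J. jump \<tau> \<phi> * (1 - lm True (heav \<tau>) t)) - (\<Sum>\<tau>\<in>J. jump \<tau> \<phi> * (1 - lm False (heav \<tau>) t)) =
        - (\<Sum>\<tau>\<in>J. jump \<tau> \<phi> * (lm True (heav \<tau>) t - lm False (heav \<tau>) t))"
      unfolding sum_subtractf[symmetric] sum_negf[symmetric] by (rule sum.cong) (simp_all add: algebra_simps)
    then have "lm True G t - lm False G t = jump t \<phi> - (\<Sum>\<tau>\<in>J. jump \<tau> \<phi> * (lm True (heav \<tau>) t - lm False (heav \<tau>) t))"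
      unfolding lG[OF that] jump_eq_lm[of t \<phi>] by algebra
    also have "(\<Sum>\<tau>\<in>J. jump \<tau> \<phi> * (lm True (heav \<tau>) t - lm False (heav \<tau>) t)) = (\<Sum>\<tau>\<in>J. if \<tau> = t then jump t \<phi> else 0)"
      by (rule sum.cong) (auto simp: lm_heav)
    also have "\<dots> = jump t \<phi>" using fin that by (auto simp: J)
    finally show ?thesis by simp
  qed
  obtain c d where cd: "c \<in> I" "d \<in> I" "c < d" "tst c d \<phi>" using test_fun_tst[OF \<phi>] by metis
  \<comment> \<open>A point to the right of the support and of \<open>t\<close>; at it every term of
    \<open>G\<close> vanishes.\<close>
  obtain e where e: "e \<in> I" "d < e" "t < e"
    by (rule compact_subset_segment[of "{d, t}"]) (use cd t that in auto)
  have "tst c d (gderiv I \<phi>)" using tst_gderiv cd by blast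
  then have "tail (gderiv I \<phi>) e = 0" using tail_eq(2)[OF tst_lreg tst_van cd(1,2) e(1)] cd e by simp
  moreover have "lm False \<phi> e = 0" using vanD[OF tst_van[OF cd(4)] e(1)] e by simp
  moreover have "\<tau> < e" if "\<tau> \<in> J" for \<tau>
  proof (rule ccontr)
    assume "\<not> \<tau> < e"
    then have "jump \<tau> \<phi> = 0" using vanD[OF tst_van[OF cd(4)], of \<tau>] that e J by (simp add: jump_eq_lm)
    then show False using that J by simp
  qed
  ultimately have "lm False G e = 0" using lG[OF e(1), of False] by (simp add: lm_heav)
  moreover have "norm (lm False G e - lm True G t) \<le> 0 * (e - t)"
  proof (rule mean_value_inequality[OF G d e(3) segment_subset[OF t e(1)]])
    show "lm True G s = lm False G s" if "t < s" "s < e" for s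
      by (rule jf) (use segment_subset[OF t e(1)] that in auto)
  qed simp
  ultimately have "lm True G t = 0" by simp
  then have "lm b G t = 0" using jf[OF t] by (cases b) auto
  then show ?thesis using lG[OF t] by simp
qed

text \<open>\<open>y\<close> is minus the transpose of \<open>tail_from u\<close> applied to
  \<open>h\<close>, the sign being that in the definition of \<open>ddt\<close>. The difference
  \<open>h \<phi> - ddt I y \<phi>\<close> is then \<open>h\<close> applied to \<open>heav u\<close>
  times \<open>\<phi> - tail (gderiv I \<phi>)\<close>, which the jump decomposition turns into a
  sum over the jumps of \<open>\<phi>\<close>.\<close>

lemma primitive_exists:
  assumes h: "h \<in> distrib I" "before t\<^sub>0 h" and t0: "t\<^sub>0 \<in> I"
  obtains y where "y \<in> distrib I" "h \<in> derivs I y" "before t\<^sub>0 y"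
proof -
  obtain u where u: "u \<in> I" "u < t\<^sub>0" using point_before[OF t0] .
  define y where "y = (\<lambda>\<psi>. - 1 * (if \<psi> \<in> test_fun I then h (tail_from u \<psi>) else 0))"
  have y: "y \<in> distrib I" unfolding y_def by (intro distrib_scale distrib_tail_from h u)
  have "before t\<^sub>0 y"
    unfolding before_def
  proof (intro ballI impI)
    fix \<phi> assume \<phi>: "\<phi> \<in> test_fun I" "gsupp I \<phi> \<subseteq> I \<inter> {..<t\<^sub>0}"
    obtain c d where cd: "c \<in> I" "d \<in> I" "c < d" "d < t\<^sub>0" "tst c d \<phi>"
      using gsupp_before_tst[OF t0 \<phi>] by metis
    have "tst u (max u d) (tail_from u \<phi>)" using cd u by (intro tst_tail_from) auto
    moreover have "max u d \<in> I" "max u d < t\<^sub>0" using cd(2,4) u by (auto simp: max_def)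
    ultimately have "h (tail_from u \<phi>) = 0" using beforeD[OF h(2) u(1)] by blast
    then show "y \<phi> = 0" by (simp add: y_def)
  qed
  moreover have "h \<in> derivs I y"
    unfolding derivs_iff Delta_def
  proof (intro CollectI conjI)
    show "(\<lambda>\<phi>. h \<phi> - ddt I y \<phi>) \<in> distrib I" by (intro distrib_minus h distrib_ddt y)
    \<comment> \<open>Indicator of the segment from \<open>u\<close> to \<open>\<tau>\<close>, the
      cut form of \<open>1 - heav \<tau>\<close>. Its value under \<open>- h\<close> is the
      coefficient at \<open>\<tau>\<close>.\<close>
    define \<rho> where "\<rho> \<tau> s = heav u s * (1 - heav \<tau> s)" for \<tau> s
    have \<rho>: "\<rho> \<tau> \<in> test_fun I" if "\<tau> \<in> I" for \<tau>
    proof (rule tst_test_fun_on(2)[of u "max u \<tau>"])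
      have "lsm (\<rho> \<tau>)" unfolding \<rho>_def[abs_def] by (intro lsm_mult lsm_diff lsm_heav lsm_const)
      moreover have "lm b (\<rho> \<tau>) t = 0" if "t \<in> I" "t \<notin> {u..max u \<tau>}" for t b
        unfolding \<rho>_def[abs_def] using that by (auto simp: lm_mult lm_diff lreg_heav lreg_diff lreg_const lm_heav)
      ultimately show "tst u (max u \<tau>) (\<rho> \<tau>)" by (simp add: tst_def van_def)
    qed (use u that in \<open>auto simp: max_def\<close>)
    show "\<exists>c. \<forall>\<phi>\<in>test_fun_F I. h \<phi> - ddt I y \<phi> = (\<Sum>t | t \<in> I \<and> jump t \<phi> \<noteq> 0. c t * jump t \<phi>)"
    proof (intro exI[of _ "\<lambda>t. - h (\<rho> t)"] ballI)
      fix \<phi> assume F: "\<phi> \<in> test_fun_F I"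
      have \<phi>: "\<phi> \<in> test_fun I" by (rule test_fun_F_test_fun[OF F])
      note \<phi>' = gderiv_test_fun[OF \<phi>]
      define J where "J = {t. t \<in> I \<and> jump t \<phi> \<noteq> 0}"
      have fin: "finite J" using test_fun_F_finite_jumps[OF F] by (simp add: J_def)
      have S: "(\<lambda>s. \<Sum>\<tau>\<in>J. (- jump \<tau> \<phi>) * \<rho> \<tau> s) \<in> test_fun I"
        "h (\<lambda>s. \<Sum>\<tau>\<in>J. (- jump \<tau> \<phi>) * \<rho> \<tau> s) = (\<Sum>\<tau>\<in>J. (- jump \<tau> \<phi>) * h (\<rho> \<tau>))"
        using distrib_linear_sum[OF h(1) fin, of \<rho> "\<lambda>\<tau>. - jump \<tau> \<phi>"] \<rho> by (auto simp: J_def)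
      have "h \<phi> - ddt I y \<phi> = h \<phi> - h (tail_from u (gderiv I \<phi>))"
        using \<phi> \<phi>' by (simp add: ddt_def y_def)
      \<comment> \<open>\<open>h\<close> does not see what happens to the left of \<open>u\<close>;
        after the cut both arguments carry the factor \<open>heav u\<close>.\<close>
      also have "\<dots> = h (\<lambda>s. heav u s * \<phi> s) - h (tail_from u (gderiv I \<phi>))"
        by (subst before_heav[OF h u \<phi> lsm_heav]) (simp_all add: heav_def)
      also have "h (\<lambda>s. heav u s * \<phi> s) - h (tail_from u (gderiv I \<phi>)) =
          h (\<lambda>s. heav u s * \<phi> s - tail_from u (gderiv I \<phi>) s)"
        using distrib_diff[OF h(1) test_fun_mult[OF lsm_heav \<phi>] tail_from_test_fun[OF u(1) \<phi>']] by simp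
      also have "\<dots> = h (\<lambda>s. \<Sum>\<tau>\<in>J. (- jump \<tau> \<phi>) * \<rho> \<tau> s)"
      proof (rule distrib_cong[OF h(1) _ S(1)])
        show "(\<lambda>s. heav u s * \<phi> s - tail_from u (gderiv I \<phi>) s) \<in> test_fun I"
          by (intro test_fun_diff test_fun_mult lsm_heav \<phi> tail_from_test_fun u \<phi>')
        fix t b assume t: "t \<in> I"
        have "lm b (\<lambda>s. heav u s * \<phi> s - tail_from u (gderiv I \<phi>) s) t =
            lm b (heav u) t * (lm b \<phi> t - tail (gderiv I \<phi>) t)"
          using t by (simp add: lm_diff lm_mult lreg_mult lreg_heav test_fun_lreg[OF \<phi>] lreg_tail_from[OF \<phi>']
              lm_tail_from[OF \<phi>'] right_diff_distrib)
        also have "lm b \<phi> t - tail (gderiv I \<phi>) t = - (\<Sum>\<tau>\<in>J. jump \<tau> \<phi> * (1 - lm b (heav \<tau>) t))"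
          using test_fun_jump_decomposition[OF \<phi> fin _ t, of b] by (simp add: J_def add_eq_0_iff)
        also have "lm b (heav u) t * \<dots> = (\<Sum>\<tau>\<in>J. (- jump \<tau> \<phi>) * (lm b (heav u) t * (1 - lm b (heav \<tau>) t)))"
          by (simp add: sum_distrib_left sum_negf[symmetric] mult_ac)
        also have "\<dots> = lm b (\<lambda>s. \<Sum>\<tau>\<in>J. (- jump \<tau> \<phi>) * \<rho> \<tau> s) t"
          unfolding \<rho>_def using t
          by (subst lm_sum) (auto intro!: lreg_cmult lreg_uminus lreg_mult lreg_heav lreg_diff lreg_const
              simp: lm_cmult lm_mult lm_diff lm_uminus lreg_mult lreg_diff lreg_heav lreg_const lreg_cmult)
        finally show "lm b (\<lambda>s. heav u s * \<phi> s - tail_from u (gderiv I \<phi>) s) t = lm b (\<lambda>s. \<Sum>\<tau>\<in>J. (- jump \<tau> \<phi>) * \<rho> \<tau> s) t" .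
      qed
      finally show "h \<phi> - ddt I y \<phi> = (\<Sum>t | t \<in> I \<and> jump t \<phi> \<noteq> 0. - h (\<rho> t) * jump t \<phi>)"
        using S(2) by (simp add: J_def mult.commute)
    qed
  qed
  ultimately show ?thesis using that y by blast
qed

text \<open>The product \<open>\<phi>\<close> of a ramp \<open>r\<close> with
  \<open>tail \<psi>\<close> is continuous, so the jump formula makes \<open>y\<close> vanish on its
  derivative. That derivative is \<open>r * \<psi>\<close>, on which \<open>y\<close> takes the
  value \<open>y \<psi>\<close>, plus a term supported in \<open>{u..v}\<close>, hence before
  \<open>t\<^sub>0\<close>.\<close>

lemma primitive_zero_unique:
  assumes y: "y \<in> distrib I" "before t\<^sub>0 y" and t0: "t\<^sub>0 \<in> I" and d: "(\<lambda>_. 0) \<in> derivs I y"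
  shows "y = (\<lambda>_. 0)"
proof
  fix \<psi>
  show "y \<psi> = 0"
  proof (cases "\<psi> \<in> test_fun I")
    case True
    obtain v where v: "v \<in> I" "v < t\<^sub>0" using point_before[OF t0] .
    obtain u where u: "u \<in> I" "u < v" using point_before[OF v(1)] .
    define k where "k = 1 / complex_of_real (v - u)"
    \<comment> \<open>A continuous ramp from 0 at \<open>u\<close> to 1 at \<open>v\<close>. A step
      in its place could give \<open>\<phi>\<close> a jump, and then an unknown coefficient would
      enter.\<close>
    define r where "r s = k * ((of_real s - of_real u) * heav u s - (of_real s - of_real v) * heav v s)" for s
    define r' where "r' s = k * (heav u s - heav v s)" for s
    note lid = sm_lreg[OF sm_of_real]
    have lm_id: "lm b of_real t = of_real t" if "t \<in> I" for b t
      using that by (intro lreg_continuous(2) continuous_intros)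
    have dr: "lder r r'"
    proof -
      have "lder r (\<lambda>s. k * (((1 - 0) * heav u s + (of_real s - of_real u) * 0) - ((1 - 0) * heav v s + (of_real s - of_real v) * 0)))"
        unfolding r_def[abs_def]
        by (intro lder_cmult lder_diff lder_mult lder_heav lder_of_real lder_const lreg_diff lreg_mult lid lreg_const lreg_heav)
      then show ?thesis by (simp add: r'_def[abs_def])
    qed
    have r: "lsm r" unfolding r_def[abs_def]
      by (intro sm_cmult sm_diff sm_mult lsm_heav sm_imp_lsm[OF sm_of_real] sm_const)
    have lr: "lm b r t = k * ((of_real t - of_real u) * lm b (heav u) t - (of_real t - of_real v) * lm b (heav v) t)"
      if "t \<in> I" for b t
      unfolding r_def[abs_def] using that
      by (simp add: lm_cmult lm_diff lm_mult lreg_diff lreg_mult lid lreg_const lreg_heav lm_id)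
    have jr: "lm True r t = lm False r t" if "t \<in> I" for t
      using that by (cases "t = u \<or> t = v") (auto simp: lr lm_heav)
    have r1: "r s = 1" if "v \<le> s" for s
    proof -
      have "r s = k * complex_of_real (v - u)" using that u(2) by (simp add: r_def heav_def)
      then show ?thesis using u(2) by (simp add: k_def flip: of_real_diff)
    qed
    obtain c d where cd: "c \<in> I" "d \<in> I" "c < d" "tst c d \<psi>" using test_fun_tst[OF True] by metis
    have tl: "tail \<psi> t = 0" if "t \<in> I" "d \<le> t" for t
      using tail_eq(2)[OF tst_lreg[OF cd(4)] tst_van[OF cd(4)] cd(1,2) that(1)] that(2) cd(3) by simp
    define \<phi> where "\<phi> s = r s * tail \<psi> s" for s
    have d\<phi>: "lder \<phi> (\<lambda>s. r' s * tail \<psi> s + r s * \<psi> s)"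
      unfolding \<phi>_def[abs_def] by (intro lder_mult dr tail_props True lsm_lreg r)
    have l\<phi>: "lreg \<phi>" "\<And>t b. t \<in> I \<Longrightarrow> lm b \<phi> t = lm b r t * tail \<psi> t"
      using lreg_mult[OF lsm_lreg[OF r] tail_props(2)[OF True]] lm_mult[OF lsm_lreg[OF r] tail_props(2)[OF True]]
        tail_props(3)[OF True] by (simp_all add: \<phi>_def[abs_def])
    have stl: "lsm (tail \<psi>)"
      by (rule lsmI[OF tail_props(2,4)[OF True] test_fun_lsm[OF True]])
    have "tst u (max u d) \<phi>"
      unfolding tst_def van_def
    proof (intro conjI ballI allI impI)
      show "lsm \<phi>" unfolding \<phi>_def[abs_def] by (rule lsm_mult[OF r stl])
      fix t b assume "t \<in> I" "t \<notin> {u..max u d}"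
      then show "lm b \<phi> t = 0" using u(2) tl by (auto simp: l\<phi> lr lm_heav)
    qed
    then have \<phi>: "\<phi> \<in> test_fun I" using u cd by (intro tst_test_fun_on(2)) (auto simp: max_def)
    have "(\<lambda>\<phi>. 0 - ddt I y \<phi>) \<in> Delta I" using d unfolding derivs_iff .
    then obtain c' where "\<And>\<phi>. \<phi> \<in> test_fun_F I \<Longrightarrow> 0 - ddt I y \<phi> = (\<Sum>t | t \<in> I \<and> jump t \<phi> \<noteq> 0. c' t * jump t \<phi>)"
      and D: "(\<lambda>\<phi>. 0 - ddt I y \<phi>) \<in> distrib I"
      unfolding Delta_def by auto
    moreover have j\<phi>: "{t. t \<in> I \<and> jump t \<phi> \<noteq> 0} = {}" using jr by (auto simp: jump_eq_lm l\<phi>)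
    moreover from this have "finite {t \<in> I. jump t \<phi> \<noteq> 0}" by (metis finite.emptyI)
    \<comment> \<open>As \<open>\<psi>\<close> is arbitrary, \<open>\<phi>\<close> may lie outside
      \<open>test_fun_F I\<close>; the extended jump formula still applies, with an empty
      sum.\<close>
    ultimately have "0 - ddt I y \<phi> = (\<Sum>t | t \<in> I \<and> jump t \<phi> \<noteq> 0. c' t * jump t \<phi>)"
      using jump_functional_extends[OF D _ \<phi>, of c'] by blast
    then have "y (gderiv I \<phi>) = 0" using \<phi> unfolding j\<phi> by (simp add: ddt_def)
    moreover have 1: "tst u v (\<lambda>s. r' s * tail \<psi> s)"
      unfolding tst_def van_def
    proof (intro conjI ballI allI impI)
      show "lsm (\<lambda>s. r' s * tail \<psi> s)" unfolding r'_def
        by (intro sm_mult sm_const sm_diff lsm_heav stl)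
      fix t b assume "t \<in> I" "t \<notin> {u..v}"
      then show "lm b (\<lambda>s. r' s * tail \<psi> s) t = 0" unfolding r'_def using u(2)
        by (auto simp: lm_mult lm_cmult lm_diff lreg_cmult lreg_mult lreg_diff lreg_heav lreg_const tail_props[OF True] lm_heav)
    qed
    then have "y (\<lambda>s. r' s * tail \<psi> s) = 0" using beforeD[OF y(2) u(1) v(1) _ v(2)] by blast
    moreover have t: "(\<lambda>s. r' s * tail \<psi> s) \<in> test_fun I" "(\<lambda>s. r s * \<psi> s) \<in> test_fun I"
      using tst_test_fun_on(2)[OF u(1) v(1) 1] test_fun_mult[OF r True] by auto
    ultimately have "y (\<lambda>s. r s * \<psi> s) = 0"
      using distrib_gderiv[OF y(1) \<phi> d\<phi> test_fun_add[OF t]] distrib_add[OF y(1) t] by simp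
    then show ?thesis using before_heav[OF y v True r r1] by simp
  qed (rule distrib_off[OF y(1)])
qed

lemma primitive_unique:
  assumes "y \<in> distrib I" "before t\<^sub>0 y" "h \<in> derivs I y" "z \<in> distrib I" "before t\<^sub>0 z" "h \<in> derivs I z" "t\<^sub>0 \<in> I"
  shows "y = z"
proof -
  have "(\<lambda>\<phi>. y \<phi> - z \<phi>) = (\<lambda>_. 0)"
  proof (rule primitive_zero_unique[OF _ _ assms(7)])
    show "before t\<^sub>0 (\<lambda>\<phi>. y \<phi> - z \<phi>)" using assms(2,5) by (auto simp: before_def)
    show "(\<lambda>_. 0) \<in> derivs I (\<lambda>\<phi>. y \<phi> - z \<phi>)" using derivs_diff[OF assms(3,6)] by simp
  qed (intro distrib_minus assms)
  then show ?thesis by (auto simp: fun_eq_iff)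
qed

end

section \<open>Absolutely continuous functions\<close>

lemma abs_cont_on_imp_continuous_on:
  assumes "abs_cont_on S X"
  shows "continuous_on S X"
  unfolding continuous_on_iff
proof (intro ballI allI impI)
  fix x and e :: real assume x: "x \<in> S" and e: "e > 0"
  obtain d where d: "d > 0" and D: "\<And>(m::nat) u v. (\<forall>i<m. u i \<in> S \<and> v i \<in> S \<and> u i \<le> v i) \<and>
     disjoint_family_on (\<lambda>i. {u i<..<v i}) {..<m} \<and> (\<Sum>i<m. v i - u i) < d
     \<Longrightarrow> (\<Sum>i<m. dist (X (u i)) (X (v i))) < e"
    using assms e unfolding abs_cont_on_def by blast
  have "dist (X x') (X x) < e" if "x' \<in> S" "dist x' x < d" for x'
    using D[of 1 "\<lambda>_. min x x'" "\<lambda>_. max x x'"] that x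
    by (cases "x \<le> x'") (auto simp: disjoint_family_on_def dist_real_def min_def max_def dist_commute)
  then show "\<exists>d>0. \<forall>x'\<in>S. dist x' x < d \<longrightarrow> dist (X x') (X x) < e" using d by blast
qed

lemma sum_lessThan_append:
  fixes F :: "nat \<Rightarrow> 'a::comm_monoid_add"
  shows "(\<Sum>i<m + n. F i) = (\<Sum>i<m. F i) + (\<Sum>i<n. F (m + i))"
  by (induction n) (auto simp: add.assoc)

text \<open>Chain intervals together (Bolzano): a point of the exceptional null set is covered by an
  interval inside an open set \<open>U\<close> of small measure, whose contribution is controlled by absolute
  continuity; at any other point the derivative bounds the increment.\<close>

lemma abs_cont_increment_bound:
  fixes g :: "real \<Rightarrow> 'a::real_normed_vector"
  assumes ac: "abs_cont_on {c..d} g" and "c \<le> d" and e: "e \<ge> 0"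
    and AE: "AE s in lebesgue. c < s \<longrightarrow> s < d \<longrightarrow> (\<exists>h. (g has_vector_derivative h) (at s) \<and> norm h \<le> e)"
  shows "norm (g d - g c) \<le> e * (d - c)"
proof -
  have "norm (g d - g c) \<le> (e + \<eta>) * (d - c) + \<eta>" if \<eta>: "\<eta> > 0" for \<eta>
  proof -
    obtain \<delta> where \<delta>: "\<delta> > 0" and D: "\<And>(m::nat) u v. (\<forall>i<m. u i \<in> {c..d} \<and> v i \<in> {c..d} \<and> u i \<le> v i) \<and>
       disjoint_family_on (\<lambda>i. {u i<..<v i}) {..<m} \<and> (\<Sum>i<m. v i - u i) < \<delta>
       \<Longrightarrow> (\<Sum>i<m. dist (g (u i)) (g (v i))) < \<eta>"
      using ac \<eta> unfolding abs_cont_on_def by blast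
    obtain N0 where N0: "N0 \<in> null_sets lebesgue"
      "\<And>s. c < s \<Longrightarrow> s < d \<Longrightarrow> s \<notin> N0 \<Longrightarrow> \<exists>h. (g has_vector_derivative h) (at s) \<and> norm h \<le> e"
      using AE unfolding eventually_ae_filter by force
    \<comment> \<open>The ends join the exceptional set because differentiability is known only
      strictly inside.\<close>
    define N where "N = N0 \<union> {c, d}"
    have N: "N \<in> null_sets lebesgue" unfolding N_def
      using N0(1) by (intro null_sets.Un) (auto intro: finite_imp_null_set_lborel null_sets_completionI)
    obtain U where U: "open U" "N \<subseteq> U" "(U - N) \<in> lmeasurable" "emeasure lebesgue (U - N) < ennreal \<delta>"
      using sets_lebesgue_outer_open[of N \<delta>] N \<delta> by auto
    have mU: "emeasure lebesgue U < ennreal \<delta>"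
    proof -
      have "emeasure lebesgue U = emeasure lebesgue (U - N)"
        using emeasure_Diff_null_set[OF N, of U] U(1) by (simp add: borel_open)
      then show ?thesis using U(4) by simp
    qed
    \<comment> \<open>Next to the increment bound, \<open>P\<close> records finitely many disjoint
      intervals inside \<open>U\<close> carrying the part that the derivative does not control.
      Absolute continuity is applied once, to the final family, so its error does not
      accumulate.\<close>
    define P where "P u v \<longleftrightarrow> (c \<le> u \<and> u \<le> v \<and> v \<le> d \<longrightarrow> (\<exists>(m::nat) a b.
      (\<forall>i<m. u \<le> a i \<and> a i \<le> b i \<and> b i \<le> v \<and> {a i<..<b i} \<subseteq> U) \<and>
      disjoint_family_on (\<lambda>i. {a i<..<b i}) {..<m} \<and>
      norm (g v - g u) \<le> (e + \<eta>) * (v - u) + (\<Sum>i<m. dist (g (a i)) (g (b i)))))" for u v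
    from \<open>c \<le> d\<close> have "P c d"
    proof (induction rule: Bolzano)
      case (trans u v w)
      show ?case unfolding P_def
      proof (intro impI)
        assume uw: "c \<le> u \<and> u \<le> w \<and> w \<le> d"
        then have uv: "c \<le> u \<and> u \<le> v \<and> v \<le> d" and vw: "c \<le> v \<and> v \<le> w \<and> w \<le> d"
          using trans(3,4) by auto
        obtain m a b where 1: "\<forall>i<m. u \<le> a i \<and> a i \<le> b i \<and> b i \<le> v \<and> {a i<..<b i} \<subseteq> U"
          "disjoint_family_on (\<lambda>i. {a i<..<b i}) {..<m::nat}"
          "norm (g v - g u) \<le> (e + \<eta>) * (v - u) + (\<Sum>i<m. dist (g (a i)) (g (b i)))"
          using trans(1)[unfolded P_def, rule_format, OF uv] by blast
        obtain n a' b' where 2: "\<forall>i<n. v \<le> a' i \<and> a' i \<le> b' i \<and> b' i \<le> w \<and> {a' i<..<b' i} \<subseteq> U"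
          "disjoint_family_on (\<lambda>i. {a' i<..<b' i}) {..<n::nat}"
          "norm (g w - g v) \<le> (e + \<eta>) * (w - v) + (\<Sum>i<n. dist (g (a' i)) (g (b' i)))"
          using trans(2)[unfolded P_def, rule_format, OF vw] by blast
        \<comment> \<open>Concatenation of the two families, which the cut \<open>v\<close>
          separates.\<close>
        define A where "A i = (if i < m then a i else a' (i - m))" for i
        define B where "B i = (if i < m then b i else b' (i - m))" for i
        have "\<forall>i<m + n. u \<le> A i \<and> A i \<le> B i \<and> B i \<le> w \<and> {A i<..<B i} \<subseteq> U"
        proof (intro allI impI)
          fix i assume "i < m + n"
          then show "u \<le> A i \<and> A i \<le> B i \<and> B i \<le> w \<and> {A i<..<B i} \<subseteq> U"
            using 1(1)[rule_format, of i] 2(1)[rule_format, of "i - m"] trans(3,4)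
              less_diff_conv2[of m i n]
            by (cases "i < m") (auto simp: A_def B_def)
        qed
        moreover have "{A i<..<B i} \<inter> {A j<..<B j} = {}" if "i < m + n" "j < m + n" "i < j" for i j
        proof -
          consider "j < m" | "i < m" "m \<le> j" | "m \<le> i" by linarith
          then show ?thesis
          proof cases
            case 1
            then show ?thesis using \<open>disjoint_family_on (\<lambda>i. {a i<..<b i}) {..<m}\<close> that
              by (auto simp: A_def B_def disjoint_family_on_def)
          next
            case 2
            then have "B i \<le> v" "v \<le> A j"
              using 1(1)[rule_format, of i] \<open>\<forall>i<n. v \<le> a' i \<and> _\<close>[rule_format, of "j - m"] that
              by (auto simp: A_def B_def)
            then show ?thesis by auto
          next
            case 3
            then have "i - m \<in> {..<n}" "j - m \<in> {..<n}" "i - m \<noteq> j - m" using that by auto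
            then have "{a' (i - m)<..<b' (i - m)} \<inter> {a' (j - m)<..<b' (j - m)} = {}"
              using 2(2) unfolding disjoint_family_on_def by blast
            then show ?thesis using 3 that by (simp add: A_def B_def)
          qed
        qed
        then have "disjoint_family_on (\<lambda>i. {A i<..<B i}) {..<m + n}"
          unfolding disjoint_family_on_def by (metis Int_commute lessThan_iff linorder_neqE_nat)
        moreover have "norm (g w - g u) \<le> (e + \<eta>) * (w - u) + (\<Sum>i<m + n. dist (g (A i)) (g (B i)))"
        proof -
          have "norm (g w - g u) \<le> norm (g w - g v) + norm (g v - g u)"
            using norm_triangle_ineq[of "g w - g v" "g v - g u"] by simp
          moreover have "(\<Sum>i<m + n. dist (g (A i)) (g (B i))) =
              (\<Sum>i<m. dist (g (a i)) (g (b i))) + (\<Sum>i<n. dist (g (a' i)) (g (b' i)))"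
            unfolding sum_lessThan_append by (simp add: A_def B_def)
          ultimately show ?thesis using 1(3) 2(3) by (simp add: algebra_simps)
        qed
        ultimately show "\<exists>(m::nat) a b. (\<forall>i<m. u \<le> a i \<and> a i \<le> b i \<and> b i \<le> w \<and> {a i<..<b i} \<subseteq> U) \<and>
            disjoint_family_on (\<lambda>i. {a i<..<b i}) {..<m} \<and>
            norm (g w - g u) \<le> (e + \<eta>) * (w - u) + (\<Sum>i<m. dist (g (a i)) (g (b i)))" by blast
      qed
    next
      case (local x)
      show ?case
      proof (cases "x \<in> U")
        case True
        then obtain r where r: "r > 0" "ball x r \<subseteq> U" using U(1) openE by blast
        show ?thesis
        proof (intro exI[of _ r] conjI allI impI)
          fix u v assume uv: "u \<le> x \<and> x \<le> v \<and> v - u < r"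
          then have "{u<..<v} \<subseteq> ball x r" by (auto simp: dist_real_def)
          then have "{u<..<v} \<subseteq> U" using r(2) by blast
          moreover have "norm (g v - g u) \<le> (e + \<eta>) * (v - u) + dist (g u) (g v)"
            using uv e \<eta> by (simp add: dist_norm norm_minus_commute)
          ultimately show "P u v" unfolding P_def
            by (intro impI exI[of _ 1] exI[of _ "\<lambda>_. u"] exI[of _ "\<lambda>_. v"]) (auto simp: disjoint_family_on_def)
        qed (rule r)
      next
        case False
        then have "x \<notin> N" using U(2) by blast
        then have "c < x" "x < d" "x \<notin> N0" using local by (auto simp: N_def)
        then obtain h where h: "(g has_vector_derivative h) (at x)" "norm h \<le> e" using N0(2) by blast
        have "\<exists>r>0. \<forall>y. norm (y - x) < r \<longrightarrow> norm (g y - g x - (y - x) *\<^sub>R h) \<le> \<eta> * norm (y - x)"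
          using h(1) \<eta> unfolding has_vector_derivative_def has_derivative_at_alt by blast
        then obtain r where r: "r > 0" "\<And>y. \<bar>y - x\<bar> < r \<Longrightarrow> norm (g y - g x - (y - x) *\<^sub>R h) \<le> \<eta> * \<bar>y - x\<bar>"
          by auto
        have b: "norm (g y - g x) \<le> (e + \<eta>) * \<bar>y - x\<bar>" if "\<bar>y - x\<bar> < r" for y
        proof -
          have "norm (g y - g x) \<le> norm (g y - g x - (y - x) *\<^sub>R h) + norm ((y - x) *\<^sub>R h)"
            using norm_triangle_ineq[of "g y - g x - (y - x) *\<^sub>R h" "(y - x) *\<^sub>R h"] by simp
          also have "\<dots> \<le> \<eta> * \<bar>y - x\<bar> + \<bar>y - x\<bar> * e"
            using r(2)[OF that] h(2) by (intro add_mono) (auto intro: mult_left_mono)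
          finally show ?thesis by (simp add: algebra_simps)
        qed
        show ?thesis
        proof (intro exI[of _ r] conjI allI impI)
          fix u v assume uv: "u \<le> x \<and> x \<le> v \<and> v - u < r"
          have "norm (g v - g u) \<le> norm (g v - g x) + norm (g u - g x)"
            using norm_triangle_ineq4[of "g v - g x" "g u - g x"] by simp
          also have "\<dots> \<le> (e + \<eta>) * \<bar>v - x\<bar> + (e + \<eta>) * \<bar>u - x\<bar>"
            using uv by (intro add_mono b) auto
          also have "\<dots> = (e + \<eta>) * (v - u)" using uv by (simp add: algebra_simps)
          finally show "P u v" unfolding P_def
            by (intro impI exI[of _ 0]) (auto simp: disjoint_family_on_def)
        qed (rule r)
      qed
    qed
    then obtain m a b where 1: "\<forall>i<m. c \<le> a i \<and> a i \<le> b i \<and> b i \<le> d \<and> {a i<..<b i} \<subseteq> U"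
      "disjoint_family_on (\<lambda>i. {a i<..<b i}) {..<m::nat}"
      "norm (g d - g c) \<le> (e + \<eta>) * (d - c) + (\<Sum>i<m. dist (g (a i)) (g (b i)))"
      using \<open>c \<le> d\<close> unfolding P_def by auto
    \<comment> \<open>Disjoint intervals inside \<open>U\<close> have total length below
      \<open>\<delta>\<close>.\<close>
    have "ennreal (\<Sum>i<m. b i - a i) = (\<Sum>i<m. emeasure lebesgue {a i<..<b i})"
      using 1(1) by (subst sum_ennreal[symmetric]) auto
    also have "\<dots> = emeasure lebesgue (\<Union>i<m. {a i<..<b i})"
      by (rule sum_emeasure[OF _ 1(2)]) auto
    also have "\<dots> \<le> emeasure lebesgue U"
      using 1(1) U(1) by (intro emeasure_mono) (auto simp: borel_open)
    also have "\<dots> < ennreal \<delta>" by (rule mU)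
    finally have "ennreal (\<Sum>i<m. b i - a i) < ennreal \<delta>" .
    moreover have "0 \<le> (\<Sum>i<m. b i - a i)" using 1(1) by (intro sum_nonneg) auto
    ultimately have "(\<Sum>i<m. b i - a i) < \<delta>" by (simp add: ennreal_less_iff)
    then have "(\<Sum>i<m. dist (g (a i)) (g (b i))) < \<eta>" using 1 by (intro D) auto
    then show ?thesis using 1(3) by linarith
  qed
  then have *: "norm (g d - g c) \<le> e * (d - c) + \<eta> * (d - c + 1)" if "\<eta> > 0" for \<eta>
    using that by (fastforce simp: algebra_simps)
  show ?thesis
  proof (rule field_le_epsilon)
    fix r :: real assume "r > 0"
    then have "norm (g d - g c) \<le> e * (d - c) + r / (d - c + 1) * (d - c + 1)"
      using \<open>c \<le> d\<close> by (intro *) auto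
    then show "norm (g d - g c) \<le> e * (d - c) + r" using \<open>c \<le> d\<close> by simp
  qed
qed

text \<open>Lets the increment bound be applied to \<open>g\<close> minus a linear function of slope
  \<open>l\<close>, whose derivative is close to 0 where that of \<open>g\<close> is close to
  \<open>l\<close>.\<close>

lemma abs_cont_on_diff_linear:
  assumes "abs_cont_on S g"
  shows "abs_cont_on S (\<lambda>s. g s - complex_of_real s * l)"
  unfolding abs_cont_on_def
proof (intro allI impI)
  fix e :: real assume e: "e > 0"
  obtain d where d: "d > 0" and D: "\<And>(m::nat) u v. (\<forall>i<m. u i \<in> S \<and> v i \<in> S \<and> u i \<le> v i) \<and>
     disjoint_family_on (\<lambda>i. {u i<..<v i}) {..<m} \<and> (\<Sum>i<m. v i - u i) < d
     \<Longrightarrow> (\<Sum>i<m. dist (g (u i)) (g (v i))) < e / 2"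
    using assms[unfolded abs_cont_on_def, rule_format, of "e / 2"] e by auto
  \<comment> \<open>Half of \<open>e\<close> pays for \<open>g\<close> and half for the linear term;
    the added 1 excludes division by 0 when \<open>l = 0\<close>.\<close>
  define d' where "d' = min d (e / (2 * (norm l + 1)))"
  have l: "norm l + 1 > 0" by (simp add: add_nonneg_pos)
  have "d' > 0" using d e l by (simp add: d'_def)
  moreover have "(\<Sum>i<m. dist (g (u i) - of_real (u i) * l) (g (v i) - of_real (v i) * l)) < e"
    if A: "(\<forall>i<m. u i \<in> S \<and> v i \<in> S \<and> u i \<le> v i) \<and>
      disjoint_family_on (\<lambda>i. {u i<..<v i}) {..<m} \<and> (\<Sum>i<m. v i - u i) < d'" for m :: nat and u v
  proof -
    have "(\<Sum>i<m. dist (g (u i) - of_real (u i) * l) (g (v i) - of_real (v i) * l))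
        \<le> (\<Sum>i<m. dist (g (u i)) (g (v i)) + (v i - u i) * norm l)"
    proof (rule sum_mono)
      fix i assume i: "i \<in> {..<m}"
      have "norm (of_real (v i - u i) * l) = (v i - u i) * norm l" using A i by (simp add: norm_mult del: of_real_diff)
      moreover have "(g (u i) - of_real (u i) * l) - (g (v i) - of_real (v i) * l) =
          (g (u i) - g (v i)) + of_real (v i - u i) * l" by (simp add: algebra_simps)
      ultimately show "dist (g (u i) - of_real (u i) * l) (g (v i) - of_real (v i) * l) \<le>
          dist (g (u i)) (g (v i)) + (v i - u i) * norm l"
        by (metis dist_norm norm_triangle_ineq)
    qed
    also have "\<dots> = (\<Sum>i<m. dist (g (u i)) (g (v i))) + (\<Sum>i<m. v i - u i) * norm l"
      by (simp add: sum.distrib sum_distrib_right)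
    also have "\<dots> < e / 2 + e / 2"
    proof (rule add_less_le_mono)
      show "(\<Sum>i<m. dist (g (u i)) (g (v i))) < e / 2" using A by (intro D) (auto simp: d'_def)
      have "(\<Sum>i<m. v i - u i) * norm l \<le> (e / (2 * (norm l + 1))) * norm l"
        using A by (intro mult_right_mono) (auto simp: d'_def)
      also have "\<dots> \<le> e / 2" using e l by (simp add: field_simps)
      finally show "(\<Sum>i<m. v i - u i) * norm l \<le> e / 2" .
    qed
    finally show ?thesis by simp
  qed
  ultimately show "\<exists>d>0. \<forall>(m::nat) u v. (\<forall>i<m. u i \<in> S \<and> v i \<in> S \<and> u i \<le> v i) \<and>
     disjoint_family_on (\<lambda>i. {u i<..<v i}) {..<m} \<and> (\<Sum>i<m. v i - u i) < d
     \<longrightarrow> (\<Sum>i<m. dist (g (u i) - of_real (u i) * l) (g (v i) - of_real (v i) * l)) < e" by blast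
qed

context open_interval
begin

text \<open>From almost everywhere to every point: close to \<open>t\<close> on side
  \<open>b\<close> the derivative is within \<open>e / 2\<close> of \<open>lm b h t\<close> almost
  everywhere, and absolute continuity turns this into a bound for the increments of \<open>g\<close>
  minus the line of slope \<open>lm b h t\<close>.\<close>

lemma lder_abs_cont:
  assumes ac: "\<And>c d. {c..d} \<subseteq> I \<Longrightarrow> abs_cont_on {c..d} g"
    and AE: "AE t in lebesgue_on I. (g has_vector_derivative h t) (at t)"
    and h: "lreg h"
  shows "lder g h"
proof (rule lderI[OF h])
  fix t b assume t: "t \<in> I"
  have "isCont g t"
  proof -
    obtain c d where cd: "c \<in> I" "d \<in> I" "c < t" "t < d"
      by (rule compact_subset_segment[of "{t}"]) (use t in auto)
    have "continuous_on {c..d} g" using abs_cont_on_imp_continuous_on ac segment_subset cd by blast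
    then show ?thesis using cd continuous_on_interior[of "{c..d}" g t] by simp
  qed
  then have gt: "lm b g t = g t" using tendsto_es_continuous lm_eq by blast
  show "((\<lambda>s. (g s - lm b g t) / of_real (s - t)) \<longlongrightarrow> lm b h t) (es b t)"
    unfolding gt
  proof (rule tendstoI)
    fix e :: real assume e: "e > 0"
    let ?l = "lm b h t"
    have "\<forall>\<^sub>F s in es b t. dist (h s) ?l < e / 2"
      using e by (intro tendstoD[OF lreg_tendsto[OF h t]]) simp
    then obtain r where r: "r > 0" "AE s in lebesgue. s \<in> side b t r \<longrightarrow> dist (h s) ?l < e / 2"
      unfolding eventually_es by blast
    have "\<forall>\<^sub>F s in es b t. s \<in> side b t r \<and> s \<in> I"
      using eventually_es_side[OF r(1)] eventually_es_open[OF open_I t] by (auto intro: eventually_conj)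
    then show "\<forall>\<^sub>F s in es b t. dist ((g s - g t) / of_real (s - t)) ?l < e"
    proof eventually_elim
      case (elim s)
      have st: "s \<noteq> t" using elim by (auto simp: side_def split: if_splits)
      define c d where "c = min s t" and "d = max s t"
      have "c \<in> I" "d \<in> I" using elim t by (auto simp: c_def d_def min_def max_def)
      then have cd: "c \<le> d" "{c..d} \<subseteq> I" using segment_subset by (auto simp: c_def d_def)
      define G where "G s = g s - of_real s * ?l" for s
      have "AE q in lebesgue. q \<in> I \<longrightarrow> (g has_vector_derivative h q) (at q)" using AE by (simp add: AE_I_iff)
      then have "AE q in lebesgue. c < q \<longrightarrow> q < d \<longrightarrow> (\<exists>h. (G has_vector_derivative h) (at q) \<and> norm h \<le> e / 2)"
        using r(2)
      proof eventually_elim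
        case (elim q)
        show ?case
        proof (intro impI exI conjI)
          assume q: "c < q" "q < d"
          then have "q \<in> side b t r" using \<open>s \<in> side b t r \<and> s \<in> I\<close>
            by (auto simp: c_def d_def side_def min_def max_def split: if_splits)
          then show "norm (h q - 1 * ?l) \<le> e / 2" using elim by (simp add: dist_norm)
          have "q \<in> I" using q cd by auto
          then have "(g has_vector_derivative h q) (at q)" using elim by blast
          moreover have "((\<lambda>s. complex_of_real s) has_vector_derivative 1) (at q)"
            using has_vector_derivative_of_real[OF DERIV_ident] by simp
          ultimately show "(G has_vector_derivative (h q - 1 * ?l)) (at q)"
            unfolding G_def[abs_def] by (intro has_vector_derivative_diff has_vector_derivative_mult_left)
        qed
      qed
      moreover have "abs_cont_on {c..d} G"
        unfolding G_def[abs_def] by (intro abs_cont_on_diff_linear ac cd)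
      ultimately have "norm (G d - G c) \<le> e / 2 * (d - c)"
        using abs_cont_increment_bound[of c d G "e / 2"] cd e by simp
      then have a: "norm (G s - G t) \<le> e / 2 * \<bar>s - t\<bar>"
        by (auto simp: c_def d_def min_def max_def norm_minus_commute split: if_splits)
      have "(g s - g t) / of_real (s - t) - ?l = (G s - G t) / of_real (s - t)"
        using st by (simp add: G_def divide_simps) (simp add: algebra_simps)
      then have "dist ((g s - g t) / of_real (s - t)) ?l = norm (G s - G t) / \<bar>s - t\<bar>"
        by (simp only: dist_norm norm_divide norm_of_real)
      also have "\<dots> \<le> e / 2" using a st by (simp add: divide_simps)
      finally show ?case using e by simp
    qed
  qed
qed

end

section \<open>Linear differential equations\<close>

text \<open>Integral of the weight used for Picard iteration; the factor \<open>1 / L\<close> is the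
  source of the contraction. On either side of \<open>t\<^sub>0\<close> the absolute value has the
  constant sign \<open>\<sigma>\<close>.\<close>

lemma exp_abs_has_integral:
  fixes L t\<^sub>0 c d :: real
  assumes "L > 0" "c \<le> d" "t\<^sub>0 \<le> c \<or> d \<le> t\<^sub>0"
  shows "((\<lambda>s. K * exp (L * \<bar>s - t\<^sub>0\<bar>)) has_integral
    (K / L * \<bar>exp (L * \<bar>d - t\<^sub>0\<bar>) - exp (L * \<bar>c - t\<^sub>0\<bar>)\<bar>)) {c..d}"
proof -
  define \<sigma> :: real where "\<sigma> = (if t\<^sub>0 \<le> c then 1 else - 1)"
  have \<sigma>: "\<sigma> * \<sigma> = 1" "\<And>s. s \<in> {c..d} \<Longrightarrow> \<bar>s - t\<^sub>0\<bar> = \<sigma> * (s - t\<^sub>0)"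
    using assms(2,3) by (auto simp: \<sigma>_def)
  have "((\<lambda>s. K * exp (L * (\<sigma> * (s - t\<^sub>0)))) has_integral
      (K / L * \<sigma> * exp (L * (\<sigma> * (d - t\<^sub>0))) - K / L * \<sigma> * exp (L * (\<sigma> * (c - t\<^sub>0))))) {c..d}"
  proof (rule fundamental_theorem_of_calculus[OF assms(2)])
    fix s assume "s \<in> {c..d}"
    have "((\<lambda>s. K / L * \<sigma> * exp (L * (\<sigma> * (s - t\<^sub>0)))) has_real_derivative
        K / L * \<sigma> * (exp (L * (\<sigma> * (s - t\<^sub>0))) * (L * (\<sigma> * 1)))) (at s within {c..d})"
      by (auto intro!: derivative_eq_intros)
    moreover have "K / L * \<sigma> * (exp (L * (\<sigma> * (s - t\<^sub>0))) * (L * (\<sigma> * 1))) = K * exp (L * (\<sigma> * (s - t\<^sub>0)))"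
      using assms(1) \<sigma>(1) by (auto simp: mult_ac \<sigma>_def)
    ultimately show "((\<lambda>s. K / L * \<sigma> * exp (L * (\<sigma> * (s - t\<^sub>0)))) has_vector_derivative
        K * exp (L * (\<sigma> * (s - t\<^sub>0)))) (at s within {c..d})"
      by (simp add: has_real_derivative_iff_has_vector_derivative)
  qed
  moreover have "K / L * \<sigma> * exp (L * (\<sigma> * (d - t\<^sub>0))) - K / L * \<sigma> * exp (L * (\<sigma> * (c - t\<^sub>0))) =
      K / L * \<bar>exp (L * \<bar>d - t\<^sub>0\<bar>) - exp (L * \<bar>c - t\<^sub>0\<bar>)\<bar>"
    using assms by (auto simp: \<sigma>_def algebra_simps diff_divide_distrib)
  ultimately have "((\<lambda>s. K * exp (L * (\<sigma> * (s - t\<^sub>0)))) has_integral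
      K / L * \<bar>exp (L * \<bar>d - t\<^sub>0\<bar>) - exp (L * \<bar>c - t\<^sub>0\<bar>)\<bar>) {c..d}" by (simp only:)
  then show ?thesis by (rule has_integral_eq[rotated]) (simp add: \<sigma>(2))
qed

context open_interval
begin

lemma integral_norm_bound_lm:
  assumes "lreg w" "{c..d} \<subseteq> I" "c \<in> I" "d \<in> I" "(B has_integral b) {c..d}"
    and "\<And>t b. t \<in> {c..d} \<Longrightarrow> norm (lm b w t) \<le> B t"
  shows "norm (integral {c..d} w) \<le> b"
proof -
  \<comment> \<open>Changes \<open>w\<close> on a null set so that the bound by \<open>B\<close>
    holds at every point.\<close>
  define v where "v s = (if norm (w s) \<le> B s then w s else 0)" for s
  have B: "0 \<le> B s" if "s \<in> {c..d}" for s using assms(6)[OF that] norm_ge_zero order_trans by blast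
  have "AE s in lebesgue. s \<in> I \<longrightarrow> (\<forall>b. lm b w s = w s)"
    using AE_lm_eq[OF open_I] assms(1) by (auto simp: lreg_def)
  then obtain N where N: "N \<in> null_sets lebesgue" "\<And>s. s \<in> I \<Longrightarrow> s \<notin> N \<Longrightarrow> lm True w s = w s"
    unfolding eventually_ae_filter by force
  have neg: "negligible N" using N(1) by (simp add: negligible_iff_null_sets)
  have "(v has_integral integral {c..d} w) {c..d}"
  proof (rule has_integral_spike[OF neg _ integrable_integral[OF lreg_integrable[OF assms(1,3,4)]]])
    fix s assume "s \<in> {c..d} - N"
    then have "w s = lm True w s" "s \<in> {c..d}" using N(2)[of s] assms(2) by auto
    then have "norm (w s) \<le> B s" using assms(6)[of s True] by simp
    then show "v s = w s" by (simp add: v_def)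
  qed
  moreover have "norm (integral {c..d} v) \<le> integral {c..d} B"
    using calculation assms(5) B by (intro integral_norm_bound_integral) (auto simp: v_def integrable_on_def)
  ultimately show ?thesis using assms(5) by (simp add: integral_unique)
qed

text \<open>Integration from \<open>t\<^sub>0\<close> gains a factor \<open>1 / L\<close> in the sup
  norm taken relative to the weight \<open>exp (L * \<bar>t - t\<^sub>0\<bar>)\<close>.\<close>

lemma antideriv_exp_bound:
  assumes "lreg w" "t\<^sub>0 \<in> I" "L > 0" "K \<ge> 0" "t \<in> I"
    and "\<And>s b. s \<in> I \<Longrightarrow> norm (lm b w s) \<le> K * exp (L * \<bar>s - t\<^sub>0\<bar>)"
  shows "norm (antideriv t\<^sub>0 w t) \<le> K / L * exp (L * \<bar>t - t\<^sub>0\<bar>)"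
proof (cases "t\<^sub>0 \<le> t")
  case True
  have sub: "{t\<^sub>0..t} \<subseteq> I" using assms segment_subset by blast
  have "norm (integral {t\<^sub>0..t} w) \<le> K / L * \<bar>exp (L * \<bar>t - t\<^sub>0\<bar>) - exp (L * \<bar>t\<^sub>0 - t\<^sub>0\<bar>)\<bar>"
    by (rule integral_norm_bound_lm[OF assms(1) sub assms(2,5) exp_abs_has_integral[OF assms(3) True]])
      (use sub assms(6) in blast)+
  also have "\<dots> \<le> K / L * exp (L * \<bar>t - t\<^sub>0\<bar>)" using assms(3,4) by (intro mult_left_mono) auto
  finally show ?thesis using True by (simp add: antideriv_def)
next
  case False
  then have ts: "t \<le> t\<^sub>0" by simp
  have sub: "{t..t\<^sub>0} \<subseteq> I" using assms segment_subset by blast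
  have "norm (integral {t..t\<^sub>0} w) \<le> K / L * \<bar>exp (L * \<bar>t\<^sub>0 - t\<^sub>0\<bar>) - exp (L * \<bar>t - t\<^sub>0\<bar>)\<bar>"
    by (rule integral_norm_bound_lm[OF assms(1) sub assms(5,2) exp_abs_has_integral[OF assms(3) ts]])
      (use sub assms(6) in blast)+
  also have "\<dots> \<le> K / L * exp (L * \<bar>t - t\<^sub>0\<bar>)" using assms(3,4) by (intro mult_left_mono) (auto simp: abs_minus_commute)
  finally show ?thesis using False by (simp add: antideriv_def)
qed

lemma antideriv_lincomb:
  assumes "lreg v" "lreg w" "u \<in> I" "t \<in> I"
  shows "antideriv u (\<lambda>s. v s - w s) t = antideriv u v t - antideriv u w t"
  using lreg_integrable assms by (auto simp: antideriv_def Henstock_Kurzweil_Integration.integral_diff)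

lemma geometric_cauchy_limit:
  fixes x :: "nat \<Rightarrow> complex"
  assumes "\<And>m. norm (x (Suc m) - x m) \<le> K * (1/2) ^ m"
  obtains l where "x \<longlonglongrightarrow> l" "\<And>m. norm (l - x m) \<le> 2 * K * (1/2) ^ m"
proof -
  have d: "norm (x (m + n) - x m) \<le> 2 * K * (1/2) ^ m - 2 * K * (1/2) ^ (m + n)" for m n
  proof (induction n)
    case (Suc n)
    have "norm (x (m + Suc n) - x m) \<le> norm (x (Suc (m + n)) - x (m + n)) + norm (x (m + n) - x m)"
      using norm_triangle_ineq[of "x (Suc (m + n)) - x (m + n)" "x (m + n) - x m"] by simp
    also have "\<dots> \<le> K * (1/2) ^ (m + n) + (2 * K * (1/2) ^ m - 2 * K * (1/2) ^ (m + n))"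
      by (intro add_mono assms Suc.IH)
    finally show ?case by simp
  qed simp
  have K: "K \<ge> 0" using order_trans[OF norm_ge_zero assms[of 0]] by simp
  have d': "norm (x (m + n) - x m) \<le> 2 * K * (1/2) ^ m" for m n
    using d[of m n] K by (smt (verit) mult_nonneg_nonneg zero_le_power divide_nonneg_nonneg)
  have lim0: "(\<lambda>m. 2 * K * (1/2) ^ m) \<longlonglongrightarrow> 2 * K * 0"
    by (intro tendsto_intros LIMSEQ_power_zero) auto
  have "Cauchy x"
  proof (rule metric_CauchyI)
    fix e :: real assume "e > 0"
    then have "\<forall>\<^sub>F m in sequentially. 2 * K * (1/2) ^ m < e / 2"
      by (intro order_tendstoD(2)[OF lim0]) simp
    then obtain M where M: "2 * K * (1/2) ^ M < e / 2" using eventually_happens by fastforce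
    have "dist (x m) (x M) < e / 2" if "m \<ge> M" for m
      using d'[of M "m - M"] M that by (simp add: dist_norm)
    then show "\<exists>M. \<forall>m\<ge>M. \<forall>n\<ge>M. dist (x m) (x n) < e"
      by (meson dist_triangle_half_l dist_commute)
  qed
  then obtain l where l: "x \<longlonglongrightarrow> l" using Cauchy_convergent convergent_def by blast
  have "norm (l - x m) \<le> 2 * K * (1/2) ^ m" for m
  proof (rule tendsto_upperbound)
    show "(\<lambda>n. norm (x n - x m)) \<longlonglongrightarrow> norm (l - x m)" by (intro tendsto_intros l)
    show "\<forall>\<^sub>F n in sequentially. norm (x n - x m) \<le> 2 * K * (1/2) ^ m"
      using eventually_ge_at_top[of m]
    proof eventually_elim
      case (elim n) then show ?case using d'[of m "n - m"] by simp
    qed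
  qed simp
  then show ?thesis using that l by blast
qed

text \<open>Picard iteration in a weighted sup norm contracts on the whole of \<open>I\<close> at
  once, so local solutions do not have to be continued. The coefficients are merely regulated, which
  is why the equation is read through \<open>lder\<close>.\<close>

lemma linear_ode_exists:
  fixes B :: "'n::finite \<Rightarrow> 'n \<Rightarrow> real \<Rightarrow> complex" and v :: "'n \<Rightarrow> complex"
  assumes B: "\<And>i k. lreg (B i k)" "\<And>i k t b. t \<in> I \<Longrightarrow> norm (lm b (B i k) t) \<le> M" and t0: "t\<^sub>0 \<in> I"
  obtains z :: "'n \<Rightarrow> real \<Rightarrow> complex" where "\<And>i. continuous_on I (z i)"
    "\<And>i. lder (z i) (\<lambda>s. \<Sum>k\<in>UNIV. B i k s * z k s)" "\<And>i. z i t\<^sub>0 = v i"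
proof -
  define n where "n = real CARD('n)"
  have n: "n \<ge> 1" by (simp add: n_def Suc_leI)
  have M: "M \<ge> 0" using B(2)[OF t0] norm_ge_zero order_trans by blast
  \<comment> \<open>\<open>n * M\<close> bounds the row sums of the coefficients; twice that makes
    the contraction factor at most 1/2, and \<open>M + 1\<close> keeps \<open>L\<close>
    positive.\<close>
  define L where "L = 2 * n * (M + 1)"
  have L: "L > 0" using n M by (simp add: L_def)
  define F where "F y i s = (\<Sum>k\<in>UNIV. B i k s * y k s)" for y :: "'n \<Rightarrow> real \<Rightarrow> complex" and i s
  have rF: "lreg (F y i)" if "\<And>k. lreg (y k)" for y i
    unfolding F_def[abs_def] using that B by (intro lreg_sum lreg_mult)
  have lF: "lm b (F y i) t = (\<Sum>k\<in>UNIV. lm b (B i k) t * lm b (y k) t)" if "\<And>k. lreg (y k)" "t \<in> I" for y i b t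
    unfolding F_def[abs_def] using that B by (simp add: lm_sum lm_mult lreg_mult)
  define P where "P y i t = v i + antideriv t\<^sub>0 (F y i) t" for y i t
  have cP: "continuous_on I (P y i)" if "\<And>k. lreg (y k)" for y i
    unfolding P_def[abs_def] by (intro continuous_intros antideriv_continuous rF that t0)
  have contr: "norm (P y i t - P y' i t) \<le> K / 2 * exp (L * \<bar>t - t\<^sub>0\<bar>)"
    if y: "\<And>k. lreg (y k)" "\<And>k. lreg (y' k)" and t: "t \<in> I" and K: "K \<ge> 0"
      and d: "\<And>k s. s \<in> I \<Longrightarrow> norm (y k s - y' k s) \<le> K * exp (L * \<bar>s - t\<^sub>0\<bar>)"
      and c: "\<And>k s b. s \<in> I \<Longrightarrow> lm b (y k) s = y k s" "\<And>k s b. s \<in> I \<Longrightarrow> lm b (y' k) s = y' k s"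
    for y y' i t K
  proof -
    have "norm (antideriv t\<^sub>0 (\<lambda>s. F y i s - F y' i s) t) \<le> (n * M * K) / L * exp (L * \<bar>t - t\<^sub>0\<bar>)"
    proof (rule antideriv_exp_bound[OF lreg_diff[OF rF rF] t0 L _ t])
      fix s b assume s: "s \<in> I"
      have "lm b (\<lambda>s. F y i s - F y' i s) s = (\<Sum>k\<in>UNIV. lm b (B i k) s * (y k s - y' k s))"
        using s y by (simp add: lm_diff rF lF c right_diff_distrib sum_subtractf)
      also have "norm \<dots> \<le> (\<Sum>k\<in>(UNIV::'n set). M * (K * exp (L * \<bar>s - t\<^sub>0\<bar>)))"
        by (intro order_trans[OF norm_sum] sum_mono) (use B(2)[OF s] d[OF s] M in \<open>auto simp: norm_mult intro!: mult_mono\<close>)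
      finally show "norm (lm b (\<lambda>s. F y i s - F y' i s) s) \<le> (n * M * K) * exp (L * \<bar>s - t\<^sub>0\<bar>)"
        by (simp add: n_def mult_ac)
    qed (use y n M K in auto)
    also have "\<dots> \<le> K / 2 * exp (L * \<bar>t - t\<^sub>0\<bar>)"
    proof (rule mult_right_mono)
      have "n * M * K \<le> n * (M + 1) * K" using n M K by (intro mult_right_mono mult_left_mono) auto
      then show "n * M * K / L \<le> K / 2" using L n M by (simp add: L_def field_simps)
    qed simp
    finally show ?thesis using antideriv_lincomb[OF rF rF t0 t, of y y'] y by (simp add: P_def)
  qed
  define Z where "Z = rec_nat (\<lambda>i _. v i) (\<lambda>_. P)"
  have Z: "Z 0 = (\<lambda>i _. v i)" "\<And>m. Z (Suc m) = P (Z m)" by (simp_all add: Z_def)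
  have cZ: "continuous_on I (Z m i)" for m i
  proof (induction m arbitrary: i)
    case (Suc m)
    then show ?case unfolding Z by (intro cP lreg_continuous(1))
  qed (simp add: Z)
  have rZ: "lreg (Z m i)" and lZ: "s \<in> I \<Longrightarrow> lm b (Z m i) s = Z m i s" for m i s b
    using lreg_continuous[OF cZ] by auto
  define V where "V = (\<Sum>k\<in>UNIV. norm (v k))"
  have V: "V \<ge> 0" "norm (v k) \<le> V" for k unfolding V_def by (auto intro: sum_nonneg member_le_sum)
  have d: "norm (Z (Suc m) i t - Z m i t) \<le> V * (1/2) ^ m * exp (L * \<bar>t - t\<^sub>0\<bar>)" if "t \<in> I" for m i t
    using that
  proof (induction m arbitrary: i t)
    case 0
    have "norm (antideriv t\<^sub>0 (F (\<lambda>i _. v i) i) t) \<le> (n * M * V) / L * exp (L * \<bar>t - t\<^sub>0\<bar>)"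
    proof (rule antideriv_exp_bound[OF rF t0 L _ 0])
      fix s b assume s: "s \<in> I"
      have "norm (lm b (F (\<lambda>i _. v i) i) s) \<le> (\<Sum>k\<in>(UNIV::'n set). M * V)"
        unfolding lF[OF lreg_const s]
        by (intro order_trans[OF norm_sum] sum_mono) (use B(2)[OF s] V M in \<open>auto simp: norm_mult intro!: mult_mono\<close>)
      also have "\<dots> = n * M * V * 1" by (simp add: n_def)
      also have "\<dots> \<le> n * M * V * exp (L * \<bar>s - t\<^sub>0\<bar>)" using n M V L by (intro mult_left_mono) auto
      finally show "norm (lm b (F (\<lambda>i _. v i) i) s) \<le> n * M * V * exp (L * \<bar>s - t\<^sub>0\<bar>)" .
    qed (use n M V lreg_const in auto)
    also have "\<dots> \<le> V * exp (L * \<bar>t - t\<^sub>0\<bar>)"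
    proof (rule mult_right_mono)
      have "n * M * V \<le> L * V" using n M V by (intro mult_right_mono) (auto simp: L_def algebra_simps)
      then show "n * M * V / L \<le> V" using L by (simp add: field_simps)
    qed simp
    finally show ?case by (simp add: Z P_def)
  next
    case (Suc m)
    have "norm (P (Z (Suc m)) i t - P (Z m) i t) \<le> (V * (1/2) ^ m) / 2 * exp (L * \<bar>t - t\<^sub>0\<bar>)"
      by (rule contr[OF rZ rZ Suc.prems _ Suc.IH lZ lZ]) (use V in auto)
    then show ?case by (simp add: Z(2)[of "Suc m"] Z(2)[of m])
  qed
  define z where "z i t = lim (\<lambda>m. Z m i t)" for i t
  have zl: "(\<lambda>m. Z m i t) \<longlonglongrightarrow> z i t" and zb: "norm (z i t - Z m i t) \<le> 2 * V * exp (L * \<bar>t - t\<^sub>0\<bar>) * (1/2) ^ m"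
    if t: "t \<in> I" for i t m
  proof -
    have "norm (Z (Suc m) i t - Z m i t) \<le> (V * exp (L * \<bar>t - t\<^sub>0\<bar>)) * (1/2) ^ m" for m
      using d[OF t, of m i] by (simp add: mult_ac)
    then obtain l where l: "(\<lambda>m. Z m i t) \<longlonglongrightarrow> l"
      "\<And>m. norm (l - Z m i t) \<le> 2 * (V * exp (L * \<bar>t - t\<^sub>0\<bar>)) * (1/2) ^ m"
      using geometric_cauchy_limit[of "\<lambda>m. Z m i t"] by metis
    then have "z i t = l" unfolding z_def by (simp add: limI)
    then show "(\<lambda>m. Z m i t) \<longlonglongrightarrow> z i t" "norm (z i t - Z m i t) \<le> 2 * V * exp (L * \<bar>t - t\<^sub>0\<bar>) * (1/2) ^ m"
      using l by (auto simp: mult.assoc)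
  qed
  have pow0: "(\<lambda>m. W * (1/2) ^ m) \<longlonglongrightarrow> 0" for W :: real
    using tendsto_mult[OF tendsto_const[of W] LIMSEQ_power_zero[of "1/2 :: real"]] by simp
  have cz: "continuous_on I (z i)" for i
  proof (intro continuous_at_imp_continuous_on ballI)
    fix t assume t: "t \<in> I"
    obtain c d where cd: "c \<in> I" "d \<in> I" "c < t" "t < d"
      by (rule compact_subset_segment[of "{t}"]) (use t in auto)
    have sub: "{c<..<d} \<subseteq> I" using segment_subset[OF cd(1,2)] by auto
    \<comment> \<open>Bounds the weight on the whole of \<open>{c<..<d}\<close>, so that the
      weighted estimate gives uniform convergence there.\<close>
    define W where "W = 2 * V * exp (L * (\<bar>c - t\<^sub>0\<bar> + \<bar>d - t\<^sub>0\<bar>))"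
    have "uniform_limit {c<..<d} (\<lambda>m. Z m i) (z i) sequentially"
    proof (rule uniform_limitI)
      fix e :: real assume "e > 0"
      then have "\<forall>\<^sub>F m in sequentially. W * (1/2) ^ m < e" using order_tendstoD(2)[OF pow0] by blast
      then show "\<forall>\<^sub>F m in sequentially. \<forall>s\<in>{c<..<d}. dist (Z m i s) (z i s) < e"
      proof eventually_elim
        case (elim m)
        show ?case
        proof
          fix s assume s: "s \<in> {c<..<d}"
          have "exp (L * \<bar>s - t\<^sub>0\<bar>) \<le> exp (L * (\<bar>c - t\<^sub>0\<bar> + \<bar>d - t\<^sub>0\<bar>))"
            using s L by (auto intro!: mult_left_mono)
          then have "2 * V * exp (L * \<bar>s - t\<^sub>0\<bar>) * (1/2) ^ m \<le> W * (1/2) ^ m"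
            unfolding W_def using V by (intro mult_right_mono mult_left_mono) auto
          then show "dist (Z m i s) (z i s) < e"
            using zb[OF subsetD[OF sub s], of i m] elim
            unfolding dist_norm norm_minus_commute[of "Z m i s"] by linarith
        qed
      qed
    qed
    then have "continuous_on {c<..<d} (z i)"
      by (rule uniform_limit_theorem[rotated]) (use continuous_on_subset[OF cZ sub] in auto)
    then show "isCont (z i) t" using cd by (simp add: continuous_on_eq_continuous_at)
  qed
  have rz: "lreg (z i)" and lz: "s \<in> I \<Longrightarrow> lm b (z i) s = z i s" for i s b
    using lreg_continuous[OF cz] by auto
  \<comment> \<open>By contraction \<open>P z\<close> is close to \<open>P (Z m)\<close>, which is
    the next iterate, so the iterates converge both to \<open>P z\<close> and to \<open>z\<close>.
    This avoids exchanging limit and integral.\<close>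
  have fixpoint: "z i t = P z i t" if t: "t \<in> I" for i t
  proof -
    have "norm (P z i t - Z (Suc m) i t) \<le> (V * exp (L * \<bar>t - t\<^sub>0\<bar>)) * (1/2) ^ m" for m
    proof -
      have "norm (P z i t - P (Z m) i t) \<le> (2 * V * (1/2) ^ m) / 2 * exp (L * \<bar>t - t\<^sub>0\<bar>)"
        by (rule contr[OF rz rZ t _ _ lz lZ]) (use V zb in \<open>auto simp: mult_ac\<close>)
      then show ?thesis by (simp add: Z mult_ac)
    qed
    then have "(\<lambda>m. P z i t - Z (Suc m) i t) \<longlonglongrightarrow> 0"
      by (intro Lim_null_comparison[OF _ pow0] always_eventually) blast
    moreover have "(\<lambda>m. P z i t - Z (Suc m) i t) \<longlonglongrightarrow> P z i t - z i t"
      using zl[OF t] by (intro tendsto_intros LIMSEQ_Suc)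
    ultimately show ?thesis using LIMSEQ_unique by fastforce
  qed
  show ?thesis
  proof (rule that[of z])
    show "continuous_on I (z i)" for i by (rule cz)
    show "z i t\<^sub>0 = v i" for i using fixpoint[OF t0] by (simp add: P_def antideriv_def)
    show "lder (z i) (\<lambda>s. \<Sum>k\<in>UNIV. B i k s * z k s)" for i
    proof (rule lder_cong)
      have "lder (\<lambda>t. v i + antideriv t\<^sub>0 (F z i) t) (\<lambda>t. 0 + F z i t)"
        by (intro lder_add lder_const lder_antideriv lreg_const lreg_antideriv rF rz t0)
      then show "lder (P z i) (\<lambda>s. \<Sum>k\<in>UNIV. B i k s * z k s)"
        by (simp add: P_def[abs_def] F_def[abs_def])
      show "\<forall>\<^sub>F s in es b t. P z i s = z i s" if "t \<in> I" for t b
        using eventually_es_open[OF open_I that] by (rule eventually_mono) (simp add: fixpoint)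
    qed
  qed
qed

end

section \<open>The fundamental matrix\<close>

lemma axis_axis_nth: "axis i (axis j z) $ k $ l = (if k = i then if l = j then z else 0 else 0)"
  by (simp add: axis_def)

lemma matrix_eq_sum_axis: "(\<Sum>i\<in>UNIV. \<Sum>j\<in>UNIV. axis i (axis j (x $ i $ j))) = (x :: 'a::comm_monoid_add ^ 'n ^ 'm)"
proof -
  have "(\<Sum>i\<in>UNIV. \<Sum>j\<in>UNIV. axis i (axis j (x $ i $ j))) $ k $ l = x $ k $ l" for k l
  proof -
    have "(\<Sum>i\<in>UNIV. \<Sum>j\<in>UNIV. axis i (axis j (x $ i $ j))) $ k $ l =
        (\<Sum>i\<in>UNIV. if k = i then (\<Sum>j\<in>UNIV. if l = j then x $ i $ j else 0) else 0)"
      unfolding sum_component axis_axis_nth by (rule sum.cong) auto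
    then show ?thesis by simp
  qed
  then show ?thesis by (simp add: vec_eq_iff)
qed

lemma has_vector_derivative_matrix:
  fixes X :: "real \<Rightarrow> complex ^ 'n ^ 'm"
  assumes "\<And>i j. ((\<lambda>t. X t $ i $ j) has_vector_derivative D $ i $ j) (at t)"
  shows "(X has_vector_derivative D) (at t)"
proof -
  have lin: "bounded_linear (\<lambda>z. axis i (axis j z) :: complex ^ 'n ^ 'm)" for i j
    by (subst linear_conv_bounded_linear[symmetric], rule linearI)
      (simp_all add: vec_eq_iff axis_axis_nth)
  have "((\<lambda>t. \<Sum>i\<in>UNIV. \<Sum>j\<in>UNIV. axis i (axis j (X t $ i $ j))) has_vector_derivative
      (\<Sum>i\<in>UNIV. \<Sum>j\<in>UNIV. axis i (axis j (D $ i $ j)))) (at t)"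
    by (intro has_vector_derivative_sum bounded_linear.has_vector_derivative[OF lin] assms)
  then show ?thesis by (simp only: matrix_eq_sum_axis)
qed

lemma dist_matrix_le:
  fixes x y :: "complex ^ 'n ^ 'm"
  shows "dist x y \<le> (\<Sum>i\<in>UNIV. \<Sum>j\<in>UNIV. dist (x $ i $ j) (y $ i $ j))"
proof -
  have "dist x y \<le> (\<Sum>i\<in>UNIV. dist (x $ i) (y $ i))"
    unfolding dist_vec_def by (rule L2_set_le_sum) simp
  also have "\<dots> \<le> (\<Sum>i\<in>UNIV. \<Sum>j\<in>UNIV. dist (x $ i $ j) (y $ i $ j))"
    by (rule sum_mono, subst dist_vec_def, rule L2_set_le_sum) simp
  finally show ?thesis .
qed

lemma lipschitz_imp_abs_cont_on:
  assumes "\<And>s t. s \<in> S \<Longrightarrow> t \<in> S \<Longrightarrow> s \<le> t \<Longrightarrow> dist (X s) (X t) \<le> K * (t - s)"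
  shows "abs_cont_on S X"
  unfolding abs_cont_on_def
proof (intro allI impI)
  fix e :: real assume e: "e > 0"
  have "(\<Sum>i<m. dist (X (u i)) (X (v i))) < e"
    if A: "(\<forall>i<m. u i \<in> S \<and> v i \<in> S \<and> u i \<le> v i) \<and>
      disjoint_family_on (\<lambda>i. {u i<..<v i}) {..<m} \<and> (\<Sum>i<m. v i - u i) < e / (\<bar>K\<bar> + 1)" for m :: nat and u v
  proof -
    have "(\<Sum>i<m. dist (X (u i)) (X (v i))) \<le> (\<Sum>i<m. (\<bar>K\<bar> + 1) * (v i - u i))"
    proof (rule sum_mono)
      fix i assume "i \<in> {..<m}"
      then have "dist (X (u i)) (X (v i)) \<le> K * (v i - u i)" "0 \<le> v i - u i" using A assms by auto
      moreover from this have "K * (v i - u i) \<le> (\<bar>K\<bar> + 1) * (v i - u i)" by (intro mult_right_mono) auto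
      ultimately show "dist (X (u i)) (X (v i)) \<le> (\<bar>K\<bar> + 1) * (v i - u i)" by linarith
    qed
    also have "\<dots> = (\<bar>K\<bar> + 1) * (\<Sum>i<m. v i - u i)" by (simp only: sum_distrib_left)
    also have "\<dots> < (\<bar>K\<bar> + 1) * (e / (\<bar>K\<bar> + 1))" using A by (intro mult_strict_left_mono) auto
    also have "\<dots> = e" by simp
    finally show ?thesis .
  qed
  moreover have "e / (\<bar>K\<bar> + 1) > 0" using e by simp
  ultimately show "\<exists>d>0. \<forall>(m::nat) u v. (\<forall>i<m. u i \<in> S \<and> v i \<in> S \<and> u i \<le> v i) \<and>
     disjoint_family_on (\<lambda>i. {u i<..<v i}) {..<m} \<and> (\<Sum>i<m. v i - u i) < d
     \<longrightarrow> (\<Sum>i<m. dist (X (u i)) (X (v i))) < e" by blast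
qed

lemma abs_cont_on_matrix_entry:
  fixes X :: "real \<Rightarrow> complex ^ 'n ^ 'm"
  assumes "abs_cont_on S X"
  shows "abs_cont_on S (\<lambda>t. X t $ i $ j)"
  unfolding abs_cont_on_def
proof (intro allI impI)
  fix e :: real assume "e > 0"
  then obtain d where d: "d > 0" and D: "\<And>(m::nat) u v. (\<forall>i<m. u i \<in> S \<and> v i \<in> S \<and> u i \<le> v i) \<and>
     disjoint_family_on (\<lambda>i. {u i<..<v i}) {..<m} \<and> (\<Sum>i<m. v i - u i) < d
     \<Longrightarrow> (\<Sum>i<m. dist (X (u i)) (X (v i))) < e"
    using assms unfolding abs_cont_on_def by blast
  have "dist (X s $ i $ j) (X t $ i $ j) \<le> dist (X s) (X t)" for s t
    using dist_vec_nth_le[of "X s $ i" j "X t $ i"] dist_vec_nth_le[of "X s" i "X t"] by linarith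
  then have "(\<Sum>l<m. dist (X (u l) $ i $ j) (X (v l) $ i $ j)) \<le> (\<Sum>l<m. dist (X (u l)) (X (v l)))" for m :: nat and u v
    by (intro sum_mono)
  then show "\<exists>d>0. \<forall>(m::nat) u v. (\<forall>i<m. u i \<in> S \<and> v i \<in> S \<and> u i \<le> v i) \<and>
     disjoint_family_on (\<lambda>i. {u i<..<v i}) {..<m} \<and> (\<Sum>i<m. v i - u i) < d
     \<longrightarrow> (\<Sum>l<m. dist (X (u l) $ i $ j) (X (v l) $ i $ j)) < e"
    using d D by (meson le_less_trans)
qed

lemma matrix_inv_mult:
  fixes M :: "complex ^ 'n ^ 'n"
  assumes "invertible M"
  shows "matrix_inv M ** M = mat 1" "M ** matrix_inv M = mat 1"
  using assms unfolding invertible_def matrix_inv_def by (metis (mono_tags, lifting) someI_ex)+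

lemma matrix_inv_eqI:
  fixes M W :: "complex ^ 'n ^ 'n"
  assumes "W ** M = mat 1"
  shows "matrix_inv M = W"
proof -
  have 1: "M ** W = mat 1" using assms matrix_left_right_inverse by blast
  then have "invertible M" using assms unfolding invertible_def by blast
  then have "matrix_inv M ** (M ** W) = W" using matrix_inv_mult(1) by (metis matrix_mul_assoc matrix_mul_lid)
  then show ?thesis using 1 by simp
qed

context open_interval
begin

text \<open>Both one-sided derivatives equal \<open>h t\<close>, so they combine to a two-sided one.
  Subtracting the line of slope \<open>h t\<close> reduces the claim to small increments of
  \<open>G\<close> on either side.\<close>

lemma lder_imp_has_vector_derivative:
  assumes g: "continuous_on I g" "lder g h" and t: "t \<in> I" "\<And>b. lm b h t = h t"
  shows "(g has_vector_derivative h t) (at t)"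
proof -
  note lid = sm_lreg[OF sm_of_real]
  define G where "G s = g s - h t * of_real s" for s
  have cG: "continuous_on I G" unfolding G_def[abs_def] by (intro continuous_intros g)
  have dG: "lder G (\<lambda>s. h s - h t * 1)" unfolding G_def[abs_def]
    by (intro lder_diff g lder_cmult lder_of_real lid lreg_cmult lreg_continuous(1)[OF g(1)])
  have z: "lm b (\<lambda>s. h s - h t * 1) t = 0" for b
    using t by (simp add: lm_diff lder_lreg[OF g(2)] lreg_const)
  have "\<exists>d>0. \<forall>y. norm (y - t) < d \<longrightarrow> norm (g y - g t - (y - t) *\<^sub>R h t) \<le> e * norm (y - t)" if e: "e > 0" for e
  proof -
    have z': "norm (lm b (\<lambda>s. h s - h t * 1) t) < e" for b using z e by simp
    have *: "\<exists>d>0. \<forall>s. s \<in> side b t d \<longrightarrow> s \<in> I \<longrightarrow> norm (G s - G t) \<le> e * \<bar>s - t\<bar>" for b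
    proof -
      obtain d where d: "d > 0" "\<And>s b'. s \<in> side b t d \<Longrightarrow> s \<in> I \<Longrightarrow> norm (lm b' G s - lm b G t) \<le> e * \<bar>s - t\<bar>"
        using lder_bound_near[OF lreg_continuous(1)[OF cG] dG t(1) z'] by metis
      then show ?thesis using lreg_continuous(2)[OF cG] t(1) by metis
    qed
    from *[of True] *[of False] obtain d1 d2 where d: "d1 > 0" "d2 > 0"
      "\<And>s. s \<in> side True t d1 \<Longrightarrow> s \<in> I \<Longrightarrow> norm (G s - G t) \<le> e * \<bar>s - t\<bar>"
      "\<And>s. s \<in> side False t d2 \<Longrightarrow> s \<in> I \<Longrightarrow> norm (G s - G t) \<le> e * \<bar>s - t\<bar>" by blast
    obtain r where r: "r > 0" "ball t r \<subseteq> I" using open_I t(1) openE by blast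
    show ?thesis
    proof (intro exI[of _ "min r (min d1 d2)"] conjI allI impI)
      fix y assume y: "norm (y - t) < min r (min d1 d2)"
      then have yI: "y \<in> I" using r(2) by (auto simp: subset_iff dist_real_def abs_minus_commute)
      have "norm (G y - G t) \<le> e * \<bar>y - t\<bar>"
      proof (cases "y = t")
        case False
        then have "y \<in> side True t d1 \<or> y \<in> side False t d2" using y by (auto simp: side_def)
        then show ?thesis using d(3,4) yI by blast
      qed simp
      then show "norm (g y - g t - (y - t) *\<^sub>R h t) \<le> e * norm (y - t)"
        by (simp add: G_def scaleR_conv_of_real algebra_simps)
    qed (use r d in auto)
  qed
  then show ?thesis
    unfolding has_vector_derivative_def has_derivative_at_alt by (blast intro: bounded_linear_scaleR_left)
qed

text \<open>Continuity is essential here: step functions too have derivative 0 in the sense of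
  \<open>lder\<close>.\<close>

lemma constant_if_lder_zero:
  assumes g: "continuous_on I g" "lder g (\<lambda>_. 0)" and "s \<in> I" "t \<in> I"
  shows "g s = g t"
proof -
  have *: "g u = g v" if "u \<in> I" "v \<in> I" "u < v" for u v
  proof -
    have "norm (lm False g v - lm True g u) \<le> 0 * (v - u)"
    proof (rule mean_value_inequality[OF lreg_continuous(1)[OF g(1)] g(2) that(3) segment_subset[OF that(1,2)]])
      fix x assume "u < x" "x < v"
      then have "x \<in> I" using segment_subset[OF that(1,2)] by auto
      then show "lm True g x = lm False g x" using lreg_continuous(2)[OF g(1)] by simp
    qed simp
    then show ?thesis using lreg_continuous(2)[OF g(1)] that by simp
  qed
  consider "s < t" | "s = t" | "t < s" by linarith
  then show ?thesis
  proof cases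
    case 1 then show ?thesis by (rule *[OF assms(3,4)])
  next
    case 3 then show ?thesis by (rule *[OF assms(4,3), symmetric])
  qed simp
qed

section \<open>The linear equation and its adjoint, entrywise\<close>

definition right_sol :: "('n \<Rightarrow> 'n \<Rightarrow> real \<Rightarrow> complex) \<Rightarrow> ('n::finite \<Rightarrow> 'n \<Rightarrow> real \<Rightarrow> complex) \<Rightarrow> bool" where
  "right_sol A X \<longleftrightarrow> (\<forall>i j. continuous_on I (X i j) \<and> lder (X i j) (\<lambda>s. \<Sum>k\<in>UNIV. A i k s * X k j s))"

text \<open>The adjoint equation \<open>Y' = - Y A\<close>, which the inverse of a fundamental
  matrix satisfies. Derivatives are taken in the sense of \<open>lder\<close>, hence on either side
  of every point.\<close>

definition left_sol :: "('n \<Rightarrow> 'n \<Rightarrow> real \<Rightarrow> complex) \<Rightarrow> ('n::finite \<Rightarrow> 'n \<Rightarrow> real \<Rightarrow> complex) \<Rightarrow> bool" where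
  "left_sol A Y \<longleftrightarrow> (\<forall>i j. continuous_on I (Y i j) \<and> lder (Y i j) (\<lambda>s. - (\<Sum>k\<in>UNIV. Y i k s * A k j s)))"

text \<open>Adjoining the entries of \<open>X\<close> to the smooth functions gives an algebra
  closed under differentiation, because the entries of \<open>A X\<close> are polynomial in those of
  \<open>A\<close> and \<open>X\<close>. This makes the entries of \<open>X\<close> legitimate
  multipliers.\<close>

lemma right_sol_lsm:
  assumes A: "\<And>i j. lsm (A i j)" and X: "right_sol A X"
  shows "lsm (X i j)"
proof (rule lsm_alg[of "Collect lsm \<union> range (\<lambda>(i, j). X i j)"])
  let ?S = "Collect lsm \<union> range (\<lambda>(i, j). X i j)"
  fix g assume "g \<in> ?S"
  then consider "lsm g" | i j where "g = X i j" by auto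
  then show "lreg g \<and> (\<exists>h\<in>alg ?S. lder g h)"
  proof cases
    case 1
    then obtain h where "lder g h" "lsm h" using lsm_lder by blast
    then show ?thesis using lsm_lreg[OF 1] by (blast intro: alg_base)
  next
    case 2
    have "(\<lambda>s. \<Sum>k\<in>UNIV. A i k s * X k j s) \<in> alg ?S"
      using A by (intro alg_sum alg_mult alg_base) auto
    then show ?thesis using X 2 lreg_continuous(1) unfolding right_sol_def by blast
  qed
qed (auto intro: alg_base)

lemma left_sol_lsm:
  assumes A: "\<And>i j. lsm (A i j)" and Y: "left_sol A Y"
  shows "lsm (Y i j)"
proof (rule lsm_alg[of "Collect lsm \<union> range (\<lambda>(i, j). Y i j)"])
  let ?S = "Collect lsm \<union> range (\<lambda>(i, j). Y i j)"
  fix g assume "g \<in> ?S"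
  then consider "lsm g" | i j where "g = Y i j" by auto
  then show "lreg g \<and> (\<exists>h\<in>alg ?S. lder g h)"
  proof cases
    case 1
    then obtain h where "lder g h" "lsm h" using lsm_lder by blast
    then show ?thesis using lsm_lreg[OF 1] by (blast intro: alg_base)
  next
    case 2
    have "(\<lambda>s. (- 1) * (\<Sum>k\<in>UNIV. Y i k s * A k j s)) \<in> alg ?S"
      using A by (intro alg_mult[OF alg_const] alg_sum alg_mult alg_base) auto
    then show ?thesis using Y 2 lreg_continuous(1) unfolding left_sol_def by fastforce
  qed
qed (auto intro: alg_base)

text \<open>By the product rule \<open>(Y X)' = - Y A X + Y A X = 0\<close>.\<close>

lemma pairing_constant:
  assumes X: "right_sol A X" and Y: "left_sol A Y" and "s \<in> I" "t \<in> I"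
  shows "(\<Sum>k\<in>UNIV. Y i k s * X k j s) = (\<Sum>k\<in>UNIV. Y i k t * X k j t)"
proof (rule constant_if_lder_zero[of "\<lambda>s. \<Sum>k\<in>UNIV. Y i k s * X k j s", OF _ _ assms(3,4)])
  have c: "continuous_on I (X i j)" "continuous_on I (Y i j)" for i j using X Y by (auto simp: right_sol_def left_sol_def)
  have d: "lder (X i j) (\<lambda>s. \<Sum>k\<in>UNIV. A i k s * X k j s)"
    "lder (Y i j) (\<lambda>s. - (\<Sum>k\<in>UNIV. Y i k s * A k j s))" for i j
    using X Y by (auto simp: right_sol_def left_sol_def)
  show "continuous_on I (\<lambda>s. \<Sum>k\<in>UNIV. Y i k s * X k j s)" by (intro continuous_intros c)
  have "lder (\<lambda>s. \<Sum>k\<in>UNIV. Y i k s * X k j s)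
      (\<lambda>s. \<Sum>k\<in>UNIV. - (\<Sum>l\<in>UNIV. Y i l s * A l k s) * X k j s + Y i k s * (\<Sum>l\<in>UNIV. A k l s * X l j s))"
    by (intro lder_sum lder_mult d lreg_mult lreg_continuous(1) c)
  moreover have "(\<Sum>k\<in>UNIV. - (\<Sum>l\<in>UNIV. Y i l s * A l k s) * X k j s + Y i k s * (\<Sum>l\<in>UNIV. A k l s * X l j s)) = 0" for s
  proof -
    have "(\<Sum>k\<in>UNIV. (\<Sum>l\<in>UNIV. Y i l s * A l k s) * X k j s) = (\<Sum>k\<in>UNIV. Y i k s * (\<Sum>l\<in>UNIV. A k l s * X l j s))"
      unfolding sum_distrib_left sum_distrib_right by (subst sum.swap) (simp add: mult.assoc)
    then show ?thesis by (simp add: sum_subtractf)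
  qed
  ultimately show "lder (\<lambda>s. \<Sum>k\<in>UNIV. Y i k s * X k j s) (\<lambda>_. 0)" by simp
qed

text \<open>The columns of \<open>X\<close> and the rows of \<open>Y\<close> each solve a linear
  system; for the rows the coefficient matrix is minus the transpose of \<open>A\<close>.\<close>

lemma right_left_sol_exist:
  fixes A :: "'n::finite \<Rightarrow> 'n \<Rightarrow> real \<Rightarrow> complex"
  assumes A: "\<And>i j. A i j \<in> reg_fun I" and t0: "t\<^sub>0 \<in> I"
  obtains X Y where "right_sol A X" "left_sol A Y"
    "\<And>i j. X i j t\<^sub>0 = (if i = j then 1 else 0)" "\<And>i j. Y i j t\<^sub>0 = (if i = j then 1 else 0)"
proof -
  have "\<exists>C. \<forall>t\<in>I. \<forall>b. norm (lm b (A i j) t) \<le> C" for i j using A by (auto simp: reg_fun_iff)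
  then obtain C where C: "\<And>i j t b. t \<in> I \<Longrightarrow> norm (lm b (A i j) t) \<le> C i j" by metis
  define M where "M = (\<Sum>i\<in>UNIV. \<Sum>j\<in>UNIV. \<bar>C i j\<bar>)"
  have M: "norm (lm b (A i j) t) \<le> M" if "t \<in> I" for i j t b
  proof -
    have "norm (lm b (A i j) t) \<le> \<bar>C i j\<bar>" using C[OF that] abs_ge_self order_trans by blast
    also have "\<dots> \<le> (\<Sum>j\<in>UNIV. \<bar>C i j\<bar>)" by (rule member_le_sum) auto
    also have "\<dots> \<le> M" unfolding M_def by (rule member_le_sum[of i UNIV "\<lambda>i. \<Sum>j\<in>UNIV. \<bar>C i j\<bar>"]) (auto intro: sum_nonneg)
    finally show ?thesis .
  qed
  have rA: "lreg (A i j)" for i j using A by (auto simp: reg_fun_iff)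
  have "\<forall>j. \<exists>z. \<forall>i. continuous_on I (z i) \<and> lder (z i) (\<lambda>s. \<Sum>k\<in>UNIV. A i k s * z k s) \<and> z i t\<^sub>0 = (if i = j then 1 else 0)"
  proof
    fix j
    show "\<exists>z. \<forall>i. continuous_on I (z i) \<and> lder (z i) (\<lambda>s. \<Sum>k\<in>UNIV. A i k s * z k s) \<and> z i t\<^sub>0 = (if i = j then 1 else 0)"
      by (rule linear_ode_exists[where B=A and M=M and v="\<lambda>i. if i = j then 1 else 0", OF rA M t0]) blast+
  qed
  from choice[OF this] obtain Z where Z: "\<And>j i. continuous_on I (Z j i)"
    "\<And>j i. lder (Z j i) (\<lambda>s. \<Sum>k\<in>UNIV. A i k s * Z j k s)"
    "\<And>j i. Z j i t\<^sub>0 = (if i = j then 1 else 0)" by blast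
  have "\<forall>i. \<exists>z. \<forall>j. continuous_on I (z j) \<and> lder (z j) (\<lambda>s. \<Sum>k\<in>UNIV. (- A k j s) * z k s) \<and> z j t\<^sub>0 = (if i = j then 1 else 0)"
  proof
    fix i
    have "lreg (\<lambda>s. - A k j s)" for k j by (rule lreg_uminus[OF rA])
    moreover have "norm (lm b (\<lambda>s. - A k j s) t) \<le> M" if "t \<in> I" for k j t b using M[OF that] by (simp add: lm_uminus rA that)
    ultimately show "\<exists>z. \<forall>j. continuous_on I (z j) \<and> lder (z j) (\<lambda>s. \<Sum>k\<in>UNIV. (- A k j s) * z k s) \<and> z j t\<^sub>0 = (if i = j then 1 else 0)"
      by (rule linear_ode_exists[where B="\<lambda>j k s. - A k j s" and M=M and v="\<lambda>j. if i = j then 1 else 0", OF _ _ t0]) blast+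
  qed
  from choice[OF this] obtain W where W: "\<And>i j. continuous_on I (W i j)"
    "\<And>i j. lder (W i j) (\<lambda>s. \<Sum>k\<in>UNIV. (- A k j s) * W i k s)"
    "\<And>i j. W i j t\<^sub>0 = (if i = j then 1 else 0)" by blast
  show ?thesis
  proof (rule that[of "\<lambda>i j. Z j i" W])
    show "right_sol A (\<lambda>i j. Z j i)" using Z by (simp add: right_sol_def)
    show "left_sol A W" using W by (simp add: left_sol_def sum_negf mult.commute)
  qed (use Z W in auto)
qed

lemma left_sol_lincomb:
  assumes "left_sol A Y"
  shows "left_sol A (\<lambda>i j s. \<Sum>k\<in>UNIV. c i k * Y k j s)"
  unfolding left_sol_def
proof (intro allI conjI)
  fix i j
  have Y: "continuous_on I (Y i j)" "lder (Y i j) (\<lambda>s. - (\<Sum>k\<in>UNIV. Y i k s * A k j s))" for i j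
    using assms by (auto simp: left_sol_def)
  show "continuous_on I (\<lambda>s. \<Sum>k\<in>UNIV. c i k * Y k j s)" by (intro continuous_intros Y)
  have "lder (\<lambda>s. \<Sum>k\<in>UNIV. c i k * Y k j s) (\<lambda>s. \<Sum>k\<in>UNIV. c i k * - (\<Sum>l\<in>UNIV. Y k l s * A l j s))"
    by (intro lder_sum lder_cmult Y lreg_cmult lreg_continuous(1))
  moreover have "(\<Sum>k\<in>UNIV. c i k * - (\<Sum>l\<in>UNIV. Y k l s * A l j s)) = - (\<Sum>l\<in>UNIV. (\<Sum>k\<in>UNIV. c i k * Y k l s) * A l j s)" for s
    unfolding sum_distrib_left sum_distrib_right mult_minus_right sum_negf
    by (subst sum.swap) (simp add: mult.assoc)
  ultimately show "lder (\<lambda>s. \<Sum>k\<in>UNIV. c i k * Y k j s) (\<lambda>s. - (\<Sum>l\<in>UNIV. (\<Sum>k\<in>UNIV. c i k * Y k l s) * A l j s))"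
    by simp
qed

text \<open>The inverse matrix will be identified with a combination of adjoint solutions only on
  \<open>I\<close>, whereas HOL functions are total.\<close>

lemma left_sol_cong:
  assumes "left_sol A Y" "\<And>i j t. t \<in> I \<Longrightarrow> Y i j t = Y' i j t" and A: "\<And>i j. lreg (A i j)"
  shows "left_sol A Y'"
  unfolding left_sol_def
proof (intro allI conjI)
  fix i j
  have Y: "continuous_on I (Y i j)" "lder (Y i j) (\<lambda>s. - (\<Sum>k\<in>UNIV. Y i k s * A k j s))" for i j
    using assms(1) by (auto simp: left_sol_def)
  show c: "continuous_on I (Y' i j)" for i j using Y(1)[of i j] assms(2) by (simp cong: continuous_on_cong)
  show "lder (Y' i j) (\<lambda>s. - (\<Sum>k\<in>UNIV. Y' i k s * A k j s))"
  proof (rule lderI)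
    show "lreg (\<lambda>s. - (\<Sum>k\<in>UNIV. Y' i k s * A k j s))"
      by (intro lreg_uminus lreg_sum lreg_mult lreg_continuous(1) c A)
    fix t b assume t: "t \<in> I"
    have ev: "\<forall>\<^sub>F s in es b t. s \<in> I" by (rule eventually_es_open[OF open_I t])
    have 1: "lm b (Y' i j) t = lm b (Y i j) t" by (rule lm_cong) (rule eventually_mono[OF ev], simp add: assms(2))
    have 2: "lm b (\<lambda>s. - (\<Sum>k\<in>UNIV. Y' i k s * A k j s)) t = lm b (\<lambda>s. - (\<Sum>k\<in>UNIV. Y i k s * A k j s)) t"
      by (rule lm_cong) (rule eventually_mono[OF ev], simp add: assms(2))
    have "\<forall>\<^sub>F s in es b t. (Y i j s - lm b (Y i j) t) / of_real (s - t) = (Y' i j s - lm b (Y i j) t) / of_real (s - t)"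
      by (rule eventually_mono[OF ev]) (simp add: assms(2))
    then show "((\<lambda>s. (Y' i j s - lm b (Y' i j) t) / of_real (s - t)) \<longlongrightarrow>
        lm b (\<lambda>s. - (\<Sum>k\<in>UNIV. Y' i k s * A k j s)) t) (es b t)"
      unfolding 1 2 by (subst tendsto_es_cong[symmetric], assumption) (rule lder_tendsto[OF Y(2) t])
  qed
qed

text \<open>Invertibility comes from a left inverse: \<open>Y X\<close> is constant and is the
  identity at \<open>t0\<close>. The mean value inequality makes the entries Lipschitz on compact
  segments, and \<open>X\<close> is differentiable wherever both limits of \<open>A X\<close> equal
  its value.\<close>

lemma fundamental_matrix_exists:
  fixes A :: "real \<Rightarrow> complex ^ 'n ^ 'n"
  assumes A: "\<And>i j. (\<lambda>t. A t $ i $ j) \<in> reg_fun I"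
  shows "\<exists>X. fundamental_matrix I A X"
proof -
  obtain t0 where t0: "t0 \<in> I" using nonempty_I by blast
  obtain X Y where XY: "right_sol (\<lambda>i j t. A t $ i $ j) X" "left_sol (\<lambda>i j t. A t $ i $ j) Y"
    "\<And>i j. X i j t0 = (if i = j then 1 else 0)" "\<And>i j. Y i j t0 = (if i = j then 1 else 0)"
    by (rule right_left_sol_exist[of "\<lambda>i j t. A t $ i $ j", OF A t0]) blast
  define Xm :: "real \<Rightarrow> complex ^ 'n ^ 'n" where "Xm t = (\<chi> i j. X i j t)" for t
  define Ym :: "real \<Rightarrow> complex ^ 'n ^ 'n" where "Ym t = (\<chi> i j. Y i j t)" for t
  have c: "continuous_on I (X i j)" and d: "lder (X i j) (\<lambda>s. \<Sum>k\<in>UNIV. A s $ i $ k * X k j s)" for i j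
    using XY(1) by (auto simp: right_sol_def)
  have r: "lreg (\<lambda>s. \<Sum>k\<in>UNIV. A s $ i $ k * X k j s)" for i j using lder_lreg[OF d] .
  have "invertible (Xm t)" if "t \<in> I" for t
  proof -
    have "Ym t ** Xm t = Ym t0 ** Xm t0"
      using pairing_constant[OF XY(1,2) that t0] by (simp add: vec_eq_iff matrix_matrix_mult_def Xm_def Ym_def)
    also have "\<dots> = mat 1 ** mat 1"
      using XY(3,4) by (intro arg_cong2[where f="(**)"]) (simp_all add: vec_eq_iff mat_def Xm_def Ym_def)
    also have "\<dots> = mat 1" by simp
    finally show ?thesis using invertible_left_inverse by auto
  qed
  moreover have "abs_cont_on {c..d} Xm" if cd: "{c..d} \<subseteq> I" for c d
  proof (cases "c \<le> d")
    case True
    then have cI: "c \<in> I" "d \<in> I" using cd by auto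
    define Q where "Q i j M \<longleftrightarrow> (\<forall>t b. c \<le> t \<longrightarrow> t \<le> d \<longrightarrow>
      norm (lm b (\<lambda>s. \<Sum>k\<in>UNIV. A s $ i $ k * X k j s) t) \<le> M)" for i j M
    have "\<exists>M. Q i j M" for i j
      unfolding Q_def by (rule lreg_bounded[OF r cI]) blast
    then obtain M where "\<And>i j. Q i j (M i j)" by metis
    then have M: "\<And>i j t b. c \<le> t \<Longrightarrow> t \<le> d \<Longrightarrow>
      norm (lm b (\<lambda>s. \<Sum>k\<in>UNIV. A s $ i $ k * X k j s) t) \<le> M i j" unfolding Q_def by blast
    have entry: "dist (X i j s) (X i j t) \<le> M i j * (t - s)" if "s \<in> {c..d}" "t \<in> {c..d}" "s \<le> t" for i j s t
    proof (cases "s = t")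
      case False
      then have st: "s < t" "s \<in> I" "t \<in> I" using that cd by auto
      have sub: "{s..t} \<subseteq> I" using segment_subset st by blast
      have "norm (lm False (X i j) t - lm True (X i j) s) \<le> M i j * (t - s)"
      proof (rule mean_value_inequality[OF lreg_continuous(1)[OF c] d st(1) sub])
        show "lm True (X i j) q = lm False (X i j) q" if "s < q" "q < t" for q
          using lreg_continuous(2)[OF c, of q] subsetD[OF sub, of q] that by simp
      qed (use M that in auto)
      then show ?thesis using lreg_continuous(2)[OF c] st by (simp add: dist_norm norm_minus_commute)
    qed simp
    show ?thesis
    proof (rule lipschitz_imp_abs_cont_on)
      fix s t assume st: "s \<in> {c..d}" "t \<in> {c..d}" "s \<le> t"
      have "dist (Xm s) (Xm t) \<le> (\<Sum>i\<in>UNIV. \<Sum>j\<in>UNIV. M i j * (t - s))"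
        by (rule order_trans[OF dist_matrix_le]) (intro sum_mono, simp add: Xm_def entry[OF st])
      then show "dist (Xm s) (Xm t) \<le> (\<Sum>i\<in>UNIV. \<Sum>j\<in>UNIV. M i j) * (t - s)"
        by (simp add: sum_distrib_right)
    qed
  qed (auto intro!: lipschitz_imp_abs_cont_on)
  moreover have "AE t in lebesgue_on I. (Xm has_vector_derivative A t ** Xm t) (at t)"
    unfolding AE_I_iff
  proof -
    have "AE t in lebesgue. \<forall>i\<in>UNIV. \<forall>j\<in>UNIV. t \<in> I \<longrightarrow> (\<forall>b. lm b (\<lambda>s. \<Sum>k\<in>UNIV. A s $ i $ k * X k j s) t = (\<Sum>k\<in>UNIV. A t $ i $ k * X k j t))"
      using AE_lm_eq[OF open_I] r by (intro AE_finite_allI) (auto simp: lreg_def)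
    then show "AE t in lebesgue. t \<in> I \<longrightarrow> (Xm has_vector_derivative A t ** Xm t) (at t)"
    proof eventually_elim
      case (elim t)
      show ?case
      proof (intro impI has_vector_derivative_matrix)
        fix i j assume t: "t \<in> I"
        have "(X i j has_vector_derivative (\<Sum>k\<in>UNIV. A t $ i $ k * X k j t)) (at t)"
          using elim t by (intro lder_imp_has_vector_derivative[OF c d t]) auto
        then show "((\<lambda>t. Xm t $ i $ j) has_vector_derivative (A t ** Xm t) $ i $ j) (at t)"
          by (simp add: Xm_def matrix_matrix_mult_def)
      qed
    qed
  qed
  ultimately show ?thesis unfolding fundamental_matrix_def by blast
qed

text \<open>The equation is given only almost everywhere; as \<open>A X\<close> has one-sided limits
  everywhere, \<open>lder_abs_cont\<close> upgrades it to one-sided derivatives at every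
  point.\<close>

lemma fundamental_matrix_right_sol:
  assumes A: "\<And>i j. (\<lambda>t. A t $ i $ j) \<in> reg_fun I" and X: "fundamental_matrix I A X"
  shows "right_sol (\<lambda>i j t. A t $ i $ j) (\<lambda>i j t. X t $ i $ j)"
  unfolding right_sol_def
proof (intro allI conjI)
  fix i j
  have ac: "abs_cont_on {c..d} (\<lambda>t. X t $ i $ j)" if "{c..d} \<subseteq> I" for c d i j
    using X that by (intro abs_cont_on_matrix_entry) (auto simp: fundamental_matrix_def)
  show c: "continuous_on I (\<lambda>t. X t $ i $ j)" for i j
  proof (intro continuous_at_imp_continuous_on ballI)
    fix t assume t: "t \<in> I"
    obtain c d where cd: "c \<in> I" "d \<in> I" "c < t" "t < d"
      by (rule compact_subset_segment[of "{t}"]) (use t in auto)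
    have "continuous_on {c..d} (\<lambda>t. X t $ i $ j)"
      using abs_cont_on_imp_continuous_on ac segment_subset cd by blast
    then show "isCont (\<lambda>t. X t $ i $ j) t" using cd continuous_on_interior[of "{c..d}" _ t] by simp
  qed
  have "AE t in lebesgue_on I. ((\<lambda>t. X t $ i $ j) has_vector_derivative (\<Sum>k\<in>UNIV. A t $ i $ k * X t $ k $ j)) (at t)"
  proof -
    have lin: "bounded_linear (\<lambda>M :: complex ^ 'a ^ 'a. M $ i $ j)"
      by (rule bounded_linear_compose[OF bounded_linear_vec_nth bounded_linear_vec_nth])
    have "AE t in lebesgue_on I. (X has_vector_derivative A t ** X t) (at t)"
      using X by (simp add: fundamental_matrix_def)
    then show ?thesis
    proof eventually_elim
      case (elim t)
      show ?case using bounded_linear.has_vector_derivative[OF lin elim] by (simp add: matrix_matrix_mult_def)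
    qed
  qed
  then show "lder (\<lambda>t. X t $ i $ j) (\<lambda>s. \<Sum>k\<in>UNIV. A s $ i $ k * X s $ k $ j)"
    by (rule lder_abs_cont[OF ac, rotated])
      (use A in \<open>auto intro!: lreg_sum lreg_mult lreg_continuous(1)[OF c] simp: reg_fun_iff\<close>)
qed

text \<open>\<open>matrix_inv\<close> is not differentiated directly. For the adjoint solution
  \<open>Y\<close> normalised at \<open>t0\<close> the product \<open>Y X\<close> is constant, so
  the inverse of \<open>X t\<close> is the constant matrix \<open>matrix_inv (X t0)\<close> times
  \<open>Y t\<close>.\<close>

lemma fundamental_matrix_inverse_left_sol:
  assumes A: "\<And>i j. (\<lambda>t. A t $ i $ j) \<in> reg_fun I" and X: "fundamental_matrix I A X"
  shows "left_sol (\<lambda>i j t. A t $ i $ j) (\<lambda>i j t. matrix_inv (X t) $ i $ j)"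
proof -
  obtain t0 where t0: "t0 \<in> I" using nonempty_I by blast
  obtain X0 Y where Y: "left_sol (\<lambda>i j t. A t $ i $ j) Y" "\<And>i j. Y i j t0 = (if i = j then 1 else 0)"
    by (rule right_left_sol_exist[of "\<lambda>i j t. A t $ i $ j", OF A t0]) blast
  define Ym :: "real \<Rightarrow> complex ^ 'a ^ 'a" where "Ym t = (\<chi> i j. Y i j t)" for t
  define c where "c = matrix_inv (X t0)"
  have "c ** Ym t = matrix_inv (X t)" if t: "t \<in> I" for t
  proof -
    have "Ym t ** X t = Ym t0 ** X t0"
      using pairing_constant[OF fundamental_matrix_right_sol[OF A X] Y(1) t t0]
      by (simp add: vec_eq_iff matrix_matrix_mult_def Ym_def)
    also have "Ym t0 = mat 1" using Y(2) by (simp add: vec_eq_iff mat_def Ym_def)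
    finally have "(c ** Ym t) ** X t = c ** X t0" by (simp add: matrix_mul_assoc[symmetric])
    also have "\<dots> = mat 1" unfolding c_def
      using X t0 by (intro matrix_inv_mult(1)) (simp add: fundamental_matrix_def)
    finally show ?thesis by (rule matrix_inv_eqI[symmetric])
  qed
  then have e: "(\<Sum>k\<in>UNIV. c $ i $ k * Y k j t) = matrix_inv (X t) $ i $ j" if "t \<in> I" for i j t
    using that by (auto simp: vec_eq_iff matrix_matrix_mult_def Ym_def)
  show ?thesis
    by (rule left_sol_cong[OF left_sol_lincomb[OF Y(1), of "\<lambda>i k. c $ i $ k"] e])
      (use A in \<open>auto simp: reg_fun_iff\<close>)
qed

end

section \<open>Variation of constants\<close>

context open_interval
begin

lemma mult_dist_sum:
  assumes f: "f \<in> distrib I" and m: "\<And>k. k \<in> S \<Longrightarrow> lsm (m k)" and "finite S"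
  shows "mult_dist I (\<lambda>t. \<Sum>k\<in>S. m k t) f = (\<lambda>\<phi>. \<Sum>k\<in>S. mult_dist I (m k) f \<phi>)"
proof
  fix \<phi>
  show "mult_dist I (\<lambda>t. \<Sum>k\<in>S. m k t) f \<phi> = (\<Sum>k\<in>S. mult_dist I (m k) f \<phi>)"
  proof (cases "\<phi> \<in> test_fun I")
    case True
    have "f (\<lambda>t. \<Sum>k\<in>S. 1 * (m k t * \<phi> t)) = (\<Sum>k\<in>S. 1 * f (\<lambda>t. m k t * \<phi> t))"
      using distrib_linear_sum[OF f assms(3), of "\<lambda>k t. m k t * \<phi> t" "\<lambda>_. 1"] test_fun_mult m True by blast
    then show ?thesis using True by (simp add: mult_dist_def sum_distrib_right)
  qed (simp add: mult_dist_def)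
qed

lemma mult_dist_uminus:
  assumes "f \<in> distrib I" "lsm m"
  shows "mult_dist I (\<lambda>t. - m t) f = (\<lambda>\<phi>. - mult_dist I m f \<phi>)"
proof
  fix \<phi>
  show "mult_dist I (\<lambda>t. - m t) f \<phi> = - mult_dist I m f \<phi>"
    using distrib_uminus[OF assms(1) test_fun_mult[OF assms(2)], of \<phi>] by (simp add: mult_dist_def)
qed

text \<open>A version of \<open>mat_mult_dist\<close> with entries given by index functions; it
  spares conversions to and from vectors and matrices in the algebra that follows.\<close>

definition dist_mat_mult :: "('n \<Rightarrow> 'n \<Rightarrow> real \<Rightarrow> complex) \<Rightarrow> ('n::finite \<Rightarrow> dist) \<Rightarrow> 'n \<Rightarrow> dist" where
  "dist_mat_mult M x i = (\<lambda>\<phi>. \<Sum>j\<in>UNIV. mult_dist I (M i j) (x j) \<phi>)"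

lemma mat_mult_dist_nth: "mat_mult_dist I A f $ i = dist_mat_mult (\<lambda>i j t. A t $ i $ j) (($) f) i"
  by (simp add: mat_mult_dist_def dist_mat_mult_def)

lemma distrib_mat_mult: "(\<And>i j. lsm (M i j)) \<Longrightarrow> (\<And>j. x j \<in> distrib I) \<Longrightarrow> dist_mat_mult M x i \<in> distrib I"
  unfolding dist_mat_mult_def by (intro distrib_sum distrib_mult)

lemma mult_dist_mat_mult:
  assumes "lsm m"
  shows "mult_dist I m (dist_mat_mult M x i) \<phi> = (\<Sum>j\<in>UNIV. mult_dist I (\<lambda>t. m t * M i j t) (x j) \<phi>)"
proof -
  have "mult_dist I m (dist_mat_mult M x i) \<phi> = (\<Sum>j\<in>UNIV. mult_dist I m (mult_dist I (M i j) (x j)) \<phi>)"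
    by (simp add: mult_dist_def dist_mat_mult_def)
  then show ?thesis using assms by (simp add: mult_dist_mult_dist)
qed

lemma dist_mat_mult_assoc:
  assumes "\<And>i j. lsm (M i j)" "\<And>i j. lsm (N i j)" "\<And>j. x j \<in> distrib I"
  shows "dist_mat_mult M (dist_mat_mult N x) i = dist_mat_mult (\<lambda>i j t. \<Sum>k\<in>UNIV. M i k t * N k j t) x i"
proof
  fix \<phi>
  have "dist_mat_mult M (dist_mat_mult N x) i \<phi> =
      (\<Sum>k\<in>UNIV. \<Sum>j\<in>UNIV. mult_dist I (\<lambda>t. M i k t * N k j t) (x j) \<phi>)"
    by (simp add: dist_mat_mult_def[of M] mult_dist_mat_mult assms)
  also have "\<dots> = (\<Sum>j\<in>UNIV. \<Sum>k\<in>UNIV. mult_dist I (\<lambda>t. M i k t * N k j t) (x j) \<phi>)" by (rule sum.swap)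
  also have "\<dots> = dist_mat_mult (\<lambda>i j t. \<Sum>k\<in>UNIV. M i k t * N k j t) x i \<phi>"
    unfolding dist_mat_mult_def using assms by (simp add: mult_dist_sum lsm_mult)
  finally show "dist_mat_mult M (dist_mat_mult N x) i \<phi> = dist_mat_mult (\<lambda>i j t. \<Sum>k\<in>UNIV. M i k t * N k j t) x i \<phi>" .
qed

text \<open>The matrices are inverse to each other only on \<open>I\<close>, so their product is
  compared with the identity through limits and carried over to distributions by
  \<open>mult_dist_cong\<close>.\<close>

lemma dist_mat_mult_inverse:
  assumes M: "\<And>i j. lsm (M i j)" "\<And>i j. lsm (N i j)" and x: "\<And>j. x j \<in> distrib I"
    and inv: "\<And>i j t. t \<in> I \<Longrightarrow> (\<Sum>k\<in>UNIV. M i k t * N k j t) = (if i = j then 1 else 0)"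
  shows "dist_mat_mult M (dist_mat_mult N x) i = x i"
proof
  fix \<phi>
  have "mult_dist I (\<lambda>t. \<Sum>k\<in>UNIV. M i k t * N k j t) (x j) = mult_dist I (\<lambda>_. if i = j then 1 else 0) (x j)" for j
  proof (rule mult_dist_cong[OF x])
    show "lsm (\<lambda>t. \<Sum>k\<in>UNIV. M i k t * N k j t)" by (intro sm_sum sm_mult M)
    show "lsm (\<lambda>_. if i = j then 1 else 0)" by (rule sm_const)
    show "lm b (\<lambda>t. \<Sum>k\<in>UNIV. M i k t * N k j t) t = lm b (\<lambda>_. if i = j then 1 else 0) t" if "t \<in> I" for t b
      by (rule lm_cong) (rule eventually_mono[OF eventually_es_open[OF open_I that]], simp add: inv)
  qed
  then have "dist_mat_mult M (dist_mat_mult N x) i \<phi> = (\<Sum>j\<in>UNIV. mult_dist I (\<lambda>_. if i = j then 1 else 0) (x j) \<phi>)"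
    unfolding dist_mat_mult_assoc[where M=M and N=N and x=x, OF M x] by (simp add: dist_mat_mult_def)
  also have "\<dots> = (\<Sum>j\<in>UNIV. if i = j then x j \<phi> else 0)"
    using x by (intro sum.cong) (auto simp: mult_dist_def distrib_off distrib_cmult[of _ _ 0, simplified])
  finally show "dist_mat_mult M (dist_mat_mult N x) i \<phi> = x i \<phi>" by simp
qed

lemma before_mat_mult:
  assumes M: "\<And>i j. lsm (M i j)" and x: "\<And>j. before t\<^sub>0 (x j)" and t0: "t\<^sub>0 \<in> I"
  shows "before t\<^sub>0 (dist_mat_mult M x i)"
  unfolding before_def
proof (intro ballI impI)
  fix \<phi> assume \<phi>: "\<phi> \<in> test_fun I" "gsupp I \<phi> \<subseteq> I \<inter> {..<t\<^sub>0}"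
  obtain c d where cd: "c \<in> I" "d \<in> I" "c < d" "d < t\<^sub>0" "tst c d \<phi>"
    using gsupp_before_tst[OF t0 \<phi>] by metis
  have "x j (\<lambda>t. M i j t * \<phi> t) = 0" for j
    using beforeD[OF x cd(1,2) tst_mult[OF M cd(5)] cd(4)] .
  then show "dist_mat_mult M x i \<phi> = 0"
    unfolding dist_mat_mult_def mult_dist_def by (intro sum.neutral) simp
qed

lemma derivs_mat_mult:
  assumes M: "\<And>i j. lsm (M i j)" "\<And>i j. continuous_on I (M i j)" "\<And>i j. lder (M i j) (M' i j)"
    and x: "\<And>j. x j \<in> distrib I" "\<And>j. h j \<in> derivs I (x j)"
  shows "(\<lambda>\<phi>. dist_mat_mult M h i \<phi> + dist_mat_mult M' x i \<phi>) \<in> derivs I (dist_mat_mult M x i)"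
proof -
  have "(\<lambda>\<phi>. \<Sum>j\<in>UNIV. mult_dist I (M i j) (h j) \<phi> + mult_dist I (M' i j) (x j) \<phi>) \<in>
      derivs I (\<lambda>\<phi>. \<Sum>j\<in>UNIV. mult_dist I (M i j) (x j) \<phi>)"
    using lreg_continuous(2)[OF M(2)] by (intro derivs_sum derivs_mult M x) simp
  then show ?thesis by (simp add: dist_mat_mult_def sum.distrib)
qed

lemma dist_mat_mult_add:
  "dist_mat_mult M (\<lambda>j \<phi>. f j \<phi> + g j \<phi>) i = (\<lambda>\<phi>. dist_mat_mult M f i \<phi> + dist_mat_mult M g i \<phi>)"
  unfolding dist_mat_mult_def mult_dist_def sum.distrib[symmetric] by (intro ext sum.cong) auto

lemma dist_mat_mult_uminus:
  assumes "\<And>i j. lsm (M i j)" "\<And>j. x j \<in> distrib I"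
  shows "dist_mat_mult (\<lambda>i j t. - M i j t) x i = (\<lambda>\<phi>. - dist_mat_mult M x i \<phi>)"
  using assms by (simp add: dist_mat_mult_def mult_dist_uminus sum_negf)

text \<open>With \<open>x' = f + A x\<close> the Leibniz rule gives
  \<open>(Y x)' = Y f + Y A x - Y A x\<close>.\<close>

lemma solution_imp_primitive:
  assumes A: "\<And>i j. lsm (A i j)" and Y: "left_sol A Y" and x: "\<And>j. x j \<in> distrib I"
    and sol: "\<And>j. (\<lambda>\<phi>. f j \<phi> + dist_mat_mult A x j \<phi>) \<in> derivs I (x j)"
  shows "dist_mat_mult Y f i \<in> derivs I (dist_mat_mult Y x i)"
proof -
  have sY: "lsm (Y i j)" for i j using left_sol_lsm[OF A Y] .
  have "(\<lambda>\<phi>. dist_mat_mult Y (\<lambda>j \<phi>. f j \<phi> + dist_mat_mult A x j \<phi>) i \<phi> +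
      dist_mat_mult (\<lambda>i j t. - (\<Sum>k\<in>UNIV. Y i k t * A k j t)) x i \<phi>) \<in> derivs I (dist_mat_mult Y x i)"
    using Y by (intro derivs_mat_mult sY x sol) (auto simp: left_sol_def)
  moreover have "lsm (\<lambda>t. \<Sum>k\<in>UNIV. Y i k t * A k j t)" for i j by (intro sm_sum sm_mult sY A)
  ultimately show ?thesis
    by (simp add: dist_mat_mult_add dist_mat_mult_uminus x dist_mat_mult_assoc[OF sY A x])
qed

text \<open>With \<open>y' = g\<close> the Leibniz rule gives \<open>(X y)' = X g + A X y\<close>;
  it will be applied with \<open>g = Y f\<close>, where \<open>Y\<close> is inverse to
  \<open>X\<close>, so that the first term is \<open>f\<close>.\<close>

lemma primitive_imp_solution:
  assumes A: "\<And>i j. lsm (A i j)" and X: "right_sol A X" and y: "\<And>j. y j \<in> distrib I"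
    and prim: "\<And>j. g j \<in> derivs I (y j)"
  shows "(\<lambda>\<phi>. dist_mat_mult X g i \<phi> + dist_mat_mult A (dist_mat_mult X y) i \<phi>) \<in> derivs I (dist_mat_mult X y i)"
proof -
  have sX: "lsm (X i j)" for i j using right_sol_lsm[OF A X] .
  have "(\<lambda>\<phi>. dist_mat_mult X g i \<phi> +
      dist_mat_mult (\<lambda>i j t. \<Sum>k\<in>UNIV. A i k t * X k j t) y i \<phi>) \<in> derivs I (dist_mat_mult X y i)"
    using X by (intro derivs_mat_mult sX y prim) (auto simp: right_sol_def)
  then show ?thesis by (simp add: dist_mat_mult_assoc[OF A sX y])
qed

text \<open>The derivative \<open>x'\<close> in the definition is tied to the equation only on test
  functions. Distributions are 0 elsewhere, so \<open>x'\<close> is forced and the existential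
  quantifier can be removed.\<close>

lemma is_solution_iff:
  fixes A :: "real \<Rightarrow> complex ^ 'n ^ 'n" and f x :: "dist ^ 'n"
  assumes A: "\<And>i j. lsm (\<lambda>t. A t $ i $ j)" and f: "f \<in> distrib_vec I"
  shows "is_solution I A f x \<longleftrightarrow> x \<in> distrib_vec I \<and>
    (\<forall>i. (\<lambda>\<phi>. (f $ i) \<phi> + dist_mat_mult (\<lambda>i j t. A t $ i $ j) (($) x) i \<phi>) \<in> derivs I (x $ i))"
    (is "_ \<longleftrightarrow> _ \<and> (\<forall>i. ?g i \<in> _)")
proof -
  have "(\<exists>x' :: dist ^ 'n. (\<forall>i. x' $ i \<in> derivs I (x $ i)) \<and>
      (\<forall>\<phi>\<in>test_fun I. \<forall>i. (x' $ i) \<phi> - (mat_mult_dist I A x $ i) \<phi> = (f $ i) \<phi>)) \<longleftrightarrow>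
      (\<forall>i. ?g i \<in> derivs I (x $ i))" if x: "x \<in> distrib_vec I"
  proof
    assume "\<exists>x' :: dist ^ 'n. (\<forall>i. x' $ i \<in> derivs I (x $ i)) \<and>
      (\<forall>\<phi>\<in>test_fun I. \<forall>i. (x' $ i) \<phi> - (mat_mult_dist I A x $ i) \<phi> = (f $ i) \<phi>)"
    then obtain x' :: "dist ^ 'n" where x': "\<And>i. x' $ i \<in> derivs I (x $ i)"
      "\<And>\<phi> i. \<phi> \<in> test_fun I \<Longrightarrow> (x' $ i) \<phi> - (mat_mult_dist I A x $ i) \<phi> = (f $ i) \<phi>" by blast
    have xd: "x $ i \<in> distrib I" "f $ i \<in> distrib I" for i using x f by (auto simp: distrib_vec_def)
    have "x' $ i = ?g i" for i
    proof
      fix \<phi>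
      show "(x' $ i) \<phi> = ?g i \<phi>"
      proof (cases "\<phi> \<in> test_fun I")
        case True
        then show ?thesis using x'(2)[OF True, of i] by (simp add: mat_mult_dist_nth algebra_simps)
      next
        case False
        then show ?thesis using distrib_off[OF derivs_distrib[OF xd(1) x'(1)], of \<phi> i] distrib_off[OF xd(2), of \<phi> i]
          by (simp add: dist_mat_mult_def mult_dist_def)
      qed
    qed
    then show "\<forall>i. ?g i \<in> derivs I (x $ i)" using x'(1) by metis
  next
    assume g: "\<forall>i. ?g i \<in> derivs I (x $ i)"
    then show "\<exists>x' :: dist ^ 'n. (\<forall>i. x' $ i \<in> derivs I (x $ i)) \<and>
      (\<forall>\<phi>\<in>test_fun I. \<forall>i. (x' $ i) \<phi> - (mat_mult_dist I A x $ i) \<phi> = (f $ i) \<phi>)"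
      by (intro exI[of _ "\<chi> i. ?g i"]) (simp add: mat_mult_dist_nth)
  qed
  then show ?thesis by (auto simp: is_solution_def)
qed

text \<open>The equivalences carry existence and uniqueness together, so that the relation between
  the two unique objects can be stated for an arbitrary fundamental matrix \<open>X\<close>.\<close>

lemma cauchy_problem:
  fixes A X :: "real \<Rightarrow> complex ^ 'n ^ 'n" and f :: "dist ^ 'n"
  assumes t0: "t\<^sub>0 \<in> I" and A: "A \<in> smooth_reg_mat I" and f: "f \<in> distrib_vec I" "zero_before I t\<^sub>0 f"
    and X: "fundamental_matrix I A X"
  defines "Y \<equiv> \<lambda>t. matrix_inv (X t)"
  obtains x y where "\<And>x'. is_solution I A f x' \<and> zero_before I t\<^sub>0 x' \<longleftrightarrow> x' = x"
    "\<And>y'. is_primitive I (mat_mult_dist I Y f) y' \<and> zero_before I t\<^sub>0 y' \<longleftrightarrow> y' = y"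
    "x = mat_mult_dist I X y"
proof -
  define Ae where "Ae i j t = A t $ i $ j" for i j t
  define Xe where "Xe i j t = X t $ i $ j" for i j t
  define Ye where "Ye i j t = Y t $ i $ j" for i j t
  define fe where "fe = ($) f"
  have regA: "(\<lambda>t. A t $ i $ j) \<in> reg_fun I" and sA: "lsm (Ae i j)" for i j
    using A by (auto simp: smooth_reg_mat_def Ae_def[abs_def] smooth_reg_fun_reg smooth_reg_fun_lsm)
  have rX: "right_sol Ae Xe" and lY: "left_sol Ae Ye"
    using fundamental_matrix_right_sol[OF regA X] fundamental_matrix_inverse_left_sol[OF regA X]
    by (simp_all add: Ae_def[abs_def] Xe_def[abs_def] Ye_def[abs_def] Y_def)
  note sX = right_sol_lsm[OF sA rX] and sY = left_sol_lsm[OF sA lY]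
  have "X t ** Y t = mat 1" "Y t ** X t = mat 1" if "t \<in> I" for t
    unfolding Y_def using X that by (auto intro: matrix_inv_mult simp: fundamental_matrix_def)
  then have inv: "(\<Sum>k\<in>UNIV. Xe i k t * Ye k j t) = (if i = j then 1 else 0)"
    "(\<Sum>k\<in>UNIV. Ye i k t * Xe k j t) = (if i = j then 1 else 0)" if "t \<in> I" for i j t
    using that unfolding vec_eq_iff matrix_matrix_mult_def mat_def Xe_def Ye_def by simp_all
  have fd: "fe j \<in> distrib I" and fb: "before t\<^sub>0 (fe j)" for j
    using f by (auto simp: fe_def distrib_vec_def zero_before_iff)
  have "\<exists>y. y \<in> distrib I \<and> dist_mat_mult Ye fe i \<in> derivs I y \<and> before t\<^sub>0 y" for i
    by (rule primitive_exists[of "dist_mat_mult Ye fe i", OF distrib_mat_mult before_mat_mult t0])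
      (use sY fd fb t0 in blast)+
  then obtain ye where ye: "\<And>i. ye i \<in> distrib I" "\<And>i. dist_mat_mult Ye fe i \<in> derivs I (ye i)" "\<And>i. before t\<^sub>0 (ye i)"
    by metis
  define y :: "dist ^ 'n" where "y = (\<chi> i. ye i)"
  define x where "x = mat_mult_dist I X y"
  have nth: "mat_mult_dist I X z $ i = dist_mat_mult Xe (($) z) i" "mat_mult_dist I Y z $ i = dist_mat_mult Ye (($) z) i"
    "mat_mult_dist I A z $ i = dist_mat_mult Ae (($) z) i" for z :: "dist ^ 'n" and i
    by (simp_all add: mat_mult_dist_nth Xe_def[abs_def] Ye_def[abs_def] Ae_def[abs_def])
  have yn: "($) y = ye" by (auto simp: y_def)
  have xn: "($) x = dist_mat_mult Xe ye" by (auto simp: x_def nth yn fun_eq_iff)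
  have prim: "is_primitive I (mat_mult_dist I Y f) z \<and> zero_before I t\<^sub>0 z \<longleftrightarrow> z = y" for z
  proof
    assume "is_primitive I (mat_mult_dist I Y f) z \<and> zero_before I t\<^sub>0 z"
    then have z: "z $ i \<in> distrib I" "dist_mat_mult Ye fe i \<in> derivs I (z $ i)" "before t\<^sub>0 (z $ i)" for i
      by (auto simp: is_primitive_def nth fe_def zero_before_iff distrib_vec_def)
    have "z $ i = ye i" for i
      by (rule primitive_unique[OF z(1,3,2) ye(1,3,2) t0])
    then show "z = y" by (simp add: vec_eq_iff y_def)
  next
    assume "z = y"
    moreover have "dist_mat_mult Ye fe i \<in> distrib I" for i by (intro distrib_mat_mult sY fd)
    ultimately show "is_primitive I (mat_mult_dist I Y f) z \<and> zero_before I t\<^sub>0 z"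
      using ye by (simp add: is_primitive_def nth fe_def zero_before_iff distrib_vec_def y_def)
  qed
  have sol_iff: "is_solution I A f z \<longleftrightarrow> (\<forall>i. z $ i \<in> distrib I) \<and>
      (\<forall>i. (\<lambda>\<phi>. fe i \<phi> + dist_mat_mult Ae (($) z) i \<phi>) \<in> derivs I (z $ i))" for z
    using is_solution_iff[OF sA[unfolded Ae_def[abs_def]] f(1), of z]
    by (simp add: distrib_vec_def fe_def Ae_def[abs_def])
  have sol: "is_solution I A f z \<and> zero_before I t\<^sub>0 z \<longleftrightarrow> z = x" for z
  proof
    assume "is_solution I A f z \<and> zero_before I t\<^sub>0 z"
    then have z: "\<And>i. z $ i \<in> distrib I" "\<And>i. (\<lambda>\<phi>. fe i \<phi> + dist_mat_mult Ae (($) z) i \<phi>) \<in> derivs I (z $ i)"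
      "\<And>i. before t\<^sub>0 (z $ i)"
      by (auto simp: sol_iff zero_before_iff)
    \<comment> \<open>Multiplication by \<open>Y\<close> turns \<open>z\<close> into a primitive of
      \<open>Y f\<close> that vanishes before \<open>t\<^sub>0\<close>. Primitives are unique, and
      \<open>z\<close> is recovered by multiplying with \<open>X\<close>.\<close>
    have "dist_mat_mult Ye (($) z) i = ye i" for i
      by (rule primitive_unique[OF distrib_mat_mult[OF sY z(1)] before_mat_mult[OF sY z(3) t0]
            solution_imp_primitive[OF sA lY z(1,2)] ye(1,3,2) t0])
    then have Yz: "dist_mat_mult Ye (($) z) = ye" by (rule ext)
    have "z $ i = x $ i" for i
      using dist_mat_mult_inverse[where M=Xe and N=Ye and x="($) z" and i=i, OF sX sY z(1) inv(1)]
        fun_cong[OF xn, of i] unfolding Yz by simp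
    then show "z = x" by (simp add: vec_eq_iff)
  next
    assume z: "z = x"
    have dX: "dist_mat_mult Xe ye i \<in> distrib I" and bX: "before t\<^sub>0 (dist_mat_mult Xe ye i)" for i
      by (intro distrib_mat_mult before_mat_mult sX ye t0)+
    have "dist_mat_mult Xe (dist_mat_mult Ye fe) = fe"
      using dist_mat_mult_inverse[where M=Xe and N=Ye and x=fe, OF sX sY fd inv(1)] by (simp add: fun_eq_iff)
    then have "(\<lambda>\<phi>. fe i \<phi> + dist_mat_mult Ae (dist_mat_mult Xe ye) i \<phi>) \<in> derivs I (dist_mat_mult Xe ye i)" for i
      using primitive_imp_solution[where A=Ae and X=Xe and y=ye and g="dist_mat_mult Ye fe" and i=i, OF sA rX ye(1,2)]
      by simp
    then show "is_solution I A f z \<and> zero_before I t\<^sub>0 z"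
      using dX bX fun_cong[OF xn]
      by (simp add: z sol_iff xn zero_before_iff)
  qed
  show ?thesis using that[of x y] prim sol by (simp add: x_def)
qed

end

theorem theorem3p3:
  fixes a b :: ereal and I :: "real set" and t\<^sub>0 :: real
    and A :: "real \<Rightarrow> complex ^ 'n ^ 'n" and f :: "dist ^ 'n"
  assumes "I = einterval a b"
    and "t\<^sub>0 \<in> I"
    and "A \<in> smooth_reg_mat I"
    and "f \<in> distrib_vec I"
    and "zero_before I t\<^sub>0 f"
  shows "(\<exists>!x. is_solution I A f x \<and> zero_before I t\<^sub>0 x) \<and>
    (\<exists>X. fundamental_matrix I A X) \<and>
    (\<forall>X x. fundamental_matrix I A X \<and> is_solution I A f x \<and> zero_before I t\<^sub>0 x \<longrightarrow>
       (\<exists>!y. is_primitive I (mat_mult_dist I (\<lambda>t. matrix_inv (X t)) f) y \<and> zero_before I t\<^sub>0 y) \<and>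
       (\<forall>y. is_primitive I (mat_mult_dist I (\<lambda>t. matrix_inv (X t)) f) y \<and> zero_before I t\<^sub>0 y
          \<longrightarrow> x = mat_mult_dist I X y))"
proof -
  have "open_interval I"
  proof
    show "open I" unfolding assms(1) by (rule open_einterval)
    show "is_interval I"
      unfolding is_interval_1
    proof (intro ballI allI impI)
      fix c d x assume *: "c \<in> I" "d \<in> I" "c \<le> x \<and> x \<le> d"
      then have "a < ereal c" "ereal c \<le> ereal x" "ereal x \<le> ereal d" "ereal d < b"
        by (simp_all add: assms(1) einterval_def)
      then have "a < ereal x" "ereal x < b"
        using less_le_trans[of a "ereal c" "ereal x"] le_less_trans[of "ereal x" "ereal d" b] by auto
      then show "x \<in> I" by (simp add: assms(1) einterval_def)
    qed
    show "I \<noteq> {}" using assms(2) by blast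
  qed
  then interpret open_interval I .
  have "(\<lambda>t. A t $ i $ j) \<in> reg_fun I" for i j
    using assms(3) smooth_reg_fun_reg by (auto simp: smooth_reg_mat_def)
  then obtain X0 where X0: "fundamental_matrix I A X0" using fundamental_matrix_exists[of A] by blast
  \<comment> \<open>This claim does not mention a fundamental matrix, so any one may be used for it;
    the representation of \<open>x\<close> is then derived for each given \<open>X\<close>.\<close>
  have "\<exists>!x. is_solution I A f x \<and> zero_before I t\<^sub>0 x"
    by (rule cauchy_problem[OF assms(2-5) X0]) simp
  moreover have "(\<exists>!y. is_primitive I (mat_mult_dist I (\<lambda>t. matrix_inv (X t)) f) y \<and> zero_before I t\<^sub>0 y) \<and>
       (\<forall>y. is_primitive I (mat_mult_dist I (\<lambda>t. matrix_inv (X t)) f) y \<and> zero_before I t\<^sub>0 y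
          \<longrightarrow> x = mat_mult_dist I X y)"
    if sol: "fundamental_matrix I A X \<and> is_solution I A f x \<and> zero_before I t\<^sub>0 x" for X x
  proof -
    obtain x' y where "\<And>z. is_solution I A f z \<and> zero_before I t\<^sub>0 z \<longleftrightarrow> z = x'"
      "\<And>z. is_primitive I (mat_mult_dist I (\<lambda>t. matrix_inv (X t)) f) z \<and> zero_before I t\<^sub>0 z \<longleftrightarrow> z = y"
      "x' = mat_mult_dist I X y"
      by (rule cauchy_problem[OF assms(2-5) conjunct1[OF sol]]) blast
    then show ?thesis using sol by simp
  qed
  ultimately show ?thesis using X0 by blast
qed

end
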